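(* Let $A$ be a simple unital C*-algebra with $\mathrm{tsr}(A) = 1$ and with the SP-property, let $G$ be a finite group, and let $\alpha\colon G \to \mathrm{Aut}(A)$ be an action of $G$ on $A$. Then $$\mathrm{tsr}(A \rtimes_\alpha G) \leq 2.$$
   Context: For a unital C*-algebra $A$, let $Lg_n(A)$ be the set of $(b_1,\dots,b_n) \in A^n$ with $Ab_1 + \cdots + Ab_n = A$. The topological stable rank $\mathrm{tsr}(A)$ is the least positive integer $n$ such that $Lg_n(A)$ is dense in $A^n$ (and $\infty$ if there is no such $n$). A C*-algebra $A$ has the SP-property if every non-zero hereditary C*-subalgebra of $A$ contains a non-zero projection. $\mathrm{Aut}(A)$ is the group of $*$-automorphisms of $A$, an action is a group homomorphism $\alpha\colon G\to\mathrm{Aut}(A)$, and $A\rtimes_\alpha G$ is the crossed product C*-algebra. *)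

theory Defs
  imports
    "HOL-Analysis.Analysis"
    "HOL-Library.Extended_Nat"
    "HOL-Algebra.Ideal"
    "HOL-Algebra.Module"
    "HOL-Algebra.Bij"
begin

section \<open>Unital C*-algebras with explicit carrier\<close>

definition complex_ring :: "complex ring" where
  "complex_ring = \<lparr>carrier = UNIV, mult = (*), one = 1, zero = 0, add = (+)\<rparr>"

record 'a star_alg = "(complex, 'a) module" +
  star :: "'a \<Rightarrow> 'a"

record 'a cstar_alg = "'a star_alg" +
  cnorm :: "'a \<Rightarrow> real"

locale unital_star_algebra =
  Module.module complex_ring A + A: ring A for A (structure) +
  assumes smult_mult_left:
      "\<lbrakk>x \<in> carrier A; y \<in> carrier A\<rbrakk> \<Longrightarrow> (c \<odot>\<^bsub>A\<^esub> x) \<otimes>\<^bsub>A\<^esub> y = c \<odot>\<^bsub>A\<^esub> (x \<otimes>\<^bsub>A\<^esub> y)"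
    and smult_mult_right:
      "\<lbrakk>x \<in> carrier A; y \<in> carrier A\<rbrakk> \<Longrightarrow> x \<otimes>\<^bsub>A\<^esub> (c \<odot>\<^bsub>A\<^esub> y) = c \<odot>\<^bsub>A\<^esub> (x \<otimes>\<^bsub>A\<^esub> y)"
    and star_closed: "x \<in> carrier A \<Longrightarrow> star A x \<in> carrier A"
    and star_star: "x \<in> carrier A \<Longrightarrow> star A (star A x) = x"
    and star_add:
      "\<lbrakk>x \<in> carrier A; y \<in> carrier A\<rbrakk> \<Longrightarrow> star A (x \<oplus>\<^bsub>A\<^esub> y) = star A x \<oplus>\<^bsub>A\<^esub> star A y"
    and star_mult:
      "\<lbrakk>x \<in> carrier A; y \<in> carrier A\<rbrakk> \<Longrightarrow> star A (x \<otimes>\<^bsub>A\<^esub> y) = star A y \<otimes>\<^bsub>A\<^esub> star A x"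
    and star_smult: "x \<in> carrier A \<Longrightarrow> star A (c \<odot>\<^bsub>A\<^esub> x) = cnj c \<odot>\<^bsub>A\<^esub> star A x"

definition cstar_seminorm :: "('a, 'm) star_alg_scheme \<Rightarrow> ('a \<Rightarrow> real) \<Rightarrow> bool" where
  "cstar_seminorm A p \<longleftrightarrow>
    (\<forall>x\<in>carrier A. 0 \<le> p x) \<and>
    (\<forall>c. \<forall>x\<in>carrier A. p (c \<odot>\<^bsub>A\<^esub> x) = cmod c * p x) \<and>
    (\<forall>x\<in>carrier A. \<forall>y\<in>carrier A. p (x \<oplus>\<^bsub>A\<^esub> y) \<le> p x + p y) \<and>
    (\<forall>x\<in>carrier A. \<forall>y\<in>carrier A. p (x \<otimes>\<^bsub>A\<^esub> y) \<le> p x * p y) \<and>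
    (\<forall>x\<in>carrier A. p (star A x \<otimes>\<^bsub>A\<^esub> x) = (p x)\<^sup>2)"

(* The value off the carrier is immaterial, but the locale Metric_space asks for
   non-negativity and symmetry on the whole type. *)
definition cdist :: "'a cstar_alg \<Rightarrow> 'a \<Rightarrow> 'a \<Rightarrow> real" where
  "cdist A x y = (if x \<in> carrier A \<and> y \<in> carrier A then cnorm A (x \<ominus>\<^bsub>A\<^esub> y) else 0)"

definition norm_topology :: "'a cstar_alg \<Rightarrow> 'a topology" where
  "norm_topology A = Metric_space.mtopology (carrier A) (cdist A)"

locale unital_cstar_algebra = unital_star_algebra A
  for A :: "'a cstar_alg" (structure) +
  assumes cnorm_cstar_seminorm: "cstar_seminorm A (cnorm A)"
    and cnorm_eq_zero: "\<lbrakk>x \<in> carrier A; cnorm A x = 0\<rbrakk> \<Longrightarrow> x = \<zero>\<^bsub>A\<^esub>"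
    and complete: "Metric_space.mcomplete (carrier A) (cdist A)"

definition simple_cstar :: "'a cstar_alg \<Rightarrow> bool" where
  "simple_cstar A \<longleftrightarrow> carrier A \<noteq> {\<zero>\<^bsub>A\<^esub>} \<and>
    (\<forall>I. ideal I A \<and> closedin (norm_topology A) I \<longrightarrow> I = {\<zero>\<^bsub>A\<^esub>} \<or> I = carrier A)"


section \<open>Topological stable rank\<close>

(* n-tuples are extensional functions on {1..n}. *)
definition Lg :: "nat \<Rightarrow> 'a cstar_alg \<Rightarrow> (nat \<Rightarrow> 'a) set" where
  "Lg n A = {b \<in> {1..n} \<rightarrow>\<^sub>E carrier A.
     {\<Oplus>\<^bsub>A\<^esub>i\<in>{1..n}. x i \<otimes>\<^bsub>A\<^esub> b i | x. x \<in> {1..n} \<rightarrow> carrier A} = carrier A}"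

(* The infimum of the empty set in enat is infinity. *)
definition tsr :: "'a cstar_alg \<Rightarrow> enat" where
  "tsr A = Inf {enat n | n. 1 \<le> n \<and>
     product_topology (\<lambda>_. norm_topology A) {1..n} closure_of Lg n A
       = ({1..n} \<rightarrow>\<^sub>E carrier A)}"


section \<open>Hereditary subalgebras and the SP-property\<close>

definition spectrum :: "'a cstar_alg \<Rightarrow> 'a \<Rightarrow> complex set" where
  "spectrum A x = {c. c \<odot>\<^bsub>A\<^esub> \<one>\<^bsub>A\<^esub> \<ominus>\<^bsub>A\<^esub> x \<notin> Units A}"

definition positive :: "'a cstar_alg \<Rightarrow> 'a \<Rightarrow> bool" where
  "positive A x \<longleftrightarrow> x \<in> carrier A \<and> star A x = x \<and> spectrum A x \<subseteq> complex_of_real ` {0..}"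

(* Not required to contain the unit of A. *)
definition cstar_subalgebra :: "'a set \<Rightarrow> 'a cstar_alg \<Rightarrow> bool" where
  "cstar_subalgebra B A \<longleftrightarrow> submodule B complex_ring A \<and>
    (\<forall>x\<in>B. \<forall>y\<in>B. x \<otimes>\<^bsub>A\<^esub> y \<in> B) \<and> (\<forall>x\<in>B. star A x \<in> B) \<and>
    closedin (norm_topology A) B"

definition hereditary_subalgebra :: "'a set \<Rightarrow> 'a cstar_alg \<Rightarrow> bool" where
  "hereditary_subalgebra B A \<longleftrightarrow> cstar_subalgebra B A \<and>
    (\<forall>a\<in>carrier A. \<forall>b\<in>B. positive A a \<and> positive A (b \<ominus>\<^bsub>A\<^esub> a) \<longrightarrow> a \<in> B)"

definition projection :: "'a cstar_alg \<Rightarrow> 'a \<Rightarrow> bool" where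
  "projection A p \<longleftrightarrow> p \<in> carrier A \<and> star A p = p \<and> p \<otimes>\<^bsub>A\<^esub> p = p"

definition SP_property :: "'a cstar_alg \<Rightarrow> bool" where
  "SP_property A \<longleftrightarrow>
    (\<forall>B. hereditary_subalgebra B A \<and> B \<noteq> {\<zero>\<^bsub>A\<^esub>} \<longrightarrow> (\<exists>p\<in>B. projection A p \<and> p \<noteq> \<zero>\<^bsub>A\<^esub>))"


section \<open>Actions of finite groups and crossed products\<close>

definition star_automorphisms :: "'a cstar_alg \<Rightarrow> ('a \<Rightarrow> 'a) set" where
  "star_automorphisms A = {f \<in> ring_hom A A \<inter> Bij (carrier A).
     (\<forall>c. \<forall>x\<in>carrier A. f (c \<odot>\<^bsub>A\<^esub> x) = c \<odot>\<^bsub>A\<^esub> f x) \<and>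
     (\<forall>x\<in>carrier A. f (star A x) = star A (f x))}"

definition Aut :: "'a cstar_alg \<Rightarrow> ('a \<Rightarrow> 'a) monoid" where
  "Aut A = BijGroup (carrier A) \<lparr>carrier := star_automorphisms A\<rparr>"

(* The *-algebra of functions f : G -> A, standing for the formal sums of f(s) u_s,
   with the relations u_s a = alpha_s(a) u_s and u_s^* = u_(inv s). *)
definition skew_group_algebra ::
    "('g, 'm) monoid_scheme \<Rightarrow> 'a cstar_alg \<Rightarrow> ('g \<Rightarrow> 'a \<Rightarrow> 'a) \<Rightarrow> ('g \<Rightarrow> 'a) star_alg" where
  "skew_group_algebra G A \<alpha> =
    \<lparr>carrier = carrier G \<rightarrow>\<^sub>E carrier A,
     mult = (\<lambda>f h. \<lambda>s\<in>carrier G.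
       \<Oplus>\<^bsub>A\<^esub>t\<in>carrier G. f t \<otimes>\<^bsub>A\<^esub> \<alpha> t (h (inv\<^bsub>G\<^esub> t \<otimes>\<^bsub>G\<^esub> s))),
     one = (\<lambda>s\<in>carrier G. if s = \<one>\<^bsub>G\<^esub> then \<one>\<^bsub>A\<^esub> else \<zero>\<^bsub>A\<^esub>),
     zero = (\<lambda>s\<in>carrier G. \<zero>\<^bsub>A\<^esub>),
     add = (\<lambda>f h. \<lambda>s\<in>carrier G. f s \<oplus>\<^bsub>A\<^esub> h s),
     smult = (\<lambda>c f. \<lambda>s\<in>carrier G. c \<odot>\<^bsub>A\<^esub> f s),
     star = (\<lambda>f. \<lambda>s\<in>carrier G. \<alpha> s (star A (f (inv\<^bsub>G\<^esub> s))))\<rparr>"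

(* The enveloping C*-norm of L^1(G,A), i.e. the supremum of all C*-seminorms bounded by
   the L^1-norm.  (C*-seminorms are exactly the functions f |-> norm (pi f) for
   *-representations pi on Hilbert spaces, by Gelfand-Naimark; stated this way, no
   quantification over types of Hilbert spaces is needed.)  As G is finite, the function
   algebra is already complete in this norm, so no completion has to be taken. *)
definition crossed_product_norm ::
    "('g, 'm) monoid_scheme \<Rightarrow> 'a cstar_alg \<Rightarrow> ('g \<Rightarrow> 'a \<Rightarrow> 'a) \<Rightarrow> ('g \<Rightarrow> 'a) \<Rightarrow> real" where
  "crossed_product_norm G A \<alpha> f = Sup {p f | p.
     cstar_seminorm (skew_group_algebra G A \<alpha>) p \<and>
     (\<forall>h \<in> carrier G \<rightarrow>\<^sub>E carrier A. p h \<le> (\<Sum>s\<in>carrier G. cnorm A (h s)))}"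

definition crossed_product ::
    "('g, 'm) monoid_scheme \<Rightarrow> 'a cstar_alg \<Rightarrow> ('g \<Rightarrow> 'a \<Rightarrow> 'a) \<Rightarrow> ('g \<Rightarrow> 'a) cstar_alg" where
  "crossed_product G A \<alpha> = star_alg.extend (skew_group_algebra G A \<alpha>)
     (cstar_alg.fields (crossed_product_norm G A \<alpha>))"

end

theory Submission
  imports Defs
begin

text \<open>Matrices over the crossed product become, in the regular representation, matrices over \<open>A\<close>
  with rows and columns indexed by copies of \<open>G\<close>, invariant under \<open>G\<close>.  For idempotent matrices \<open>e\<close>
  and \<open>f\<close>, consider the property that the left invertible homomorphisms from the module of \<open>e\<close> to the
  module of \<open>f\<close> are dense.  Since \<open>A\<close> has stable rank one, it holds between one copy of a projection
  \<open>p\<close> and \<open>card G\<close> copies, and row operations extend it to \<open>k\<close> copies and \<open>k + card G - 1\<close> copies.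
  If \<open>A\<close> is infinite dimensional, then by the SP-property and simplicity there is some \<open>p \<noteq> 0\<close> of
  which \<open>card G - 1\<close> copies fit into the unit, and by simplicity the unit fits into \<open>k\<close> copies of
  \<open>p\<close> for some \<open>k\<close>.  The \<open>card G - 1\<close> additional copies are absorbed by one copy of the unit, and
  cancelling the complement of the unit in the \<open>k\<close> copies shows that the left invertible columns of
  length two are dense.  If \<open>A\<close> is finite dimensional, almost every perturbation by a scalar is
  already invertible.  As the enveloping norm is dominated by the norm of \<open>L\<^sup>1(G,A)\<close>, approximation
  in the latter norm is enough.\<close>

section \<open>Invertibility near idempotents\<close>

text \<open>The decisive point is that the surplus of \<open>card G - 1\<close> copies of
  \<open>p\<close> does not grow with \<open>k\<close>. The surplus has to fit into one unit, which
  forces \<open>p\<close> to be small, and the smaller \<open>p\<close> is, the more copies are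
  needed to cover the unit. So \<open>p\<close> is chosen first, and \<open>k\<close> may then be
  anything. The surplus exists because \<open>p\<close> is moved by the group. The corner of the
  crossed product at \<open>p\<close> is a single row of the matrix algebra over \<open>A\<close>
  cut down by the direct sum of all translates of \<open>p\<close>, whereas stable rank one speaks
  about square matrices; \<open>card G\<close> copies of \<open>p\<close> supply the missing rows.
  Density of left invertible homomorphisms is carried through instead of the stable rank of one
  algebra, because it compares two different modules, adds up over direct sums and lets common
  summands be cancelled; the crossed product itself need not be simple. Positivity is developed from
  an iteration for square roots, so no Gelfand theory is involved.\<close>

lemma invertible_near_idempotent:
  fixes S :: "'b::real_normed_algebra set"
  assumes S: "complete S" and add: "\<And>x y. x \<in> S \<Longrightarrow> y \<in> S \<Longrightarrow> x + y \<in> S"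
    and diff: "\<And>x y. x \<in> S \<Longrightarrow> y \<in> S \<Longrightarrow> x - y \<in> S"
    and mult: "\<And>x y. x \<in> S \<Longrightarrow> y \<in> S \<Longrightarrow> x * y \<in> S"
    and z: "z \<in> S" "z * z = z" and x: "x \<in> S" "z * x = x" "x * z = x"
    and near: "norm (z - x) < 1"
  shows "\<exists>w\<in>S. z * w = w \<and> w * z = w \<and> w * x = z \<and> x * w = z"
proof -
  define y where "y = z - x"
  have y: "y \<in> S" "z * y = y" "y * z = y"
    using z x diff by (auto simp: y_def algebra_simps)
  have n: "norm y < 1" using near by (simp add: y_def)
  \<comment> \<open>Fixed points of contractions with factor \<open>norm y\<close> replace the
    Neumann series: they stay in the complete set \<open>S\<close> and need no unit of the ring.
    This one is a right inverse of \<open>x\<close> relative to \<open>z\<close>, the second one a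
    left inverse.\<close>
  have "\<exists>!w. w \<in> S \<and> z + y * w = w"
  proof (rule Banach_fix[OF S, of "norm y"])
    show "S \<noteq> {}" using z by auto
    show "(\<lambda>w. z + y * w) ` S \<subseteq> S" using add mult y z by auto
    fix u v
    have "dist (z + y * u) (z + y * v) = norm (y * (u - v))"
      by (simp add: dist_norm algebra_simps)
    also have "\<dots> \<le> norm y * norm (u - v)" by (rule norm_mult_ineq)
    finally show "dist (z + y * u) (z + y * v) \<le> norm y * dist u v"
      by (simp add: dist_norm)
  qed (use n in auto)
  then obtain w where w: "w \<in> S" "z + y * w = w" by blast
  have "\<exists>!w. w \<in> S \<and> z + w * y = w"
  proof (rule Banach_fix[OF S, of "norm y"])
    show "S \<noteq> {}" using z by auto
    show "(\<lambda>w. z + w * y) ` S \<subseteq> S" using add mult y z by auto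
    fix u v
    have "dist (z + u * y) (z + v * y) = norm ((u - v) * y)"
      by (simp add: dist_norm algebra_simps)
    also have "\<dots> \<le> norm (u - v) * norm y" by (rule norm_mult_ineq)
    finally show "dist (z + u * y) (z + v * y) \<le> norm y * dist u v"
      by (simp add: dist_norm mult.commute)
  qed (use n in auto)
  then obtain w' where w': "w' \<in> S" "z + w' * y = w'" by blast
  have zw: "z * w = w"
  proof -
    have "z * w = z * (z + y * w)" using w by simp
    also have "\<dots> = z + y * w" using z y by (simp add: distrib_left mult.assoc[symmetric])
    finally show ?thesis using w by simp
  qed
  have w'z: "w' * z = w'"
  proof -
    have "w' * z = (z + w' * y) * z" using w' by simp
    also have "\<dots> = z + w' * y" using z y by (simp add: distrib_right mult.assoc)
    finally show ?thesis using w' by simp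
  qed
  have xw: "x * w = z"
  proof -
    have "x * w = z * w - y * w" by (simp add: y_def algebra_simps)
    also have "\<dots> = z" using zw w by (simp add: algebra_simps)
    finally show ?thesis .
  qed
  have w'x: "w' * x = z"
  proof -
    have "w' * x = w' * z - w' * y" by (simp add: y_def algebra_simps)
    also have "\<dots> = z" using w'z w' by (simp add: algebra_simps)
    finally show ?thesis .
  qed
  have "w' = w' * (x * w)" by (simp add: xw w'z)
  also have "\<dots> = w" by (simp add: mult.assoc[symmetric] w'x zw)
  finally have "w' = w" .
  then show ?thesis using w zw w'z xw w'x by blast
qed

section \<open>Positivity in C*-algebras\<close>

text \<open>\<^class>\<open>ring_1\<close> would exclude the zero algebra, hence \<^class>\<open>monoid_mult\<close>.  Complex scalars are encoded by the central element \<open>imu\<close>,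
  the product of the imaginary unit and the unit of the algebra.\<close>

class cstar = real_normed_algebra + monoid_mult + banach +
  fixes adj :: "'a \<Rightarrow> 'a" and imu :: 'a
  assumes adj_adj [simp]: "adj (adj x) = x"
    and adj_add: "adj (x + y) = adj x + adj y"
    and adj_mult: "adj (x * y) = adj y * adj x"
    and adj_scaleR [simp]: "adj (r *\<^sub>R x) = r *\<^sub>R adj x"
    and norm_adj_mult: "norm (adj x * x) = (norm x)\<^sup>2"
    and imu_imu [simp]: "imu * imu = - 1"
    and imu_commute: "imu * x = x * imu"
    and adj_imu [simp]: "adj imu = - imu"
lemma adj_zero [simp]: "adj 0 = (0::'b::cstar)"
  using adj_add[of 0 "0::'b"] by simp

lemma adj_minus [simp]: "adj (- x) = - adj (x::'b::cstar)"
  using adj_add[of x "- x"] by (metis add.right_inverse add_eq_0_iff adj_zero)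

lemma adj_diff: "adj (x - y) = adj x - adj (y::'b::cstar)"
  using adj_add[of x "- y"] by simp

lemma adj_one [simp]: "adj 1 = (1::'b::cstar)"
  by (metis adj_adj adj_mult mult_1_left mult_1_right)

lemma norm_adj [simp]: "norm (adj x) = norm (x::'b::cstar)"
proof -
  have le: "norm x \<le> norm (adj x)" for x :: 'b
  proof (cases "norm x = 0")
    case False
    have "(norm x)\<^sup>2 \<le> norm (adj x) * norm x"
      using norm_mult_ineq[of "adj x" x] by (simp add: norm_adj_mult)
    then have "norm x * norm x \<le> norm (adj x) * norm x" by (simp add: power2_eq_square)
    moreover have "norm x > 0" using False by simp
    ultimately show ?thesis using mult_le_cancel_right_pos by blast
  qed auto
  show ?thesis using le[of x] le[of "adj x"] by simp
qed

definition sa :: "'b::cstar \<Rightarrow> bool" where "sa x \<longleftrightarrow> adj x = x"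

lemma norm_mult_self: "sa x \<Longrightarrow> norm (x * x) = (norm (x::'b::cstar))\<^sup>2"
  using norm_adj_mult[of x] by (simp add: sa_def)

lemma sa_mult_self_eq_0: "sa x \<Longrightarrow> x * x = 0 \<Longrightarrow> x = (0::'b::cstar)"
  using norm_mult_self[of x] by simp

lemma adj_mult_eq_0: "adj x * x = 0 \<Longrightarrow> x = (0::'b::cstar)"
  using norm_adj_mult[of x] by simp

lemma norm_one_le: "norm (1::'b::cstar) \<le> 1"
proof -
  have "norm (1::'b::cstar) = (norm (1::'b::cstar))\<^sup>2" using norm_adj_mult[of 1] by simp
  then have "norm (1::'b) * (norm (1::'b) - 1) = 0" by (simp add: power2_eq_square algebra_simps)
  then show ?thesis unfolding mult_eq_0_iff by linarith
qed

lemma sa_simps [simp]: "sa (0::'b::cstar)" "sa (1::'b)" "sa x \<Longrightarrow> sa (r *\<^sub>R x :: 'b)" "sa x \<Longrightarrow> sa (- x :: 'b)"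
  "sa x \<Longrightarrow> sa y \<Longrightarrow> sa (x + y :: 'b)" "sa x \<Longrightarrow> sa y \<Longrightarrow> sa (x - y :: 'b)" "sa x \<Longrightarrow> sa (x * x :: 'b)"
  "sa (adj x * x :: 'b)" "sa (x * adj x :: 'b)"
  by (auto simp: sa_def adj_add adj_diff adj_mult)

lemma sa_mult: "sa x \<Longrightarrow> sa y \<Longrightarrow> x * y = y * x \<Longrightarrow> sa (x * y :: 'b::cstar)"
  by (simp add: sa_def adj_mult)

text \<open>For self-adjoint \<open>x\<close> the inequality places the spectrum between 0 and
  \<open>2 * t\<close>, so this is spectral positivity without a spectrum. In this form sums are
  immediate, and after rescaling a square root comes from an iteration in the unit ball.\<close>

definition pos :: "'b::cstar \<Rightarrow> bool" where
  "pos x \<longleftrightarrow> sa x \<and> (\<exists>t. norm (t *\<^sub>R 1 - x) \<le> t)"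

lemma pos_sa: "pos x \<Longrightarrow> sa (x::'b::cstar)" by (simp add: pos_def)

lemma bounded_linear_adj: "bounded_linear (adj :: 'b::cstar \<Rightarrow> 'b)"
  by (rule bounded_linear_intro[where K=1]) (auto simp: adj_add)

lemma continuous_on_adj [continuous_intros]:
  "continuous_on A f \<Longrightarrow> continuous_on A (\<lambda>x. adj (f x :: 'b::cstar))"
  by (rule bounded_linear.continuous_on[OF bounded_linear_adj])

lemma tendsto_adj: "(f \<longlongrightarrow> a) F \<Longrightarrow> ((\<lambda>x. adj (f x :: 'b::cstar)) \<longlongrightarrow> adj a) F"
  by (rule bounded_linear.tendsto[OF bounded_linear_adj])

section \<open>Square roots of positive elements by iteration\<close>

primrec sqrt_iter :: "'b::real_normed_algebra \<Rightarrow> nat \<Rightarrow> 'b" where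
  "sqrt_iter y 0 = 0"
| "sqrt_iter y (Suc n) = (1/2) *\<^sub>R (y + sqrt_iter y n * sqrt_iter y n)"

lemma sqrt_iter_real: "0 \<le> sqrt_iter (1::real) n" "sqrt_iter (1::real) n \<le> 1"
proof -
  have "0 \<le> sqrt_iter (1::real) n \<and> sqrt_iter (1::real) n \<le> 1"
  proof (induction n)
    case (Suc n)
    then have "sqrt_iter (1::real) n * sqrt_iter 1 n \<le> 1 * 1" by (intro mult_mono) auto
    with Suc show ?case by simp
  qed simp
  then show "0 \<le> sqrt_iter (1::real) n" "sqrt_iter (1::real) n \<le> 1" by auto
qed

lemma sqrt_iter_commute: "c * y = y * c \<Longrightarrow> c * sqrt_iter y n = sqrt_iter y n * c"
proof (induction n)
  case (Suc n)
  have "c * (sqrt_iter y n * sqrt_iter y n) = sqrt_iter y n * sqrt_iter y n * c"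
  proof -
    have "c * (sqrt_iter y n * sqrt_iter y n) = c * sqrt_iter y n * sqrt_iter y n"
      by (simp only: mult.assoc)
    then show ?thesis by (simp only: Suc.IH[OF Suc.prems] mult.assoc)
  qed
  with Suc show ?case by (simp add: algebra_simps)
qed simp

text \<open>The increments of the iteration are dominated by those of the scalar iteration at 1.\<close>
lemma sqrt_iter_bound:
  fixes y :: "'b::real_normed_algebra"
  assumes "norm y \<le> 1"
  shows "norm (sqrt_iter y n) \<le> sqrt_iter 1 n"
    and "norm (sqrt_iter y (Suc n) - sqrt_iter y n) \<le> sqrt_iter 1 (Suc n) - sqrt_iter 1 n"
proof -
  show b: "norm (sqrt_iter y n) \<le> sqrt_iter 1 n" for n
  proof (induction n)
    case (Suc n)
    have "norm (sqrt_iter y n * sqrt_iter y n) \<le> sqrt_iter 1 n * sqrt_iter 1 n"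
      by (rule order_trans[OF norm_mult_ineq]) (intro mult_mono Suc order_trans[OF norm_ge_zero Suc], simp)
    then have "norm (y + sqrt_iter y n * sqrt_iter y n) \<le> 1 + sqrt_iter 1 n * sqrt_iter 1 n"
      using norm_triangle_ineq[of y "sqrt_iter y n * sqrt_iter y n"] assms by linarith
    then show ?case by simp
  qed simp
  show "norm (sqrt_iter y (Suc n) - sqrt_iter y n) \<le> sqrt_iter 1 (Suc n) - sqrt_iter 1 n"
  proof (induction n)
    case 0
    then show ?case using assms by simp
  next
    case (Suc n)
    define a b where "a = sqrt_iter y (Suc n)" and "b = sqrt_iter y n"
    define s t where "s = sqrt_iter (1::real) (Suc n)" and "t = sqrt_iter (1::real) n"
    have ab: "a * b = b * a"
      unfolding a_def b_def by (intro sqrt_iter_commute sqrt_iter_commute[symmetric]) simp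
    have "norm (a * a - b * b) = norm ((a - b) * (a + b))"
      using ab by (simp add: algebra_simps)
    also have "\<dots> \<le> norm (a - b) * norm (a + b)" by (rule norm_mult_ineq)
    also have "\<dots> \<le> (s - t) * (s + t)"
    proof (rule mult_mono)
      show "norm (a - b) \<le> s - t" using Suc by (simp add: a_def b_def s_def t_def del: sqrt_iter.simps)
      then show "0 \<le> s - t" by (rule order_trans[OF norm_ge_zero])
      show "norm (a + b) \<le> s + t"
        using norm_triangle_ineq[of a b] b[of n] b[of "Suc n"]
        by (simp add: a_def b_def s_def t_def del: sqrt_iter.simps)
    qed simp
    also have "\<dots> = s * s - t * t" by (simp add: algebra_simps)
    finally have le: "norm (a * a - b * b) \<le> s * s - t * t" .
    have "sqrt_iter y (Suc (Suc n)) - sqrt_iter y (Suc n) = (1/2) *\<^sub>R (a * a - b * b)"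
    proof -
      have "sqrt_iter y (Suc (Suc n)) = (1/2) *\<^sub>R (y + a * a)" by (simp add: a_def)
      moreover have "sqrt_iter y (Suc n) = (1/2) *\<^sub>R (y + b * b)" by (simp add: b_def)
      ultimately show ?thesis by (simp only: scaleR_right_diff_distrib[symmetric]) simp
    qed
    moreover have "sqrt_iter 1 (Suc (Suc n)) - sqrt_iter (1::real) (Suc n) = (1/2) * (s * s - t * t)"
    proof -
      have "sqrt_iter 1 (Suc (Suc n)) = (1/2) * (1 + s * s)" by (simp add: s_def)
      moreover have "sqrt_iter 1 (Suc n) = (1/2) * (1 + t * t)" by (simp add: t_def)
      ultimately show ?thesis by (simp only: right_diff_distrib[symmetric]) simp
    qed
    ultimately show ?case using le by (simp del: sqrt_iter.simps)
  qed
qed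

text \<open>On the boundary \<open>norm y = 1\<close> there is no geometric rate of convergence. The
  scalar sequence at 1 is increasing and bounded, hence Cauchy, and it dominates all
  increments.\<close>

lemma sqrt_iter_convergent:
  fixes y :: "'b::{real_normed_algebra,banach}"
  assumes y: "norm y \<le> 1"
  obtains l where "sqrt_iter y \<longlonglongrightarrow> l"
proof -
  have mono: "incseq (sqrt_iter (1::real))"
  proof (rule incseq_SucI)
    show "sqrt_iter (1::real) n \<le> sqrt_iter 1 (Suc n)" for n
      using order_trans[OF norm_ge_zero sqrt_iter_bound(2)[OF y, of n]] by simp
  qed
  then obtain L where "sqrt_iter (1::real) \<longlonglongrightarrow> L"
    using incseq_convergent[of "sqrt_iter (1::real)" 1] sqrt_iter_real by blast
  then have c: "Cauchy (sqrt_iter (1::real))" by (rule LIMSEQ_imp_Cauchy)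
  have d: "norm (sqrt_iter y (n + k) - sqrt_iter y n) \<le> sqrt_iter 1 (n + k) - sqrt_iter 1 n" for n k
  proof (induction k)
    case (Suc k)
    have "norm (sqrt_iter y (n + Suc k) - sqrt_iter y n)
      \<le> norm (sqrt_iter y (Suc (n + k)) - sqrt_iter y (n + k)) + norm (sqrt_iter y (n + k) - sqrt_iter y n)"
      using norm_triangle_ineq[of "sqrt_iter y (Suc (n + k)) - sqrt_iter y (n + k)" "sqrt_iter y (n + k) - sqrt_iter y n"]
      by (simp del: sqrt_iter.simps)
    then show ?case using Suc sqrt_iter_bound(2)[OF y, of "n + k"] by (simp del: sqrt_iter.simps)
  qed simp
  have "Cauchy (sqrt_iter y)"
  proof (rule CauchyI')
    fix e :: real assume "0 < e"
    then obtain M where M: "\<And>m n. m \<ge> M \<Longrightarrow> n \<ge> M \<Longrightarrow> norm (sqrt_iter (1::real) m - sqrt_iter 1 n) < e"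
      using CauchyD[OF c] by blast
    show "\<exists>M. \<forall>m\<ge>M. \<forall>n>m. dist (sqrt_iter y m) (sqrt_iter y n) < e"
    proof (intro exI[of _ M] allI impI)
      fix m n assume mn: "M \<le> m" "m < n"
      then obtain k where k: "n = m + k" using less_imp_add_positive by blast
      show "dist (sqrt_iter y m) (sqrt_iter y n) < e"
        using d[of m k] M[of n m] mn by (simp add: k dist_norm norm_minus_commute)
    qed
  qed
  then show thesis using that Cauchy_convergent_iff convergent_def by metis
qed

text \<open>The limit \<open>l\<close> of the iteration satisfies \<open>l + l = y + l * l\<close>,
  that is \<open>(1 - l) * (1 - l) = 1 - y\<close>. The root commutes with everything that commutes
  with \<open>y\<close>; this clause takes the place of a commutative functional calculus in what
  follows.\<close>

lemma sqrt_one_minus: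
  fixes y :: "'b::cstar"
  assumes y: "norm y \<le> 1" and sy: "sa y"
  obtains g where "sa g" "g * g = 1 - y" "norm (1 - g) \<le> 1" "\<And>c. c * y = y * c \<Longrightarrow> c * g = g * c"
proof -
  obtain l where l: "sqrt_iter y \<longlonglongrightarrow> l" using sqrt_iter_convergent[OF y] .
  have "(\<lambda>n. sqrt_iter y (Suc n)) \<longlonglongrightarrow> l" using l by (rule LIMSEQ_Suc)
  moreover have "(\<lambda>n. sqrt_iter y (Suc n)) \<longlonglongrightarrow> (1/2) *\<^sub>R (y + l * l)"
    unfolding sqrt_iter.simps by (intro tendsto_intros l)
  ultimately have "l = (1/2) *\<^sub>R (y + l * l)" by (rule LIMSEQ_unique)
  then have "2 *\<^sub>R l = 2 *\<^sub>R ((1/2) *\<^sub>R (y + l * l))" by (rule arg_cong)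
  then have fix1: "l + l = y + l * l" by (simp add: scaleR_2)
  have sa: "sa (sqrt_iter y n)" for n
    by (induction n) (auto simp: sy)
  have "(\<lambda>n. adj (sqrt_iter y n)) \<longlonglongrightarrow> adj l" by (rule tendsto_adj[OF l])
  moreover have "(\<lambda>n. adj (sqrt_iter y n)) = sqrt_iter y" using sa by (auto simp: sa_def)
  ultimately have sl: "sa l" using l LIMSEQ_unique by (auto simp: sa_def)
  have nl: "norm l \<le> 1"
  proof (rule LIMSEQ_le_const2[OF tendsto_norm[OF l]])
    show "\<exists>N. \<forall>n\<ge>N. norm (sqrt_iter y n) \<le> 1"
      using sqrt_iter_bound(1)[OF y] sqrt_iter_real(2) order_trans by blast
  qed
  have comm: "c * l = l * c" if "c * y = y * c" for c
  proof -
    have "(\<lambda>n. c * sqrt_iter y n) \<longlonglongrightarrow> c * l" by (intro tendsto_intros l)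
    moreover have "(\<lambda>n. c * sqrt_iter y n) \<longlonglongrightarrow> l * c"
      unfolding sqrt_iter_commute[OF that] by (intro tendsto_intros l)
    ultimately show ?thesis by (rule LIMSEQ_unique)
  qed
  show thesis
  proof (rule that[of "1 - l"])
    have "(1 - l) * (1 - l) = 1 - (l + l) + l * l" by (simp add: algebra_simps)
    also have "\<dots> = 1 - y" by (simp add: fix1)
    finally show "(1 - l) * (1 - l) = 1 - y" .
  qed (use sl nl comm in \<open>auto simp: algebra_simps\<close>)
qed

lemma pos_sqrt:
  fixes x :: "'b::cstar"
  assumes "pos x"
  obtains g where "pos g" "g * g = x" "\<And>c. c * x = x * c \<Longrightarrow> c * g = g * c"
proof -
  obtain t where t: "norm (t *\<^sub>R 1 - x) \<le> t" and sx: "sa x" using assms by (auto simp: pos_def)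
  have "0 \<le> t" using order_trans[OF norm_ge_zero t] .
  show thesis
  proof (cases "t = 0")
    case True
    then have "x = 0" using t by simp
    then show thesis by (intro that[of 0]) (auto simp: pos_def intro: exI[of _ 0])
  next
    case False
    then have tp: "t > 0" using \<open>0 \<le> t\<close> by simp
    \<comment> \<open>Rescaling by the witness \<open>t\<close> of positivity moves \<open>x\<close>
      to \<open>1 - y\<close> with \<open>norm y \<le> 1\<close>.\<close>
    define y where "y = 1 - (1/t) *\<^sub>R x"
    have "y = (1/t) *\<^sub>R (t *\<^sub>R 1 - x)" using tp by (simp add: y_def scaleR_right_diff_distrib)
    then have ny: "norm y \<le> 1" using t tp by simp
    have "sa y" using sx by (simp add: y_def)
    then obtain g where g: "sa g" "g * g = 1 - y" "norm (1 - g) \<le> 1"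
        "\<And>c. c * y = y * c \<Longrightarrow> c * g = g * c"
      using sqrt_one_minus[OF ny] by blast
    show thesis
    proof (rule that[of "sqrt t *\<^sub>R g"])
      have "norm (sqrt t *\<^sub>R 1 - sqrt t *\<^sub>R g) = sqrt t * norm (1 - g)"
        using tp by (simp add: scaleR_right_diff_distrib[symmetric])
      also have "\<dots> \<le> sqrt t" using g(3) tp by simp
      finally show "pos (sqrt t *\<^sub>R g)" using g(1) by (auto simp: pos_def)
      show "sqrt t *\<^sub>R g * sqrt t *\<^sub>R g = x" using g(2) tp by (simp add: y_def)
      fix c assume "c * x = x * c"
      then have "c * y = y * c" by (simp add: y_def algebra_simps)
      then show "c * sqrt t *\<^sub>R g = sqrt t *\<^sub>R g * c" using g(4) by simp
    qed
  qed
qed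

section \<open>The cone of positive elements\<close>

lemma pos_zero [simp]: "pos (0::'b::cstar)"
  by (auto simp: pos_def intro: exI[of _ 0])

lemma pos_one [simp]: "pos (1::'b::cstar)"
  by (auto simp: pos_def intro!: exI[of _ 1])

lemma pos_add: "pos x \<Longrightarrow> pos y \<Longrightarrow> pos (x + y :: 'b::cstar)"
  unfolding pos_def
proof (elim conjE exE, intro conjI)
  fix s t assume "norm (s *\<^sub>R 1 - x) \<le> s" "norm (t *\<^sub>R 1 - y) \<le> t"
  then have "norm ((s + t) *\<^sub>R 1 - (x + y)) \<le> s + t"
    using norm_triangle_ineq[of "s *\<^sub>R 1 - x" "t *\<^sub>R 1 - y"] by (simp add: algebra_simps)
  then show "\<exists>t. norm (t *\<^sub>R 1 - (x + y)) \<le> t" by blast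
qed auto

lemma pos_scaleR: "pos x \<Longrightarrow> 0 \<le> r \<Longrightarrow> pos (r *\<^sub>R x :: 'b::cstar)"
  unfolding pos_def
proof (elim conjE exE, intro conjI)
  fix s assume "norm (s *\<^sub>R 1 - x) \<le> s" "0 \<le> r"
  moreover have "(r * s) *\<^sub>R 1 - r *\<^sub>R x = r *\<^sub>R (s *\<^sub>R 1 - x)" by (simp add: algebra_simps)
  ultimately have "norm ((r * s) *\<^sub>R 1 - r *\<^sub>R x) \<le> r * s"
    by (simp add: mult_left_mono)
  then show "\<exists>t. norm (t *\<^sub>R 1 - r *\<^sub>R x) \<le> t" by blast
qed auto

lemma pos_of_near_scalar: "sa x \<Longrightarrow> norm x \<le> t \<Longrightarrow> pos (t *\<^sub>R 1 - x :: 'b::cstar)"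
  unfolding pos_def by (intro conjI exI[of _ t]) auto

text \<open>With a commuting pair whose squares sum to 1 comes the unitary \<open>c + imu * m\<close>.\<close>
lemma norm_le_1_of_sum_squares:
  fixes c m :: "'b::cstar"
  assumes c: "sa c" and m: "sa m" and cm: "c * m = m * c" and s: "c * c + m * m = 1"
  shows "norm c \<le> 1"
proof -
  define u where "u = c + imu * m"
  have au: "adj u = c - imu * m"
    using c m by (simp add: u_def sa_def adj_add adj_mult imu_commute)
  have mi: "m * imu = imu * m" "c * imu = imu * c" by (simp_all add: imu_commute)
  have "imu * m * (imu * m) = - (m * m)"
    by (metis imu_commute imu_imu mult.assoc mult_1_left mult_minus_left)
  moreover have "c * (imu * m) = imu * m * c"
    by (metis cm mi(2) mult.assoc)
  ultimately have "adj u * u = 1"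
    unfolding au unfolding u_def using s by (simp add: algebra_simps)
  then have "norm u \<le> 1"
    using norm_adj_mult[of u] norm_one_le[where 'b='b] by (simp add: abs_square_le_1)
  moreover have "2 *\<^sub>R c = u + adj u" unfolding au by (simp add: u_def scaleR_2)
  then have "2 * norm c \<le> norm u + norm (adj u)"
    by (metis norm_triangle_ineq norm_scaleR abs_numeral)
  ultimately show ?thesis by simp
qed

text \<open>The root \<open>m\<close> of \<open>1 - k * k\<close> satisfies
  \<open>m * m + k * k = 1\<close> and is therefore a contraction itself, so its square
  \<open>1 - k * k\<close> is one too. Exchanging the two summands in this way is what makes squares
  positive.\<close>

lemma norm_one_minus_square:
  fixes k :: "'b::cstar"
  assumes k: "sa k" and n: "norm k \<le> 1"
  shows "norm (1 - k * k) \<le> 1"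
proof -
  have nk: "norm (k * k) \<le> 1" using norm_mult_self[OF k] n by (simp add: power_le_one)
  obtain m where m: "sa m" "m * m = 1 - k * k" "\<And>c. c * (k * k) = k * k * c \<Longrightarrow> c * m = m * c"
    using sqrt_one_minus[OF nk sa_simps(7)[OF k]] by blast
  have "norm m \<le> 1"
  proof (rule norm_le_1_of_sum_squares[OF m(1) k])
    show "m * k = k * m" using m(3)[of k] by (simp add: mult.assoc)
    show "m * m + k * k = 1" using m(2) by simp
  qed
  then show ?thesis using norm_mult_self[OF m(1)] m(2) by (simp add: power_le_one)
qed

lemma norm_scalar_minus_square:
  fixes k :: "'b::cstar"
  assumes k: "sa k" and n: "norm (k * k) \<le> t"
  shows "norm (t *\<^sub>R 1 - k * k) \<le> t"
proof -
  have t: "0 \<le> t" using order_trans[OF norm_ge_zero n] .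
  show ?thesis
  proof (cases "t = 0")
    case True
    then show ?thesis using n by simp
  next
    case False
    then have tp: "t > 0" using t by simp
    define h where "h = (1 / sqrt t) *\<^sub>R k"
    have "(norm k)\<^sup>2 \<le> t" using norm_mult_self[OF k] n by simp
    then have "norm k \<le> sqrt t" using real_le_rsqrt by blast
    then have "norm h \<le> 1" using tp by (simp add: h_def)
    moreover have "sa h" using k by (simp add: h_def)
    ultimately have "norm (1 - h * h) \<le> 1" by (intro norm_one_minus_square)
    moreover have "t *\<^sub>R 1 - k * k = t *\<^sub>R (1 - h * h)"
      using tp by (simp add: h_def scaleR_right_diff_distrib)
    ultimately show ?thesis using tp by simp
  qed
qed

lemma pos_square: "sa k \<Longrightarrow> pos (k * k :: 'b::cstar)"
  using norm_scalar_minus_square[of k "norm (k * k)"] by (auto simp: pos_def)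

lemma pos_norm_scalar_minus: "pos x \<Longrightarrow> norm x \<le> t \<Longrightarrow> norm (t *\<^sub>R 1 - x :: 'b::cstar) \<le> t"
proof -
  assume x: "pos x" and t: "norm x \<le> t"
  obtain g where "pos g" "g * g = x" using pos_sqrt[OF x] by blast
  then show ?thesis using norm_scalar_minus_square[OF pos_sa, of g t] t by simp
qed

text \<open>The existential bound in \<open>pos\<close> may always be the norm itself, because a
  positive element is a square. Without the quantifier, positivity is visibly a closed
  condition.\<close>

lemma pos_iff: "pos (x::'b::cstar) \<longleftrightarrow> adj x = x \<and> norm (norm x *\<^sub>R 1 - x) \<le> norm x"
  using pos_norm_scalar_minus[of x "norm x"] by (auto simp: pos_def sa_def)

lemma closed_pos: "closed {x::'b::cstar. pos x}"
  unfolding pos_iff Collect_conj_eq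
  by (intro closed_Int closed_Collect_eq closed_Collect_le continuous_intros)

lemma pos_limit:
  fixes x :: "'b::cstar"
  assumes "\<And>e::real. e > 0 \<Longrightarrow> pos (x + e *\<^sub>R d)"
  shows "pos x"
proof -
  have "(\<lambda>n. x + inverse (real (Suc n)) *\<^sub>R d) \<longlonglongrightarrow> x + 0 *\<^sub>R d"
    by (intro tendsto_intros LIMSEQ_inverse_real_of_nat)
  then show ?thesis
    using closed_sequentially[OF closed_pos, of "\<lambda>n. x + inverse (real (Suc n)) *\<^sub>R d"] assms by simp
qed

lemma pos_mult:
  fixes x y :: "'b::cstar"
  assumes x: "pos x" and y: "pos y" and xy: "x * y = y * x"
  shows "pos (x * y)"
proof -
  obtain g where g: "pos g" "g * g = x" "\<And>c. c * x = x * c \<Longrightarrow> c * g = g * c"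
    using pos_sqrt[OF x] by blast
  obtain h where h: "pos h" "h * h = y" "\<And>c. c * y = y * c \<Longrightarrow> c * h = h * c"
    using pos_sqrt[OF y] by blast
  have "y * g = g * y" using g(3)[of y] xy by simp
  then have gh: "g * h = h * g" using h(3)[of g] by simp
  have "x * y = (g * h) * (g * h)"
    unfolding g(2)[symmetric] h(2)[symmetric] by (metis gh mult.assoc)
  then show ?thesis using pos_square sa_mult[OF pos_sa pos_sa, OF g(1) h(1) gh] by simp
qed

lemma invertible_near_one:
  fixes x :: "'b::cstar"
  assumes "norm (1 - x) < 1"
  obtains w where "w * x = 1" "x * w = 1"
proof -
  have "\<exists>w\<in>UNIV. 1 * w = w \<and> w * 1 = w \<and> w * x = 1 \<and> x * w = 1"
    by (rule invertible_near_idempotent) (use assms in \<open>simp_all add: complete_UNIV\<close>)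
  then show thesis using that by blast
qed

lemma pos_add_scalar_invertible:
  fixes x :: "'b::cstar"
  assumes "pos x" and t: "t > 0"
  obtains w where "w * (t *\<^sub>R 1 + x) = 1" "(t *\<^sub>R 1 + x) * w = 1"
proof -
  obtain s where s: "norm (s *\<^sub>R 1 - x) \<le> s" using assms by (auto simp: pos_def)
  have s0: "s \<ge> 0" using order_trans[OF norm_ge_zero s] .
  \<comment> \<open>With this scaling the distance of \<open>t + x\<close> from 1 becomes
    \<open>c\<close> times the norm of \<open>s - x\<close>, which is at most
    \<open>s / (s + t) < 1\<close>.\<close>
  define c where "c = 1 / (s + t)"
  have c: "c > 0" "c * (s + t) = 1" using s0 t by (auto simp: c_def)
  have "1 - c *\<^sub>R (t *\<^sub>R 1 + x) = c *\<^sub>R (s *\<^sub>R 1 - x)"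
  proof -
    have "1 = (c * s) *\<^sub>R 1 + (c * t) *\<^sub>R (1::'b)"
      by (metis c(2) distrib_left scaleR_add_left scaleR_one)
    then have "1 - (c * t) *\<^sub>R 1 = (c * s) *\<^sub>R (1::'b)" by (metis add_diff_cancel_right')
    then show ?thesis by (simp add: scaleR_add_right scaleR_right_diff_distrib diff_diff_eq[symmetric])
  qed
  then have "norm (1 - c *\<^sub>R (t *\<^sub>R 1 + x)) \<le> c * s" using s c(1) by simp
  also have "\<dots> < 1"
    using c t mult_pos_pos[of c t] unfolding distrib_left by linarith
  finally obtain w where "w * (c *\<^sub>R (t *\<^sub>R 1 + x)) = 1" "(c *\<^sub>R (t *\<^sub>R 1 + x)) * w = 1"
    using invertible_near_one by blast
  then show thesis by (intro that[of "c *\<^sub>R w"]) simp_all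
qed

text \<open>The link from invertibility back to \<open>pos\<close>. The set of
  \<open>t \<ge> 0\<close> for which \<open>t + h\<close> is positive is closed. At a least element
  \<open>l > 0\<close> the positive element \<open>x = l + h\<close> has an inverse
  \<open>y\<close>, and then \<open>x * (1 - d *\<^sub>R y) = x - d\<close> is still positive for
  small \<open>d\<close>, against minimality.\<close>

lemma pos_of_invertible_translates:
  fixes h :: "'b::cstar"
  assumes h: "sa h" and inv: "\<And>t. t > 0 \<Longrightarrow> \<exists>y. y * (t *\<^sub>R 1 + h) = 1 \<and> (t *\<^sub>R 1 + h) * y = 1"
  shows "pos h"
proof -
  define T where "T = {t. 0 \<le> t \<and> pos (t *\<^sub>R 1 + h)}"
  have "norm h \<in> T"
    using pos_of_near_scalar[of "- h" "norm h"] h by (simp add: T_def)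
  have bdd: "bdd_below T" by (auto simp: T_def bdd_below_def)
  have "closed T"
  proof -
    have "T = {0..} \<inter> (\<lambda>t. t *\<^sub>R 1 + h) -` {x. pos x}" by (auto simp: T_def)
    moreover have "continuous_on {0..} (\<lambda>t::real. t *\<^sub>R 1 + h)" by (intro continuous_intros)
    ultimately show ?thesis 
      using continuous_closed_preimage[of "{0..}" "\<lambda>t::real. t *\<^sub>R 1 + h", OF _ closed_atLeast closed_pos]
      by simp
  qed
  then have l: "Inf T \<in> T" using \<open>norm h \<in> T\<close> bdd closed_contains_Inf by blast
  define l where "l = Inf T"
  have lT: "l \<in> T" using l by (simp add: l_def)
  have "l = 0"
  proof (rule ccontr)
    assume "l \<noteq> 0"
    then have lp: "l > 0" using lT by (auto simp: T_def)
    define x where "x = l *\<^sub>R 1 + h"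
    have px: "pos x" using lT by (simp add: T_def x_def)
    obtain y where y: "y * x = 1" "x * y = 1" using inv[OF lp] unfolding x_def by blast
    have sx: "adj x = x" using pos_sa[OF px] by (simp add: sa_def)
    have "adj y * x = 1" using y(2) sx by (metis adj_mult adj_one)
    then have sy: "sa y" unfolding sa_def using y(2)
      by (metis mult.assoc mult_1_left mult_1_right)
    \<comment> \<open>\<open>d \<le> l\<close> keeps \<open>l - d\<close> nonnegative, and
      \<open>d * norm y \<le> 1\<close> makes \<open>1 - d *\<^sub>R y\<close> positive; the added 1
      avoids a division by zero.\<close>
    define d where "d = min l (1 / (norm y + 1))"
    have d: "d > 0" "d \<le> l" "d * norm y \<le> 1"
    proof -
      show "d > 0" using lp by (simp add: d_def add_nonneg_pos)
      show "d \<le> l" by (simp add: d_def)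
      have "d * norm y \<le> (1 / (norm y + 1)) * norm y"
        by (intro mult_right_mono) (auto simp: d_def)
      also have "\<dots> \<le> 1" by (simp add: divide_le_eq add_nonneg_pos)
      finally show "d * norm y \<le> 1" .
    qed
    have "pos (1 *\<^sub>R 1 - d *\<^sub>R y)"
      by (rule pos_of_near_scalar) (use d sy in auto)
    then have "pos (x * (1 - d *\<^sub>R y))"
      by (intro pos_mult px) (simp_all add: algebra_simps y)
    moreover have "x * (1 - d *\<^sub>R y) = (l - d) *\<^sub>R 1 + h"
      using y by (simp add: algebra_simps x_def)
    ultimately have "l - d \<in> T" using d by (simp add: T_def)
    then show False using cInf_lower[OF _ bdd, of "l - d"] d by (simp add: l_def)
  qed
  then show ?thesis using lT by (simp add: T_def)
qed

text \<open>Commuting roots \<open>s\<close> of \<open>x\<close> and \<open>t\<close> of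
  \<open>- x\<close> have squares summing to 0, so \<open>u = s + imu * t\<close> satisfies
  \<open>adj u * u = 0\<close>. The C*-identity gives \<open>u = 0\<close>, and \<open>s\<close> is
  the self-adjoint part of \<open>u\<close>.\<close>

lemma pos_neg_eq_0:
  fixes x :: "'b::cstar"
  assumes "pos x" "pos (- x)"
  shows "x = 0"
proof -
  obtain s where s: "pos s" "s * s = x" "\<And>c. c * x = x * c \<Longrightarrow> c * s = s * c"
    using pos_sqrt[OF assms(1)] by blast
  obtain t where t: "pos t" "t * t = - x" "\<And>c. c * (- x) = - x * c \<Longrightarrow> c * t = t * c"
    using pos_sqrt[OF assms(2)] by blast
  have "s * x = x * s" by (simp add: s(2)[symmetric] mult.assoc)
  then have st: "s * t = t * s" using t(3)[of s] by simp
  define u where "u = s + imu * t"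
  have ss: "adj s = s" "adj t = t" using s(1) t(1) pos_sa by (auto simp: sa_def)
  have au: "adj u = s - imu * t"
    by (simp add: u_def adj_add adj_mult ss imu_commute)
  have "imu * t * (imu * t) = imu * imu * (t * t)" by (metis imu_commute mult.assoc)
  then have "imu * t * (imu * t) = x" by (simp add: t(2))
  moreover have "imu * t * s = s * (imu * t)" by (metis imu_commute mult.assoc st)
  ultimately have "adj u * u = 0"
    unfolding au unfolding u_def by (simp add: distrib_left left_diff_distrib s(2))
  then have "u = 0" by (rule adj_mult_eq_0)
  moreover have "2 *\<^sub>R s = u + adj u" unfolding au by (simp add: u_def scaleR_2)
  ultimately have "s = 0" by simp
  then show ?thesis using s(2) by simp
qed

section \<open>Positivity of \<open>adj x * x\<close> and its consequences\<close>

text \<open>Twice \<open>x\<^sup>* x + x x\<^sup>*\<close> is a sum of squares of self-adjoint elements, so \<open>x x\<^sup>*\<close> is positive; and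
  \<open>x\<^sup>* x\<close>, \<open>x x\<^sup>*\<close> have the same nonzero spectrum.\<close>
lemma neg_adj_mult_pos:
  fixes x :: "'b::cstar"
  assumes "pos (- (adj x * x))"
  shows "x = 0"
proof -
  define a b where "a = x + adj x" and "b = imu * (x - adj x)"
  have "sa a" by (simp add: a_def sa_def adj_add add.commute)
  have "sa b" unfolding b_def sa_def
    by (simp add: adj_mult adj_diff imu_commute[symmetric] algebra_simps)
  have "b * b = imu * ((x - adj x) * imu) * (x - adj x)"
    unfolding b_def by (simp only: mult.assoc)
  then have "b * b = imu * imu * ((x - adj x) * (x - adj x))"
    by (simp only: imu_commute[of "x - adj x", symmetric] mult.assoc)
  then have "a * a + b * b = 2 *\<^sub>R (x * adj x + adj x * x)"
    by (simp add: a_def algebra_simps scaleR_2)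
  then have "x * adj x + adj x * x = (1/2) *\<^sub>R (a * a + b * b)" by simp
  then have "pos (x * adj x + adj x * x)"
    using \<open>sa a\<close> \<open>sa b\<close> by (simp only:) (intro pos_scaleR pos_add pos_square, auto)
  from pos_add[OF this assms] have p: "pos (x * adj x)" by simp
  have "pos (adj x * x)"
  proof (rule pos_of_invertible_translates)
    fix t :: real assume t: "t > 0"
    obtain y where y: "y * (t *\<^sub>R 1 + x * adj x) = 1" "(t *\<^sub>R 1 + x * adj x) * y = 1"
      using pos_add_scalar_invertible[OF p t] by blast
    \<comment> \<open>The Jacobson formula: an inverse \<open>y\<close> of
      \<open>t + x * adj x\<close> yields this inverse of \<open>t + adj x * x\<close>.\<close>
    define w where "w = (1/t) *\<^sub>R (1 - adj x * y * x)"
    have y1: "y * (x * adj x) = 1 - t *\<^sub>R y" "x * adj x * y = 1 - t *\<^sub>R y"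
      using y by (simp_all add: algebra_simps)
    have 1: "adj x * y * x * (adj x * x) = adj x * (y * (x * adj x)) * x"
      and 2: "adj x * x * (adj x * y * x) = adj x * (x * adj x * y) * x"
      by (simp_all add: mult.assoc)
    have "(1 - adj x * y * x) * (t *\<^sub>R 1 + adj x * x) = t *\<^sub>R 1"
      using 1 unfolding y1 by (simp add: algebra_simps)
    moreover have "(t *\<^sub>R 1 + adj x * x) * (1 - adj x * y * x) = t *\<^sub>R 1"
      using 2 unfolding y1 by (simp add: algebra_simps)
    ultimately have "w * (t *\<^sub>R 1 + adj x * x) = 1" "(t *\<^sub>R 1 + adj x * x) * w = 1"
      using t by (simp_all add: w_def)
    then show "\<exists>y. y * (t *\<^sub>R 1 + adj x * x) = 1 \<and> (t *\<^sub>R 1 + adj x * x) * y = 1" by blast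
  qed simp
  from pos_neg_eq_0[OF this assms] show ?thesis by (rule adj_mult_eq_0)
qed

text \<open>Here \<open>s\<close> is an absolute value of \<open>h\<close>, and formally
  \<open>s + h = s * (1 + h / s)\<close>. As \<open>s\<close> need not be invertible, it is replaced
  by \<open>x = e + s\<close>; then \<open>c = h / x\<close> is a self-adjoint contraction because
  \<open>1 - c * c\<close> is positive. So \<open>(1 + c) * x = s + h + e\<close> is positive, and
  \<open>e\<close> tends to 0.\<close>

lemma pos_add_of_square_eq:
  fixes s h :: "'b::cstar"
  assumes s: "pos s" and h: "sa h" and sh: "s * h = h * s" and eq: "s * s = h * h"
  shows "pos (s + h)"
proof (rule pos_limit[where d=1])
  fix e :: real assume e: "e > 0"
  define x where "x = e *\<^sub>R 1 + s"
  obtain y where y: "y * x = 1" "x * y = 1"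
    using pos_add_scalar_invertible[OF s e] unfolding x_def by blast
  have px: "pos x" unfolding x_def by (intro pos_add pos_scaleR s) (use e in auto)
  have sy: "sa y"
  proof -
    have "adj y * x = 1" using y(2) pos_sa[OF px] by (metis adj_mult adj_one sa_def)
    then show ?thesis unfolding sa_def using y(2) by (metis mult.assoc mult_1_left mult_1_right)
  qed
  have yc: "y * c = c * y" if "x * c = c * x" for c
    using that y by (metis mult.assoc mult_1_left mult_1_right)
  have xh: "x * h = h * x" "x * s = s * x" using sh by (simp_all add: x_def algebra_simps)
  define c where "c = h * y"
  have sc: "sa c" unfolding c_def by (rule sa_mult[OF h sy]) (simp add: yc xh)
  define d where "d = (2 * e) *\<^sub>R s + (e * e) *\<^sub>R 1"
  have "x * x = h * h + d"
    by (simp add: x_def d_def eq[symmetric] algebra_simps scaleR_2[symmetric])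
  then have hh: "h * h = x * x - d" by (metis add_diff_cancel_right')
  have yh: "y * h = h * y" by (simp add: yc xh)
  have "c * c = h * (y * h) * y" by (simp only: c_def mult.assoc)
  also have "\<dots> = h * h * (y * y)" by (simp only: yh mult.assoc)
  also have "\<dots> = x * (x * y) * y - d * (y * y)"
    unfolding hh left_diff_distrib by (simp only: mult.assoc)
  finally have cc: "1 - c * c = d * (y * y)" by (simp add: y)
  have yd: "y * d = d * y" by (rule yc) (simp add: d_def xh algebra_simps)
  have "pos (d * (y * y))"
  proof (rule pos_mult)
    show "pos d" unfolding d_def by (intro pos_add pos_scaleR s) (use e in auto)
    show "pos (y * y)" by (rule pos_square[OF sy])
    have "d * (y * y) = y * d * y" by (simp only: yd mult.assoc)
    also have "\<dots> = y * (y * d)" by (simp only: mult.assoc) (simp only: yd)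
    finally show "d * (y * y) = y * y * d" by (simp only: mult.assoc)
  qed
  then obtain m where m: "pos m" "m * m = 1 - c * c"
      "\<And>b. b * (1 - c * c) = (1 - c * c) * b \<Longrightarrow> b * m = m * b"
    unfolding cc[symmetric] using pos_sqrt by blast
  have "norm c \<le> 1"
  proof (rule norm_le_1_of_sum_squares[OF sc pos_sa[OF m(1)]])
    show "c * m = m * c" by (rule m(3)) (simp add: algebra_simps)
    show "c * c + m * m = 1" by (simp add: m(2))
  qed
  then have "pos (1 *\<^sub>R 1 - (- c))" by (intro pos_of_near_scalar) (use sc in auto)
  then have "pos ((1 + c) * x)"
  proof (intro pos_mult px)
    have "c * x = h" by (simp add: c_def mult.assoc y)
    moreover have "x * c = h"
      unfolding c_def mult.assoc[symmetric] xh by (simp add: mult.assoc y)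
    ultimately have "c * x = x * c" by simp
    then show "(1 + c) * x = x * (1 + c)" by (simp add: algebra_simps)
  qed simp
  moreover have "(1 + c) * x = s + h + e *\<^sub>R 1"
    unfolding distrib_right c_def mult.assoc y by (simp add: x_def algebra_simps)
  ultimately show "pos (s + h + e *\<^sub>R 1)" by simp
qed

text \<open>The positive and negative parts are the halves of \<open>s + h\<close> and
  \<open>s - h\<close>, where \<open>s\<close> is the root of \<open>h * h\<close>; their products
  vanish since \<open>s * s = h * h\<close>.\<close>

lemma sa_decomposition:
  fixes h :: "'b::cstar"
  assumes h: "sa h"
  obtains w z where "pos w" "pos z" "w * z = 0" "z * w = 0" "h = w - z"
proof -
  obtain s where s: "pos s" "s * s = h * h" "\<And>c. c * (h * h) = h * h * c \<Longrightarrow> c * s = s * c"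
    using pos_sqrt[OF pos_square[OF h]] by blast
  have sh: "s * h = h * s" using s(3)[of h] by (simp add: mult.assoc)
  show thesis
  proof (rule that[of "(1/2) *\<^sub>R (s + h)" "(1/2) *\<^sub>R (s + (- h))"])
    show "pos ((1/2) *\<^sub>R (s + h))"
      by (rule pos_scaleR[OF pos_add_of_square_eq]) (simp_all add: s(1,2) h sh)
    show "pos ((1/2) *\<^sub>R (s + (- h)))"
      by (rule pos_scaleR[OF pos_add_of_square_eq]) (simp_all add: s(1,2) h sh)
    have "(s + h) * (s - h) = 0" "(s - h) * (s + h) = 0"
      using s(2) sh by (simp_all add: algebra_simps)
    then show "(1/2) *\<^sub>R (s + h) * (1/2) *\<^sub>R (s + (- h)) = 0"
      "(1/2) *\<^sub>R (s + (- h)) * (1/2) *\<^sub>R (s + h) = 0" by simp_all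
    have "(1/2) *\<^sub>R (s + h) - (1/2) *\<^sub>R (s + (- h)) = (1/2) *\<^sub>R (2 *\<^sub>R h)"
      by (simp add: scaleR_right_diff_distrib[symmetric] scaleR_2)
    then show "h = (1/2) *\<^sub>R (s + h) - (1/2) *\<^sub>R (s + (- h))" by simp
  qed
qed

text \<open>Multiplication by the negative part \<open>z\<close> isolates it:
  \<open>adj (x * z) * (x * z) = - (z * (z * z))\<close> is a negative element of the form that
  \<open>neg_adj_mult_pos\<close> admits only for \<open>x * z = 0\<close>. Then a power of
  \<open>z\<close> vanishes, and with it \<open>z\<close>.\<close>

lemma pos_adj_mult: "pos (adj x * x :: 'b::cstar)"
proof -
  obtain w z where wz: "pos w" "pos z" "w * z = 0" "z * w = 0" "adj x * x = w - z"
    using sa_decomposition[of "adj x * x"] by auto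
  have sz: "sa z" "adj z = z" using pos_sa[OF wz(2)] by (auto simp: sa_def)
  have "adj (x * z) * (x * z) = z * (adj x * x) * z"
    by (simp add: adj_mult sz mult.assoc)
  also have "\<dots> = - (z * (z * z))"
    by (simp add: wz(5) algebra_simps wz(4))
  finally have e: "adj (x * z) * (x * z) = - (z * (z * z))" .
  have "pos (z * (z * z))"
    by (rule pos_mult[OF wz(2) pos_square[OF sz(1)]]) (simp add: mult.assoc)
  then have "x * z = 0" using e by (intro neg_adj_mult_pos) simp
  then have "z * (z * z) = 0" using e by simp
  then have "(z * z) * (z * z) = 0" by (simp add: mult.assoc)
  then have "z * z = 0" using sa_mult_self_eq_0[of "z * z"] sz by simp
  then have "z = 0" using sa_mult_self_eq_0 sz by blast
  then show ?thesis using wz by simp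
qed

lemma sum_adj_mult_eq_0:
  fixes x y :: "'b::cstar"
  assumes "adj x * x + adj y * y = 0"
  shows "x = 0"
proof (rule neg_adj_mult_pos)
  have "- (adj x * x) = adj y * y" using assms by (simp add: neg_eq_iff_add_eq_0)
  then show "pos (- (adj x * x))" using pos_adj_mult by simp
qed

text \<open>Contractivity follows from the order: a root of a positive element is mapped to a root
  of its image, so positivity of \<open>norm h - h\<close> is preserved. This is what bounds the
  automorphisms, since \<open>star_automorphisms\<close> contains no condition on the norm.\<close>

lemma star_hom_contractive:
  fixes f :: "'b::cstar \<Rightarrow> 'b"
  assumes add: "\<And>x y. f (x + y) = f x + f y" and scale: "\<And>r x. f (r *\<^sub>R x) = r *\<^sub>R f x"
    and mult: "\<And>x y. f (x * y) = f x * f y" and one: "f 1 = 1"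
    and adj: "\<And>x. f (adj x) = adj (f x)"
  shows "norm (f x) \<le> norm x"
proof -
  have diff: "f (u - v) = f u - f v" for u v
    using add[of "u - v" v] by (simp add: algebra_simps)
  have posf: "pos (f u)" if u: "pos u" for u
  proof -
    obtain g where g: "pos g" "g * g = u" using pos_sqrt[OF u] by blast
    have "sa (f g)" using pos_sa[OF g(1)] by (simp add: sa_def adj[symmetric])
    then show ?thesis using pos_square mult[of g g] g(2) by metis
  qed
  define h t where "h = adj x * x" and "t = norm h"
  have h: "pos h" unfolding h_def by (rule pos_adj_mult)
  have "pos (t *\<^sub>R 1 - h)" unfolding t_def by (rule pos_of_near_scalar[OF pos_sa[OF h]]) simp
  from posf[OF this] have p: "pos (t *\<^sub>R 1 - f h)" by (simp add: diff scale one)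
  obtain g where g: "pos g" "g * g = f h" "\<And>c. c * f h = f h * c \<Longrightarrow> c * g = g * c"
    using pos_sqrt[OF posf[OF h]] by blast
  obtain m where m: "pos m" "m * m = t *\<^sub>R 1 - f h"
      "\<And>c. c * (t *\<^sub>R 1 - f h) = (t *\<^sub>R 1 - f h) * c \<Longrightarrow> c * m = m * c"
    using pos_sqrt[OF p] by blast
  have "g * f h = f h * g" by (simp add: g(2)[symmetric] mult.assoc)
  then have gm: "g * m = m * g" by (intro m(3)) (simp add: algebra_simps)
  have "norm (f h) \<le> t"
  proof (cases "t = 0")
    case True
    then have "h = 0" by (simp add: t_def)
    then show ?thesis using add[of 0 0] True by simp
  next
    case False
    then have t: "t > 0" by (simp add: t_def)
    have "norm ((1 / sqrt t) *\<^sub>R g) \<le> 1"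
    proof (rule norm_le_1_of_sum_squares[where m="(1 / sqrt t) *\<^sub>R m"])
      show "(1 / sqrt t) *\<^sub>R g * (1 / sqrt t) *\<^sub>R g + (1 / sqrt t) *\<^sub>R m * (1 / sqrt t) *\<^sub>R m = 1"
        using t by (simp add: g(2) m(2) scaleR_add_right[symmetric])
    qed (use pos_sa[OF g(1)] pos_sa[OF m(1)] gm in auto)
    then have "norm g \<le> sqrt t" using t by simp
    then have "(norm g)\<^sup>2 \<le> t" using t by (metis norm_ge_zero power_mono real_sqrt_pow2 less_imp_le)
    then show ?thesis using norm_mult_self[OF pos_sa[OF g(1)]] g(2) by simp
  qed
  moreover have "f h = adj (f x) * f x" by (simp add: h_def mult adj)
  moreover have "t = (norm x)\<^sup>2" by (simp add: t_def h_def norm_adj_mult)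
  ultimately have "(norm (f x))\<^sup>2 \<le> (norm x)\<^sup>2" by (simp add: norm_adj_mult)
  then show ?thesis by (rule power2_le_imp_le) simp
qed

section \<open>Small projections\<close>

definition proj :: "'b::cstar \<Rightarrow> bool" where "proj p \<longleftrightarrow> p * p = p \<and> adj p = p"

text \<open>Relative to the corner of \<open>e\<close>, with the order given by \<open>pos\<close>
  of the whole algebra; real scalars together with \<open>imu\<close> account for the complex
  ones.\<close>

definition hereditary_in :: "'b::cstar \<Rightarrow> 'b set \<Rightarrow> bool" where
  "hereditary_in e B \<longleftrightarrow> (\<forall>x\<in>B. e * x = x) \<and> closed B \<and> 0 \<in> B \<and>
    (\<forall>x\<in>B. \<forall>y\<in>B. x + y \<in> B \<and> x * y \<in> B) \<and>
    (\<forall>x\<in>B. adj x \<in> B \<and> imu * x \<in> B \<and> (\<forall>r. r *\<^sub>R x \<in> B)) \<and>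
    (\<forall>a. \<forall>b\<in>B. e * a = a \<and> pos a \<and> pos (b - a) \<longrightarrow> a \<in> B)"

text \<open>Simplicity is assumed in algebraic form, with the unit of the corner as an exact finite
  sum. Closed ideals give only an approximation of the unit at first; \<open>simple_corner\<close>
  makes it exact by invertibility near the unit.\<close>

locale simple_sp_corner =
  fixes e :: "'b::cstar"
  assumes proj_e: "proj e" and central: "e * x = x * e"
    and simple: "e * x = x \<Longrightarrow> x \<noteq> 0 \<Longrightarrow> \<exists>(k::nat) X Y. e = (\<Sum>i<k. X i * x * Y i)"
    and sp: "hereditary_in e B \<Longrightarrow> B \<noteq> {0} \<Longrightarrow> \<exists>q\<in>B. proj q \<and> q \<noteq> 0"
begin

text \<open>Stands in for a spectral projection. With \<open>r = 1 - p\<close>, the equation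
  \<open>r * (k * k) * r = 0\<close> splits into two positive terms, one for \<open>w\<close> and
  one for \<open>z\<close>, so both parts of \<open>k\<close> lie in the corner of \<open>p\<close>.
  The SP-property then finds \<open>q\<close> where the negative part is absent.\<close>

lemma proj_cut:
  assumes p: "proj p" "e * p = p" and k: "sa k" "k * p = k"
    and wz: "pos w" "pos z" "w * z = 0" "z * w = 0" "k = w - z" "w \<noteq> 0"
  shows "\<exists>q. proj q \<and> q \<noteq> 0 \<and> q * p = q \<and> p * q = q \<and> q * z = 0 \<and> w * p = w \<and> z * p = z"
proof -
  have ap: "adj p = p" "p * p = p" using p by (auto simp: proj_def)
  have sw: "sa w" "sa z" "adj w = w" "adj z = z" using wz pos_sa by (auto simp: sa_def)
  define r where "r = 1 - p"
  have r: "adj r = r" "r * r = r" "k * r = 0" "p * r = 0" "r * p = 0"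
    using ap k by (auto simp: r_def adj_diff algebra_simps)
  have "adj (w * r) * (w * r) + adj (z * r) * (z * r) = r * (w * w + z * z) * r"
    by (simp add: adj_mult sw r algebra_simps)
  also have "w * w + z * z = k * k"
    by (simp only: wz(5)) (simp add: algebra_simps wz(3,4))
  finally have s0: "adj (w * r) * (w * r) + adj (z * r) * (z * r) = 0"
    by (simp add: mult.assoc r)
  have wr: "w * r = 0" using sum_adj_mult_eq_0[OF s0] .
  have zr: "z * r = 0" using sum_adj_mult_eq_0[of "z * r" "w * r"] s0 by (simp add: add.commute)
  have wp: "w * p = w" "z * p = z" using wr zr by (auto simp: r_def algebra_simps)
  then have pw: "p * w = w" "p * z = z" by (metis adj_mult ap(1) sw(3,4))+
  \<comment> \<open>The annihilator of the negative part inside the corner of \<open>p\<close>; it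
    contains \<open>w\<close> and is therefore nonzero.\<close>
  define B where "B = {x. x * z = 0 \<and> z * x = 0 \<and> p * x = x \<and> x * p = x}"
  have "hereditary_in e B"
    unfolding hereditary_in_def
  proof (intro conjI ballI allI impI)
    fix x assume "x \<in> B"
    then have "e * x = e * p * x" by (simp add: B_def mult.assoc)
    then show "e * x = x" using p \<open>x \<in> B\<close> by (simp add: B_def)
  next
    show "closed B" unfolding B_def Collect_conj_eq
      by (intro closed_Int closed_Collect_eq continuous_intros)
  next
    fix x assume x: "x \<in> B"
    then show "adj x \<in> B" unfolding B_def mem_Collect_eq
      by (metis adj_mult adj_zero ap(1) sw(4))
    show "imu * x \<in> B" using x unfolding B_def mem_Collect_eq
      by (simp add: mult.assoc) (metis imu_commute mult.assoc mult_zero_right)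
  next
    fix a b assume b: "b \<in> B" and a: "e * a = a \<and> pos a \<and> pos (b - a)"
    obtain g where g: "pos g" "g * g = a" using pos_sqrt a by blast
    obtain h where h: "pos h" "h * h = b - a" using pos_sqrt a by blast
    have sg: "adj g = g" "adj h = h" "adj a = a" using g(1) h(1) a pos_sa by (auto simp: sa_def)
    \<comment> \<open>Heredity: \<open>t * b * t = 0\<close> is the sum of the positive elements
      \<open>t * a * t\<close> and \<open>t * (b - a) * t\<close>, so both vanish. This is used for
      \<open>t = 1 - p\<close> and for \<open>t = z\<close>.\<close>
    have key: "a * t = 0 \<and> t * a = 0" if t: "adj t = t" and bt: "b * t = 0" for t
    proof -
      have "adj (g * t) * (g * t) + adj (h * t) * (h * t) = t * (g * g) * t + t * (h * h) * t"
        by (simp add: adj_mult sg t mult.assoc)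
      also have "\<dots> = t * (b * t)" by (simp add: g(2) h(2) algebra_simps)
      finally have "g * t = 0" using sum_adj_mult_eq_0[of "g * t" "h * t"] bt by simp
      then have at: "a * t = 0" by (simp add: g(2)[symmetric] mult.assoc)
      moreover have "t * a = adj (a * t)" by (simp add: adj_mult t sg)
      ultimately show ?thesis by simp
    qed
    have "b * r = 0" using b by (simp add: B_def r_def algebra_simps)
    from key[OF r(1) this] key[OF sw(4)] b show "a \<in> B"
      by (simp add: B_def r_def algebra_simps)
  next
    fix x y assume "x \<in> B" "y \<in> B"
    moreover have "z * (x * y) = z * x * y" "p * (x * y) = p * x * y" by (simp_all only: mult.assoc)
    ultimately show "x * y \<in> B" by (simp add: B_def mult.assoc)
  qed (auto simp: B_def algebra_simps)
  moreover have "w \<in> B" using wz pw wp by (simp add: B_def)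
  ultimately obtain q where "q \<in> B" "proj q" "q \<noteq> 0" using sp[of B] wz(6) by blast
  then show ?thesis using wp by (auto simp: B_def intro!: exI[of _ q])
qed

text \<open>By simplicity some \<open>a = f * y0 * p\<close> is nonzero. For
  \<open>h = adj a * a\<close> and small \<open>t\<close>, the positive part of
  \<open>h * h - t *\<^sub>R p\<close> leads through \<open>proj_cut\<close> to a projection
  \<open>q\<close> on which \<open>h * h\<close> is bounded below, and there \<open>a\<close> can be
  inverted. The pair \<open>x\<close>, \<open>y\<close> is an algebraic equivalence, so no polar
  decomposition is involved.\<close>

lemma subprojection_subequivalent:
  assumes p: "proj p" "e * p = p" "p \<noteq> 0" and f: "proj f" "e * f = f" "f \<noteq> 0"
  shows "\<exists>q x y. proj q \<and> q \<noteq> 0 \<and> q * p = q \<and> p * q = q \<and> y * x = q \<and>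
    f * x = x \<and> x * q = x \<and> y * f = y \<and> q * y = y"
proof -
  have ap: "adj p = p" "p * p = p" and af: "adj f = f" "f * f = f" using p f by (auto simp: proj_def)
  obtain k :: nat and X Y where k: "e = (\<Sum>i<k. X i * f * Y i)" using simple[OF f(2,3)] by blast
  have "\<exists>y. f * y * p \<noteq> 0"
  proof (rule ccontr)
    assume "\<not> ?thesis"
    then have 0: "f * y * p = 0" for y by blast
    have "p = (\<Sum>i<k. X i * f * Y i) * p" using p k by simp
    also have "\<dots> = (\<Sum>i<k. X i * (f * Y i * p))" by (simp add: sum_distrib_right mult.assoc)
    finally show False using p(3) 0 by simp
  qed
  then obtain y0 where y0: "f * y0 * p \<noteq> 0" by blast
  define a where "a = f * y0 * p"
  have a: "f * a = a" "a * p = a" "adj a * f = adj a" "p * adj a = adj a"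
    using ap af by (simp_all add: a_def adj_mult mult.assoc) (simp_all add: mult.assoc[symmetric])
  define h where "h = adj a * a"
  have h: "sa h" "h * p = h" "p * h = h" by (simp_all add: h_def a mult.assoc) (simp add: a mult.assoc[symmetric])
  have "h \<noteq> 0" using y0 adj_mult_eq_0[of a] by (auto simp: h_def a_def)
  \<comment> \<open>Otherwise \<open>t *\<^sub>R p - h * h\<close> would be positive for every
    \<open>t > 0\<close>, and in the limit \<open>- (h * h)\<close> as well.\<close>
  have "\<exists>t>0. \<exists>w z. pos w \<and> pos z \<and> w * z = 0 \<and> z * w = 0 \<and> h * h - t *\<^sub>R p = w - z \<and> w \<noteq> 0"
  proof (rule ccontr)
    assume n: "\<not> ?thesis"
    have "pos (- (h * h) + t *\<^sub>R p)" if t: "t > 0" for t :: real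
    proof -
      have "sa (h * h - t *\<^sub>R p)" using h by (simp add: sa_def adj_diff adj_mult ap)
      then obtain w z where wz: "pos w" "pos z" "w * z = 0" "z * w = 0" "h * h - t *\<^sub>R p = w - z"
        using sa_decomposition by blast
      then have "w = 0" using n t by blast
      then have "z = - (h * h) + t *\<^sub>R p" using wz(5) by (simp add: algebra_simps)
      then show ?thesis using wz by simp
    qed
    then have "pos (- (h * h))" by (rule pos_limit)
    then have "h * h = 0" using pos_neg_eq_0 pos_square[OF h(1)] by blast
    then show False using sa_mult_self_eq_0[OF h(1)] \<open>h \<noteq> 0\<close> by simp
  qed
  then obtain t w z where t: "t > 0" and
    wz: "pos w" "pos z" "w * z = 0" "z * w = 0" "h * h - t *\<^sub>R p = w - z" "w \<noteq> 0" by blast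
  have "\<exists>q. proj q \<and> q \<noteq> 0 \<and> q * p = q \<and> p * q = q \<and> q * z = 0 \<and> w * p = w \<and> z * p = z"
  proof (rule proj_cut[OF p(1,2) _ _ wz])
    show "sa (h * h - t *\<^sub>R p)" using h by (simp add: sa_def adj_diff adj_mult ap)
    show "(h * h - t *\<^sub>R p) * p = h * h - t *\<^sub>R p"
      by (simp add: left_diff_distrib mult.assoc h ap)
  qed
  then obtain q where q: "proj q" "q \<noteq> 0" "q * p = q" "p * q = q" "q * z = 0" by blast
  have qq: "q * q = q" using q by (simp add: proj_def)
  obtain v where v: "(t *\<^sub>R 1 + w) * v = 1" using pos_add_scalar_invertible[OF wz(1) t] by blast
  have w: "w = h * h - t *\<^sub>R p + z" using wz(5) by simp
  \<comment> \<open>The negative part drops out under \<open>q\<close>, and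
    \<open>q * p = q\<close>; so on \<open>q\<close> the element \<open>h * h\<close> agrees with
    \<open>t + w\<close>, which has the inverse \<open>v\<close>.\<close>
  have qhh: "q * (t *\<^sub>R 1 + w) = q * (h * h)"
    unfolding w by (simp add: algebra_simps q)
  have qe: "q = q * (h * h) * v * q"
    unfolding qhh[symmetric] by (simp add: mult.assoc v qq)
  show ?thesis
  proof (intro exI conjI)
    show "(q * h * adj a) * (a * v * q) = q"
    proof -
      have "(q * h * adj a) * (a * v * q) = q * (h * h) * v * q" by (simp only: h_def mult.assoc)
      then show ?thesis using qe by simp
    qed
    show "f * (a * v * q) = a * v * q" using a(1) by (simp add: mult.assoc[symmetric])
    show "a * v * q * q = a * v * q" by (simp add: mult.assoc qq)
    show "q * h * adj a * f = q * h * adj a" using a(3) by (simp add: mult.assoc)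
    show "q * (q * h * adj a) = q * h * adj a" by (simp add: mult.assoc[symmetric] qq)
  qed (use q in auto)
qed

lemma pos_compress:
  assumes "pos x" "adj p = p"
  shows "pos (p * x * p)"
proof -
  obtain g where g: "pos g" "g * g = x" using pos_sqrt assms by blast
  have "adj (g * p) * (g * p) = p * x * p"
    using pos_sa[OF g(1)] by (simp add: adj_mult assms sa_def g(2)[symmetric] mult.assoc)
  then show ?thesis using pos_adj_mult by metis
qed

text \<open>Minimality gives every self-adjoint element of the corner a sign: if its positive part
  is nonzero, the projection from \<open>proj_cut\<close> is \<open>p\<close> itself and kills the
  negative part. For the largest \<open>c\<close> with \<open>h - c *\<^sub>R p\<close> positive,
  the opposite sign holds too, as a limit from above.\<close>

lemma minimal_projection_scalar:
  assumes p: "proj p" "e * p = p" "p \<noteq> 0"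
    and min: "\<And>q. proj q \<Longrightarrow> q * p = q \<Longrightarrow> p * q = q \<Longrightarrow> q \<noteq> 0 \<Longrightarrow> q = p"
    and h: "sa h" "h * p = h" "p * h = h"
  shows "\<exists>c::real. h = c *\<^sub>R p"
proof -
  have ap: "adj p = p" "p * p = p" using p by (auto simp: proj_def)
  have pp: "pos p" using pos_adj_mult[of p] ap by simp
  have dich: "pos k \<or> pos (- k)" if k: "sa k" "k * p = k" for k
  proof -
    obtain w z where wz: "pos w" "pos z" "w * z = 0" "z * w = 0" "k = w - z"
      using sa_decomposition[OF k(1)] by blast
    show ?thesis
    proof (cases "w = 0")
      case False
      from proj_cut[OF p(1,2) k wz this] obtain q where
        q: "proj q" "q \<noteq> 0" "q * p = q" "p * q = q" "q * z = 0" "z * p = z" by blast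
      then have "p * z = 0" using min by blast
      then have "adj (p * z) = 0" by simp
      then have "z * p = 0" using pos_sa[OF wz(2)] ap by (simp add: adj_mult sa_def)
      then show ?thesis using q(6) wz by simp
    qed (use wz in auto)
  qed
  define S where "S = {c::real. pos (h - c *\<^sub>R p)}"
  define n where "n = norm h"
  have "pos (n *\<^sub>R 1 - (- h))" "pos (n *\<^sub>R 1 - h)"
    by (rule pos_of_near_scalar; use h in \<open>simp add: n_def\<close>)+
  from this[THEN pos_compress[OF _ ap(1)]]
  have nh: "pos (n *\<^sub>R p + h)" "pos (n *\<^sub>R p - h)"
    using h ap by (simp_all add: algebra_simps)
  have "- n \<in> S" using nh by (simp add: S_def add.commute)
  have "c \<le> n" if "c \<in> S" for c
  proof (rule ccontr)
    assume c: "\<not> c \<le> n"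
    have "pos ((h - c *\<^sub>R p) + (n *\<^sub>R p - h))" using that nh by (intro pos_add) (auto simp: S_def)
    then have "pos (- ((c - n) *\<^sub>R p))" by (simp add: algebra_simps)
    moreover have "pos ((c - n) *\<^sub>R p)" using c by (intro pos_scaleR pp) auto
    ultimately have "(c - n) *\<^sub>R p = 0" using pos_neg_eq_0 by blast
    then show False using c p by simp
  qed
  then have bdd: "bdd_above S" by (auto simp: bdd_above_def)
  define c where "c = Sup S"
  have "closed S"
    using continuous_closed_preimage[of UNIV "\<lambda>t::real. h - t *\<^sub>R p", OF _ _ closed_pos]
    by (simp add: S_def vimage_def continuous_intros)
  then have "c \<in> S" unfolding c_def using \<open>- n \<in> S\<close> bdd closed_contains_Sup by blast
  then have 1: "pos (h - c *\<^sub>R p)" by (simp add: S_def)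
  have "pos (- (h - c *\<^sub>R p) + t *\<^sub>R p)" if t: "t > 0" for t
  proof -
    have "c + t \<notin> S" using cSup_upper[OF _ bdd, of "c + t"] t by (auto simp: c_def)
    moreover have "sa (h - (c + t) *\<^sub>R p)" using h by (simp add: sa_def adj_diff ap)
    moreover have "(h - (c + t) *\<^sub>R p) * p = h - (c + t) *\<^sub>R p"
      using h ap by (simp add: algebra_simps)
    ultimately have "pos (- (h - (c + t) *\<^sub>R p))" using dich by (simp only: S_def mem_Collect_eq) blast
    then show ?thesis by (simp add: algebra_simps)
  qed
  then have "pos (- (h - c *\<^sub>R p))" by (rule pos_limit)
  with 1 have "h - c *\<^sub>R p = 0" by (rule pos_neg_eq_0)
  then show ?thesis by auto
qed

text \<open>The corner of \<open>p\<close> is spanned over the reals by \<open>p\<close> and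
  \<open>imu * p\<close>. Writing the unit as a sum of terms \<open>X i * p * Y i\<close> on both
  sides of \<open>x\<close> therefore leaves finitely many spanning elements.\<close>

lemma minimal_projection_finite_dimensional:
  assumes p: "proj p" "e * p = p" "p \<noteq> 0"
    and min: "\<And>q. proj q \<Longrightarrow> q * p = q \<Longrightarrow> p * q = q \<Longrightarrow> q \<noteq> 0 \<Longrightarrow> q = p"
  shows "\<exists>F. finite F \<and> {x. e * x = x} \<subseteq> span F"
proof -
  have ap: "adj p = p" "p * p = p" using p by (auto simp: proj_def)
  obtain k :: nat and X Y where k: "e = (\<Sum>i<k. X i * p * Y i)" using simple[OF p(2,3)] by blast
  define F where "F = (\<lambda>(i,j). X i * p * Y j) ` ({..<k} \<times> {..<k}) \<union>
    (\<lambda>(i,j). imu * (X i * p * Y j)) ` ({..<k} \<times> {..<k})"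
  have sc: "\<exists>a b::real. p * x * p = a *\<^sub>R p + b *\<^sub>R (imu * p)" for x
  proof -
    define y where "y = p * x * p"
    have y: "y * p = y" "p * y = y" "adj y * p = adj y" "p * adj y = adj y"
      using ap by (simp_all add: y_def adj_mult mult.assoc) (simp_all add: mult.assoc[symmetric])
    have "\<exists>c::real. y + adj y = c *\<^sub>R p"
      by (rule minimal_projection_scalar[OF p min])
        (auto simp: sa_def adj_add algebra_simps y)
    moreover have "\<exists>c::real. imu * (y - adj y) = c *\<^sub>R p"
    proof (rule minimal_projection_scalar[OF p min])
      show "sa (imu * (y - adj y))"
        by (simp add: sa_def adj_mult adj_diff imu_commute[symmetric] algebra_simps)
      show "imu * (y - adj y) * p = imu * (y - adj y)" by (simp add: algebra_simps y)
      have "p * (imu * (y - adj y)) = imu * (p * (y - adj y))"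
        by (simp only: mult.assoc[symmetric] imu_commute[of p])
      then show "p * (imu * (y - adj y)) = imu * (y - adj y)" by (simp add: algebra_simps y)
    qed
    ultimately obtain c d :: real where c: "y + adj y = c *\<^sub>R p" and d: "imu * (y - adj y) = d *\<^sub>R p"
      by blast
    have "imu * (imu * (y - adj y)) = d *\<^sub>R (imu * p)" using d by simp
    then have "- (y - adj y) = d *\<^sub>R (imu * p)" by (simp add: mult.assoc[symmetric])
    then have "y - adj y = (- d) *\<^sub>R (imu * p)" by (metis minus_minus scaleR_minus_left)
    with c have "(y + adj y) + (y - adj y) = c *\<^sub>R p + (- d) *\<^sub>R (imu * p)" by simp
    then have "2 *\<^sub>R y = c *\<^sub>R p + (- d) *\<^sub>R (imu * p)" by (simp add: scaleR_2)
    then have "(1/2) *\<^sub>R 2 *\<^sub>R y = (c/2) *\<^sub>R p + (- d/2) *\<^sub>R (imu * p)"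
      by (simp only: scaleR_add_right scaleR_scaleR) simp
    then have "y = (c/2) *\<^sub>R p + (- d/2) *\<^sub>R (imu * p)" by simp
    then show ?thesis unfolding y_def by blast
  qed
  have "x \<in> span F" if x: "e * x = x" for x
  proof -
    have "x = e * x * e" using x central[of x] by simp
    also have "\<dots> = (\<Sum>i<k. \<Sum>j<k. X i * (p * (Y i * x * X j) * p) * Y j)"
      unfolding k sum_distrib_right sum_distrib_left
      by (subst sum.swap) (simp add: mult.assoc)
    also have "\<dots> \<in> span F"
    proof (intro span_sum)
      fix i j assume ij: "i \<in> {..<k}" "j \<in> {..<k}"
      obtain a b :: real where ab: "p * (Y i * x * X j) * p = a *\<^sub>R p + b *\<^sub>R (imu * p)"
        using sc by blast
      have "X i * (imu * p) * Y j = imu * (X i * p * Y j)"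
        by (simp only: mult.assoc[symmetric] imu_commute[of "X i"])
      then have "X i * (p * (Y i * x * X j) * p) * Y j
          = a *\<^sub>R (X i * p * Y j) + b *\<^sub>R (imu * (X i * p * Y j))"
        unfolding ab by (simp add: distrib_left distrib_right)
      moreover have "X i * p * Y j \<in> F" "imu * (X i * p * Y j) \<in> F"
        using ij by (force simp: F_def)+
      ultimately show "X i * (p * (Y i * x * X j) * p) * Y j \<in> span F"
        by (simp add: span_add span_scale span_base)
    qed
    finally show ?thesis .
  qed
  moreover have "finite F" by (simp add: F_def)
  ultimately show ?thesis by blast
qed

text \<open>The relations for \<open>Y i * X j\<close> say that the \<open>X i * Y i\<close> are
  orthogonal idempotents, all equivalent to \<open>q\<close>. In infinite dimension no nonzero
  projection below \<open>e\<close> is minimal, so room for one more copy can always be split off,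
  at the price of a smaller \<open>q\<close>.\<close>

theorem small_projections:
  assumes inf: "\<not> (\<exists>F. finite F \<and> {x. e * x = x} \<subseteq> span F)" and e0: "e \<noteq> 0"
  shows "\<exists>q X Y. proj q \<and> e * q = q \<and> q \<noteq> 0 \<and>
    (\<forall>i<N. \<forall>j<N. Y i * X j = (if i = (j::nat) then q else 0)) \<and>
    (\<forall>i<N. e * X i = X i \<and> X i * q = X i \<and> e * Y i = Y i \<and> q * Y i = Y i)"
proof -
  have "\<exists>q X Y. proj q \<and> q \<noteq> 0 \<and> p * q = q \<and>
    (\<forall>i<N. \<forall>j<N. Y i * X j = (if i = (j::nat) then q else 0)) \<and>
    (\<forall>i<N. p * X i = X i \<and> X i * q = X i \<and> Y i * p = Y i \<and> q * Y i = Y i)"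
    if "proj p" "e * p = p" "p \<noteq> 0" for p
    using that
  proof (induction N arbitrary: p)
    case 0
    then show ?case by (auto simp: proj_def intro!: exI[of _ p])
  next
    case (Suc N)
    \<comment> \<open>\<open>p'\<close> makes room for the additional copy, while the induction
      hypothesis is applied to the remainder \<open>p - p'\<close>; hence the induction is over
      arbitrary \<open>p\<close>.\<close>
    then obtain p' where p': "proj p'" "p' * p = p'" "p * p' = p'" "p' \<noteq> 0" "p' \<noteq> p"
      using minimal_projection_finite_dimensional[OF Suc.prems] inf by blast
    have ep': "e * p' = p'" using Suc.prems(2) p'(3) by (metis mult.assoc)
    define d where "d = p - p'"
    have d: "proj d" "e * d = d" "d \<noteq> 0" "p' * d = 0" "p * d = d" "d * p = d" "d * p' = 0"
      using Suc.prems p' ep' by (auto simp: d_def proj_def adj_diff algebra_simps)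
    obtain q X Y where q: "proj q" "q \<noteq> 0" "d * q = q"
      and XY: "\<And>i j. i < N \<Longrightarrow> j < N \<Longrightarrow> Y i * X j = (if i = j then q else 0)"
      and X: "\<And>i. i < N \<Longrightarrow> d * X i = X i" and Xq: "\<And>i. i < N \<Longrightarrow> X i * q = X i"
      and Y: "\<And>i. i < N \<Longrightarrow> Y i * d = Y i" and Yq: "\<And>i. i < N \<Longrightarrow> q * Y i = Y i"
      using Suc.IH[OF d(1,2,3)] by blast
    have eq: "e * q = q" using d(2) q(3) by (metis mult.assoc)
    obtain r x y where r: "proj r" "r \<noteq> 0" "r * q = r" "q * r = r" "y * x = r"
        "p' * x = x" "x * r = x" "y * p' = y" "r * y = y"
      using subprojection_subequivalent[OF q(1) eq q(2) p'(1) ep' p'(4)] by blast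
    have rr: "r * r = r" using r(1) by (simp add: proj_def)
    \<comment> \<open>The old copies are cut down to \<open>r\<close>, the part of \<open>q\<close>
      that has a further copy below \<open>p'\<close>, given by \<open>x\<close> and
      \<open>y\<close>. Old and new copies are orthogonal because \<open>d * p' = 0\<close> and
      \<open>p' * d = 0\<close>.\<close>
    define X' where "X' i = (if i < N then X i * r else x)" for i
    define Y' where "Y' i = (if i < N then r * Y i else y)" for i
    have c1: "r * Y i * (X j * r) = (if i = j then r else 0)" if "i < N" "j < N" for i j
    proof -
      have "r * Y i * (X j * r) = r * (Y i * X j) * r" by (simp only: mult.assoc)
      then show ?thesis using XY[OF that] by (simp add: r rr)
    qed
    have c2: "r * Y i * x = 0" if "i < N" for i
    proof -
      have "r * Y i * x = r * (Y i * d) * (p' * x)" using Y[OF that] r(6) by simp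
      also have "\<dots> = r * Y i * (d * p') * x" by (simp only: mult.assoc)
      finally show ?thesis using d(7) by simp
    qed
    have c3: "y * (X i * r) = 0" if "i < N" for i
    proof -
      have "y * (X i * r) = (y * p') * ((d * X i) * r)" using X[OF that] r(8) by simp
      also have "\<dots> = y * (p' * d) * (X i * r)" by (simp only: mult.assoc)
      finally show ?thesis using d(4) by simp
    qed
    have pX: "p * (X i * r) = X i * r" if "i < N" for i
      using X[OF that] d(5) by (metis mult.assoc)
    have pY: "r * Y i * p = r * Y i" if "i < N" for i
      using Y[OF that] d(6) by (metis mult.assoc)
    have px: "p * x = x" using p'(3) r(6) by (metis mult.assoc)
    have yp: "y * p = y" using p'(2) r(8) by (metis mult.assoc)
    have pr: "p * r = r" using d(5) q(3) r(4) by (metis mult.assoc)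
    show ?case
    proof (intro exI conjI allI impI)
      show "Y' i * X' j = (if i = j then r else 0)" if "i < Suc N" "j < Suc N" for i j
        using that c1 c2 c3 r(5) by (auto simp: X'_def Y'_def)
      show "p * X' i = X' i" "X' i * r = X' i" "Y' i * p = Y' i" "r * Y' i = Y' i" for i
        using pX pY px yp rr r by (auto simp: X'_def Y'_def mult.assoc) (auto simp: mult.assoc[symmetric] rr)
    qed (use r pr in auto)
  qed
  from this[OF proj_e _ e0] proj_e obtain q X Y where q: "proj q" "q \<noteq> 0" "e * q = q"
    "\<forall>i<N. \<forall>j<N. Y i * X j = (if i = (j::nat) then q else 0)"
    "\<forall>i<N. e * X i = X i \<and> X i * q = X i \<and> Y i * e = Y i \<and> q * Y i = Y i"
    by (auto simp: proj_def)
  then show ?thesis using central by metis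
qed

end

section \<open>Generic left invertibility\<close>

text \<open>An idempotent \<open>f\<close> of the ring \<open>S\<close> stands for the projective right module \<open>f S\<close>, and
  \<open>f S e\<close> for the homomorphisms from \<open>e S\<close> to \<open>f S\<close>.\<close>

definition left_inv_dense :: "'b::real_normed_algebra set \<Rightarrow> 'b \<Rightarrow> 'b \<Rightarrow> bool" where
  "left_inv_dense S e f \<longleftrightarrow>
    (\<forall>x\<in>S. \<forall>\<epsilon>>0. f * x = x \<longrightarrow> x * e = x \<longrightarrow>
      (\<exists>x'\<in>S. f * x' = x' \<and> x' * e = x' \<and> norm (x - x') < \<epsilon> \<and>
        (\<exists>y\<in>S. e * y = y \<and> y * f = y \<and> y * x' = e)))"

lemma left_inv_denseD:
  assumes "left_inv_dense S e f" "x \<in> S" "f * x = x" "x * e = x" "0 < \<epsilon>"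
  obtains x' y where "x' \<in> S" "f * x' = x'" "x' * e = x'" "norm (x - x') < \<epsilon>"
    "y \<in> S" "e * y = y" "y * f = y" "y * x' = e"
  using assms unfolding left_inv_dense_def by blast

lemma left_inv_denseI:
  assumes "\<And>x \<epsilon>. x \<in> S \<Longrightarrow> 0 < \<epsilon> \<Longrightarrow> f * x = x \<Longrightarrow> x * e = x \<Longrightarrow>
    \<exists>x' y. x' \<in> S \<and> y \<in> S \<and> f * x' = x' \<and> x' * e = x' \<and> norm (x - x') < \<epsilon> \<and>
      e * y = y \<and> y * f = y \<and> y * x' = e"
  shows "left_inv_dense S e f"
  unfolding left_inv_dense_def
proof (intro ballI allI impI)
  fix x and \<epsilon> :: real assume "x \<in> S" "0 < \<epsilon>" "f * x = x" "x * e = x"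
  from assms[OF this] show "\<exists>x'\<in>S. f * x' = x' \<and> x' * e = x' \<and> norm (x - x') < \<epsilon> \<and>
    (\<exists>y\<in>S. e * y = y \<and> y * f = y \<and> y * x' = e)" by blast
qed

text \<open>No unit is asked for: \<open>S\<close> will be a ring of matrices inside one type that
  holds all finite sizes, and idempotents take the place of identity matrices.\<close>

locale complete_subring =
  fixes S :: "'b::real_normed_algebra set"
  assumes complete_S: "complete S" and zero_S [simp]: "0 \<in> S"
    and add_S [simp]: "x \<in> S \<Longrightarrow> y \<in> S \<Longrightarrow> x + y \<in> S"
    and diff_S [simp]: "x \<in> S \<Longrightarrow> y \<in> S \<Longrightarrow> x - y \<in> S"
    and mult_S [simp]: "x \<in> S \<Longrightarrow> y \<in> S \<Longrightarrow> x * y \<in> S"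
begin

definition idem :: "'b \<Rightarrow> bool" where "idem p \<longleftrightarrow> p \<in> S \<and> p * p = p"

text \<open>Additional target rows do no harm: only the \<open>f\<close>-component of
  \<open>x\<close> is perturbed, and the left inverse ignores the
  \<open>g\<close>-component.\<close>

lemma left_inv_dense_add_target:
  assumes d: "left_inv_dense S e f" and f: "idem f" and g: "idem g" and fg: "f * g = 0" "g * f = 0"
    and e: "idem e"
  shows "left_inv_dense S e (f + g)"
proof (rule left_inv_denseI)
  fix x and \<epsilon> :: real assume x: "x \<in> S" "0 < \<epsilon>" "(f + g) * x = x" "x * e = x"
  have I: "f \<in> S" "g \<in> S" "f * f = f" "g * g = g" using f g by (auto simp: idem_def)
  have "f * (f * x) = f * x" "f * x * e = f * x" "f * x \<in> S"
    using I x by (simp_all add: mult.assoc[symmetric]) (simp add: mult.assoc)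
  from left_inv_denseD[OF d this(3) this(1,2) x(2)] obtain x' y where
    x': "x' \<in> S" "f * x' = x'" "x' * e = x'" "norm (f * x - x') < \<epsilon>" and
    y: "y \<in> S" "e * y = y" "y * f = y" "y * x' = e" by blast
  have gx': "g * x' = 0" using x'(2) fg by (metis mult.assoc mult_zero_left)
  have yg: "y * g = 0" using y(3) fg by (metis mult.assoc mult_zero_right)
  show "\<exists>x' y. x' \<in> S \<and> y \<in> S \<and> (f + g) * x' = x' \<and> x' * e = x' \<and> norm (x - x') < \<epsilon> \<and>
      e * y = y \<and> y * (f + g) = y \<and> y * x' = e"
  proof (rule exI[of _ "x' + g * x"], rule exI[of _ y], intro conjI)
    have gg: "g * (g * x) = g * x" "f * (g * x) = 0"
      using I fg by (simp_all add: mult.assoc[symmetric])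
    show "(f + g) * (x' + g * x) = x' + g * x"
      by (simp add: algebra_simps x' gx' gg)
    show "(x' + g * x) * e = x' + g * x" by (simp add: algebra_simps x' x)
    have "x - (x' + g * x) = (f + g) * x - (x' + g * x)" using x by simp
    also have "\<dots> = f * x - x'" by (simp add: algebra_simps)
    finally have eq: "x - (x' + g * x) = f * x - x'" .
    show "norm (x - (x' + g * x)) < \<epsilon>" unfolding eq by (rule x'(4))
    have "y * (g * x) = 0" using yg by (simp add: mult.assoc[symmetric])
    then show "y * (x' + g * x) = e" by (simp add: distrib_left y)
  qed (use x' y I x yg in \<open>auto simp: distrib_left\<close>)
qed

text \<open>Gaussian elimination for two by two blocks. Once the entry \<open>b\<close> has been
  perturbed to have a left inverse \<open>c\<close>, the remaining condition concerns the Schur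
  complement \<open>d - m * c * n\<close>, which is perturbed next.\<close>

lemma left_inv_dense_sum:
  assumes d1: "left_inv_dense S e1 f1" and d2: "left_inv_dense S e2 f2"
    and I: "idem e1" "idem e2" "idem f1" "idem f2"
    and O: "e1 * e2 = 0" "e2 * e1 = 0" "f1 * f2 = 0" "f2 * f1 = 0"
  shows "left_inv_dense S (e1 + e2) (f1 + f2)"
proof (rule left_inv_denseI)
  fix x and \<epsilon> :: real assume x: "x \<in> S" "0 < \<epsilon>" "(f1 + f2) * x = x" "x * (e1 + e2) = x"
  have S: "e1 \<in> S" "e2 \<in> S" "f1 \<in> S" "f2 \<in> S"
    and i: "e1 * e1 = e1" "e2 * e2 = e2" "f1 * f1 = f1" "f2 * f2 = f2"
    using I by (auto simp: idem_def)
  have i2: "e1 * (e1 * v) = e1 * v" "e2 * (e2 * v) = e2 * v" "f1 * (f1 * v) = f1 * v" "f2 * (f2 * v) = f2 * v"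
     "e1 * (e2 * v) = 0" "e2 * (e1 * v) = 0" "f1 * (f2 * v) = 0" "f2 * (f1 * v) = 0" for v
    by (simp_all add: mult.assoc[symmetric] i O)
  define b m n d where "b = f1 * x * e1" and "m = f2 * x * e1" and "n = f1 * x * e2" and "d = f2 * x * e2"
  have xe: "x = b + m + n + d"
  proof -
    have "x = (f1 + f2) * x * (e1 + e2)" using x by simp
    then show ?thesis by (simp add: b_def m_def n_def d_def algebra_simps)
  qed
  have mS: "m \<in> S" "n \<in> S" "b \<in> S" "d \<in> S" using S x by (auto simp: b_def m_def n_def d_def)
  have m: "f2 * m = m" "f1 * m = 0" "m * e1 = m" "m * e2 = 0"
    and n: "f1 * n = n" "f2 * n = 0" "n * e2 = n" "n * e1 = 0"
    by (simp_all add: m_def n_def mult.assoc i i2 O)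
  have "f1 * b = b" "b * e1 = b" by (simp_all add: b_def mult.assoc i i2)
  from left_inv_denseD[OF d1 mS(3) this, of "\<epsilon>/2"] x(2) obtain b' c where
    b': "b' \<in> S" "f1 * b' = b'" "b' * e1 = b'" "norm (b - b') < \<epsilon>/2" and
    c: "c \<in> S" "e1 * c = c" "c * f1 = c" "c * b' = e1" by auto
  have d': "d - m * c * n \<in> S" "f2 * (d - m * c * n) = d - m * c * n" "(d - m * c * n) * e2 = d - m * c * n"
  proof -
    have "f2 * (m * t) = m * t" for t by (simp add: mult.assoc[symmetric] m)
    then show "f2 * (d - m * c * n) = d - m * c * n" by (simp add: right_diff_distrib mult.assoc d_def i2)
    show "(d - m * c * n) * e2 = d - m * c * n" by (simp add: left_diff_distrib mult.assoc d_def i n)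
    show "d - m * c * n \<in> S" using mS c by simp
  qed
  from left_inv_denseD[OF d2 d', of "\<epsilon>/2"] x(2) obtain g h where
    g: "g \<in> S" "f2 * g = g" "g * e2 = g" "norm (d - m * c * n - g) < \<epsilon>/2" and
    h: "h \<in> S" "e2 * h = h" "h * f2 = h" "h * g = e2" by auto
  \<comment> \<open>Adding \<open>m * c * n\<close> back makes \<open>g\<close> the Schur complement
    of \<open>x'\<close>, and the off-diagonal entries stay untouched. \<open>y\<close> is the left
    inverse of the upper triangular matrix with entries \<open>b'\<close>, \<open>n\<close>,
    \<open>g\<close>, multiplied by the row operation that cleared \<open>m\<close>.\<close>
  define x' where "x' = b' + m + n + (g + m * c * n)"
  define y where "y = c + h - c * n * h - (h * m * c - c * n * h * m * c)"
  have z: "c * m = 0" "c * g = 0" "h * b' = 0" "h * n = 0" "f1 * g = 0" "f2 * b' = 0" "g * e1 = 0" "b' * e2 = 0"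
     "e2 * c = 0" "e1 * h = 0" "c * f2 = 0" "h * f1 = 0"
    using c(3) m(2) g(2) O h(3) b'(2) n(2) c(2) h(2) g(3) b'(3) n(1) m(1)
    by (metis mult.assoc mult_zero_left mult_zero_right)+
  have cv: "c * (b' * v) = e1 * v" "c * (m * v) = 0" "c * (g * v) = 0" "h * (b' * v) = 0" "h * (n * v) = 0"
    "h * (g * v) = e2 * v" "c * (f1 * v) = c * v" "h * (f2 * v) = h * v" "e1 * (c * v) = c * v" "e2 * (h * v) = h * v"
    "n * (e2 * v) = n * v" "m * (e1 * v) = m * v" "f2 * (m * v) = m * v" "f1 * (m * v) = 0"
    "e2 * (c * v) = 0" "e1 * (h * v) = 0" for v
    by (simp_all add: mult.assoc[symmetric] z c h m n)
  show "\<exists>x' y. x' \<in> S \<and> y \<in> S \<and> (f1 + f2) * x' = x' \<and> x' * (e1 + e2) = x' \<and> norm (x - x') < \<epsilon> \<and>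
      (e1 + e2) * y = y \<and> y * (f1 + f2) = y \<and> y * x' = e1 + e2"
  proof (rule exI[of _ x'], rule exI[of _ y], intro conjI)
    show "(f1 + f2) * x' = x'"
      by (simp add: x'_def distrib_left distrib_right mult.assoc m n b' g z cv)
    show "x' * (e1 + e2) = x'"
      by (simp add: x'_def distrib_left distrib_right mult.assoc m n b' g z cv)
    have "norm (x - x') = norm ((b - b') + (d - m * c * n - g))"
      unfolding x'_def by (subst xe) (simp add: algebra_simps)
    also have "\<dots> < \<epsilon>" using norm_triangle_ineq[of "b - b'" "d - m * c * n - g"] b'(4) g(4) by simp
    finally show "norm (x - x') < \<epsilon>" .
    show "(e1 + e2) * y = y"
      by (simp add: y_def algebra_simps c h z cv)
    show "y * (f1 + f2) = y"
      by (simp add: y_def algebra_simps c h z cv)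
    show "y * x' = e1 + e2"
      by (simp add: x'_def y_def algebra_simps c h z cv m n)
    show "x' \<in> S" "y \<in> S" using mS c h g b' by (auto simp: x'_def y_def)
  qed
qed

text \<open>Here \<open>u\<close> and \<open>v\<close> identify \<open>e1\<close> with \<open>f1\<close>.  Once the \<open>w\<close>-component of the first
  column is left invertible, two elementary row operations turn that column into \<open>u\<close>.\<close>
lemma left_inv_dense_sum_equiv:
  assumes d1: "left_inv_dense S e1 w" and d2: "left_inv_dense S e2 w"
    and I: "idem e1" "idem e2" "idem w" "idem f1"
    and O: "e1 * e2 = 0" "e2 * e1 = 0" "f1 * w = 0" "w * f1 = 0"
    and uv: "u \<in> S" "v \<in> S" "f1 * u = u" "u * e1 = u" "e1 * v = v" "v * f1 = v" "v * u = e1" "u * v = f1"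
  shows "left_inv_dense S (e1 + e2) (f1 + w)"
proof (rule left_inv_denseI)
  fix x and \<epsilon> :: real assume x: "x \<in> S" "0 < \<epsilon>" "(f1 + w) * x = x" "x * (e1 + e2) = x"
  have S: "e1 \<in> S" "e2 \<in> S" "f1 \<in> S" "w \<in> S"
    and i: "e1 * e1 = e1" "e2 * e2 = e2" "f1 * f1 = f1" "w * w = w"
    using I by (auto simp: idem_def)
  have i2: "e1 * (e1 * t) = e1 * t" "e2 * (e2 * t) = e2 * t" "f1 * (f1 * t) = f1 * t" "w * (w * t) = w * t"
     "e1 * (e2 * t) = 0" "e2 * (e1 * t) = 0" "f1 * (w * t) = 0" "w * (f1 * t) = 0" for t
    by (simp_all add: mult.assoc[symmetric] i O)
  define a b0 x2 where "a = f1 * x * e1" and "b0 = w * x * e1" and "x2 = x * e2"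
  have xe: "x = a + b0 + x2"
  proof -
    have "x * e1 = ((f1 + w) * x) * e1" using x(3) by (simp only:)
    then have "x * e1 = a + b0" by (simp add: a_def b0_def algebra_simps)
    moreover have "x = x * e1 + x2" using x(4) by (simp only: x2_def distrib_left)
    ultimately show ?thesis by (simp only:)
  qed
  have aS: "a \<in> S" "b0 \<in> S" "x2 \<in> S" using S x by (auto simp: a_def b0_def x2_def)
  have a: "f1 * a = a" "a * e1 = a" "w * a = 0" "a * e2 = 0"
    and b0: "w * b0 = b0" "b0 * e1 = b0"
    by (simp_all add: a_def b0_def mult.assoc i i2 O)
  have x2: "x2 * e2 = x2" "f1 * x2 + w * x2 = x2"
    using x by (simp_all add: x2_def mult.assoc i) (simp add: mult.assoc[symmetric] distrib_right[symmetric])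
  from left_inv_denseD[OF d1 aS(2) b0, of "\<epsilon>/2"] x(2) obtain b c where
    b: "b \<in> S" "w * b = b" "b * e1 = b" "norm (b0 - b) < \<epsilon>/2" and
    c: "c \<in> S" "e1 * c = c" "c * w = c" "c * b = e1" by auto
  define r where "r = u - a"
  have r: "r \<in> S" "f1 * r = r" "r * e1 = r" "w * r = 0"
    using uv aS a by (auto simp: r_def algebra_simps)
      (metis O(4) mult.assoc mult_zero_left uv(3))
  have z: "c * r = 0" "v * b = 0" "c * f1 = 0" "v * w = 0" "f1 * b = 0" "w * u = 0" "b * e2 = 0"
     "c * u = 0" "c * a = 0" "e2 * c = 0" "e2 * v = 0" "u * e2 = 0" "r * e2 = 0"
    using c r uv O b a by (metis mult.assoc mult_zero_left mult_zero_right)+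
  \<comment> \<open>Since \<open>c * (a + b) = e1\<close>, adding \<open>r\<close> times
    \<open>c\<close> changes \<open>a\<close> into \<open>u\<close>, and subtracting
    \<open>b\<close> times \<open>v\<close> then clears \<open>b\<close>. Both operations are
    functions of \<open>t\<close>, because there is no unit with which to form elementary matrices;
    \<open>T'\<close> undoes them.\<close>
  define T where "T t = t + r * (c * t) - b * (v * (t + r * (c * t)))" for t
  define T' where "T' t = t + b * (v * t) - r * (c * (t + b * (v * t)))" for t
  have TS: "T t \<in> S" "T' t \<in> S" if "t \<in> S" for t
    using that r c b uv by (auto simp: T_def T'_def)
  have cv: "c * (r * t) = 0" "v * (b * t) = 0" "c * (b * t) = e1 * t" "r * (e1 * t) = r * t" "b * (e1 * t) = b * t"
     "f1 * (r * t) = r * t" "w * (r * t) = 0" "f1 * (b * t) = 0" "w * (b * t) = b * t" "e1 * (v * t) = v * t"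
     "v * (u * t) = e1 * t" "v * (f1 * t) = v * t" "v * (w * t) = 0" "c * (w * t) = c * t" "c * (f1 * t) = 0"
     "w * (u * t) = 0" "f1 * (u * t) = u * t" "e1 * (c * t) = c * t" for t
    by (simp_all add: mult.assoc[symmetric] z c r b uv)
  have TT': "T (T' t) = t" for t
    by (simp add: T_def T'_def algebra_simps cv)
  define X2 where "X2 = T x2"
  have X2S: "X2 \<in> S" using TS aS by (simp add: X2_def)
  have X2: "X2 * e2 = X2" "f1 * X2 + w * X2 = X2"
  proof -
    show "X2 * e2 = X2" by (simp add: X2_def T_def algebra_simps x2)
    have "f1 * X2 + w * X2 = (f1 * x2 + w * x2) + r * (c * x2) - b * (v * (x2 + r * (c * x2)))"
      by (simp add: X2_def T_def algebra_simps cv)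
    then show "f1 * X2 + w * X2 = X2" by (simp add: x2 X2_def T_def)
  qed
  \<comment> \<open>A bound for \<open>T'\<close>, so that an error made after the row operations
    can be carried back to the original matrix.\<close>
  define K where "K = 1 + norm b * norm v + norm r * norm c * (1 + norm b * norm v)"
  have K: "norm (T' t) \<le> K * norm t" for t
  proof -
    have 1: "norm (t + b * (v * t)) \<le> (1 + norm b * norm v) * norm t"
    proof -
      have "norm (b * (v * t)) \<le> norm b * (norm v * norm t)"
        by (meson mult_left_mono norm_ge_zero norm_mult_ineq order_trans)
      then show ?thesis using norm_triangle_ineq[of t "b * (v * t)"] by (simp add: algebra_simps)
    qed
    have "norm (r * (c * (t + b * (v * t)))) \<le> norm r * (norm c * norm (t + b * (v * t)))"
      by (meson mult_left_mono norm_ge_zero norm_mult_ineq order_trans)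
    also have "\<dots> \<le> norm r * (norm c * ((1 + norm b * norm v) * norm t))"
      by (intro mult_left_mono 1) auto
    finally show ?thesis
      using 1 norm_triangle_ineq4[of "t + b * (v * t)" "r * (c * (t + b * (v * t)))"]
      by (simp add: T'_def K_def algebra_simps)
  qed
  have Kp: "K > 0" unfolding K_def by (intro add_pos_nonneg) auto
  have "w * (w * X2) = w * X2" "w * X2 * e2 = w * X2" "w * X2 \<in> S"
    using X2 X2S S by (simp_all add: i2 mult.assoc)
  from left_inv_denseD[OF d2 this(3,1,2), of "\<epsilon> / (2 * K)"] x(2) Kp obtain d h where
    d: "d \<in> S" "w * d = d" "d * e2 = d" "norm (w * X2 - d) < \<epsilon> / (2 * K)" and
    h: "h \<in> S" "e2 * h = h" "h * w = h" "h * d = e2" by auto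
  define m where "m = f1 * X2"
  have m: "f1 * m = m" "m * e2 = m" "m \<in> S" using X2 X2S S by (simp_all add: m_def i2 mult.assoc)
  define x2' where "x2' = T' (m + d)"
  define x' where "x' = a + b + x2'"
  have f1d: "f1 * d = 0" and wm: "w * m = 0"
    using d(2) m(1) O by (metis mult.assoc mult_zero_left)+
  \<comment> \<open>A left inverse of the transformed matrix, which is upper triangular with entries
    \<open>u\<close>, \<open>m\<close>, \<open>d\<close>. The element \<open>y\<close> is
    \<open>L\<close> after \<open>T\<close>, multiplied out.\<close>
  define L where "L = v + h - v * m * h"
  define y where "y = L + L * r * c - (L * b * v + L * b * v * r * c)"
  have z2: "v * d = 0" "h * u = 0" "h * m = 0" "h * r = 0" "e1 * h = 0"
    using d(2) h(3) uv m r O h(2) z by (metis mult.assoc mult_zero_left mult_zero_right)+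
  have hv: "h * (r * t) = 0" "h * (u * t) = 0" "h * (m * t) = 0" "h * (d * t) = e2 * t" "v * (d * t) = 0" "m * (e2 * t) = m * t"
      "e1 * (h * t) = 0" "e2 * (h * t) = h * t" "e2 * (v * t) = 0" for t
    by (simp_all add: mult.assoc[symmetric] z2 h m z)
  have Lx: "L * (u + (m + d)) = e1 + e2"
    by (simp add: L_def algebra_simps uv z z2 h m hv)
  have yT: "y * t = L * T t" for t
    by (simp add: y_def T_def algebra_simps)
  have "T (a + b) = u"
  proof -
    have "c * (a + b) = e1" by (simp add: distrib_left z c)
    then have "T (a + b) = a + b + r - b * (v * (a + b + r))" by (simp add: T_def r)
    also have "a + b + r = u + b" by (simp add: r_def)
    finally show ?thesis by (simp add: distrib_left uv z b)
  qed
  moreover have "T (s + t) = T s + T t" for s t by (simp add: T_def algebra_simps)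
  ultimately have "T x' = u + (m + d)" by (simp add: x'_def x2'_def TT')
  then have yx: "y * x' = e1 + e2" by (simp add: yT Lx)
  have X2T: "x2 = T' X2"
    by (simp add: X2_def T_def T'_def algebra_simps cv)
  show "\<exists>x' y. x' \<in> S \<and> y \<in> S \<and> (f1 + w) * x' = x' \<and> x' * (e1 + e2) = x' \<and> norm (x - x') < \<epsilon> \<and>
      (e1 + e2) * y = y \<and> y * (f1 + w) = y \<and> y * x' = e1 + e2"
  proof (rule exI[of _ x'], rule exI[of _ y], intro conjI)
    show "y * x' = e1 + e2" by (rule yx)
    show "(f1 + w) * x' = x'"
      by (simp add: x'_def x2'_def T'_def algebra_simps a b m d z f1d wm cv)
    show "x' * (e1 + e2) = x'"
    proof -
      have "(m + d) * e1 = 0"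
        using m(2) d(3) O by (metis distrib_right mult.assoc mult_zero_right)
      then have 1: "m * e1 + d * e1 = 0" by (simp add: distrib_right)
      have "x2' * e1 = T' (m * e1 + d * e1)" by (simp add: x2'_def T'_def algebra_simps)
      then have "x2' * e1 = 0" by (simp add: 1 T'_def)
      moreover have "x2' * e2 = x2'" by (simp add: x2'_def T'_def algebra_simps m d)
      ultimately show ?thesis by (simp add: x'_def algebra_simps a b z)
    qed
    have "x - x' = (b0 - b) + (x2 - x2')" unfolding x'_def by (subst xe) simp
    moreover have "x2 - x2' = T' (w * X2 - d)"
    proof -
      have "T' s - T' t = T' (s - t)" for s t by (simp add: T'_def algebra_simps)
      moreover have "X2 - (m + d) = w * X2 - d" using X2(2) by (simp add: m_def algebra_simps)
      ultimately show ?thesis unfolding x2'_def by (subst X2T) (simp only:)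
    qed
    moreover have "norm (T' (w * X2 - d)) < \<epsilon> / 2"
    proof -
      have "norm (T' (w * X2 - d)) \<le> K * norm (w * X2 - d)" by (rule K)
      also have "\<dots> < K * (\<epsilon> / (2 * K))" using d(4) Kp by (intro mult_strict_left_mono)
      finally show ?thesis using Kp by simp
    qed
    ultimately show "norm (x - x') < \<epsilon>"
      using norm_triangle_ineq[of "b0 - b" "x2 - x2'"] b(4) by simp
    show "(e1 + e2) * y = y"
      by (simp add: y_def L_def algebra_simps c h z z2 cv hv uv)
    show "y * (f1 + w) = y"
      by (simp add: y_def L_def algebra_simps c h z z2 cv hv uv)
        (metis O(3) h(3) mult.assoc mult_zero_right O(4))
    show "x' \<in> S" using aS b TS m d by (auto simp: x'_def x2'_def)
    show "y \<in> S" using uv h m r c b by (auto simp: y_def L_def)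
  qed
qed

text \<open>Extend \<open>x\<close> by the identity on \<open>z\<close>. In a perturbation
  \<open>x'\<close> the corner \<open>k\<close> at \<open>z\<close> is still invertible, and
  eliminating it leaves a Schur complement \<open>x''\<close> close to \<open>x\<close>. The corner
  \<open>e * l * f\<close> of the left inverse \<open>l\<close> of \<open>x'\<close> is a left
  inverse of this Schur complement.\<close>

lemma left_inv_dense_cancel:
  assumes d: "left_inv_dense S (e + z) (f + z)"
    and I: "idem e" "idem f" "idem z"
    and O: "e * z = 0" "z * e = 0" "f * z = 0" "z * f = 0"
  shows "left_inv_dense S e f"
proof (rule left_inv_denseI)
  fix x and \<epsilon> :: real assume x: "x \<in> S" "0 < \<epsilon>" "f * x = x" "x * e = x"
  have S: "e \<in> S" "f \<in> S" "z \<in> S"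
    and i: "e * e = e" "f * f = f" "z * z = z"
    using I by (auto simp: idem_def)
  have i2: "e * (e * t) = e * t" "f * (f * t) = f * t" "z * (z * t) = z * t"
     "e * (z * t) = 0" "z * (e * t) = 0" "f * (z * t) = 0" "z * (f * t) = 0" for t
    by (simp_all add: mult.assoc[symmetric] i O)
  have xz: "x * z = 0" "z * x = 0" using x O by (metis mult.assoc mult_zero_left mult_zero_right)+
  have xz1: "x + z \<in> S" "(f + z) * (x + z) = x + z" "(x + z) * (e + z) = x + z"
    using x S by (auto simp: algebra_simps O i xz)
  \<comment> \<open>The bound 1/2 provides an inverse of the \<open>z\<close>-corner of norm at most
    \<open>2 * norm z\<close>; the bound by \<open>\<epsilon>\<close> is the resulting estimate for
    \<open>x - x''\<close>.\<close>
  obtain \<delta> where dl: "0 < \<delta>" "(norm z * \<delta> * norm z) < 1"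
      "norm f * \<delta> * norm e + norm f * \<delta> * norm z * (2 * norm z) * (norm z * \<delta> * norm e) < \<epsilon>"
      "norm z * \<delta> * norm z < 1/2"
  proof -
    have "((\<lambda>d. norm z * d * norm z) \<longlongrightarrow> norm z * 0 * norm z) (at_right (0::real))"
      "((\<lambda>d. norm f * d * norm e + norm f * d * norm z * (2 * norm z) * (norm z * d * norm e)) \<longlongrightarrow>
         norm f * 0 * norm e + norm f * 0 * norm z * (2 * norm z) * (norm z * 0 * norm e)) (at_right (0::real))"
      by (intro tendsto_intros)+
    then have "((\<lambda>d. norm z * d * norm z) \<longlongrightarrow> 0) (at_right (0::real))"
      "((\<lambda>d. norm f * d * norm e + norm f * d * norm z * (2 * norm z) * (norm z * d * norm e)) \<longlongrightarrow> 0) (at_right (0::real))"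
      by simp_all
    then have "\<forall>\<^sub>F d in at_right (0::real). norm z * d * norm z < 1/2 \<and>
      norm f * d * norm e + norm f * d * norm z * (2 * norm z) * (norm z * d * norm e) < \<epsilon> \<and> 0 < d"
      using x(2) by (intro eventually_conj order_tendstoD(2) eventually_at_right_less) auto
    then obtain d where "norm z * d * norm z < 1/2"
      "norm f * d * norm e + norm f * d * norm z * (2 * norm z) * (norm z * d * norm e) < \<epsilon>" "0 < d"
      using eventually_happens by (metis (no_types, lifting) trivial_limit_at_right_real)
    then show thesis by (intro that[of d]) auto
  qed
  obtain x' l where x': "x' \<in> S" "(f + z) * x' = x'" "x' * (e + z) = x'" "norm (x + z - x') < \<delta>"
    and l: "l \<in> S" "(e + z) * l = l" "l * (f + z) = l" "l * x' = e + z"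
    using left_inv_denseD[OF d xz1 dl(1)] by blast
  define D where "D = x + z - x'"
  have Dn: "norm D < \<delta>" using x' by (simp add: D_def)
  have nm: "norm (p * D * q) \<le> norm p * \<delta> * norm q" for p q
  proof -
    have "norm (p * D * q) \<le> norm p * norm D * norm q"
      by (meson mult_right_mono norm_ge_zero norm_mult_ineq order_trans)
    also have "\<dots> \<le> norm p * \<delta> * norm q" using Dn by (intro mult_right_mono mult_left_mono) auto
    finally show ?thesis .
  qed
  define k where "k = z * x' * z"
  have k: "k \<in> S" "z * k = k" "k * z = k" using S x' by (auto simp: k_def mult.assoc i i2)
  have zk: "z - k = z * D * z" by (simp add: k_def D_def algebra_simps xz i)
  then have nzk: "norm (z - k) < 1/2" using nm[of z z] dl by simp
  obtain w where w: "w \<in> S" "z * w = w" "w * z = w" "w * k = z" "k * w = z"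
    using invertible_near_idempotent[OF complete_S add_S diff_S mult_S S(3) i(3) k] nzk by fastforce
  have nw: "norm w \<le> 2 * norm z"
  proof -
    have "w = z + (z - k) * w" by (simp add: algebra_simps w)
    then have "norm w \<le> norm z + norm ((z - k) * w)" by (metis norm_triangle_ineq)
    also have "norm ((z - k) * w) \<le> (1/2) * norm w"
      using norm_mult_ineq[of "z - k" w] mult_right_mono[of "norm (z - k)" "1/2" "norm w"] nzk by simp
    finally show ?thesis by simp
  qed
  define x'' where "x'' = f * x' * e - f * x' * z * w * (z * x' * e)"
  have r: "e * (l * x') = e" using l(4) by (simp add: distrib_left i O)
  have le: "e * l * x' * t = e * t" for t using r by (simp add: mult.assoc)
  have lsplit: "e * l * f + e * l * z = e * l"
    using l(3) by (metis distrib_left mult.assoc)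
  \<comment> \<open>The row of \<open>l\<close> at \<open>e\<close>, applied to the columns of
    \<open>x'\<close> at \<open>e\<close> and at \<open>z\<close>, gives \<open>e\<close> and 0.
    Solving for the \<open>f\<close>-component expresses both products through the
    \<open>z\<close>-component, where \<open>k * w = z\<close> makes the terms cancel.\<close>
  have q1: "e * l * f * x' * e = e - e * l * z * x' * e"
  proof -
    have "e * l * f * x' * e + e * l * z * x' * e = e * l * x' * e"
      by (simp add: lsplit distrib_right[symmetric])
    also have "\<dots> = e" using le[of e] i by simp
    finally show ?thesis by (simp add: algebra_simps)
  qed
  have q2: "e * l * f * x' * z = - (e * l * k)"
  proof -
    have "e * l * f * x' * z + e * l * z * x' * z = e * l * x' * z"
      by (simp add: lsplit distrib_right[symmetric])
    also have "\<dots> = 0" using le[of z] O by simp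
    finally show ?thesis by (simp add: k_def mult.assoc eq_neg_iff_add_eq_0)
  qed
  have yx: "(e * l * f) * x'' = e"
  proof -
    have "(e * l * f) * x'' = e * l * f * x' * e - (e * l * f * x' * z) * w * (z * x' * e)"
      by (simp add: x''_def algebra_simps i2)
    also have "\<dots> = e - e * l * z * x' * e + e * l * (k * w) * (z * x' * e)"
      unfolding q1 q2 by (simp add: mult.assoc)
    also have "\<dots> = e" by (simp add: w mult.assoc i2)
    finally show ?thesis .
  qed
  show "\<exists>x' y. x' \<in> S \<and> y \<in> S \<and> f * x' = x' \<and> x' * e = x' \<and> norm (x - x') < \<epsilon> \<and>
      e * y = y \<and> y * f = y \<and> y * x' = e"
  proof (rule exI[of _ x''], rule exI[of _ "e * l * f"], intro conjI)
    show "(e * l * f) * x'' = e" by (rule yx)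
    show "f * x'' = x''" by (simp add: x''_def algebra_simps i2)
    show "x'' * e = x''" by (simp add: x''_def algebra_simps i)
    show "e * (e * l * f) = e * l * f" by (simp add: mult.assoc i2)
    show "e * l * f * f = e * l * f" by (simp add: mult.assoc i)
    show "e * l * f \<in> S" using S l by simp
    show "x'' \<in> S" using S x' w by (auto simp: x''_def)
    have fz: "f * x' * z = - (f * D * z)" and ze: "z * x' * e = - (z * D * e)"
      using x xz O by (simp_all add: D_def algebra_simps i)
    have "x - x'' = f * D * e + f * D * z * w * (z * D * e)"
    proof -
      have "f * D * e = x - f * x' * e" using x O by (simp add: D_def algebra_simps)
      then show ?thesis unfolding x''_def fz ze by simp
    qed
    also have "norm \<dots> \<le> norm (f * D * e) + norm (f * D * z * w * (z * D * e))" by (rule norm_triangle_ineq)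
    also have "norm (f * D * z * w * (z * D * e)) \<le> norm (f * D * z) * norm w * norm (z * D * e)"
      by (meson mult_right_mono norm_ge_zero norm_mult_ineq order_trans)
    also have "\<dots> \<le> (norm f * \<delta> * norm z) * (2 * norm z) * (norm z * \<delta> * norm e)"
      using dl(1) by (intro mult_mono nm nw mult_nonneg_nonneg) auto
    also have "norm (f * D * e) \<le> norm f * \<delta> * norm e" by (rule nm)
    finally show "norm (x - x'') < \<epsilon>" using dl(3) by simp
  qed
qed

text \<open>Transport along isomorphisms of source and target; \<open>K\<close> absorbs the norms of
  the conjugating elements into the tolerance.\<close>

lemma left_inv_dense_equiv:
  assumes d: "left_inv_dense S e f" and I: "idem e" "idem f" "idem e'" "idem f'"
    and u: "u \<in> S" "v \<in> S" "e' * u = u" "u * e = u" "e * v = v" "v * e' = v" "v * u = e" "u * v = e'"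
    and s: "s \<in> S" "t \<in> S" "f' * s = s" "s * f = s" "f * t = t" "t * f' = t" "t * s = f" "s * t = f'"
  shows "left_inv_dense S e' f'"
proof (rule left_inv_denseI)
  fix x and \<epsilon> :: real assume x: "x \<in> S" "0 < \<epsilon>" "f' * x = x" "x * e' = x"
  define K where "K = 1 + norm s * norm v"
  have K: "K > 0" unfolding K_def by (intro add_pos_nonneg) auto
  have rules: "e' * (u * r) = u * r" "u * (e * r) = u * r" "e * (v * r) = v * r" "v * (e' * r) = v * r"
    "v * (u * r) = e * r" "u * (v * r) = e' * r" "f' * (s * r) = s * r" "s * (f * r) = s * r"
    "f * (t * r) = t * r" "t * (f' * r) = t * r" "t * (s * r) = f * r" "s * (t * r) = f' * r" for r
    by (simp_all add: mult.assoc[symmetric] u s)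
  have x1: "t * x * u \<in> S" "f * (t * x * u) = t * x * u" "t * x * u * e = t * x * u"
    using x u s by (auto simp: mult.assoc rules)
  from left_inv_denseD[OF d this, of "\<epsilon> / K"] x(2) K obtain x' y where
    x': "x' \<in> S" "f * x' = x'" "x' * e = x'" "norm (t * x * u - x') < \<epsilon> / K" and
    y: "y \<in> S" "e * y = y" "y * f = y" "y * x' = e" by auto
  show "\<exists>x' y. x' \<in> S \<and> y \<in> S \<and> f' * x' = x' \<and> x' * e' = x' \<and> norm (x - x') < \<epsilon> \<and>
      e' * y = y \<and> y * f' = y \<and> y * x' = e'"
  proof (rule exI[of _ "s * x' * v"], rule exI[of _ "u * y * t"], intro conjI)
    have "s * (t * x * u - x') * v = x - s * x' * v"
      using x by (simp add: algebra_simps rules u)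
    then have "norm (x - s * x' * v) = norm (s * (t * x * u - x') * v)" by simp
    also have "\<dots> \<le> norm s * norm (t * x * u - x') * norm v"
      by (rule order_trans[OF norm_mult_ineq mult_right_mono[OF norm_mult_ineq norm_ge_zero]])
    also have "\<dots> \<le> K * norm (t * x * u - x')"
      by (simp add: K_def algebra_simps)
    also have "\<dots> < K * (\<epsilon> / K)" using x'(4) K by (intro mult_strict_left_mono)
    finally show "norm (x - s * x' * v) < \<epsilon>" using K by simp
    have "y * (f * r) = y * r" "y * (x' * r) = e * r" for r by (simp_all add: mult.assoc[symmetric] y)
    then show "u * y * t * (s * x' * v) = e'" by (simp add: mult.assoc rules u)
  qed (use x' y u s in \<open>auto simp: mult.assoc rules\<close>)
qed

end

section \<open>Finitely supported matrices\<close>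

text \<open>Finite support instead of a fixed size: the number of blocks depends on elements found
  within the proof, which a type cannot express.\<close>

typedef (overloaded) ('i, 'b::zero) fmat = "{a :: 'i \<Rightarrow> 'i \<Rightarrow> 'b. finite {(i, j). a i j \<noteq> 0}}"
  morphisms ent mat
  by (intro exI[of _ "\<lambda>_ _. 0"]) simp

setup_lifting type_definition_fmat

definition supported :: "'i set \<Rightarrow> ('i, 'b::zero) fmat \<Rightarrow> bool" where
  "supported J a \<longleftrightarrow> (\<forall>i j. i \<notin> J \<or> j \<notin> J \<longrightarrow> ent a i j = 0)"

lemma fmat_eqI: "(\<And>i j. ent a i j = ent b i j) \<Longrightarrow> a = b"
proof -
  assume "\<And>i j. ent a i j = ent b i j"
  then have "ent a = ent b" by (intro ext)
  then show "a = b" by (simp only: ent_inject)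
qed

lemma finite_support_subset:
  assumes "finite J" "\<And>i j. f i j \<noteq> 0 \<Longrightarrow> i \<in> J \<and> j \<in> J"
  shows "finite {(i, j). f i j \<noteq> 0}"
  by (rule finite_subset[of _ "J \<times> J"]) (use assms in auto)

lemma ent_mat:
  assumes "finite J" "\<And>i j. f i j \<noteq> 0 \<Longrightarrow> i \<in> J \<and> j \<in> J"
  shows "ent (mat f) = f"
  by (rule mat_inverse[OF CollectI]) (rule finite_support_subset[OF assms])

lemma ex_finite_supported: "\<exists>J. finite J \<and> supported J a"
proof -
  let ?S = "{(i, j). ent a i j \<noteq> 0}"
  have "finite ?S" using ent[of a] by simp
  moreover have "supported (fst ` ?S \<union> snd ` ?S) a"
    unfolding supported_def
  proof (intro allI impI, rule ccontr)
    fix i j assume "ent a i j \<noteq> 0" "i \<notin> fst ` ?S \<union> snd ` ?S \<or> j \<notin> fst ` ?S \<union> snd ` ?S"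
    moreover from this(1) have "i \<in> fst ` ?S" "j \<in> snd ` ?S" by force+
    ultimately show False by blast
  qed
  ultimately show ?thesis
    by (intro exI[of _ "fst ` ?S \<union> snd ` ?S"]) (simp only: finite_Un finite_imageI simp_thms)
qed

lemma ex_finite_supported3:
  "\<exists>J. finite J \<and> supported J a \<and> supported J b \<and> supported J c"
proof -
  obtain J where J: "finite J" "supported J a" using ex_finite_supported[of a] by blast
  obtain K where K: "finite K" "supported K b" using ex_finite_supported[of b] by blast
  obtain L where L: "finite L" "supported L c" using ex_finite_supported[of c] by blast
  show ?thesis
    using J K L by (intro exI[of _ "J \<union> K \<union> L"]) (simp add: supported_def)
qed

lemma supported_ent: "supported J a \<Longrightarrow> i \<notin> J \<or> j \<notin> J \<Longrightarrow> ent a i j = 0"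
  by (simp only: supported_def)

instantiation fmat :: (type, real_normed_algebra) real_normed_algebra
begin

lift_definition zero_fmat :: "('a, 'b) fmat" is "\<lambda>_ _. 0" by simp

lift_definition plus_fmat :: "('a, 'b) fmat \<Rightarrow> ('a, 'b) fmat \<Rightarrow> ('a, 'b) fmat"
  is "\<lambda>a b i j. a i j + b i j"
  by (erule (1) rev_finite_subset[OF finite_UnI]) auto

lift_definition minus_fmat :: "('a, 'b) fmat \<Rightarrow> ('a, 'b) fmat \<Rightarrow> ('a, 'b) fmat"
  is "\<lambda>a b i j. a i j - b i j"
  by (erule (1) rev_finite_subset[OF finite_UnI]) auto

lift_definition uminus_fmat :: "('a, 'b) fmat \<Rightarrow> ('a, 'b) fmat"
  is "\<lambda>a i j. - a i j" by simp

lift_definition scaleR_fmat :: "real \<Rightarrow> ('a, 'b) fmat \<Rightarrow> ('a, 'b) fmat"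
  is "\<lambda>r a i j. r *\<^sub>R a i j"
  by (erule rev_finite_subset) auto

lift_definition times_fmat :: "('a, 'b) fmat \<Rightarrow> ('a, 'b) fmat \<Rightarrow> ('a, 'b) fmat"
  is "\<lambda>a b i k. \<Sum>j | a i j \<noteq> 0. a i j * b j k"
proof -
  fix a b :: "'a \<Rightarrow> 'a \<Rightarrow> 'b"
  assume "finite {(i, j). a i j \<noteq> 0}" "finite {(i, j). b i j \<noteq> 0}"
  then have "finite (fst ` {(i, j). a i j \<noteq> 0} \<times> snd ` {(i, j). b i j \<noteq> 0})" by simp
  then show "finite {(i, k). (\<Sum>j | a i j \<noteq> 0. a i j * b j k) \<noteq> 0}"
  proof (rule rev_finite_subset, safe)
    fix i k assume "(\<Sum>j | a i j \<noteq> 0. a i j * b j k) \<noteq> 0"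
    then obtain j where "a i j * b j k \<noteq> 0" by (meson sum.not_neutral_contains_not_neutral)
    then have "a i j \<noteq> 0" "b j k \<noteq> 0" by auto
    then show "i \<in> fst ` {(i, j). a i j \<noteq> 0}" "k \<in> snd ` {(i, j). b i j \<noteq> 0}" by force+
  qed
qed

text \<open>The sum of all entry norms is submultiplicative, and on matrices of a fixed finite size
  any equivalent norm serves equally well for density.\<close>

definition norm_fmat :: "('a, 'b) fmat \<Rightarrow> real" where
  "norm_fmat a = (\<Sum>(i, j) | ent a i j \<noteq> 0. norm (ent a i j))"

definition sgn_fmat :: "('a, 'b) fmat \<Rightarrow> ('a, 'b) fmat" where "sgn_fmat a = scaleR (inverse (norm a)) a"
definition dist_fmat :: "('a, 'b) fmat \<Rightarrow> ('a, 'b) fmat \<Rightarrow> real" where "dist_fmat a b = norm (a - b)"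
definition uniformity_fmat :: "(('a, 'b) fmat \<times> ('a, 'b) fmat) filter" where
  "uniformity_fmat = (INF e\<in>{0<..}. principal {(x, y). dist x y < e})"
definition open_fmat :: "('a, 'b) fmat set \<Rightarrow> bool" where
  "open_fmat U = (\<forall>x\<in>U. \<forall>\<^sub>F (x', y) in uniformity. x' = x \<longrightarrow> y \<in> U)"

lemma ent_simps [simp]:
  "ent (0::('a, 'b) fmat) i j = 0" "ent (a + b) i j = ent a i j + ent b i j"
  "ent (a - b) i j = ent a i j - ent b i j" "ent (- a) i j = - ent a i j"
  "ent (r *\<^sub>R a) i j = r *\<^sub>R ent a i j"
  by (transfer, simp)+

lemma ent_mult_eq: "ent (a * b) i k = (\<Sum>j | ent a i j \<noteq> 0. ent a i j * ent b j k)"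
  by transfer (rule refl)

lemma ent_mult:
  assumes "finite J" "\<And>j. j \<notin> J \<Longrightarrow> ent a i j = 0 \<or> ent b j k = 0"
  shows "ent (a * b) i k = (\<Sum>j\<in>J. ent a i j * ent b j k)"
proof -
  obtain K where K: "finite K" "supported K a" using ex_finite_supported by blast
  have "{j. ent a i j \<noteq> 0} \<subseteq> K" using K(2) by (auto simp: supported_def)
  then have "ent (a * b) i k = (\<Sum>j\<in>K. ent a i j * ent b j k)"
    unfolding ent_mult_eq using K(1) by (intro sum.mono_neutral_left) auto
  also have "\<dots> = (\<Sum>j\<in>K \<union> J. ent a i j * ent b j k)"
    using K assms supported_ent[OF K(2)] by (intro sum.mono_neutral_left) auto
  also have "\<dots> = (\<Sum>j\<in>J. ent a i j * ent b j k)"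
  proof (rule sum.mono_neutral_right)
    show "\<forall>j\<in>K \<union> J - J. ent a i j * ent b j k = 0"
      using assms(2) by (metis DiffD2 mult_zero_left mult_zero_right)
  qed (use K assms(1) in auto)
  finally show ?thesis .
qed

lemma norm_fmat_supported:
  assumes "finite J" "supported J a"
  shows "norm a = (\<Sum>i\<in>J. \<Sum>j\<in>J. norm (ent a i j))"
proof -
  have "norm a = (\<Sum>(i, j)\<in>J \<times> J. norm (ent a i j))"
    unfolding norm_fmat_def using assms
    by (intro sum.mono_neutral_left) (auto simp: supported_def)
  then show ?thesis by (simp only: sum.cartesian_product)
qed

lemma supported_simps [simp]:
  fixes a b :: "('a, 'b) fmat"
  shows "supported J (0 :: ('a, 'b) fmat)" "supported J a \<Longrightarrow> supported J b \<Longrightarrow> supported J (a + b)"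
    "supported J a \<Longrightarrow> supported J b \<Longrightarrow> supported J (a - b)"
    "supported J a \<Longrightarrow> supported J (r *\<^sub>R a)"
  by (simp_all only: supported_def ent_simps) simp_all

lemma supported_mult:
  fixes a b :: "('a, 'b) fmat"
  assumes "supported J a" "supported J b"
  shows "supported J (a * b)"
  unfolding supported_def
proof (intro allI impI)
  fix i k assume "i \<notin> J \<or> k \<notin> J"
  then show "ent (a * b) i k = 0"
    unfolding ent_mult_eq using assms by (intro sum.neutral) (auto simp: supported_def)
qed

instance
proof
  fix a b c :: "('a, 'b) fmat" and r s :: real
  show "a + b + c = a + (b + c)" "a + b = b + a" "0 + a = a" "- a + a = 0" "a - b = a + - b"
    by (rule fmat_eqI, simp add: algebra_simps)+
  show "r *\<^sub>R (a + b) = r *\<^sub>R a + r *\<^sub>R b" "(r + s) *\<^sub>R a = r *\<^sub>R a + s *\<^sub>R a"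
    "r *\<^sub>R s *\<^sub>R a = (r * s) *\<^sub>R a" "1 *\<^sub>R a = a"
    by (rule fmat_eqI, simp add: algebra_simps)+
  obtain J where J: "finite J" "supported J a" "supported J b" "supported J c"
    using ex_finite_supported3 by blast
  have m: "ent (x * y) i k = (\<Sum>j\<in>J. ent x i j * ent y j k)"
    if "supported J x \<or> supported J y" for x y :: "('a, 'b) fmat" and i k
    by (rule ent_mult[OF J(1)]) (use that in \<open>auto simp: supported_def\<close>)
  have Jab: "supported J (a * b)" "supported J (a + b)" "supported J (b + c)"
    using J supported_mult by simp_all
  show "a * b * c = a * (b * c)"
  proof (rule fmat_eqI)
    fix i k
    have "ent (a * b * c) i k = (\<Sum>l\<in>J. \<Sum>j\<in>J. ent a i j * ent b j l * ent c l k)"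
      by (simp only: m[OF disjI2[OF J(4)]] m[OF disjI1[OF J(2)]] sum_distrib_right)
    also have "\<dots> = (\<Sum>j\<in>J. \<Sum>l\<in>J. ent a i j * ent b j l * ent c l k)" by (rule sum.swap)
    also have "\<dots> = (\<Sum>j\<in>J. ent a i j * ent (b * c) j k)"
      by (simp only: m[OF disjI1[OF J(3)]] sum_distrib_left mult.assoc)
    also have "\<dots> = ent (a * (b * c)) i k" by (simp only: m[OF disjI1[OF J(2)]])
    finally show "ent (a * b * c) i k = ent (a * (b * c)) i k" .
  qed
  show "(a + b) * c = a * c + b * c" "a * (b + c) = a * b + a * c"
    by (rule fmat_eqI, simp add: m[OF disjI2[OF J(4)]] m[OF disjI1[OF J(2)]] distrib_left distrib_right sum.distrib)+
  show "r *\<^sub>R a * b = r *\<^sub>R (a * b)" "a * r *\<^sub>R b = r *\<^sub>R (a * b)"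
  proof -
    have "supported J (r *\<^sub>R a)" using J by simp
    then show "r *\<^sub>R a * b = r *\<^sub>R (a * b)" "a * r *\<^sub>R b = r *\<^sub>R (a * b)"
      by (auto intro!: fmat_eqI simp: m[OF disjI1] J(2) scaleR_sum_right)
  qed
  show "dist a b = norm (a - b)" "sgn a = scaleR (inverse (norm a)) a"
    by (simp_all add: dist_fmat_def sgn_fmat_def)
  show "uniformity = (INF e\<in>{0<..}. principal {(x, y :: ('a, 'b) fmat). dist x y < e})"
    by (rule uniformity_fmat_def)
  show "open U = (\<forall>x\<in>U. \<forall>\<^sub>F (x', y) in uniformity. x' = x \<longrightarrow> y \<in> U)" for U :: "('a, 'b) fmat set"
    by (rule open_fmat_def)
  show "norm (r *\<^sub>R a) = \<bar>r\<bar> * norm a"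
  proof -
    have "supported J (r *\<^sub>R a)" using J by simp
    then show ?thesis by (simp add: norm_fmat_supported[OF J(1)] J(2) sum_distrib_left)
  qed
  show "norm (a + b) \<le> norm a + norm b"
  proof -
    have "norm (a + b) = (\<Sum>i\<in>J. \<Sum>j\<in>J. norm (ent a i j + ent b i j))"
      by (simp add: norm_fmat_supported[OF J(1) Jab(2)])
    also have "\<dots> \<le> (\<Sum>i\<in>J. \<Sum>j\<in>J. norm (ent a i j) + norm (ent b i j))"
      by (intro sum_mono norm_triangle_ineq)
    also have "\<dots> = norm a + norm b"
      by (simp add: norm_fmat_supported[OF J(1,2)] norm_fmat_supported[OF J(1,3)] sum.distrib)
    finally show ?thesis .
  qed
  show "(norm a = 0) = (a = 0)"
  proof
    assume "norm a = 0"
    then have s0: "(\<Sum>i\<in>J. \<Sum>j\<in>J. norm (ent a i j)) = 0" by (simp only: norm_fmat_supported[OF J(1,2)])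
    have "ent a i j = 0" if ij: "i \<in> J" "j \<in> J" for i j
    proof -
      have "norm (ent a i j) \<le> (\<Sum>j\<in>J. norm (ent a i j))"
        by (rule member_le_sum[OF ij(2) norm_ge_zero J(1)])
      also have "\<dots> \<le> (\<Sum>i\<in>J. \<Sum>j\<in>J. norm (ent a i j))"
        by (rule member_le_sum[OF ij(1) sum_nonneg[OF norm_ge_zero] J(1)])
      finally show ?thesis unfolding s0 by simp
    qed
    then have "ent a i j = 0" for i j using J(2) by (cases "i \<in> J \<and> j \<in> J") (auto simp: supported_def)
    then show "a = 0" by (intro fmat_eqI) simp
  qed (simp add: norm_fmat_def)
  show "norm (a * b) \<le> norm a * norm b"
  proof -
    have row: "(\<Sum>k\<in>J. norm (ent b j k)) \<le> norm b" if "j \<in> J" for j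
      unfolding norm_fmat_supported[OF J(1,3)]
      by (rule member_le_sum[OF that sum_nonneg[OF norm_ge_zero] J(1)])
    have "norm (a * b) = (\<Sum>i\<in>J. \<Sum>k\<in>J. norm (\<Sum>j\<in>J. ent a i j * ent b j k))"
      by (simp only: norm_fmat_supported[OF J(1) Jab(1)] m[OF disjI1[OF J(2)]])
    also have "\<dots> \<le> (\<Sum>i\<in>J. \<Sum>k\<in>J. \<Sum>j\<in>J. norm (ent a i j) * norm (ent b j k))"
      by (intro sum_mono order_trans[OF norm_sum] norm_mult_ineq)
    also have "\<dots> = (\<Sum>i\<in>J. \<Sum>j\<in>J. norm (ent a i j) * (\<Sum>k\<in>J. norm (ent b j k)))"
    proof (rule sum.cong[OF refl])
      fix i
      have "(\<Sum>k\<in>J. \<Sum>j\<in>J. norm (ent a i j) * norm (ent b j k))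
          = (\<Sum>j\<in>J. \<Sum>k\<in>J. norm (ent a i j) * norm (ent b j k))" by (rule sum.swap)
      then show "(\<Sum>k\<in>J. \<Sum>j\<in>J. norm (ent a i j) * norm (ent b j k))
          = (\<Sum>j\<in>J. norm (ent a i j) * (\<Sum>k\<in>J. norm (ent b j k)))" by (simp add: sum_distrib_left)
    qed
    also have "\<dots> \<le> (\<Sum>i\<in>J. \<Sum>j\<in>J. norm (ent a i j) * norm b)"
      by (intro sum_mono mult_left_mono row) auto
    also have "\<dots> = norm a * norm b"
      by (simp add: norm_fmat_supported[OF J(1,2)] sum_distrib_right)
    finally show ?thesis .
  qed
qed

end

lemma norm_ent_le: "norm (ent a i j) \<le> norm (a :: ('i, 'b::real_normed_algebra) fmat)"
proof -
  obtain J where J: "finite J" "supported J a" using ex_finite_supported[of a] by blast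
  show ?thesis
  proof (cases "i \<in> J \<and> j \<in> J")
    case True
    then have ij: "i \<in> J" "j \<in> J" by simp_all
    have "norm (ent a i j) \<le> (\<Sum>j\<in>J. norm (ent a i j))"
      by (rule member_le_sum[OF ij(2) norm_ge_zero J(1)])
    also have "\<dots> \<le> (\<Sum>i\<in>J. \<Sum>j\<in>J. norm (ent a i j))"
      by (rule member_le_sum[OF ij(1) sum_nonneg[OF norm_ge_zero] J(1)])
    finally show ?thesis by (simp only: norm_fmat_supported[OF J])
  next
    case False
    then have "ent a i j = 0" using J(2) by (auto simp: supported_def)
    then show ?thesis by (simp only: norm_zero norm_ge_zero)
  qed
qed

lemma bounded_linear_ent: "bounded_linear (\<lambda>a :: ('i, 'b::real_normed_algebra) fmat. ent a i j)"
proof (rule bounded_linear_intro)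
  show "norm (ent a i j) \<le> norm a * 1" for a :: "('i, 'b) fmat"
    using norm_ent_le[of a i j] by (simp only: mult_1_right)
qed (rule ent_simps)+

lemmas continuous_on_ent [continuous_intros] = bounded_linear.continuous_on[OF bounded_linear_ent]

text \<open>With the support confined to \<open>J\<close>, entrywise limits suffice. The whole type
  is in general not complete, since supports along a Cauchy sequence may grow; this is why
  completeness is asked of sets.\<close>

lemma complete_supported:
  assumes J: "finite J"
  shows "complete {a :: ('i, 'b::{real_normed_algebra,banach}) fmat. supported J a}"
  unfolding complete_def
proof (intro allI impI, elim conjE)
  fix f :: "nat \<Rightarrow> ('i, 'b) fmat" assume f: "\<forall>n. f n \<in> {a. supported J a}" and c: "Cauchy f"
  have "Cauchy (\<lambda>n. ent (f n) i j)" for i j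
    using bounded_linear.Cauchy[OF bounded_linear_ent c] .
  then have "\<exists>l. (\<lambda>n. ent (f n) i j) \<longlonglongrightarrow> l" for i j
    using Cauchy_convergent_iff convergent_def by blast
  then obtain L where L: "\<And>i j. (\<lambda>n. ent (f n) i j) \<longlonglongrightarrow> L i j" by metis
  have L0: "L i j \<noteq> 0 \<Longrightarrow> i \<in> J \<and> j \<in> J" for i j
  proof (rule ccontr)
    assume n: "L i j \<noteq> 0" and "\<not> (i \<in> J \<and> j \<in> J)"
    then have "ent (f n) i j = 0" for n using f by (simp add: supported_def)
    then show False using L[of i j] n by (simp add: LIMSEQ_const_iff)
  qed
  have e: "ent (mat L) = L" by (rule ent_mat[OF J L0])
  have sL: "supported J (mat L)" using L0 by (auto simp: supported_def e)
  have "(\<lambda>n. \<Sum>i\<in>J. \<Sum>j\<in>J. norm (ent (f n) i j - L i j)) \<longlonglongrightarrow> (\<Sum>i\<in>J. \<Sum>j\<in>J. norm (L i j - L i j))"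
    by (intro tendsto_intros L)
  moreover have "norm (f n - mat L) = (\<Sum>i\<in>J. \<Sum>j\<in>J. norm (ent (f n) i j - L i j))" for n
    using f sL by (subst norm_fmat_supported[OF J]) (auto simp: e)
  ultimately have "(\<lambda>n. norm (f n - mat L)) \<longlonglongrightarrow> 0" by simp
  then have "f \<longlonglongrightarrow> mat L" using LIM_zero_cancel tendsto_norm_zero_iff by blast
  then show "\<exists>l\<in>{a. supported J a}. f \<longlonglongrightarrow> l" using sL by blast
qed

section \<open>Matrices fixed by the group action\<close>

context complete_subring
begin

lemma left_inv_denseI_idem:
  assumes e: "idem e" and f: "idem f"
    and ex: "\<And>x \<epsilon>. x \<in> S \<Longrightarrow> 0 < \<epsilon> \<Longrightarrow> f * x = x \<Longrightarrow> x * e = x \<Longrightarrow>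
      \<exists>x' y. x' \<in> S \<and> y \<in> S \<and> f * x' = x' \<and> x' * e = x' \<and> norm (x - x') < \<epsilon> \<and> y * x' = e"
  shows "left_inv_dense S e f"
proof (rule left_inv_denseI)
  fix x and \<epsilon> :: real assume "x \<in> S" "0 < \<epsilon>" "f * x = x" "x * e = x"
  from ex[OF this] obtain x' y where x': "x' \<in> S" "y \<in> S" "f * x' = x'" "x' * e = x'"
    "norm (x - x') < \<epsilon>" "y * x' = e" by blast
  have i: "e \<in> S" "f \<in> S" "e * e = e" "f * f = f" using e f by (auto simp: idem_def)
  show "\<exists>x' y. x' \<in> S \<and> y \<in> S \<and> f * x' = x' \<and> x' * e = x' \<and> norm (x - x') < \<epsilon> \<and>
      e * y = y \<and> y * f = y \<and> y * x' = e"
  proof (rule exI[of _ x'], rule exI[of _ "e * y * f"], intro conjI)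
    show "e * y * f \<in> S" using i x' by simp
    show "e * (e * y * f) = e * y * f" by (simp only: mult.assoc[symmetric] i)
    show "e * y * f * f = e * y * f" by (simp only: mult.assoc i)
    show "e * y * f * x' = e" by (simp only: mult.assoc x' i)
  qed (rule x')+
qed

lemma left_inv_dense_0: "left_inv_dense S 0 f"
proof (rule left_inv_denseI)
  fix x and \<epsilon> :: real assume "x \<in> S" "0 < \<epsilon>" "f * x = x" "x * 0 = x"
  then show "\<exists>x' y. x' \<in> S \<and> y \<in> S \<and> f * x' = x' \<and> x' * 0 = x' \<and> norm (x - x') < \<epsilon> \<and>
      0 * y = y \<and> y * f = y \<and> y * x' = 0"
    by (intro exI[of _ 0]) simp
qed

end

lemma closed_Collect_ball:
  "(\<And>x. x \<in> A \<Longrightarrow> closed {a. P a x}) \<Longrightarrow> closed {a. \<forall>x\<in>A. P a x}"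
  by (simp add: Collect_ball_eq closed_INT)

lemma ent_sum: "ent (sum f F) i j = (\<Sum>k\<in>F. ent (f k :: ('i, 'b::real_normed_algebra) fmat) i j)"
  by (induction F rule: infinite_finite_induct) simp_all

text \<open>The involution and the order do not occur here: what matters is a contractive action by
  ring automorphisms that fixes the central idempotent \<open>e\<close>.\<close>

locale corner_action = group G for G :: "('g, 'm) monoid_scheme" (structure) +
  fixes \<beta> :: "'g \<Rightarrow> 'b \<Rightarrow> 'b::{real_normed_algebra,banach}" and e :: 'b
  assumes finite_G: "finite (carrier G)"
    and ee: "e * e = e" and central: "e * x = x * e"
    and act_add: "s \<in> carrier G \<Longrightarrow> \<beta> s (x + y) = \<beta> s x + \<beta> s y"
    and act_mult: "s \<in> carrier G \<Longrightarrow> \<beta> s (x * y) = \<beta> s x * \<beta> s y"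
    and act_scaleR: "s \<in> carrier G \<Longrightarrow> \<beta> s (r *\<^sub>R x) = r *\<^sub>R \<beta> s x"
    and act_norm: "s \<in> carrier G \<Longrightarrow> norm (\<beta> s x) \<le> norm x"
    and act_one: "\<beta> \<one> x = x"
    and act_comp: "s \<in> carrier G \<Longrightarrow> t \<in> carrier G \<Longrightarrow> \<beta> (s \<otimes> t) x = \<beta> s (\<beta> t x)"
    and act_e: "s \<in> carrier G \<Longrightarrow> \<beta> s e = e"
begin

lemma act_0 [simp]: "s \<in> carrier G \<Longrightarrow> \<beta> s 0 = 0"
  using act_scaleR[of s 0 0] by simp

lemma act_linear: "s \<in> carrier G \<Longrightarrow> bounded_linear (\<beta> s)"
  by (rule bounded_linear_intro[where K=1]) (simp_all add: act_add act_scaleR act_norm)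

lemma act_diff: "s \<in> carrier G \<Longrightarrow> \<beta> s (x - y) = \<beta> s x - \<beta> s y"
  using linear_diff[OF bounded_linear.linear[OF act_linear]] .

lemma act_sum: "s \<in> carrier G \<Longrightarrow> \<beta> s (sum f F) = (\<Sum>x\<in>F. \<beta> s (f x))"
  using linear_sum[OF bounded_linear.linear[OF act_linear]] .

lemma act_corner: "s \<in> carrier G \<Longrightarrow> e * x = x \<Longrightarrow> e * \<beta> s x = \<beta> s x"
  using act_mult[of s e x] act_e[of s] by simp

definition corner_mats :: "'i set \<Rightarrow> ('i, 'b) fmat set" where
  "corner_mats J = {a. supported J a} \<inter> {a. \<forall>i j. e * ent a i j = ent a i j}"

lemma e_mult_left: "e * x = x \<Longrightarrow> e * (x * y) = x * y"
  by (simp only: mult.assoc[symmetric])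

lemma complete_subring_corner_mats:
  fixes J :: "'i set"
  assumes J: "finite J"
  shows "complete_subring (corner_mats J)"
proof
  have "closed {a :: ('i, 'b) fmat. \<forall>i j. e * ent a i j = ent a i j}"
    by (intro closed_Collect_all closed_Collect_eq continuous_intros)
  then show "complete (corner_mats J)"
    unfolding corner_mats_def by (rule complete_Int_closed[OF complete_supported[OF J]])
  show "0 \<in> corner_mats J" by (simp add: corner_mats_def)
  fix x y assume xy: "x \<in> corner_mats J" "y \<in> corner_mats J"
  then show "x + y \<in> corner_mats J" "x - y \<in> corner_mats J"
    by (simp_all add: corner_mats_def distrib_left right_diff_distrib)
  have "e * ent (x * y) i j = ent (x * y) i j" for i j
    unfolding ent_mult_eq sum_distrib_left
    using xy by (intro sum.cong) (simp_all add: corner_mats_def e_mult_left)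
  then show "x * y \<in> corner_mats J"
    using xy by (simp add: corner_mats_def supported_mult)
qed

text \<open>Matrices of size \<open>m\<close> over the crossed product in the regular
  representation: in each block a function \<open>f\<close> has the entry
  \<open>\<beta> (inv s) (f (s \<otimes> inv t))\<close> at \<open>(s, t)\<close>, and the equation
  characterises these matrices. A block is determined by any one of its rows.\<close>

definition equivariant_mats :: "nat \<Rightarrow> (nat \<times> 'g, 'b) fmat set" where
  "equivariant_mats m = corner_mats ({..<m} \<times> carrier G) \<inter>
    {a. \<forall>i j. \<forall>s\<in>carrier G. \<forall>t\<in>carrier G. \<forall>r\<in>carrier G.
      ent a (i, s \<otimes> r) (j, t \<otimes> r) = \<beta> (inv r) (ent a (i, s) (j, t))}"

lemma equivariant_matsD:
  assumes "a \<in> equivariant_mats m"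
  shows "supported ({..<m} \<times> carrier G) a" "e * ent a x y = ent a x y"
    "s \<in> carrier G \<Longrightarrow> t \<in> carrier G \<Longrightarrow> r \<in> carrier G \<Longrightarrow>
      ent a (i, s \<otimes> r) (j, t \<otimes> r) = \<beta> (inv r) (ent a (i, s) (j, t))"
  using assms unfolding equivariant_mats_def corner_mats_def by blast+

lemma equivariant_matsI:
  assumes "supported ({..<m} \<times> carrier G) a" "\<And>x y. e * ent a x y = ent a x y"
    "\<And>s t r i j. s \<in> carrier G \<Longrightarrow> t \<in> carrier G \<Longrightarrow> r \<in> carrier G \<Longrightarrow>
      ent a (i, s \<otimes> r) (j, t \<otimes> r) = \<beta> (inv r) (ent a (i, s) (j, t))"
  shows "a \<in> equivariant_mats m"
  using assms unfolding equivariant_mats_def corner_mats_def by blast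

lemma finite_idx: "finite ({..<m::nat} \<times> carrier G)"
  using finite_G by simp

lemma ent_mult_idx:
  fixes m :: nat
  assumes "supported ({..<m} \<times> carrier G) a \<or> supported ({..<m} \<times> carrier G) b"
  shows "ent (a * b) x z = (\<Sum>j<m. \<Sum>t\<in>carrier G. ent a x (j, t) * ent b (j, t) z)"
proof -
  have "ent (a * b) x z = (\<Sum>y\<in>{..<m} \<times> carrier G. ent a x y * ent b y z)"
  proof (rule ent_mult[OF finite_idx])
    show "ent a x y = 0 \<or> ent b y z = 0" if "y \<notin> {..<m} \<times> carrier G" for y
      using assms that supported_ent[of _ a x y] supported_ent[of _ b y z] by blast
  qed
  then show ?thesis by (simp add: sum.cartesian_product case_prod_unfold)
qed

lemma complete_subring_equivariant_mats: "complete_subring (equivariant_mats m)"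
proof -
  let ?C = "corner_mats ({..<m} \<times> carrier G)"
  interpret C: complete_subring ?C
    by (rule complete_subring_corner_mats[OF finite_idx])
  show ?thesis
  proof
    have c: "continuous_on UNIV (\<lambda>a. \<beta> (inv r) (ent a x y))" if "r \<in> carrier G" for r and x y :: "nat \<times> 'g"
      by (rule bounded_linear.continuous_on[OF act_linear]) (use that in \<open>auto intro: continuous_intros\<close>)
    have "closed {a :: (nat \<times> 'g, 'b) fmat. \<forall>i j. \<forall>s\<in>carrier G. \<forall>t\<in>carrier G. \<forall>r\<in>carrier G.
      ent a (i, s \<otimes> r) (j, t \<otimes> r) = \<beta> (inv r) (ent a (i, s) (j, t))}"
      by (intro closed_Collect_all closed_Collect_ball closed_Collect_eq c continuous_on_ent continuous_on_id)
    then show "complete (equivariant_mats m)"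
      unfolding equivariant_mats_def by (rule complete_Int_closed[OF C.complete_S])
    show "0 \<in> equivariant_mats m" by (simp add: equivariant_mats_def)
    fix x y assume xy: "x \<in> equivariant_mats m" "y \<in> equivariant_mats m"
    have xyC: "x \<in> ?C" "y \<in> ?C" using xy by (simp_all add: equivariant_mats_def)
    show "x + y \<in> equivariant_mats m" "x - y \<in> equivariant_mats m"
      using xy unfolding equivariant_mats_def by (simp_all add: act_add act_diff)
    have "ent (x * y) (i, s \<otimes> r) (j, t \<otimes> r) = \<beta> (inv r) (ent (x * y) (i, s) (j, t))"
      if st: "s \<in> carrier G" "t \<in> carrier G" "r \<in> carrier G" for i j s t r
    proof -
      note sx = equivariant_matsD(1)[OF xy(1)]
      have "ent (x * y) (i, s \<otimes> r) (j, t \<otimes> r) =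
        (\<Sum>k<m. \<Sum>u\<in>carrier G. ent x (i, s \<otimes> r) (k, u) * ent y (k, u) (j, t \<otimes> r))"
        by (rule ent_mult_idx) (simp add: sx)
      also have "\<dots> = (\<Sum>k<m. \<Sum>u\<in>carrier G. ent x (i, s \<otimes> r) (k, u \<otimes> r) * ent y (k, u \<otimes> r) (j, t \<otimes> r))"
      proof (rule sum.cong[OF refl])
        fix k
        have "bij_betw (\<lambda>u. u \<otimes> r) (carrier G) (carrier G)"
          by (rule bij_betwI[where g="\<lambda>u. u \<otimes> inv r"]) (use st in \<open>auto simp: m_assoc\<close>)
        from sum.reindex_bij_betw[OF this, of "\<lambda>u. ent x (i, s \<otimes> r) (k, u) * ent y (k, u) (j, t \<otimes> r)"]
        show "(\<Sum>u\<in>carrier G. ent x (i, s \<otimes> r) (k, u) * ent y (k, u) (j, t \<otimes> r)) =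
          (\<Sum>u\<in>carrier G. ent x (i, s \<otimes> r) (k, u \<otimes> r) * ent y (k, u \<otimes> r) (j, t \<otimes> r))" by (rule sym)
      qed
      also have "\<dots> = (\<Sum>k<m. \<Sum>u\<in>carrier G. \<beta> (inv r) (ent x (i, s) (k, u) * ent y (k, u) (j, t)))"
        by (intro sum.cong refl) (simp add: equivariant_matsD(3)[OF xy(1)] equivariant_matsD(3)[OF xy(2)] st act_mult)
      also have "\<dots> = \<beta> (inv r) (ent (x * y) (i, s) (j, t))"
        by (subst ent_mult_idx[of m]) (simp_all add: sx act_sum st)
      finally show ?thesis .
    qed
    moreover have "x * y \<in> ?C" using xyC by (rule C.mult_S)
    ultimately show "x * y \<in> equivariant_mats m" unfolding equivariant_mats_def by blast
  qed
qed

text \<open>The coefficient \<open>a\<close> at the unit of \<open>G\<close>, placed in block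
  \<open>(i, j)\<close>: in the regular representation it becomes the diagonal of the translates of
  \<open>a\<close>.\<close>

definition E :: "nat \<Rightarrow> nat \<Rightarrow> 'b \<Rightarrow> (nat \<times> 'g, 'b) fmat" where
  "E i j a = mat (\<lambda>x y. if fst x = i \<and> fst y = j \<and> snd x = snd y \<and> snd x \<in> carrier G
    then \<beta> (inv (snd x)) a else 0)"

lemma ent_E: "ent (E i j a) x y = (if fst x = i \<and> fst y = j \<and> snd x = snd y \<and> snd x \<in> carrier G
    then \<beta> (inv (snd x)) a else 0)"
proof -
  have "ent (E i j a) = (\<lambda>x y. if fst x = i \<and> fst y = j \<and> snd x = snd y \<and> snd x \<in> carrier G
    then \<beta> (inv (snd x)) a else 0)"
    unfolding E_def
    by (rule ent_mat[of "{i, j} \<times> carrier G"]) (use finite_G in \<open>auto split: if_splits\<close>)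
  then show ?thesis by (simp only:)
qed

lemma E_mult: "E i j a * E k l b = (if j = k then E i l (a * b) else 0)"
proof (rule fmat_eqI)
  fix x y
  let ?m = "Suc (max (max i j) (max k l))"
  have "supported ({..<?m} \<times> carrier G) (E i j a)"
    unfolding supported_def ent_E by (auto split: if_splits)
  then have "ent (E i j a * E k l b) x y = (\<Sum>p<?m. \<Sum>t\<in>carrier G. ent (E i j a) x (p, t) * ent (E k l b) (p, t) y)"
    by (intro ent_mult_idx) simp
  also have "\<dots> = (\<Sum>p<?m. if p = j then (\<Sum>t\<in>carrier G. ent (E i j a) x (p, t) * ent (E k l b) (p, t) y) else 0)"
    by (intro sum.cong refl) (simp add: ent_E cong: if_cong)
  also have "\<dots> = (\<Sum>t\<in>carrier G. ent (E i j a) x (j, t) * ent (E k l b) (j, t) y)"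
    by (subst sum.delta) simp_all
  also have "\<dots> = (\<Sum>t\<in>carrier G. if t = snd x then ent (E i j a) x (j, t) * ent (E k l b) (j, t) y else 0)"
    by (intro sum.cong refl) (simp add: ent_E)
  also have "\<dots> = (if snd x \<in> carrier G then ent (E i j a) x (j, snd x) * ent (E k l b) (j, snd x) y else 0)"
    using finite_G by (simp add: sum.delta)
  also have "\<dots> = ent (if j = k then E i l (a * b) else 0) x y"
    by (simp add: ent_E act_mult)
  finally show "ent (E i j a * E k l b) x y = ent (if j = k then E i l (a * b) else 0) x y" .
qed

lemma E_add: "E i j (a + b) = E i j a + E i j b"
  by (rule fmat_eqI) (auto simp: ent_E act_add)

lemma E_0 [simp]: "E i j 0 = 0"
  by (rule fmat_eqI) (auto simp: ent_E)

lemma E_sum: "E i j (sum f F) = (\<Sum>k\<in>F. E i j (f k))"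
  by (induction F rule: infinite_finite_induct) (simp_all add: E_add)

lemma E_equivariant:
  assumes "i < m" "j < m" "e * a = a"
  shows "E i j a \<in> equivariant_mats m"
proof (rule equivariant_matsI)
  show "supported ({..<m} \<times> carrier G) (E i j a)"
    unfolding supported_def ent_E using assms by (auto split: if_splits)
  show "e * ent (E i j a) x y = ent (E i j a) x y" for x y
    using assms by (auto simp: ent_E act_corner)
  show "ent (E i j a) (k, s \<otimes> r) (l, t \<otimes> r) = \<beta> (inv r) (ent (E i j a) (k, s) (l, t))"
    if "s \<in> carrier G" "t \<in> carrier G" "r \<in> carrier G" for s t r k l
    using that by (simp add: ent_E inv_mult_group act_comp)
qed

text \<open>Stable rank one passes to matrix algebras and their corners, here without any
  equivariance. The diagonal idempotents \<open>D F\<close> are built up one entry at a time, and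
  for a general \<open>q\<close> its complement in the full identity \<open>D J\<close> is
  cancelled.\<close>

lemma left_inv_dense_corner_mats:
  fixes J :: "'i set"
  assumes tsr: "\<And>x \<epsilon>. e * x = x \<Longrightarrow> (\<epsilon>::real) > 0 \<Longrightarrow>
      \<exists>x' l. e * x' = x' \<and> e * l = l \<and> l * x' = e \<and> norm (x - x') < \<epsilon>"
    and J: "finite J" and q: "q \<in> corner_mats J" "q * q = q"
  shows "left_inv_dense (corner_mats J) q q"
proof -
  interpret C: complete_subring "corner_mats J"
    by (rule complete_subring_corner_mats[OF J])
  define D :: "'i set \<Rightarrow> ('i, 'b) fmat" where "D F = mat (\<lambda>i k. if i = k \<and> i \<in> F then e else 0)" for F
  have entD: "ent (D F) i k = (if i = k \<and> i \<in> F then e else 0)" if "F \<subseteq> J" for F i k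
  proof -
    have "ent (D F) = (\<lambda>i k. if i = k \<and> i \<in> F then e else 0)"
      unfolding D_def by (rule ent_mat[OF J]) (use that in \<open>auto split: if_splits\<close>)
    then show ?thesis by (simp only:)
  qed
  have DC: "D F \<in> corner_mats J" if "F \<subseteq> J" for F
    using that by (auto simp: corner_mats_def supported_def entD ee)
  have Dl: "ent (D F * a) i k = (if i \<in> F then e * ent a i k else 0)" if F: "F \<subseteq> J" for F a i k
  proof -
    have "ent (D F * a) i k = (\<Sum>j\<in>J. ent (D F) i j * ent a j k)"
      by (rule ent_mult[OF J]) (use DC[OF F] in \<open>auto simp: corner_mats_def supported_def\<close>)
    also have "\<dots> = (\<Sum>j\<in>J. if j = i then (if i \<in> F then e * ent a i k else 0) else 0)"
      by (intro sum.cong refl) (simp add: entD[OF F])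
    also have "\<dots> = (if i \<in> F then e * ent a i k else 0)"
      using F J by (auto simp: sum.delta)
    finally show ?thesis .
  qed
  have Dr: "ent (a * D F) i k = (if k \<in> F then ent a i k * e else 0)" if F: "F \<subseteq> J" for F a i k
  proof -
    have "ent (a * D F) i k = (\<Sum>j\<in>J. ent a i j * ent (D F) j k)"
      by (rule ent_mult[OF J]) (use DC[OF F] in \<open>auto simp: corner_mats_def supported_def\<close>)
    also have "\<dots> = (\<Sum>j\<in>J. if j = k then (if k \<in> F then ent a i k * e else 0) else 0)"
      by (intro sum.cong refl) (simp add: entD[OF F])
    also have "\<dots> = (if k \<in> F then ent a i k * e else 0)"
      using F J by (auto simp: sum.delta)
    finally show ?thesis .
  qed
  have DD: "D F * D F' = D (F \<inter> F')" if "F \<subseteq> J" "F' \<subseteq> J" for F F'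
  proof (rule fmat_eqI)
    have "F \<inter> F' \<subseteq> J" using that by blast
    then show "ent (D F * D F') i k = ent (D (F \<inter> F')) i k" for i k
      using that by (auto simp: Dl entD ee)
  qed
  have Didem: "C.idem (D F)" if "F \<subseteq> J" for F
    using DD[OF that that] DC[OF that] by (simp add: C.idem_def)
  have D0: "D {} = 0" by (rule fmat_eqI) (simp add: entD)
  have single: "left_inv_dense (corner_mats J) (D {j}) (D {j})" if j: "j \<in> J" for j
  proof (rule C.left_inv_denseI_idem)
    have jJ: "{j} \<subseteq> J" using j by simp
    show "C.idem (D {j})" "C.idem (D {j})" using Didem[OF jJ] by simp_all
    fix x and \<epsilon> :: real
    assume x: "x \<in> corner_mats J" "0 < \<epsilon>" "D {j} * x = x" "x * D {j} = x"
    define u :: "'b \<Rightarrow> ('i, 'b) fmat" where "u z = mat (\<lambda>i k. if i = j \<and> k = j then z else 0)" for z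
    have ent_u: "ent (u z) i k = (if i = j \<and> k = j then z else 0)" for z i k
    proof -
      have "ent (u z) = (\<lambda>i k. if i = j \<and> k = j then z else 0)"
        unfolding u_def by (rule ent_mat[OF J]) (use j in \<open>auto split: if_splits\<close>)
      then show ?thesis by (simp only:)
    qed
    have uC: "u z \<in> corner_mats J" if "e * z = z" for z
      using that j by (auto simp: corner_mats_def supported_def ent_u)
    have ex: "e * ent x j j = ent x j j" using x by (simp add: corner_mats_def)
    obtain z l where z: "e * z = z" "e * l = l" "l * z = e" "norm (ent x j j - z) < \<epsilon>"
      using tsr[OF ex x(2)] by blast
    have xu: "x = u (ent x j j)"
    proof (rule fmat_eqI)
      fix i k
      have "ent x i k = ent (D {j} * (x * D {j})) i k" using x by simp
      also have "\<dots> = ent (u (ent x j j)) i k"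
        using central ex by (simp add: Dl[OF jJ] Dr[OF jJ] ent_u)
      finally show "ent x i k = ent (u (ent x j j)) i k" .
    qed
    show "\<exists>x' y. x' \<in> corner_mats J \<and> y \<in> corner_mats J \<and> D {j} * x' = x' \<and> x' * D {j} = x' \<and>
        norm (x - x') < \<epsilon> \<and> y * x' = D {j}"
    proof (rule exI[of _ "u z"], rule exI[of _ "u l"], intro conjI uC z)
      show "D {j} * u z = u z" by (rule fmat_eqI) (simp add: Dl[OF jJ] ent_u z)
      show "u z * D {j} = u z" by (rule fmat_eqI) (simp add: Dr[OF jJ] ent_u z central[symmetric])
      have "x - u z = u (ent x j j - z)" by (subst xu) (rule fmat_eqI, simp add: ent_u)
      moreover have "norm (u w) = norm w" for w
      proof -
        have "supported {j} (u w)" by (auto simp: supported_def ent_u)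
        then show ?thesis by (subst norm_fmat_supported[of "{j}"]) (simp_all add: ent_u)
      qed
      ultimately show "norm (x - u z) < \<epsilon>" using z by simp
      show "u l * u z = D {j}"
      proof (rule fmat_eqI)
        fix i k
        have "ent (u l * u z) i k = (\<Sum>p\<in>{j}. ent (u l) i p * ent (u z) p k)"
          by (rule ent_mult) (auto simp: ent_u)
        then show "ent (u l * u z) i k = ent (D {j}) i k" by (auto simp: ent_u entD[OF jJ] z)
      qed
    qed
  qed
  have full: "left_inv_dense (corner_mats J) (D F) (D F)" if "F \<subseteq> J" for F
  proof -
    have "finite F" using that J finite_subset by blast
    then show ?thesis using that
    proof (induction F)
      case empty
      then show ?case by (simp add: D0 C.left_inv_dense_0)
    next
      case (insert j F)
      then have F: "F \<subseteq> J" "{j} \<subseteq> J" "insert j F \<subseteq> J" "j \<in> J" by auto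
      have sum: "D (insert j F) = D {j} + D F"
        by (rule fmat_eqI) (use F insert.hyps in \<open>auto simp: entD\<close>)
      have o: "D {j} * D F = 0" "D F * D {j} = 0"
        using insert.hyps F by (simp_all add: DD D0)
      show ?case unfolding sum
        by (rule C.left_inv_dense_sum[OF single[OF F(4)] insert.IH[OF F(1)]
              Didem[OF F(2)] Didem[OF F(1)] Didem[OF F(2)] Didem[OF F(1)] o o])
    qed
  qed
  have Dq: "D J * q = q" "q * D J = q"
  proof -
    have 1: "e * ent q i k = ent q i k" "supported J q" for i k using q by (auto simp: corner_mats_def)
    show "D J * q = q"
      by (rule fmat_eqI) (use 1 in \<open>auto simp: Dl[OF subset_refl] supported_def\<close>)
    show "q * D J = q"
      by (rule fmat_eqI) (use 1 in \<open>auto simp: Dr[OF subset_refl] central[symmetric] supported_def\<close>)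
  qed
  define z where "z = D J - q"
  have DJ: "D J \<in> corner_mats J" "D J * D J = D J" using DC[OF subset_refl] DD[of J J] by simp_all
  have z: "C.idem z" "q * z = 0" "z * q = 0" "q + z = D J"
    using DJ q Dq by (simp_all add: z_def C.idem_def algebra_simps)
  show ?thesis
  proof (rule C.left_inv_dense_cancel)
    show "left_inv_dense (corner_mats J) (q + z) (q + z)" unfolding z(4) by (rule full) simp
  qed (use z q in \<open>simp_all add: C.idem_def\<close>)
qed

end

section \<open>Copies of an idempotent in the equivariant matrices\<close>

locale stable_corner_action = corner_action G \<beta> e
  for G :: "('g, 'm) monoid_scheme" (structure) and \<beta> :: "'g \<Rightarrow> 'b \<Rightarrow> 'b::{real_normed_algebra,banach}" and e :: 'b +
  assumes sr1: "e * x = x \<Longrightarrow> (\<epsilon>::real) > 0 \<Longrightarrow>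
      \<exists>x' l. e * x' = x' \<and> e * l = l \<and> l * x' = e \<and> norm (x - x') < \<epsilon>"
begin

definition Dg :: "'b \<Rightarrow> nat set \<Rightarrow> (nat \<times> 'g, 'b) fmat" where "Dg p F = (\<Sum>i\<in>F. E i i p)"

lemma ent_Dg:
  assumes "finite F"
  shows "ent (Dg p F) x y = (if x = y \<and> fst x \<in> F \<and> snd x \<in> carrier G then \<beta> (inv (snd x)) p else 0)"
proof -
  have "ent (Dg p F) x y = (\<Sum>i\<in>F. if i = fst x then ent (E (fst x) (fst x) p) x y else 0)"
    unfolding Dg_def ent_sum by (intro sum.cong refl) (auto simp: ent_E)
  also have "\<dots> = (if fst x \<in> F then ent (E (fst x) (fst x) p) x y else 0)"
    using assms by (simp add: sum.delta)
  finally show ?thesis by (auto simp: ent_E prod_eq_iff)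
qed

lemma E_Dg: "finite F \<Longrightarrow> E i j a * Dg p F = (if j \<in> F then E i j (a * p) else 0)"
  unfolding Dg_def sum_distrib_left by (simp add: E_mult if_distrib sum.delta cong: if_cong)

lemma Dg_E: "finite F \<Longrightarrow> Dg p F * E i j a = (if i \<in> F then E i j (p * a) else 0)"
  unfolding Dg_def sum_distrib_right by (simp add: E_mult sum.delta cong: if_cong)

lemma Dg_mult: "finite F \<Longrightarrow> finite F' \<Longrightarrow> Dg p F * Dg q F' = Dg (p * q) (F \<inter> F')"
  by (simp add: Dg_def[of p] sum_distrib_right E_Dg sum.inter_restrict) (simp add: Dg_def sum.inter_restrict)

lemma Dg_union: "finite F \<Longrightarrow> finite F' \<Longrightarrow> F \<inter> F' = {} \<Longrightarrow> Dg p (F \<union> F') = Dg p F + Dg p F'"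
  by (simp add: Dg_def sum.union_disjoint)

lemma Dg_insert: "finite F \<Longrightarrow> a \<notin> F \<Longrightarrow> Dg p (insert a F) = E a a p + Dg p F"
  by (simp add: Dg_def)

lemma Dg_equivariant:
  assumes "finite F" "F \<subseteq> {..<m}" "e * p = p"
  shows "Dg p F \<in> equivariant_mats m"
proof -
  interpret S: complete_subring "equivariant_mats m" by (rule complete_subring_equivariant_mats)
  show ?thesis using assms
  proof (induction F)
    case empty
    then show ?case by (simp add: Dg_def)
  next
    case (insert a F)
    then show ?case by (simp add: Dg_insert E_equivariant)
  qed
qed

text \<open>A homomorphism from the single block \<open>p\<close> to \<open>card G\<close> blocks is determined by one row from
  each of them.  Choosing the rows indexed by the different group elements, these form an arbitrary
  endomorphism of the module given by the images of \<open>p\<close> under the group.\<close>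
lemma left_inv_dense_single_block:
  assumes p: "p * p = p" "e * p = p" and i0: "i0 < m" and F: "F \<subseteq> {..<m}" "card F = card (carrier G)"
  shows "left_inv_dense (equivariant_mats m) (E i0 i0 p) (Dg p F)"
proof -
  interpret S: complete_subring "equivariant_mats m" by (rule complete_subring_equivariant_mats)
  interpret C: complete_subring "corner_mats (carrier G)"
    by (rule complete_subring_corner_mats[OF finite_G])
  have fF: "finite F" using F(1) finite_subset by blast
  \<comment> \<open>Assigns to each block of \<open>F\<close> the row that will represent
    it.\<close>
  obtain \<rho> where \<rho>: "bij_betw \<rho> F (carrier G)"
    using finite_same_card_bij[OF fF finite_G F(2)] by blast
  define \<sigma> where "\<sigma> = inv_into F \<rho>"
  have \<rho>G: "\<rho> i \<in> carrier G" if "i \<in> F" for i using \<rho> that by (rule bij_betwE[rule_format])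
  have \<sigma>F: "\<sigma> s \<in> F" if "s \<in> carrier G" for s
    using bij_betw_inv_into[OF \<rho>] that unfolding \<sigma>_def by (rule bij_betwE[rule_format])
  have \<rho>\<sigma>: "\<rho> (\<sigma> s) = s" if "s \<in> carrier G" for s
    unfolding \<sigma>_def using bij_betw_inv_into_right[OF \<rho> that] .
  have \<sigma>\<rho>: "\<sigma> (\<rho> i) = i" if "i \<in> F" for i
    unfolding \<sigma>_def using bij_betw_inv_into_left[OF \<rho> that] .
  \<comment> \<open>The direct sum of the translates of \<open>p\<close>, as an idempotent matrix
    indexed by the group and not subject to equivariance.\<close>
  define q where "q = mat (\<lambda>s t. if s = t \<and> s \<in> carrier G then \<beta> (inv s) p else 0)"
  have ent_q: "ent q s t = (if s = t \<and> s \<in> carrier G then \<beta> (inv s) p else 0)" for s t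
  proof -
    have "ent q = (\<lambda>s t. if s = t \<and> s \<in> carrier G then \<beta> (inv s) p else 0)"
      unfolding q_def by (rule ent_mat[OF finite_G]) (auto split: if_splits)
    then show ?thesis by (simp only:)
  qed
  have ql: "ent (q * a) s t = (if s \<in> carrier G then \<beta> (inv s) p * ent a s t else 0)" for a s t
  proof -
    have "ent (q * a) s t = (\<Sum>u\<in>carrier G. ent q s u * ent a u t)"
      by (rule ent_mult[OF finite_G]) (auto simp: ent_q)
    also have "\<dots> = (\<Sum>u\<in>carrier G. if u = s then \<beta> (inv s) p * ent a s t else 0)"
      by (intro sum.cong refl) (auto simp: ent_q)
    finally show ?thesis using finite_G by (simp add: sum.delta)
  qed
  have qr: "ent (a * q) s t = (if t \<in> carrier G then ent a s t * \<beta> (inv t) p else 0)" for a s t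
  proof -
    have "ent (a * q) s t = (\<Sum>u\<in>carrier G. ent a s u * ent q u t)"
      by (rule ent_mult[OF finite_G]) (auto simp: ent_q)
    also have "\<dots> = (\<Sum>u\<in>carrier G. if u = t then ent a s t * \<beta> (inv t) p else 0)"
      by (intro sum.cong refl) (auto simp: ent_q)
    finally show ?thesis using finite_G by (simp add: sum.delta)
  qed
  have pp: "\<beta> s p * \<beta> s p = \<beta> s p" if "s \<in> carrier G" for s
    using act_mult[OF that, of p p] p by simp
  have qC: "q \<in> corner_mats (carrier G)"
    using p by (auto simp: corner_mats_def supported_def ent_q act_corner)
  have qq: "q * q = q" by (rule fmat_eqI) (auto simp: ql ent_q pp)
  have dq: "left_inv_dense (corner_mats (carrier G)) q q"
    by (rule left_inv_dense_corner_mats[OF sr1 finite_G qC qq])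
  have entDg: "ent (Dg p F) x y = (if x = y \<and> fst x \<in> F \<and> snd x \<in> carrier G then \<beta> (inv (snd x)) p else 0)" for x y
    by (rule ent_Dg[OF fF])
  have Eq: "E i0 i0 p = Dg p {i0}" by (simp add: Dg_def)
  have Dl: "ent (Dg p K * a) x y = (if fst x \<in> K \<and> snd x \<in> carrier G then \<beta> (inv (snd x)) p * ent a x y else 0)"
    if K: "K \<subseteq> {..<m}" for K a x y
  proof -
    have fK: "finite K" using K finite_subset by blast
    have "ent (Dg p K * a) x y = (\<Sum>z\<in>{..<m} \<times> carrier G. ent (Dg p K) x z * ent a z y)"
      by (rule ent_mult[OF finite_idx]) (use K in \<open>auto simp: ent_Dg[OF fK]\<close>)
    also have "\<dots> = (\<Sum>z\<in>{..<m} \<times> carrier G. if z = x then ent (Dg p K) x x * ent a x y else 0)"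
      by (intro sum.cong refl) (auto simp: ent_Dg[OF fK])
    also have "\<dots> = (if x \<in> {..<m} \<times> carrier G then ent (Dg p K) x x * ent a x y else 0)"
      by (simp add: sum.delta[OF finite_idx])
    finally show ?thesis using K by (auto simp: ent_Dg[OF fK] mem_Times_iff)
  qed
  have Dr: "ent (a * Dg p K) x y = (if fst y \<in> K \<and> snd y \<in> carrier G then ent a x y * \<beta> (inv (snd y)) p else 0)"
    if K: "K \<subseteq> {..<m}" for K a x y
  proof -
    have fK: "finite K" using K finite_subset by blast
    have "ent (a * Dg p K) x y = (\<Sum>z\<in>{..<m} \<times> carrier G. ent a x z * ent (Dg p K) z y)"
      by (rule ent_mult[OF finite_idx]) (use K in \<open>auto simp: ent_Dg[OF fK]\<close>)
    also have "\<dots> = (\<Sum>z\<in>{..<m} \<times> carrier G. if z = y then ent a x y * ent (Dg p K) y y else 0)"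
      by (intro sum.cong refl) (auto simp: ent_Dg[OF fK])
    also have "\<dots> = (if y \<in> {..<m} \<times> carrier G then ent a x y * ent (Dg p K) y y else 0)"
      by (simp add: sum.delta[OF finite_idx])
    finally show ?thesis using K by (auto simp: ent_Dg[OF fK] mem_Times_iff)
  qed
  have i0m: "{i0} \<subseteq> {..<m}" using i0 by simp
  have idem: "S.idem (E i0 i0 p)" "S.idem (Dg p F)"
    using E_equivariant[OF i0 i0 p(2)] Dg_equivariant[OF fF F(1) p(2)] p fF
    by (simp_all add: S.idem_def E_mult Dg_mult)
  show ?thesis
  proof (rule S.left_inv_denseI_idem[OF idem])
    fix x and \<epsilon> :: real
    assume x: "x \<in> equivariant_mats m" "0 < \<epsilon>" "Dg p F * x = x" "x * E i0 i0 p = x"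
    note xS = equivariant_matsD[OF x(1)]
    \<comment> \<open>Row \<open>s\<close> of \<open>c\<close> is row \<open>s\<close> of the block
      \<open>\<sigma> s\<close> of \<open>x\<close>: one row from each block, and altogether a
      square matrix, to which stable rank one applies.\<close>
    define c where "c = mat (\<lambda>s t. if s \<in> carrier G \<and> t \<in> carrier G then ent x (\<sigma> s, s) (i0, t) else 0)"
    have ent_c: "ent c s t = (if s \<in> carrier G \<and> t \<in> carrier G then ent x (\<sigma> s, s) (i0, t) else 0)" for s t
    proof -
      have "ent c = (\<lambda>s t. if s \<in> carrier G \<and> t \<in> carrier G then ent x (\<sigma> s, s) (i0, t) else 0)"
        unfolding c_def by (rule ent_mat[OF finite_G]) (auto split: if_splits)
      then show ?thesis by (simp only:)
    qed
    have cC: "c \<in> corner_mats (carrier G)"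
      by (auto simp: corner_mats_def supported_def ent_c xS(2))
    have xl: "\<beta> (inv s) p * ent x (i, s) y = ent x (i, s) y" if "i \<in> F" "s \<in> carrier G" for i s y
      using Dl[OF F(1), of x "(i,s)" y] that unfolding x(3) by simp
    have xr: "ent x y (i0, s) * \<beta> (inv s) p = ent x y (i0, s)" if "s \<in> carrier G" for s y
      using Dr[OF i0m, of x y "(i0,s)"] that x(4) unfolding Eq by simp
    have x0: "ent x (i, s) (j, t) = 0" if "i \<notin> F \<or> j \<noteq> i0" for i s j t
    proof -
      have "ent x (i, s) (j, t) = 0" if "i \<notin> F"
        using Dl[OF F(1), of x "(i,s)" "(j,t)"] that unfolding x(3) by simp
      moreover have "ent x (i, s) (j, t) = 0" if "j \<noteq> i0"
        using Dr[OF i0m, of x "(i,s)" "(j,t)"] that x(4) unfolding Eq by simp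
      ultimately show ?thesis using that by blast
    qed
    have qc: "q * c = c" by (rule fmat_eqI) (auto simp: ql ent_c xl \<sigma>F)
    have cq: "c * q = c" by (rule fmat_eqI) (auto simp: qr ent_c xr)
    \<comment> \<open>The number of entries, by which the norm, a sum, is bounded in terms of the
      largest entry; 1 is added to keep \<open>M\<close> positive.\<close>
    define M where "M = real (card ({..<m} \<times> carrier G)) * real (card ({..<m} \<times> carrier G)) + 1"
    have M: "M > 0" unfolding M_def by (intro add_nonneg_pos mult_nonneg_nonneg) simp_all
    obtain c' y where c': "c' \<in> corner_mats (carrier G)" "q * c' = c'" "c' * q = c'" "norm (c - c') < \<epsilon> / M"
      and y: "y \<in> corner_mats (carrier G)" "y * c' = q"
      using left_inv_denseD[OF dq cC qc cq, of "\<epsilon> / M"] x(2) M by (metis divide_pos_pos)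
    have c'e: "e * ent c' s t = ent c' s t" and ye: "e * ent y s t = ent y s t" for s t
      using c' y by (simp_all add: corner_mats_def)
    have c'l: "\<beta> (inv s) p * ent c' s t = ent c' s t" if "s \<in> carrier G" for s t
      using ql[of c' s t] that unfolding c'(2) by simp
    have c'r: "ent c' s t * \<beta> (inv t) p = ent c' s t" if "t \<in> carrier G" for s t
      using qr[of c' s t] that unfolding c'(3) by simp
    \<comment> \<open>The equivariant extension of the rows of \<open>c'\<close>: right translation
      by \<open>inv s \<otimes> \<rho> i\<close> moves row \<open>s\<close> of block
      \<open>i\<close> to row \<open>\<rho> i\<close>, which is prescribed.\<close>
    define X where "X = (\<lambda>x y. if fst x \<in> F \<and> fst y = i0 \<and> snd x \<in> carrier G \<and> snd y \<in> carrier G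
      then \<beta> (inv (snd x) \<otimes> \<rho> (fst x)) (ent c' (\<rho> (fst x)) (snd y \<otimes> inv (snd x) \<otimes> \<rho> (fst x))) else 0)"
    define x' where "x' = mat X"
    have ent_x': "ent x' = X"
      unfolding x'_def by (rule ent_mat[OF finite_idx[of m]]) (use F i0 in \<open>auto simp: X_def mem_Times_iff split: if_splits\<close>)
    \<comment> \<open>Only row \<open>\<one>\<close> of \<open>y\<close> is extended. At row
      \<open>\<one>\<close> the matrix \<open>y'\<close> meets block \<open>k\<close> in column
      \<open>\<rho> k\<close> alone, so its product with \<open>x'\<close> involves just those rows
      of \<open>x'\<close> that are rows of \<open>c'\<close>.\<close>
    define Y where "Y = (\<lambda>x z. if fst x = i0 \<and> fst z \<in> F \<and> snd x \<in> carrier G \<and> snd z = \<rho> (fst z) \<otimes> snd x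
      then \<beta> (inv (snd x)) (ent y \<one> (\<rho> (fst z))) else 0)"
    define y' where "y' = mat Y"
    have ent_y': "ent y' = Y"
      unfolding y'_def by (rule ent_mat[OF finite_idx[of m]]) (use F i0 \<rho>G in \<open>auto simp: Y_def mem_Times_iff split: if_splits\<close>)
    have x'S: "x' \<in> equivariant_mats m"
    proof (rule equivariant_matsI)
      show "supported ({..<m} \<times> carrier G) x'"
        using F i0 by (auto simp: supported_def ent_x' X_def)
      show "e * ent x' a b = ent x' a b" for a b
        by (auto simp: ent_x' X_def act_corner c'e \<rho>G)
      show "ent x' (i, s \<otimes> u) (j, t \<otimes> u) = \<beta> (inv u) (ent x' (i, s) (j, t))"
        if g: "s \<in> carrier G" "t \<in> carrier G" "u \<in> carrier G" for s t u i j
      proof (cases "i \<in> F \<and> j = i0")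
        case True
        then have r: "\<rho> i \<in> carrier G" using \<rho>G by simp
        have "inv (s \<otimes> u) \<otimes> \<rho> i = inv u \<otimes> (inv s \<otimes> \<rho> i)"
          using g r by (simp add: inv_mult_group m_assoc)
        moreover have "t \<otimes> u \<otimes> inv (s \<otimes> u) \<otimes> \<rho> i = t \<otimes> inv s \<otimes> \<rho> i"
          using g r by (simp add: inv_mult_group m_assoc) (simp add: m_assoc[symmetric])
        ultimately show ?thesis using True g r by (simp add: ent_x' X_def act_comp)
      next
        case False
        then show ?thesis using g by (auto simp: ent_x' X_def)
      qed
    qed
    have y'S: "y' \<in> equivariant_mats m"
    proof (rule equivariant_matsI)
      show "supported ({..<m} \<times> carrier G) y'"
        using F i0 \<rho>G by (auto simp: supported_def ent_y' Y_def)
      show "e * ent y' a b = ent y' a b" for a b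
        by (auto simp: ent_y' Y_def act_corner ye)
      show "ent y' (i, s \<otimes> u) (j, t \<otimes> u) = \<beta> (inv u) (ent y' (i, s) (j, t))"
        if g: "s \<in> carrier G" "t \<in> carrier G" "u \<in> carrier G" for s t u i j
      proof (cases "i = i0 \<and> j \<in> F")
        case True
        then have r: "\<rho> j \<in> carrier G" using \<rho>G by simp
        have "t \<otimes> u = \<rho> j \<otimes> (s \<otimes> u) \<longleftrightarrow> t = \<rho> j \<otimes> s"
          using g r by (simp add: m_assoc[symmetric])
        then show ?thesis using True g r by (auto simp: ent_y' Y_def act_comp inv_mult_group)
      next
        case False
        then show ?thesis using g by (auto simp: ent_y' Y_def)
      qed
    qed
    show "\<exists>x' y. x' \<in> equivariant_mats m \<and> y \<in> equivariant_mats m \<and> Dg p F * x' = x' \<and>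
        x' * E i0 i0 p = x' \<and> norm (x - x') < \<epsilon> \<and> y * x' = E i0 i0 p"
    proof (rule exI[of _ x'], rule exI[of _ y'], intro conjI x'S y'S)
      show "Dg p F * x' = x'"
      proof (rule fmat_eqI)
        fix a b :: "nat \<times> 'g"
        have "\<beta> (inv (snd a)) p * \<beta> (inv (snd a) \<otimes> \<rho> (fst a)) (ent c' (\<rho> (fst a)) t)
            = \<beta> (inv (snd a) \<otimes> \<rho> (fst a)) (ent c' (\<rho> (fst a)) t)" if "fst a \<in> F" "snd a \<in> carrier G" for t
        proof -
          have r: "\<rho> (fst a) \<in> carrier G" using \<rho>G that by simp
          have "\<beta> (inv (snd a)) p = \<beta> (inv (snd a) \<otimes> \<rho> (fst a)) (\<beta> (inv (\<rho> (fst a))) p)"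
            using that r by (simp add: act_comp[symmetric] m_assoc)
          then show ?thesis using that r by (simp add: act_mult[symmetric] c'l)
        qed
        then show "ent (Dg p F * x') a b = ent x' a b"
          by (auto simp: Dl[OF F(1)] ent_x' X_def)
      qed
      show "x' * E i0 i0 p = x'"
      proof (rule fmat_eqI)
        fix a b :: "nat \<times> 'g"
        have "\<beta> (inv (snd a) \<otimes> \<rho> (fst a)) (ent c' (\<rho> (fst a)) (snd b \<otimes> inv (snd a) \<otimes> \<rho> (fst a))) * \<beta> (inv (snd b)) p
            = \<beta> (inv (snd a) \<otimes> \<rho> (fst a)) (ent c' (\<rho> (fst a)) (snd b \<otimes> inv (snd a) \<otimes> \<rho> (fst a)))"
          if g: "fst a \<in> F" "snd a \<in> carrier G" "snd b \<in> carrier G"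
        proof -
          have r: "\<rho> (fst a) \<in> carrier G" using \<rho>G that by simp
          define w where "w = snd b \<otimes> inv (snd a) \<otimes> \<rho> (fst a)"
          have w: "w \<in> carrier G" using g r by (simp add: w_def)
          have "inv (snd a) \<otimes> \<rho> (fst a) \<otimes> inv w = inv (snd b)"
            using g r by (simp add: w_def inv_mult_group m_assoc) (simp add: m_assoc[symmetric])
          then have "\<beta> (inv (snd b)) p = \<beta> (inv (snd a) \<otimes> \<rho> (fst a)) (\<beta> (inv w) p)"
            using g r w by (simp add: act_comp[symmetric])
          then show ?thesis unfolding w_def[symmetric]
            using g r w by (simp add: act_mult[symmetric] c'r)
        qed
        then show "ent (x' * E i0 i0 p) a b = ent x' a b"
          unfolding Eq by (auto simp: Dr[OF i0m] ent_x' X_def)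
      qed
      have xx': "norm (ent (x - x') a b) \<le> norm (c - c')" for a b :: "nat \<times> 'g"
      proof -
        obtain i s j t where ab: "a = (i, s)" "b = (j, t)" by (cases a, cases b) auto
        show ?thesis
        proof (cases "i \<in> F \<and> j = i0 \<and> s \<in> carrier G \<and> t \<in> carrier G")
          case True
          define r where "r = \<rho> i"
          have r: "r \<in> carrier G" "\<sigma> r = i" using \<rho>G \<sigma>\<rho> True by (auto simp: r_def)
          define w where "w = t \<otimes> inv s \<otimes> r"
          define u where "u = inv r \<otimes> s"
          have g: "s \<in> carrier G" "t \<in> carrier G" "w \<in> carrier G" "u \<in> carrier G"
            using True r by (simp_all add: w_def u_def)
          have "r \<otimes> u = s" using r g by (simp add: u_def m_assoc[symmetric])
          moreover have "w \<otimes> u = t"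
          proof -
            have "w \<otimes> u = t \<otimes> (inv s \<otimes> (r \<otimes> inv r) \<otimes> s)"
              unfolding w_def u_def using r g by (simp only: m_assoc m_closed inv_closed)
            then show ?thesis using r g by simp
          qed
          moreover have iu: "inv u = inv s \<otimes> r" using r g by (simp add: u_def inv_mult_group)
          ultimately have "ent x a b = \<beta> (inv s \<otimes> r) (ent x (i, r) (i0, w))"
            using xS(3)[of r w u i i0] r g True by (simp add: ab)
          also have "ent x (i, r) (i0, w) = ent c r w" using r g by (simp add: ent_c)
          finally have "ent (x - x') a b = \<beta> (inv s \<otimes> r) (ent (c - c') r w)"
            using True r g by (simp add: ab ent_x' X_def r_def[symmetric] w_def[symmetric] act_diff)
          then show ?thesis
            using act_norm[of "inv s \<otimes> r" "ent (c - c') r w"] norm_ent_le[of "c - c'" r w] r g by simp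
        next
          case False
          have "ent x a b = 0"
          proof (cases "i \<notin> F \<or> j \<noteq> i0")
            case True
            then show ?thesis using x0 by (simp add: ab)
          next
            case f2: False
            then show ?thesis using False supported_ent[OF xS(1), of a b] by (auto simp: ab)
          qed
          moreover have "ent x' a b = 0" using False by (auto simp: ab ent_x' X_def)
          ultimately show ?thesis by simp
        qed
      qed
      have "norm (x - x') = (\<Sum>a\<in>{..<m} \<times> carrier G. \<Sum>b\<in>{..<m} \<times> carrier G. norm (ent (x - x') a b))"
        by (rule norm_fmat_supported[OF finite_idx])
          (use equivariant_matsD(1)[OF x(1)] equivariant_matsD(1)[OF x'S] in simp)
      also have "\<dots> \<le> (\<Sum>a\<in>{..<m} \<times> carrier G. \<Sum>b\<in>{..<m} \<times> carrier G. norm (c - c'))"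
        by (intro sum_mono xx')
      also have "\<dots> \<le> M * norm (c - c')" by (simp add: M_def distrib_right)
      also have "\<dots> < M * (\<epsilon> / M)" using c'(4) M by (intro mult_strict_left_mono)
      also have "\<dots> = \<epsilon>" using M by simp
      finally show "norm (x - x') < \<epsilon>" .
      show "y' * x' = E i0 i0 p"
      proof (rule fmat_eqI)
        fix a b :: "nat \<times> 'g"
        obtain i s j t where ab: "a = (i, s)" "b = (j, t)" by (cases a, cases b) auto
        have "ent (y' * x') a b = (\<Sum>k<m. \<Sum>v\<in>carrier G. Y a (k, v) * X (k, v) b)"
          unfolding ent_y'[symmetric] ent_x'[symmetric]
          by (rule ent_mult_idx) (use equivariant_matsD(1)[OF x'S] in simp)
        also have "\<dots> = (\<Sum>k\<in>F. \<Sum>v\<in>carrier G. Y a (k, v) * X (k, v) b)"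
          by (rule sum.mono_neutral_right) (use F in \<open>auto simp: Y_def\<close>)
        also have "\<dots> = ent (E i0 i0 p) a b"
        proof (cases "i = i0 \<and> s \<in> carrier G \<and> j = i0 \<and> t \<in> carrier G")
          case True
          then have g: "s \<in> carrier G" "t \<in> carrier G" "inv s \<in> carrier G" by simp_all
          have "(\<Sum>v\<in>carrier G. Y a (k, v) * X (k, v) b)
              = \<beta> (inv s) (ent y \<one> (\<rho> k) * ent c' (\<rho> k) (t \<otimes> inv s))" if k: "k \<in> F" for k
          proof -
            have r: "\<rho> k \<in> carrier G" using \<rho>G k by simp
            have 1: "inv (\<rho> k \<otimes> s) \<otimes> \<rho> k = inv s"
              using r g by (simp add: inv_mult_group m_assoc)
            then have 2: "t \<otimes> inv (\<rho> k \<otimes> s) \<otimes> \<rho> k = t \<otimes> inv s" using r g by (simp add: m_assoc)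
            have "(\<Sum>v\<in>carrier G. Y a (k, v) * X (k, v) b)
                = (\<Sum>v\<in>carrier G. if v = \<rho> k \<otimes> s then Y a (k, \<rho> k \<otimes> s) * X (k, \<rho> k \<otimes> s) b else 0)"
              by (intro sum.cong refl) (auto simp: Y_def ab)
            also have "\<dots> = Y a (k, \<rho> k \<otimes> s) * X (k, \<rho> k \<otimes> s) b"
              using finite_G r g by (simp add: sum.delta)
            also have "\<dots> = \<beta> (inv s) (ent y \<one> (\<rho> k) * ent c' (\<rho> k) (t \<otimes> inv s))"
              using True r g k by (simp add: Y_def X_def ab 1 2 act_mult)
            finally show ?thesis .
          qed
          then have "(\<Sum>k\<in>F. \<Sum>v\<in>carrier G. Y a (k, v) * X (k, v) b)
              = \<beta> (inv s) (\<Sum>k\<in>F. ent y \<one> (\<rho> k) * ent c' (\<rho> k) (t \<otimes> inv s))"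
            by (simp add: act_sum g)
          also have "(\<Sum>k\<in>F. ent y \<one> (\<rho> k) * ent c' (\<rho> k) (t \<otimes> inv s))
              = (\<Sum>u\<in>carrier G. ent y \<one> u * ent c' u (t \<otimes> inv s))"
            by (rule sum.reindex_bij_betw[OF \<rho>])
          also have "\<dots> = ent (y * c') \<one> (t \<otimes> inv s)"
            by (rule ent_mult[OF finite_G, symmetric]) (use y(1) in \<open>auto simp: corner_mats_def supported_def\<close>)
          also have "\<beta> (inv s) \<dots> = (if s = t then \<beta> (inv s) p else 0)"
          proof -
            have "\<one> = t \<otimes> inv s \<longleftrightarrow> s = t"
            proof
              assume "\<one> = t \<otimes> inv s"
              then have "\<one> \<otimes> s = t \<otimes> inv s \<otimes> s" by simp
              then show "s = t" using g by (simp add: m_assoc)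
            qed (use g in simp)
            then show ?thesis unfolding y(2) ent_q using g by (simp add: act_one)
          qed
          finally show ?thesis using True by (simp add: ent_E ab)
        next
          case False
          then have "(\<Sum>k\<in>F. \<Sum>v\<in>carrier G. Y a (k, v) * X (k, v) b) = 0"
            by (intro sum.neutral ballI) (auto simp: Y_def X_def ab)
          then show ?thesis using False by (auto simp: ent_E ab)
        qed
        finally show "ent (y' * x') a b = ent (E i0 i0 p) a b" .
      qed
    qed
  qed
qed

end

section \<open>Constant surplus for many copies, and its absorption\<close>

context stable_corner_action
begin

text \<open>Induction on the copies in the source. Each step adds one copy of \<open>p\<close> to
  source and target by \<open>left_inv_dense_sum_equiv\<close>, so the difference
  \<open>card (carrier G) - 1\<close> stays the same; the cardinality condition states it without
  subtraction.\<close>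

lemma left_inv_dense_blocks:
  assumes p: "p * p = p" "e * p = p" and K: "K \<subseteq> {..<m}" and F: "F \<subseteq> {..<m}"
    and card: "card F + 1 = card K + card (carrier G)"
  shows "left_inv_dense (equivariant_mats m) (Dg p K) (Dg p F)"
proof -
  interpret S: complete_subring "equivariant_mats m" by (rule complete_subring_equivariant_mats)
  have idem: "S.idem (Dg p K)" if "K \<subseteq> {..<m}" for K
  proof -
    have "finite K" using that finite_subset by blast
    then show ?thesis using Dg_equivariant[OF _ that p(2)] p by (simp add: S.idem_def Dg_mult)
  qed
  have Es: "E a a p = Dg p {a}" for a by (simp add: Dg_def)
  have G1: "card (carrier G) > 0" using finite_G one_closed by (auto simp: card_gt_0_iff)
  have single: "left_inv_dense (equivariant_mats m) (E a a p) (Dg p F)"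
    if a: "a < m" and F: "F \<subseteq> {..<m}" "card (carrier G) \<le> card F" for a F
  proof -
    have fF: "finite F" using F finite_subset by blast
    obtain F1 where F1: "F1 \<subseteq> F" "card F1 = card (carrier G)" "finite F1"
      using obtain_subset_with_card_n[OF F(2)] by blast
    have dj: "F1 \<inter> (F - F1) = {}" "(F - F1) \<inter> F1 = {}" "Dg (p * p) {} = 0" by (auto simp: Dg_def)
    have sub: "F1 \<subseteq> {..<m}" "F - F1 \<subseteq> {..<m}" "{a} \<subseteq> {..<m}" using F F1 a by auto
    have "left_inv_dense (equivariant_mats m) (E a a p) (Dg p F1 + Dg p (F - F1))"
      by (rule S.left_inv_dense_add_target[OF left_inv_dense_single_block[OF p a sub(1) F1(2)]])
        (use idem[OF sub(1)] idem[OF sub(2)] idem[OF sub(3)] F1 fF dj in \<open>simp_all add: Dg_mult Es\<close>)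
    moreover have "Dg p F1 + Dg p (F - F1) = Dg p F"
      using Dg_union[of F1 "F - F1" p] F1 fF by (simp add: Un_absorb1)
    ultimately show ?thesis by simp
  qed
  have fK: "finite K" using K finite_subset by blast
  from fK K F card show ?thesis
  proof (induction K arbitrary: F)
    case empty
    then show ?case by (simp add: Dg_def S.left_inv_dense_0)
  next
    case (insert a K)
    have a: "a < m" and K: "K \<subseteq> {..<m}" using insert.prems by auto
    have fF: "finite F" using insert.prems finite_subset by blast
    show ?case
    \<comment> \<open>With \<open>K\<close> empty only \<open>card (carrier G) - 1\<close> blocks
      would remain in \<open>F1\<close>, too few for the new copy; there \<open>single\<close>
      applies to \<open>F\<close> directly.\<close>
    proof (cases "K = {}")
      case True
      then show ?thesis using single[OF a insert.prems(2)] insert.prems(3) by (simp add: Dg_def)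
    next
      case False
      then have cK: "card K > 0" using insert.hyps(1) by (simp add: card_gt_0_iff)
      have "card F > 0" using insert.prems(3) insert.hyps G1 by simp
      then obtain b where b: "b \<in> F" by (metis card_gt_0_iff ex_in_conv)
      define F1 where "F1 = F - {b}"
      have F1: "F1 \<subseteq> {..<m}" "finite F1" "b \<notin> F1" "F = insert b F1" "b < m"
        using b fF insert.prems by (auto simp: F1_def)
      have cF1: "card F1 + 1 = card K + card (carrier G)"
        using insert.prems(3) insert.hyps F1(2,3) unfolding F1(4) by simp
      have ab: "{a} \<subseteq> {..<m}" "{b} \<subseteq> {..<m}" using a F1 by auto
      have "left_inv_dense (equivariant_mats m) (E a a p + Dg p K) (E b b p + Dg p F1)"
      proof (rule S.left_inv_dense_sum_equiv[where u = "E b a p" and v = "E a b p"])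
        show "left_inv_dense (equivariant_mats m) (E a a p) (Dg p F1)"
          by (rule single[OF a F1(1)]) (use cF1 cK in linarith)
        show "left_inv_dense (equivariant_mats m) (Dg p K) (Dg p F1)"
          by (rule insert.IH[OF K F1(1) cF1])
        show "S.idem (E a a p)" "S.idem (E b b p)" using idem[OF ab(1)] idem[OF ab(2)] by (simp_all add: Es)
      qed (use idem[OF K] idem[OF F1(1)] insert.hyps F1 a p in
          \<open>simp_all add: E_Dg Dg_E E_mult E_equivariant\<close>)
      then show ?thesis using insert.hyps F1 by (simp add: Dg_insert)
    qed
  qed
qed

theorem left_inv_dense_two_rows:
  fixes k N :: nat
  assumes p: "p * p = p" "e * p = p"
    and full: "e = (\<Sum>i<k. X i * p * Y i)" "\<And>i. i < k \<Longrightarrow> e * X i = X i"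
    and small: "\<And>i j. i < N \<Longrightarrow> j < N \<Longrightarrow> V i * W j = (if i = j then p else 0)"
      "\<And>i. i < N \<Longrightarrow> e * W i = W i" "\<And>i. i < N \<Longrightarrow> W i * p = W i"
      "\<And>i. i < N \<Longrightarrow> e * V i = V i" "\<And>i. i < N \<Longrightarrow> p * V i = V i"
    and N: "card (carrier G) = N + 1"
  shows "\<exists>m\<ge>2. left_inv_dense (equivariant_mats m) (E 0 0 e) (E 0 0 e + E 1 1 e)"
proof -
  \<comment> \<open>Blocks 0 and 1 hold two units, the next \<open>k\<close> blocks the copies of
    \<open>p\<close> that cover a unit, and the last \<open>N\<close> blocks the surplus.\<close>
  define m where "m = 2 + k + N"
  interpret S: complete_subring "equivariant_mats m" by (rule complete_subring_equivariant_mats)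
  have sumS: "sum f A \<in> equivariant_mats m" if "\<And>i. i \<in> A \<Longrightarrow> f i \<in> equivariant_mats m" for f and A :: "nat set"
    using that by (induction A rule: infinite_finite_induct) simp_all
  define kk where "kk i = 2 + i" for i :: nat
  define nn where "nn i = 2 + k + i" for i :: nat
  have kn: "kk i = kk j \<longleftrightarrow> i = j" "nn i = nn j \<longleftrightarrow> i = j" for i j by (auto simp: kk_def nn_def)
  have kk: "kk i < m" "kk i \<noteq> 0" "kk i \<noteq> 1" "kk i \<noteq> nn l" "0 \<noteq> kk i" "1 \<noteq> kk i"
    "nn l \<noteq> kk i" "kk i \<noteq> Suc 0" "Suc 0 \<noteq> kk i"
    if "i < k" for i l using that by (auto simp: kk_def nn_def m_def)
  have nn: "nn i < m" "nn i \<noteq> 0" "nn i \<noteq> 1" "0 \<noteq> nn i" "1 \<noteq> nn i"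
    "nn i \<noteq> Suc 0" "Suc 0 \<noteq> nn i"
    if "i < N" for i using that by (auto simp: nn_def m_def)
  have m2: "0 < m" "1 < m" "Suc 0 < m" by (auto simp: m_def)
  have Xe: "e * X i = X i" if "i < k" for i using full(2)[OF that] .
  define PK where "PK = (\<Sum>i<k. E (kk i) (kk i) p)"
  define PF where "PF = (\<Sum>i<N. E (nn i) (nn i) p)"
  define K F where "K = kk ` {..<k}" and "F = nn ` {..<N}"
  have KF: "K \<subseteq> {..<m}" "F \<subseteq> {..<m}" "K \<inter> F = {}" "finite K" "finite F" "card K = k" "card F = N"
    by (auto simp: K_def F_def kk nn kn card_image inj_on_def)
  have PKF: "PK = Dg p K" "PF = Dg p F"
    unfolding PK_def PF_def Dg_def K_def F_def
    by (subst sum.reindex; simp add: inj_on_def kn)+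
  have step_a: "left_inv_dense (equivariant_mats m) PK (PK + PF)"
  proof -
    have "left_inv_dense (equivariant_mats m) (Dg p K) (Dg p (K \<union> F))"
      by (rule left_inv_dense_blocks[OF p KF(1)])
        (use KF in \<open>simp_all add: card_Un_disjoint N\<close>)
    then show ?thesis using KF by (simp add: PKF Dg_union)
  qed
  have sum_if: "(\<Sum>x<n. if x < n then h x else 0) = sum h {..<n}"
    for n :: nat and h :: "nat \<Rightarrow> (nat \<times> 'g, 'b) fmat"
    by (intro sum.cong) auto
  note Es = kn sum_if E_mult sum_distrib_left sum_distrib_right if_distrib[of "\<lambda>x. _ * x"] if_distrib[of "\<lambda>x. x * _"]
    sum.delta sum.delta'
  \<comment> \<open>The place in the second unit to which \<open>U\<close> and \<open>U'\<close>
    move the \<open>N\<close> surplus copies of \<open>p\<close>.\<close>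
  define f where "f = E 1 1 (\<Sum>i<N. W i * V i)"
  define U where "U = (\<Sum>i<N. E 1 (nn i) (W i))"
  define U' where "U' = (\<Sum>i<N. E (nn i) 1 (V i))"
  define I0 I1 where "I0 = E 0 0 e" and "I1 = E 1 1 e"
  \<comment> \<open>\<open>R * R' = I0\<close> by the assumption that the unit is a sum over
    multiples of \<open>p\<close>, so \<open>g = R' * R\<close> is a copy of the unit inside the
    \<open>k\<close> copies of \<open>p\<close>.\<close>
  define R where "R = (\<Sum>i<k. E 0 (kk i) (X i * p))"
  define R' where "R' = (\<Sum>i<k. E (kk i) 0 (p * Y i * e))"
  define g where "g = R' * R"
  have fullX: "(\<Sum>i<k. X i * (p * (Y i * e))) = e"
  proof -
    have "(\<Sum>i<k. X i * (p * (Y i * e))) = (\<Sum>i<k. X i * p * Y i) * e"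
      by (simp only: sum_distrib_right mult.assoc)
    then show ?thesis by (simp add: full(1)[symmetric] ee)
  qed
  have pp: "p * (p * t) = p * t" for t by (simp only: mult.assoc[symmetric] p)
  have eX: "e * (X i * t) = X i * t" if "i < k" for i t by (simp only: mult.assoc[symmetric] Xe[OF that])
  have inS: "PK \<in> equivariant_mats m" "PF \<in> equivariant_mats m" "U \<in> equivariant_mats m" "U' \<in> equivariant_mats m"
    "R \<in> equivariant_mats m" "R' \<in> equivariant_mats m" "I0 \<in> equivariant_mats m" "I1 \<in> equivariant_mats m"
    "f \<in> equivariant_mats m"
  proof -
    show "PK \<in> equivariant_mats m" "PF \<in> equivariant_mats m"
      unfolding PK_def PF_def by (intro sumS E_equivariant; simp add: kk nn p)+
    show "U \<in> equivariant_mats m" "U' \<in> equivariant_mats m"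
      unfolding U_def U'_def by (intro sumS E_equivariant; simp add: nn m2 small)+
    show "R \<in> equivariant_mats m" unfolding R_def
      by (intro sumS E_equivariant) (simp_all add: kk m2 Xe mult.assoc[symmetric])
    show "R' \<in> equivariant_mats m" unfolding R'_def
      by (intro sumS E_equivariant) (simp_all add: kk m2 p mult.assoc[symmetric])
    show "I0 \<in> equivariant_mats m" "I1 \<in> equivariant_mats m" unfolding I0_def I1_def
      by (intro E_equivariant; simp add: m2 ee)+
    show "f \<in> equivariant_mats m" unfolding f_def
      by (intro E_equivariant) (simp_all add: m2 sum_distrib_left mult.assoc[symmetric] small)
  qed
  have Ve: "V i * e = V i" if "i < N" for i using small(4)[OF that] central by metis
  have We: "W i * e = W i" if "i < N" for i using small(2)[OF that] central by metis
  have pe: "p * e = p" using p(2) central by metis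
  have c1: "PK * PK = PK" "PF * PF = PF" "U * U' = f" "I0 * I0 = I0" "I1 * I1 = I1" "I0 * I1 = 0" "I1 * I0 = 0"
    unfolding PK_def PF_def U_def U'_def f_def I0_def I1_def
    by (simp_all add: Es kk nn p ee E_sum cong: if_cong sum.cong_simp)
  have UU: "U' * U = PF"
  proof -
    have "U' * U = (\<Sum>x<N. \<Sum>y<N. E (nn y) (nn x) (V y * W x))"
      unfolding U_def U'_def by (simp add: Es)
    also have "\<dots> = (\<Sum>x<N. \<Sum>y<N. if y = x then E (nn y) (nn x) p else 0)"
      by (intro sum.cong refl) (simp add: small(1))
    also have "\<dots> = PF" by (simp add: PF_def sum.delta sum_if)
    finally show ?thesis .
  qed
  have c2: "PK * PF = 0" "PF * PK = 0" "PK * U = 0" "U * PK = 0" "PK * U' = 0" "U' * PK = 0"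
    "I1 * U = U" "U' * I1 = U'" "U * PF = U" "PF * U' = U'" "PK * I1 = 0" "I1 * PK = 0"
    "I1 * R = 0" "R * I1 = 0" "I1 * R' = 0" "R' * I1 = 0" "I0 * R = R" "R' * I0 = R'" "R * PK = R" "PK * R' = R'"
    "R * R' = I0"
    unfolding PK_def PF_def U_def U'_def f_def I0_def I1_def R_def R'_def
    by (simp_all add: Es kk nn p ee pe pp small Ve We eX fullX mult.assoc E_sum[symmetric] cong: if_cong sum.cong_simp)
  note c = c1 UU c2
  have assoc: "x * (y * t) = w * t" if "x * y = w" for x y w t :: "(nat \<times> 'g, 'b) fmat"
    using that by (simp add: mult.assoc[symmetric])
  have gg: "g * g = g" "g * PK = g" "PK * g = g" "R * g = R" "g * R' = R'" "g * I1 = 0" "I1 * g = 0"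
    unfolding g_def by (simp_all add: mult.assoc c assoc[OF c(29)] assoc[OF c(28)] assoc[OF c(23)])
  have ff: "f * f = f" "f * U = U" "U' * f = U'" "f * PK = 0" "PK * f = 0" "f * I1 = f" "I1 * f = f"
    unfolding c(3)[symmetric] by (simp_all add: mult.assoc c(1,2) c(4-) assoc[OF UU] assoc[OF c(11)] assoc[OF c(15)])
  have idem: "S.idem PK" "S.idem PF" "S.idem f" "S.idem I0" "S.idem I1" "S.idem g"
    using inS c gg ff by (simp_all add: S.idem_def) (simp add: g_def)
  have S: "g \<in> equivariant_mats m" using inS by (simp add: g_def)
  \<comment> \<open>The surplus \<open>PF\<close> is exchanged for its copy \<open>f\<close>, which
    afterwards is enlarged to the whole second unit.\<close>
  have step_b: "left_inv_dense (equivariant_mats m) PK (PK + f)"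
    by (rule S.left_inv_dense_equiv[OF step_a, where u = PK and v = PK and s = "PK + U" and t = "PK + U'"])
      (use inS c ff in \<open>simp_all add: S.idem_def distrib_left distrib_right\<close>)
  have "left_inv_dense (equivariant_mats m) PK (PK + f + (I1 - f))"
    by (rule S.left_inv_dense_add_target[OF step_b])
      (use inS c ff in \<open>simp_all add: S.idem_def algebra_simps\<close>)
  then have step_c: "left_inv_dense (equivariant_mats m) PK (PK + I1)" by (simp add: algebra_simps)
  \<comment> \<open>\<open>PK - g\<close> is a common summand of source and target.\<close>
  have step_d: "left_inv_dense (equivariant_mats m) g (g + I1)"
  proof (rule S.left_inv_dense_cancel[where z = "PK - g"])
    show "left_inv_dense (equivariant_mats m) (g + (PK - g)) (g + I1 + (PK - g))"
      using step_c by (simp add: algebra_simps)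
  qed (use inS c gg S in \<open>simp_all add: S.idem_def algebra_simps\<close>)
  have gd: "R' * R = g" by (simp add: g_def)
  have "left_inv_dense (equivariant_mats m) I0 (I0 + I1)"
    by (rule S.left_inv_dense_equiv[OF step_d, where u = R and v = R' and s = "R + I1" and t = "R' + I1"])
      (use inS c gg S gd in \<open>simp_all add: S.idem_def distrib_left distrib_right\<close>)
  then show ?thesis unfolding I0_def I1_def by (intro exI[of _ m]) (simp add: m_def)
qed

end

section \<open>The finite-dimensional case\<close>

context complete_subring
begin

text \<open>\<open>x\<close> satisfies a nontrivial polynomial relation. If the polynomial does not
  vanish at the real number \<open>c\<close>, division by the linear factor exhibits a left inverse
  of \<open>x - c *\<^sub>R z\<close>, and only finitely many \<open>c\<close> are excluded.\<close>

lemma left_inv_dense_finite_dimensional: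
  assumes z: "idem z" and scale: "\<And>r x. x \<in> S \<Longrightarrow> r *\<^sub>R x \<in> S"
    and F: "finite F" "\<And>x. x \<in> S \<Longrightarrow> z * x = x \<Longrightarrow> x * z = x \<Longrightarrow> x \<in> span F"
  shows "left_inv_dense S z z"
proof (rule left_inv_denseI_idem[OF z z])
  fix x and \<epsilon> :: real assume x: "x \<in> S" "0 < \<epsilon>" "z * x = x" "x * z = x"
  have zz: "z \<in> S" "z * z = z" using z by (auto simp: idem_def)
  define pw where "pw = rec_nat z (\<lambda>_ y. x * y)"
  have pw: "pw 0 = z" "pw (Suc i) = x * pw i" for i by (simp_all add: pw_def)
  have pwS: "pw i \<in> S \<and> z * pw i = pw i \<and> pw i * z = pw i" for i
    by (induction i) (simp_all add: pw zz x mult.assoc, metis x(3) mult.assoc)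
  have "\<exists>n a. (\<Sum>i\<le>n. a i *\<^sub>R pw i) = 0 \<and> (\<exists>i\<le>n. a i \<noteq> (0::real))"
  \<comment> \<open>Two equal powers already form a relation; linear dependence concerns the set of
    powers and would overlook it.\<close>
  proof (cases "inj_on pw {..card F}")
    case False
    then obtain i j where ij: "i \<le> card F" "j \<le> card F" "pw i = pw j" "i \<noteq> j" by (auto simp: inj_on_def)
    define a where "a k = (if k = i then 1 else 0) - (if k = j then 1 else (0::real))" for k
    have "(\<Sum>k\<le>card F. a k *\<^sub>R pw k) = (\<Sum>k\<le>card F. (if k = i then pw k else 0) - (if k = j then pw k else 0))"
      by (intro sum.cong refl) (auto simp: a_def)
    also have "\<dots> = 0" using ij by (simp add: sum_subtractf sum.delta)
    finally show ?thesis using ij by (intro exI[of _ "card F"] exI[of _ a]) (auto simp: a_def)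
  next
    case True
    have sub: "pw ` {..card F} \<subseteq> span F" using pwS F(2) by blast
    have "dependent (pw ` {..card F})"
    proof (rule ccontr)
      assume "independent (pw ` {..card F})"
      from independent_span_bound[OF F(1) this sub] show False by (simp add: card_image[OF True])
    qed
    then obtain u where u: "\<exists>v\<in>pw ` {..card F}. u v \<noteq> 0" "(\<Sum>v\<in>pw ` {..card F}. u v *\<^sub>R v) = 0"
      by (subst (asm) real_vector.dependent_finite) auto
    have "(\<Sum>i\<le>card F. u (pw i) *\<^sub>R pw i) = 0"
      using u(2) by (simp add: sum.reindex[OF True])
    then show ?thesis using u(1) by (intro exI[of _ "card F"] exI[of _ "\<lambda>i. u (pw i)"]) auto
  qed
  then obtain n a where rel: "(\<Sum>i\<le>n. a i *\<^sub>R pw i) = 0" and a: "\<exists>i\<le>n. a i \<noteq> (0::real)" by blast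
  define \<delta> where "\<delta> = \<epsilon> / (norm z + 1)"
  have \<delta>: "\<delta> > 0" "\<delta> * norm z < \<epsilon>"
  proof -
    have "norm z + 1 > 0" by (intro add_nonneg_pos) simp_all
    then show "\<delta> > 0" "\<delta> * norm z < \<epsilon>" using x(2) by (simp_all add: \<delta>_def field_simps)
  qed
  have "finite {c. (\<Sum>i\<le>n. a i * c ^ i) = 0}" using polyfun_finite_roots a by blast
  then have "\<not> {0<..<\<delta>} \<subseteq> {c. (\<Sum>i\<le>n. a i * c ^ i) = 0}"
    using infinite_Ioo[OF \<delta>(1)] finite_subset by blast
  then obtain c where "c \<in> {0<..<\<delta>}" "c \<notin> {c. (\<Sum>i\<le>n. a i * c ^ i) = 0}" by blast
  then have c: "0 < c" "c < \<delta>" "(\<Sum>i\<le>n. a i * c ^ i) \<noteq> 0" by simp_all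
  define P where "P = (\<Sum>i\<le>n. a i * c ^ i)"
  \<comment> \<open>\<open>q i\<close> is the quotient of \<open>x ^ i - c ^ i\<close> by
    \<open>x - c\<close>, formed in the corner with unit \<open>z\<close>.\<close>
  define q where "q = rec_nat 0 (\<lambda>i y. x * y + c ^ i *\<^sub>R z)"
  have q: "q 0 = 0" "q (Suc i) = x * q i + c ^ i *\<^sub>R z" for i by (simp_all add: q_def)
  have qS: "q i \<in> S" for i by (induction i) (simp_all add: q zz x scale)
  have qx: "q i * (x - c *\<^sub>R z) = pw i - c ^ i *\<^sub>R z" for i
  proof (induction i)
    case (Suc i)
    have "q (Suc i) * (x - c *\<^sub>R z) = x * (q i * (x - c *\<^sub>R z)) + c ^ i *\<^sub>R (z * (x - c *\<^sub>R z))"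
      by (simp add: q distrib_right mult.assoc)
    also have "\<dots> = x * (pw i - c ^ i *\<^sub>R z) + c ^ i *\<^sub>R (x - c *\<^sub>R z)"
      unfolding Suc by (simp add: right_diff_distrib x zz)
    also have "\<dots> = pw (Suc i) - c ^ Suc i *\<^sub>R z"
      by (simp add: pw right_diff_distrib x scaleR_right_diff_distrib mult.commute)
    finally show ?case .
  qed (simp add: q pw)
  \<comment> \<open>Because of the relation, the sum times \<open>x - c *\<^sub>R z\<close> is
    \<open>- P\<close> times \<open>z\<close>; hence the factor.\<close>
  define y where "y = (- 1 / P) *\<^sub>R (\<Sum>i\<le>n. a i *\<^sub>R q i)"
  have sumS: "(\<Sum>i\<in>A. a i *\<^sub>R q i) \<in> S" for A :: "nat set"
    by (induction A rule: infinite_finite_induct) (simp_all add: qS scale)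
  have "(\<Sum>i\<le>n. a i *\<^sub>R q i) * (x - c *\<^sub>R z) = (\<Sum>i\<le>n. a i *\<^sub>R pw i) - P *\<^sub>R z"
    unfolding sum_distrib_right P_def scaleR_sum_left
    by (simp add: qx scaleR_right_diff_distrib sum_subtractf)
  then have yx: "y * (x - c *\<^sub>R z) = z" using c(3) by (simp add: y_def rel P_def)
  show "\<exists>x' y. x' \<in> S \<and> y \<in> S \<and> z * x' = x' \<and> x' * z = x' \<and> norm (x - x') < \<epsilon> \<and> y * x' = z"
  proof (rule exI[of _ "x - c *\<^sub>R z"], rule exI[of _ y], intro conjI yx)
    show "x - c *\<^sub>R z \<in> S" using x zz by (simp add: scale)
    show "y \<in> S" unfolding y_def by (rule scale[OF sumS])
    show "z * (x - c *\<^sub>R z) = x - c *\<^sub>R z" "(x - c *\<^sub>R z) * z = x - c *\<^sub>R z"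
      by (simp_all add: right_diff_distrib left_diff_distrib x zz)
    have "norm (x - (x - c *\<^sub>R z)) \<le> \<delta> * norm z" using c by (simp add: mult_right_mono)
    then show "norm (x - (x - c *\<^sub>R z)) < \<epsilon>" using \<delta>(2) by linarith
  qed
qed

end

section \<open>Functions on the group as columns of equivariant matrices\<close>

context corner_action
begin

lemma ent_E_mult: "ent (E i j a * b) x y =
  (if fst x = i \<and> snd x \<in> carrier G then \<beta> (inv (snd x)) a * ent b (j, snd x) y else 0)"
proof -
  let ?J = "{(j, snd x)}"
  have "ent (E i j a * b) x y = (\<Sum>z\<in>?J. ent (E i j a) x z * ent b z y)"
    by (rule ent_mult) (auto simp: ent_E)
  then show ?thesis by (simp add: ent_E)
qed

lemma ent_mult_E: "ent (b * E i j a) x y =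
  (if fst y = j \<and> snd y \<in> carrier G then ent b x (i, snd y) * \<beta> (inv (snd y)) a else 0)"
proof -
  let ?J = "{(i, snd y)}"
  have "ent (b * E i j a) x y = (\<Sum>z\<in>?J. ent b x z * ent (E i j a) z y)"
    by (rule ent_mult) (auto simp: ent_E)
  then show ?thesis by (auto simp: ent_E)
qed

text \<open>The regular representations of \<open>n\<close> functions, stacked in the first block
  column.\<close>

definition column :: "nat \<Rightarrow> (nat \<Rightarrow> 'g \<Rightarrow> 'b) \<Rightarrow> (nat \<times> 'g, 'b) fmat" where
  "column n b = mat (\<lambda>x y. if fst x < n \<and> fst y = 0 \<and> snd x \<in> carrier G \<and> snd y \<in> carrier G
    then \<beta> (inv (snd x)) (b (fst x) (snd x \<otimes> inv (snd y))) else 0)"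

lemma ent_column: "ent (column n b) x y =
  (if fst x < n \<and> fst y = 0 \<and> snd x \<in> carrier G \<and> snd y \<in> carrier G
    then \<beta> (inv (snd x)) (b (fst x) (snd x \<otimes> inv (snd y))) else 0)"
proof -
  have "ent (column n b) = (\<lambda>x y. if fst x < n \<and> fst y = 0 \<and> snd x \<in> carrier G \<and> snd y \<in> carrier G
    then \<beta> (inv (snd x)) (b (fst x) (snd x \<otimes> inv (snd y))) else 0)"
    unfolding column_def
    by (rule ent_mat[OF finite_idx[of "n + 1"]]) (auto simp: mem_Times_iff split: if_splits)
  then show ?thesis by (simp only:)
qed

lemma column_equivariant:
  assumes "n \<le> m" "0 < m" "\<And>i s. i < n \<Longrightarrow> s \<in> carrier G \<Longrightarrow> e * b i s = b i s"
  shows "column n b \<in> equivariant_mats m"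
proof (rule equivariant_matsI)
  show "supported ({..<m} \<times> carrier G) (column n b)"
    using assms by (auto simp: supported_def ent_column)
  show "e * ent (column n b) x y = ent (column n b) x y" for x y
    using assms by (auto simp: ent_column act_corner)
  show "ent (column n b) (i, s \<otimes> r) (j, t \<otimes> r) = \<beta> (inv r) (ent (column n b) (i, s) (j, t))"
    if g: "s \<in> carrier G" "t \<in> carrier G" "r \<in> carrier G" for s t r i j
  proof -
    have "s \<otimes> r \<otimes> inv (t \<otimes> r) = s \<otimes> inv t"
      using g by (simp add: inv_mult_group m_assoc) (simp add: m_assoc[symmetric])
    then show ?thesis using g by (simp add: ent_column inv_mult_group act_comp)
  qed
qed

lemma scaleR_equivariant: "x \<in> equivariant_mats m \<Longrightarrow> r *\<^sub>R x \<in> equivariant_mats m"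
  by (rule equivariant_matsI) (simp_all add: equivariant_matsD act_scaleR)

text \<open>In block \<open>(0, 0)\<close> an equivariant matrix is a sum over \<open>t\<close> of
  representations of functions concentrated at \<open>t\<close>, so finite dimension of the
  coefficients passes to that block. There a single row suffices, and the second one is added to the
  target.\<close>

lemma left_inv_dense_two_rows_finite_dimensional:
  assumes F: "finite F" "{x. e * x = x} \<subseteq> span F"
  shows "left_inv_dense (equivariant_mats 2) (E 0 0 e) (E 0 0 e + E 1 1 e)"
proof -
  interpret S: complete_subring "equivariant_mats 2" by (rule complete_subring_equivariant_mats)
  have E: "E 0 0 e \<in> equivariant_mats 2" "E 1 1 e \<in> equivariant_mats 2"
    by (simp_all add: E_equivariant ee)
  then have idem: "S.idem (E 0 0 e)" "S.idem (E 1 1 e)" by (simp_all add: S.idem_def E_mult ee)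
  define R where "R t a = column 1 (\<lambda>i s. if s = t then a else 0)" for t a
  have linR: "linear (R t)" if "t \<in> carrier G" for t
    by (rule linearI; rule fmat_eqI) (auto simp: R_def ent_column act_add act_scaleR)
  define FF where "FF = (\<Union>t\<in>carrier G. R t ` F)"
  have "left_inv_dense (equivariant_mats 2) (E 0 0 e) (E 0 0 e)"
  proof (rule S.left_inv_dense_finite_dimensional[OF idem(1) scaleR_equivariant])
    show "finite FF" using finite_G F(1) by (simp add: FF_def)
    fix x assume x: "x \<in> equivariant_mats 2" "E 0 0 e * x = x" "x * E 0 0 e = x"
    define a where "a t = ent x (0, \<one>) (0, inv t)" for t
    have "x = (\<Sum>t\<in>carrier G. R t (a t))"
    proof (rule fmat_eqI)
      fix y z :: "nat \<times> 'g"
      obtain i s j u where yz: "y = (i, s)" "z = (j, u)" by (cases y, cases z) auto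
      show "ent x y z = ent (\<Sum>t\<in>carrier G. R t (a t)) y z"
      proof (cases "i = 0 \<and> j = 0 \<and> s \<in> carrier G \<and> u \<in> carrier G")
        case True
        then have g: "s \<in> carrier G" "u \<in> carrier G" "s \<otimes> inv u \<in> carrier G" by simp_all
        have "ent (\<Sum>t\<in>carrier G. R t (a t)) y z
            = (\<Sum>t\<in>carrier G. if t = s \<otimes> inv u then \<beta> (inv s) (a t) else 0)"
          unfolding ent_sum by (intro sum.cong refl) (use True in \<open>auto simp: R_def ent_column yz\<close>)
        also have "\<dots> = \<beta> (inv s) (a (s \<otimes> inv u))" using finite_G g by (simp add: sum.delta)
        also have "\<dots> = ent x (0, \<one> \<otimes> s) (0, (u \<otimes> inv s) \<otimes> s)"
          using g by (subst equivariant_matsD(3)[OF x(1)]) (simp_all add: a_def inv_mult_group)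
        also have "\<dots> = ent x y z" using g True by (simp add: m_assoc yz)
        finally show ?thesis by simp
      next
        case False
        have "ent x y z = ent (E 0 0 e * x * E 0 0 e) y z" by (simp add: x)
        also have "\<dots> = 0" using False by (auto simp: ent_mult_E ent_E_mult yz)
        finally show ?thesis using False by (auto simp: ent_sum R_def ent_column yz intro!: sum.neutral[symmetric])
      qed
    qed
    also have "\<dots> \<in> span FF"
    proof (rule span_sum)
      fix t assume t: "t \<in> carrier G"
      have "a t \<in> span F" using F(2) equivariant_matsD(2)[OF x(1)] by (auto simp: a_def)
      then have "R t (a t) \<in> span (R t ` F)"
        using linear_span_image[OF linR[OF t]] by blast
      moreover have "span (R t ` F) \<subseteq> span FF" by (rule span_mono) (use t in \<open>auto simp: FF_def\<close>)
      ultimately show "R t (a t) \<in> span FF" by blast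
    qed
    finally show "x \<in> span FF" .
  qed
  then show ?thesis
    by (rule S.left_inv_dense_add_target) (simp_all add: idem[simplified] E_mult)
qed

text \<open>Row \<open>\<one>\<close> of block \<open>i\<close> in the first block column recovers a
  function: the entry in column \<open>inv s\<close> is its value at \<open>s\<close>. In these
  coordinates the matrix product becomes the convolution of the skew group algebra.\<close>

lemma unimodular_pairs_dense:
  fixes b :: "nat \<Rightarrow> 'g \<Rightarrow> 'b" and \<epsilon> :: real
  assumes d: "left_inv_dense (equivariant_mats m) (E 0 0 e) (E 0 0 e + E 1 1 e)" and m: "m \<ge> 2"
    and b: "\<And>i s. i < 2 \<Longrightarrow> s \<in> carrier G \<Longrightarrow> e * b i s = b i s" and \<epsilon>: "\<epsilon> > 0"
  shows "\<exists>b'. (\<forall>i<2. \<forall>s\<in>carrier G. e * b' i s = b' i s) \<and>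
    (\<forall>i<2. (\<Sum>s\<in>carrier G. norm (b i s - b' i s)) < \<epsilon>) \<and>
    (\<forall>h. (\<forall>s\<in>carrier G. e * h s = h s) \<longrightarrow> (\<exists>c. (\<forall>i<2. \<forall>s\<in>carrier G. e * c i s = c i s) \<and>
      (\<forall>s\<in>carrier G. (\<Sum>i<2. \<Sum>t\<in>carrier G. c i t * \<beta> t (b' i (inv t \<otimes> s))) = h s)))"
proof -
  interpret S: complete_subring "equivariant_mats m" by (rule complete_subring_equivariant_mats)
  define f where "f = E 0 0 e + E 1 1 e"
  define x where "x = column 2 b"
  have x: "x \<in> equivariant_mats m" unfolding x_def by (rule column_equivariant) (use m b in auto)
  have be: "e * \<beta> s (b i t) = \<beta> s (b i t)" if "i < 2" "s \<in> carrier G" "t \<in> carrier G" for i s t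
    using that b act_corner by simp
  have fx: "f * x = x"
  proof (rule fmat_eqI)
    fix y z :: "nat \<times> 'g"
    have "fst y < 2 \<longleftrightarrow> fst y = 0 \<or> fst y = 1" by auto
    then show "ent (f * x) y z = ent x y z"
      by (auto simp: f_def x_def distrib_right ent_E_mult ent_column act_e be)
  qed
  have xe: "x * E 0 0 e = x"
    by (rule fmat_eqI) (auto simp: x_def ent_mult_E ent_column act_e be central[symmetric])
  define n where "n = real (card (carrier G))"
  have n: "n > 0" using finite_G one_closed by (auto simp: n_def card_gt_0_iff)
  obtain x' y where x': "x' \<in> equivariant_mats m" "f * x' = x'" "x' * E 0 0 e = x'" "norm (x - x') < \<epsilon> / n"
    and y: "y \<in> equivariant_mats m" "y * x' = E 0 0 e"
    using left_inv_denseD[OF d[folded f_def] x fx xe, of "\<epsilon> / n"] \<epsilon> n by (metis divide_pos_pos)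
  define b' where "b' i s = ent x' (i, \<one>) (0, inv s)" for i s
  have x'0: "ent x' (i, s) z = 0" if "i \<noteq> 0" "i \<noteq> 1" for i s z
  proof -
    have "ent x' (i, s) z = ent (f * x') (i, s) z" by (simp add: x')
    also have "\<dots> = 0" using that by (simp add: f_def distrib_right ent_E_mult)
    finally show ?thesis .
  qed
  show ?thesis
  proof (rule exI[of _ b'], intro conjI allI impI ballI)
    show "e * b' i s = b' i s" for i s by (simp add: b'_def equivariant_matsD(2)[OF x'(1)])
    show "(\<Sum>s\<in>carrier G. norm (b i s - b' i s)) < \<epsilon>" if i: "i < 2" for i
    proof -
      have "norm (b i s - b' i s) \<le> norm (x - x')" if s: "s \<in> carrier G" for s
      proof -
        have "b i s - b' i s = ent (x - x') (i, \<one>) (0, inv s)"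
          using i s by (simp add: x_def b'_def ent_column act_one)
        then show ?thesis by (simp only: norm_ent_le)
      qed
      then have "(\<Sum>s\<in>carrier G. norm (b i s - b' i s)) \<le> (\<Sum>s\<in>carrier G. norm (x - x'))"
        by (rule sum_mono)
      also have "\<dots> = n * norm (x - x')" by (simp add: n_def)
      also have "\<dots> < n * (\<epsilon> / n)" using x'(4) n by (intro mult_strict_left_mono)
      also have "\<dots> = \<epsilon>" using n by simp
      finally show ?thesis .
    qed
    fix h :: "'g \<Rightarrow> 'b" assume h: "\<forall>s\<in>carrier G. e * h s = h s"
    define D where "D = column 1 (\<lambda>_. h)"
    have D: "D \<in> equivariant_mats m" unfolding D_def by (rule column_equivariant) (use m h in auto)
    have De: "D * E 0 0 e = D"
      by (rule fmat_eqI) (use h in \<open>auto simp: D_def ent_mult_E ent_column act_e act_corner central[symmetric]\<close>)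
    \<comment> \<open>As \<open>y * x'\<close> is the identity of the first block, every column
      \<open>D\<close> supported there is reached: \<open>w * x' = D\<close>.\<close>
    define w where "w = D * y"
    have w: "w \<in> equivariant_mats m" unfolding w_def by (rule S.mult_S[OF D y(1)])
    have wx: "w * x' = D" by (simp add: w_def mult.assoc y De)
    define c where "c i u = ent w (0, \<one>) (i, inv u)" for i u
    show "\<exists>c. (\<forall>i<2. \<forall>s\<in>carrier G. e * c i s = c i s) \<and>
      (\<forall>s\<in>carrier G. (\<Sum>i<2. \<Sum>t\<in>carrier G. c i t * \<beta> t (b' i (inv t \<otimes> s))) = h s)"
    proof (rule exI[of _ c], intro conjI allI impI ballI)
      show "e * c i s = c i s" for i s by (simp add: c_def equivariant_matsD(2)[OF w])
      fix s assume s: "s \<in> carrier G"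
      have bij: "bij_betw (\<lambda>t. inv t) (carrier G) (carrier G)"
        by (rule bij_betwI[where g = "\<lambda>t. inv t"]) auto
      have "(\<Sum>i<2. \<Sum>t\<in>carrier G. c i t * \<beta> t (b' i (inv t \<otimes> s)))
          = (\<Sum>i<2. \<Sum>t\<in>carrier G. ent w (0, \<one>) (i, inv t) * ent x' (i, inv t) (0, inv s))"
      proof (intro sum.cong refl)
        fix i t assume t: "t \<in> carrier G"
        have "ent x' (i, \<one> \<otimes> inv t) (0, (inv s \<otimes> t) \<otimes> inv t) = \<beta> (inv (inv t)) (ent x' (i, \<one>) (0, inv s \<otimes> t))"
          by (rule equivariant_matsD(3)[OF x'(1)]) (use s t in auto)
        then have "ent x' (i, inv t) (0, inv s) = \<beta> t (ent x' (i, \<one>) (0, inv s \<otimes> t))"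
          using s t by (simp add: m_assoc)
        then show "c i t * \<beta> t (b' i (inv t \<otimes> s)) = ent w (0, \<one>) (i, inv t) * ent x' (i, inv t) (0, inv s)"
          using s t by (simp add: c_def b'_def inv_mult_group)
      qed
      also have "\<dots> = (\<Sum>i<2. \<Sum>t\<in>carrier G. ent w (0, \<one>) (i, t) * ent x' (i, t) (0, inv s))"
        by (intro sum.cong refl sum.reindex_bij_betw[OF bij, of "\<lambda>t. ent w (0, \<one>) (_, t) * ent x' (_, t) (0, inv s)"])
      also have "\<dots> = (\<Sum>i<m. \<Sum>t\<in>carrier G. ent w (0, \<one>) (i, t) * ent x' (i, t) (0, inv s))"
        by (rule sum.mono_neutral_left) (use m x'0 in \<open>auto intro!: sum.neutral\<close>)
      also have "\<dots> = ent (w * x') (0, \<one>) (0, inv s)"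
        by (rule ent_mult_idx[symmetric]) (use equivariant_matsD(1)[OF w] in simp)
      also have "\<dots> = h s" using s by (simp add: wx D_def ent_column act_one)
      finally show "(\<Sum>i<2. \<Sum>t\<in>carrier G. c i t * \<beta> t (b' i (inv t \<otimes> s))) = h s" .
    qed
  qed
qed

end

section \<open>Bounded families over all C*-algebra structures on a type\<close>

text \<open>A C*-algebra with an explicit carrier is not an instance of a type class, but it is a corner, cut
  down by a central projection, of the product of all C*-algebra structures on the same type, and
  this product is such an instance.\<close>

lemma cring_complex_ring: "cring complex_ring"
proof (rule cringI)
  show "abelian_group complex_ring"
  proof (rule abelian_groupI)
    show "\<exists>y\<in>carrier complex_ring. y \<oplus>\<^bsub>complex_ring\<^esub> x = \<zero>\<^bsub>complex_ring\<^esub>" for x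
      by (intro bexI[of _ "- x"]) (simp_all add: complex_ring_def)
  qed (simp_all add: complex_ring_def)
  show "Group.comm_monoid complex_ring"
    by (rule comm_monoidI) (simp_all add: complex_ring_def)
qed (simp_all add: complex_ring_def algebra_simps)

context unital_star_algebra
begin

lemma scale_add_left: "x \<in> carrier A \<Longrightarrow> (a + b) \<odot>\<^bsub>A\<^esub> x = a \<odot>\<^bsub>A\<^esub> x \<oplus>\<^bsub>A\<^esub> b \<odot>\<^bsub>A\<^esub> x"
  using smult_l_distr[of a b x] by (simp add: complex_ring_def)

lemma scale_add_right: "x \<in> carrier A \<Longrightarrow> y \<in> carrier A \<Longrightarrow> a \<odot>\<^bsub>A\<^esub> (x \<oplus>\<^bsub>A\<^esub> y) = a \<odot>\<^bsub>A\<^esub> x \<oplus>\<^bsub>A\<^esub> a \<odot>\<^bsub>A\<^esub> y"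
  using smult_r_distr[of a x y] by (simp add: complex_ring_def)

lemma scale_scale: "x \<in> carrier A \<Longrightarrow> a \<odot>\<^bsub>A\<^esub> (b \<odot>\<^bsub>A\<^esub> x) = (a * b) \<odot>\<^bsub>A\<^esub> x"
  using smult_assoc1[of a b x] by (simp add: complex_ring_def)

lemma scale_one: "x \<in> carrier A \<Longrightarrow> 1 \<odot>\<^bsub>A\<^esub> x = x"
  using smult_one[of x] by (simp add: complex_ring_def)

lemma scale_closed [simp]: "x \<in> carrier A \<Longrightarrow> a \<odot>\<^bsub>A\<^esub> x \<in> carrier A"
  using smult_closed[of a x] by (simp add: complex_ring_def)

lemma scale_zero_left: "x \<in> carrier A \<Longrightarrow> 0 \<odot>\<^bsub>A\<^esub> x = \<zero>\<^bsub>A\<^esub>"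
  using scale_add_left[of x 0 0] by (metis M.add.l_cancel_one' add.right_neutral scale_closed)

lemma scale_minus_one: "x \<in> carrier A \<Longrightarrow> (- 1) \<odot>\<^bsub>A\<^esub> x = \<ominus>\<^bsub>A\<^esub> x"
proof -
  assume x: "x \<in> carrier A"
  have "(- 1) \<odot>\<^bsub>A\<^esub> x \<oplus>\<^bsub>A\<^esub> x = \<zero>\<^bsub>A\<^esub>"
    using scale_add_left[OF x, of "- 1" 1] scale_zero_left[OF x] scale_one[OF x] by simp
  then show ?thesis using x by (simp add: M.minus_equality)
qed

lemma star_one: "star A \<one>\<^bsub>A\<^esub> = \<one>\<^bsub>A\<^esub>"
  by (metis A.l_one A.one_closed A.r_one star_closed star_mult star_star)

end

context unital_cstar_algebra
begin

lemma cnorm_nonneg: "x \<in> carrier A \<Longrightarrow> 0 \<le> cnorm A x"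
  and cnorm_scale: "x \<in> carrier A \<Longrightarrow> cnorm A (c \<odot>\<^bsub>A\<^esub> x) = cmod c * cnorm A x"
  and cnorm_triangle: "x \<in> carrier A \<Longrightarrow> y \<in> carrier A \<Longrightarrow> cnorm A (x \<oplus>\<^bsub>A\<^esub> y) \<le> cnorm A x + cnorm A y"
  and cnorm_mult: "x \<in> carrier A \<Longrightarrow> y \<in> carrier A \<Longrightarrow> cnorm A (x \<otimes>\<^bsub>A\<^esub> y) \<le> cnorm A x * cnorm A y"
  and cnorm_star_mult: "x \<in> carrier A \<Longrightarrow> cnorm A (star A x \<otimes>\<^bsub>A\<^esub> x) = (cnorm A x)\<^sup>2"
  using cnorm_cstar_seminorm unfolding cstar_seminorm_def by blast+

lemma cnorm_zero [simp]: "cnorm A \<zero>\<^bsub>A\<^esub> = 0"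
  using cnorm_scale[of "\<zero>\<^bsub>A\<^esub>" 0] scale_zero_left[of "\<zero>\<^bsub>A\<^esub>"] by simp

lemma cnorm_minus: "x \<in> carrier A \<Longrightarrow> cnorm A (\<ominus>\<^bsub>A\<^esub> x) = cnorm A x"
  using cnorm_scale[of x "- 1"] scale_minus_one[of x] by simp

lemma minus_swap: "x \<in> carrier A \<Longrightarrow> y \<in> carrier A \<Longrightarrow> \<ominus>\<^bsub>A\<^esub> (x \<ominus>\<^bsub>A\<^esub> y) = y \<ominus>\<^bsub>A\<^esub> x"
  by (simp add: M.minus_eq M.minus_add M.a_comm)

lemma minus_split: "x \<in> carrier A \<Longrightarrow> y \<in> carrier A \<Longrightarrow> z \<in> carrier A \<Longrightarrow>
    x \<ominus>\<^bsub>A\<^esub> z = (x \<ominus>\<^bsub>A\<^esub> y) \<oplus>\<^bsub>A\<^esub> (y \<ominus>\<^bsub>A\<^esub> z)"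
  by (simp add: M.minus_eq M.a_assoc M.r_neg1)

lemma cnorm_minus_commute: "x \<in> carrier A \<Longrightarrow> y \<in> carrier A \<Longrightarrow> cnorm A (x \<ominus>\<^bsub>A\<^esub> y) = cnorm A (y \<ominus>\<^bsub>A\<^esub> x)"
  using cnorm_minus[of "x \<ominus>\<^bsub>A\<^esub> y"] minus_swap[of x y] by simp

lemma minus_eq_zeroD:
  assumes x: "x \<in> carrier A" and y: "y \<in> carrier A" and 0: "x \<ominus>\<^bsub>A\<^esub> y = \<zero>\<^bsub>A\<^esub>"
  shows "x = y"
proof -
  have "x = (x \<ominus>\<^bsub>A\<^esub> y) \<oplus>\<^bsub>A\<^esub> y" using x y by (simp add: M.minus_eq M.a_assoc M.l_neg)
  also have "\<dots> = y" using y by (simp add: 0)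
  finally show ?thesis .
qed

lemma Metric_space_cdist: "Metric_space (carrier A) (cdist A)"
proof
  show "0 \<le> cdist A x y" for x y by (simp add: cdist_def cnorm_nonneg)
  show "cdist A x y = cdist A y x" for x y by (auto simp: cdist_def cnorm_minus_commute)
  fix x y z assume x: "x \<in> carrier A" and y: "y \<in> carrier A"
  show "cdist A x y = 0 \<longleftrightarrow> x = y"
    using x y cnorm_eq_zero[of "x \<ominus>\<^bsub>A\<^esub> y"] minus_eq_zeroD[OF x y]
    by (auto simp: cdist_def M.minus_eq M.r_neg)
  assume z: "z \<in> carrier A"
  show "cdist A x z \<le> cdist A x y + cdist A y z"
    using x y z cnorm_triangle[of "x \<ominus>\<^bsub>A\<^esub> y" "y \<ominus>\<^bsub>A\<^esub> z"] minus_split[OF x y z] by (simp add: cdist_def)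
qed

lemma cauchy_limit:
  fixes f :: "nat \<Rightarrow> 'a"
  assumes f: "\<And>n. f n \<in> carrier A"
    and c: "\<And>\<epsilon>::real. \<epsilon> > 0 \<Longrightarrow> \<exists>N. \<forall>m\<ge>N. \<forall>n\<ge>N. cnorm A (f m \<ominus>\<^bsub>A\<^esub> f n) < \<epsilon>"
  shows "\<exists>l\<in>carrier A. \<forall>\<epsilon>>0. \<exists>N. \<forall>n\<ge>N. cnorm A (f n \<ominus>\<^bsub>A\<^esub> l) < \<epsilon>"
proof -
  interpret M: Metric_space "carrier A" "cdist A" by (rule Metric_space_cdist)
  have "M.MCauchy f"
    unfolding M.MCauchy_def
  proof (intro conjI allI impI)
    show "range f \<subseteq> carrier A" using f by blast
    fix \<epsilon> :: real assume "\<epsilon> > 0"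
    from c[OF this] obtain N where "\<forall>m\<ge>N. \<forall>n\<ge>N. cnorm A (f m \<ominus>\<^bsub>A\<^esub> f n) < \<epsilon>" by blast
    then show "\<exists>N. \<forall>n n'. N \<le> n \<longrightarrow> N \<le> n' \<longrightarrow> cdist A (f n) (f n') < \<epsilon>"
      by (intro exI[of _ N]) (simp add: cdist_def f)
  qed
  then obtain l where "limitin M.mtopology f l sequentially"
    using complete unfolding M.mcomplete_def by blast
  then have l: "l \<in> carrier A" "\<forall>\<epsilon>>0. \<exists>N. \<forall>n\<ge>N. f n \<in> carrier A \<and> cdist A (f n) l < \<epsilon>"
    unfolding M.limit_metric_sequentially by auto
  then show ?thesis by (intro bexI[of _ l]) (simp_all add: cdist_def f)
qed

end

text \<open>The zero algebra exists on every type and makes the type of structures below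
  nonempty.\<close>

definition trivial_cstar :: "'a cstar_alg" where
  "trivial_cstar = \<lparr>carrier = {undefined}, mult = (\<lambda>_ _. undefined), one = undefined, zero = undefined,
    add = (\<lambda>_ _. undefined), smult = (\<lambda>_ _. undefined), star = (\<lambda>_. undefined), cnorm = (\<lambda>_. 0)\<rparr>"

lemma trivial_cstar: "unital_cstar_algebra (trivial_cstar :: 'a cstar_alg)"
proof -
  let ?A = "trivial_cstar :: 'a cstar_alg"
  have ab: "abelian_group ?A"
    by (rule abelian_groupI) (simp_all add: trivial_cstar_def)
  have ring: "ring ?A"
    by (rule ringI[OF ab]) (auto simp: trivial_cstar_def intro!: monoidI)
  have mod: "Module.module complex_ring ?A"
    by (rule moduleI[OF cring_complex_ring ab]) (simp_all add: trivial_cstar_def)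
  have star: "unital_star_algebra ?A"
    by (intro unital_star_algebra.intro mod ring unital_star_algebra_axioms.intro)
      (simp_all add: trivial_cstar_def)
  have met: "Metric_space (carrier ?A) (cdist ?A)"
  proof
    show "cdist ?A x y = 0 \<longleftrightarrow> x = y" if "x \<in> carrier ?A" "y \<in> carrier ?A" for x y
      using that by (simp add: cdist_def trivial_cstar_def)
  qed (simp_all add: cdist_def trivial_cstar_def)
  show ?thesis
  proof (intro unital_cstar_algebra.intro star unital_cstar_algebra_axioms.intro)
    show "cstar_seminorm ?A (cnorm ?A)" by (simp add: cstar_seminorm_def trivial_cstar_def)
    show "x = \<zero>\<^bsub>?A\<^esub>" if "x \<in> carrier ?A" for x using that by (simp add: trivial_cstar_def)
    interpret M: Metric_space "carrier ?A" "cdist ?A" by (rule met)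
    show "M.mcomplete"
      unfolding M.mcomplete_def
    proof (intro allI impI exI)
      fix f assume f: "M.MCauchy f"
      then have "f n = undefined" for n using M.MCauchy_def[of f] by (auto simp: trivial_cstar_def)
      then show "limitin M.mtopology f undefined sequentially"
        unfolding M.limit_metric_sequentially by (simp add: cdist_def trivial_cstar_def)
    qed
  qed
qed

text \<open>A type may depend on the element type \<open>'a\<close> but not on the given algebra
  \<open>A\<close>; taking all structures on \<open>'a\<close> at once removes the
  dependence.\<close>

typedef 'a cstar_structure = "{A :: 'a cstar_alg. unital_cstar_algebra A}"
  morphisms struct_of Struct
  using trivial_cstar by blast

lemma struct_of_cstar: "unital_cstar_algebra (struct_of i)"
  using struct_of by blast

definition fam_ok :: "('a cstar_structure \<Rightarrow> 'a) \<Rightarrow> bool" where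
  "fam_ok F \<longleftrightarrow> (\<forall>i. F i \<in> carrier (struct_of i)) \<and>
    (\<exists>B. \<forall>i. cnorm (struct_of i) (F i) \<le> B)"

lemma fam_okI:
  "(\<And>i. F i \<in> carrier (struct_of i)) \<Longrightarrow> (\<And>i. cnorm (struct_of i) (F i) \<le> B) \<Longrightarrow> fam_ok F"
  unfolding fam_ok_def by blast

lemma fam_ok_zero: "fam_ok (\<lambda>i. \<zero>\<^bsub>struct_of i\<^esub>)"
proof (rule fam_okI[where B = 0])
  fix i
  interpret unital_cstar_algebra "struct_of i" by (rule struct_of_cstar)
  show "\<zero>\<^bsub>struct_of i\<^esub> \<in> carrier (struct_of i)" "cnorm (struct_of i) \<zero>\<^bsub>struct_of i\<^esub> \<le> 0"
    by simp_all
qed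

typedef 'a fam = "{F :: 'a cstar_structure \<Rightarrow> 'a. fam_ok F}"
  morphisms crd Fam
  using fam_ok_zero by blast

lemma crd_closed [simp]: "crd F i \<in> carrier (struct_of i)"
  using crd[of F] by (simp add: fam_ok_def)

lemma crd_bounded: "\<exists>B. \<forall>i. cnorm (struct_of i) (crd F i) \<le> B"
  using crd[of F] by (simp add: fam_ok_def)

lemma crd_Fam: "fam_ok F \<Longrightarrow> crd (Fam F) i = F i"
  by (simp add: Fam_inverse)

lemma fam_eqI: "(\<And>i. crd F i = crd H i) \<Longrightarrow> F = H"
proof -
  assume "\<And>i. crd F i = crd H i"
  then have "crd F = crd H" by (rule ext)
  then show "F = H" by (simp only: crd_inject)
qed

instantiation fam :: (type) "{real_normed_algebra, monoid_mult}"
begin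

definition zero_fam :: "'a fam" where "zero_fam = Fam (\<lambda>i. \<zero>\<^bsub>struct_of i\<^esub>)"
definition one_fam :: "'a fam" where "one_fam = Fam (\<lambda>i. \<one>\<^bsub>struct_of i\<^esub>)"
definition plus_fam :: "'a fam \<Rightarrow> 'a fam \<Rightarrow> 'a fam" where
  "plus_fam F H = Fam (\<lambda>i. crd F i \<oplus>\<^bsub>struct_of i\<^esub> crd H i)"
definition minus_fam :: "'a fam \<Rightarrow> 'a fam \<Rightarrow> 'a fam" where
  "minus_fam F H = Fam (\<lambda>i. crd F i \<ominus>\<^bsub>struct_of i\<^esub> crd H i)"
definition uminus_fam :: "'a fam \<Rightarrow> 'a fam" where
  "uminus_fam F = Fam (\<lambda>i. \<ominus>\<^bsub>struct_of i\<^esub> crd F i)"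
definition times_fam :: "'a fam \<Rightarrow> 'a fam \<Rightarrow> 'a fam" where
  "times_fam F H = Fam (\<lambda>i. crd F i \<otimes>\<^bsub>struct_of i\<^esub> crd H i)"
definition scaleR_fam :: "real \<Rightarrow> 'a fam \<Rightarrow> 'a fam" where
  "scaleR_fam r F = Fam (\<lambda>i. complex_of_real r \<odot>\<^bsub>struct_of i\<^esub> crd F i)"
definition norm_fam :: "'a fam \<Rightarrow> real" where
  "norm_fam F = (SUP i. cnorm (struct_of i) (crd F i))"
definition sgn_fam :: "'a fam \<Rightarrow> 'a fam" where "sgn_fam F = scaleR (inverse (norm F)) F"
definition dist_fam :: "'a fam \<Rightarrow> 'a fam \<Rightarrow> real" where "dist_fam F H = norm (F - H)"
definition uniformity_fam :: "('a fam \<times> 'a fam) filter" where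
  "uniformity_fam = (INF e\<in>{0<..}. principal {(x, y). dist x y < e})"
definition open_fam :: "'a fam set \<Rightarrow> bool" where
  "open_fam U = (\<forall>x\<in>U. \<forall>\<^sub>F (x', y) in uniformity. x' = x \<longrightarrow> y \<in> U)"

lemma cnorm_crd_le: "cnorm (struct_of i) (crd F i) \<le> norm F"
  unfolding norm_fam_def by (rule cSUP_upper) (use crd_bounded in \<open>auto simp: bdd_above_def\<close>)

lemma norm_fam_le: "(\<And>i. cnorm (struct_of i) (crd F i) \<le> B) \<Longrightarrow> norm F \<le> B"
  unfolding norm_fam_def by (rule cSUP_least) auto

lemma cnorm_one_le: "cnorm (struct_of i) \<one>\<^bsub>struct_of i\<^esub> \<le> 1"
proof -
  interpret unital_cstar_algebra "struct_of i" by (rule struct_of_cstar)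
  have "cnorm (struct_of i) \<one>\<^bsub>struct_of i\<^esub> = (cnorm (struct_of i) \<one>\<^bsub>struct_of i\<^esub>)\<^sup>2"
    using cnorm_star_mult[OF A.one_closed] by (simp add: star_one)
  then have "cnorm (struct_of i) \<one>\<^bsub>struct_of i\<^esub> * (cnorm (struct_of i) \<one>\<^bsub>struct_of i\<^esub> - 1) = 0"
    by (simp add: power2_eq_square algebra_simps)
  then show ?thesis unfolding mult_eq_0_iff by linarith
qed

lemma crd_simps [simp]:
  "crd 0 i = \<zero>\<^bsub>struct_of i\<^esub>" "crd 1 i = \<one>\<^bsub>struct_of i\<^esub>"
  "crd (F + H) i = crd F i \<oplus>\<^bsub>struct_of i\<^esub> crd H i"
  "crd (F - H) i = crd F i \<ominus>\<^bsub>struct_of i\<^esub> crd H i"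
  "crd (- F) i = \<ominus>\<^bsub>struct_of i\<^esub> crd F i"
  "crd (F * H) i = crd F i \<otimes>\<^bsub>struct_of i\<^esub> crd H i"
  "crd (r *\<^sub>R F) i = complex_of_real r \<odot>\<^bsub>struct_of i\<^esub> crd F i"
proof -
  show "crd 0 i = \<zero>\<^bsub>struct_of i\<^esub>" unfolding zero_fam_def by (rule crd_Fam[OF fam_ok_zero])
  show "crd 1 i = \<one>\<^bsub>struct_of i\<^esub>" unfolding one_fam_def
  proof (rule crd_Fam, rule fam_okI[where B = 1])
    fix i :: "'a cstar_structure"
    interpret unital_cstar_algebra "struct_of i" by (rule struct_of_cstar)
    show "\<one>\<^bsub>struct_of i\<^esub> \<in> carrier (struct_of i)" by simp
  qed (rule cnorm_one_le)
  show "crd (F + H) i = crd F i \<oplus>\<^bsub>struct_of i\<^esub> crd H i" unfolding plus_fam_def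
  proof (rule crd_Fam, rule fam_okI[where B = "norm F + norm H"])
    fix i :: "'a cstar_structure"
    interpret unital_cstar_algebra "struct_of i" by (rule struct_of_cstar)
    show "crd F i \<oplus>\<^bsub>struct_of i\<^esub> crd H i \<in> carrier (struct_of i)" by simp
    show "cnorm (struct_of i) (crd F i \<oplus>\<^bsub>struct_of i\<^esub> crd H i) \<le> norm F + norm H"
      using cnorm_triangle[of "crd F i" "crd H i"] cnorm_crd_le[of i F] cnorm_crd_le[of i H] by simp
  qed
  show "crd (F - H) i = crd F i \<ominus>\<^bsub>struct_of i\<^esub> crd H i" unfolding minus_fam_def
  proof (rule crd_Fam, rule fam_okI[where B = "norm F + norm H"])
    fix i :: "'a cstar_structure"
    interpret unital_cstar_algebra "struct_of i" by (rule struct_of_cstar)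
    show "crd F i \<ominus>\<^bsub>struct_of i\<^esub> crd H i \<in> carrier (struct_of i)" by simp
    show "cnorm (struct_of i) (crd F i \<ominus>\<^bsub>struct_of i\<^esub> crd H i) \<le> norm F + norm H"
      using cnorm_triangle[of "crd F i" "\<ominus>\<^bsub>struct_of i\<^esub> crd H i"] cnorm_crd_le[of i F] cnorm_crd_le[of i H]
      by (simp add: cnorm_minus M.minus_eq)
  qed
  show "crd (- F) i = \<ominus>\<^bsub>struct_of i\<^esub> crd F i" unfolding uminus_fam_def
  proof (rule crd_Fam, rule fam_okI[where B = "norm F"])
    fix i :: "'a cstar_structure"
    interpret unital_cstar_algebra "struct_of i" by (rule struct_of_cstar)
    show "\<ominus>\<^bsub>struct_of i\<^esub> crd F i \<in> carrier (struct_of i)" by simp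
    show "cnorm (struct_of i) (\<ominus>\<^bsub>struct_of i\<^esub> crd F i) \<le> norm F"
      using cnorm_crd_le[of i F] by (simp add: cnorm_minus)
  qed
  show "crd (F * H) i = crd F i \<otimes>\<^bsub>struct_of i\<^esub> crd H i" unfolding times_fam_def
  proof (rule crd_Fam, rule fam_okI[where B = "norm F * norm H"])
    fix i :: "'a cstar_structure"
    interpret unital_cstar_algebra "struct_of i" by (rule struct_of_cstar)
    show "crd F i \<otimes>\<^bsub>struct_of i\<^esub> crd H i \<in> carrier (struct_of i)" by simp
    have "cnorm (struct_of i) (crd F i) * cnorm (struct_of i) (crd H i) \<le> norm F * norm H"
      using cnorm_crd_le cnorm_nonneg order_trans[OF cnorm_nonneg cnorm_crd_le] by (intro mult_mono) auto
    then show "cnorm (struct_of i) (crd F i \<otimes>\<^bsub>struct_of i\<^esub> crd H i) \<le> norm F * norm H"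
      using cnorm_mult[of "crd F i" "crd H i"] by simp
  qed
  show "crd (r *\<^sub>R F) i = complex_of_real r \<odot>\<^bsub>struct_of i\<^esub> crd F i" unfolding scaleR_fam_def
  proof (rule crd_Fam, rule fam_okI[where B = "\<bar>r\<bar> * norm F"])
    fix i :: "'a cstar_structure"
    interpret unital_cstar_algebra "struct_of i" by (rule struct_of_cstar)
    show "complex_of_real r \<odot>\<^bsub>struct_of i\<^esub> crd F i \<in> carrier (struct_of i)" by simp
    show "cnorm (struct_of i) (complex_of_real r \<odot>\<^bsub>struct_of i\<^esub> crd F i) \<le> \<bar>r\<bar> * norm F"
      using cnorm_crd_le[of i F] by (simp add: cnorm_scale mult_left_mono)
  qed
qed

instance
proof
  fix F H K :: "'a fam" and r s :: real
  note S = struct_of_cstar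
  have u: "unital_star_algebra (struct_of i)" "ring (struct_of i)" "abelian_group (struct_of i)" for i :: "'a cstar_structure"
  proof -
    interpret unital_cstar_algebra "struct_of i" by (rule struct_of_cstar)
    show "unital_star_algebra (struct_of i)" "ring (struct_of i)" "abelian_group (struct_of i)"
      by unfold_locales
  qed
  show "F + H + K = F + (H + K)" "F + H = H + F" "0 + F = F" "- F + F = 0" "F - H = F + - H"
    by (rule fam_eqI, simp add: ring.ring_simprules[OF u(2)])+
  show "F * H * K = F * (H * K)" "(F + H) * K = F * K + H * K" "F * (H + K) = F * H + F * K" "1 * F = F" "F * 1 = F"
    by (rule fam_eqI, simp add: ring.ring_simprules[OF u(2)] monoid.m_assoc[OF ring.is_monoid[OF u(2)]]
      monoid.r_one[OF ring.is_monoid[OF u(2)]])+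
  show "r *\<^sub>R (F + H) = r *\<^sub>R F + r *\<^sub>R H" "(r + s) *\<^sub>R F = r *\<^sub>R F + s *\<^sub>R F"
    "r *\<^sub>R s *\<^sub>R F = (r * s) *\<^sub>R F" "1 *\<^sub>R F = F"
    by (rule fam_eqI, simp add: unital_star_algebra.scale_add_left[OF u(1)] unital_star_algebra.scale_add_right[OF u(1)]
      unital_star_algebra.scale_scale[OF u(1)] unital_star_algebra.scale_one[OF u(1)])+
  show "r *\<^sub>R F * H = r *\<^sub>R (F * H)" "F * r *\<^sub>R H = r *\<^sub>R (F * H)"
    by (rule fam_eqI, simp add: unital_star_algebra.smult_mult_left[OF u(1)] unital_star_algebra.smult_mult_right[OF u(1)])+
  show "dist F H = norm (F - H)" "sgn F = scaleR (inverse (norm F)) F"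
    by (simp_all only: dist_fam_def sgn_fam_def)
  show "uniformity = (INF e\<in>{0<..}. principal {(x, y :: 'a fam). dist x y < e})"
    by (rule uniformity_fam_def)
  show "open U = (\<forall>x\<in>U. \<forall>\<^sub>F (x', y) in uniformity. x' = x \<longrightarrow> y \<in> U)" for U :: "'a fam set"
    by (rule open_fam_def)
  have nn: "0 \<le> norm F" for F :: "'a fam"
    using unital_cstar_algebra.cnorm_nonneg[OF S crd_closed[of F]] cnorm_crd_le[of _ F] order_trans by blast
  show "(norm F = 0) = (F = 0)"
  proof
    assume n: "norm F = 0"
    show "F = 0"
    proof (rule fam_eqI)
      fix i :: "'a cstar_structure"
      interpret unital_cstar_algebra "struct_of i" by (rule struct_of_cstar)
      show "crd F i = crd 0 i"
        using cnorm_crd_le[of i F] cnorm_nonneg[of "crd F i"] n cnorm_eq_zero[of "crd F i"] by simp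
    qed
  next
    assume "F = 0"
    then have "norm F \<le> 0"
      by (intro norm_fam_le) (simp add: unital_cstar_algebra.cnorm_zero[OF S])
    then show "norm F = 0" using nn[of F] by simp
  qed
  show "norm (F + H) \<le> norm F + norm H"
  proof (rule norm_fam_le)
    fix i :: "'a cstar_structure"
    interpret unital_cstar_algebra "struct_of i" by (rule struct_of_cstar)
    show "cnorm (struct_of i) (crd (F + H) i) \<le> norm F + norm H"
      using cnorm_triangle[of "crd F i" "crd H i"] cnorm_crd_le[of i F] cnorm_crd_le[of i H] by simp
  qed
  have sc: "norm (r *\<^sub>R F) \<le> \<bar>r\<bar> * norm F" for r and F :: "'a fam"
  proof (rule norm_fam_le)
    fix i :: "'a cstar_structure"
    interpret unital_cstar_algebra "struct_of i" by (rule struct_of_cstar)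
    show "cnorm (struct_of i) (crd (r *\<^sub>R F) i) \<le> \<bar>r\<bar> * norm F"
      using cnorm_crd_le[of i F] by (simp add: cnorm_scale mult_left_mono)
  qed
  show "norm (r *\<^sub>R F) = \<bar>r\<bar> * norm F"
  proof (cases "r = 0")
    case True
    then show ?thesis using sc[of 0 F] nn[of "0 *\<^sub>R F"] by simp
  next
    case False
    have r1: "complex_of_real (inverse r) * complex_of_real r = 1" using False by simp
    have "inverse r *\<^sub>R r *\<^sub>R F = F"
    proof (rule fam_eqI)
      fix i :: "'a cstar_structure"
      interpret unital_cstar_algebra "struct_of i" by (rule struct_of_cstar)
      show "crd (inverse r *\<^sub>R r *\<^sub>R F) i = crd F i"
        unfolding crd_simps scale_scale[OF crd_closed] r1 by (rule scale_one) simp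
    qed
    then have "norm F = norm (inverse r *\<^sub>R r *\<^sub>R F)" by simp
    also have "\<dots> \<le> \<bar>inverse r\<bar> * norm (r *\<^sub>R F)" by (rule sc)
    finally have "\<bar>r\<bar> * norm F \<le> norm (r *\<^sub>R F)" using False by (simp add: field_simps)
    then show ?thesis using sc[of r F] by simp
  qed
  show "norm (F * H) \<le> norm F * norm H"
  proof (rule norm_fam_le)
    fix i :: "'a cstar_structure"
    interpret unital_cstar_algebra "struct_of i" by (rule struct_of_cstar)
    have "cnorm (struct_of i) (crd F i) * cnorm (struct_of i) (crd H i) \<le> norm F * norm H"
      using cnorm_crd_le cnorm_nonneg nn by (intro mult_mono) auto
    then show "cnorm (struct_of i) (crd (F * H) i) \<le> norm F * norm H"
      using cnorm_mult[of "crd F i" "crd H i"] by simp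
  qed
qed

end

instance fam :: (type) banach
proof
  fix X :: "nat \<Rightarrow> 'a fam" assume X: "Cauchy X"
  have XC: "\<exists>N. \<forall>m\<ge>N. \<forall>n\<ge>N. norm (X m - X n) < \<epsilon>" if "\<epsilon> > 0" for \<epsilon> :: real
    using X that unfolding Cauchy_def dist_norm by blast
  have crd_minus: "cnorm (struct_of i) (crd F i \<ominus>\<^bsub>struct_of i\<^esub> crd H i) \<le> norm (F - H)" for F H :: "'a fam" and i
    using cnorm_crd_le[of i "F - H"] by simp
  have "\<exists>l\<in>carrier (struct_of i). \<forall>\<epsilon>>0. \<exists>N. \<forall>n\<ge>N. cnorm (struct_of i) (crd (X n) i \<ominus>\<^bsub>struct_of i\<^esub> l) < \<epsilon>" for i
  proof (rule unital_cstar_algebra.cauchy_limit[OF struct_of_cstar crd_closed])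
    fix \<epsilon> :: real assume "\<epsilon> > 0"
    from XC[OF this] obtain N where "\<forall>m\<ge>N. \<forall>n\<ge>N. norm (X m - X n) < \<epsilon>" by blast
    then show "\<exists>N. \<forall>m\<ge>N. \<forall>n\<ge>N. cnorm (struct_of i) (crd (X m) i \<ominus>\<^bsub>struct_of i\<^esub> crd (X n) i) < \<epsilon>"
      using crd_minus le_less_trans by blast
  qed
  then obtain L where L: "\<And>i. L i \<in> carrier (struct_of i)"
    "\<And>i \<epsilon>. \<epsilon> > 0 \<Longrightarrow> \<exists>N. \<forall>n\<ge>N. cnorm (struct_of i) (crd (X n) i \<ominus>\<^bsub>struct_of i\<^esub> L i) < \<epsilon>"
    by metis
  have close: "cnorm (struct_of i) (crd (X n) i \<ominus>\<^bsub>struct_of i\<^esub> L i) \<le> \<epsilon>"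
    if N: "\<forall>m\<ge>N. \<forall>n\<ge>N. norm (X m - X n) < \<epsilon>" "n \<ge> N" for \<epsilon> :: real and N n i
  proof (rule field_le_epsilon)
    fix d :: real assume d: "d > 0"
    interpret unital_cstar_algebra "struct_of i" by (rule struct_of_cstar)
    obtain M where M: "\<forall>n\<ge>M. cnorm (struct_of i) (crd (X n) i \<ominus>\<^bsub>struct_of i\<^esub> L i) < d"
      using L(2)[OF d] by blast
    \<comment> \<open>\<open>M\<close> depends on \<open>i\<close> and \<open>d\<close>, but the
      bound obtained involves neither \<open>M\<close> nor \<open>i\<close>; so the limit is uniform
      over all structures.\<close>
    let ?k = "max M N"
    have "crd (X n) i \<ominus>\<^bsub>struct_of i\<^esub> L i =
        (crd (X n) i \<ominus>\<^bsub>struct_of i\<^esub> crd (X ?k) i) \<oplus>\<^bsub>struct_of i\<^esub> (crd (X ?k) i \<ominus>\<^bsub>struct_of i\<^esub> L i)"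
      by (rule minus_split) (simp_all add: L)
    then have "cnorm (struct_of i) (crd (X n) i \<ominus>\<^bsub>struct_of i\<^esub> L i)
        \<le> cnorm (struct_of i) (crd (X n) i \<ominus>\<^bsub>struct_of i\<^esub> crd (X ?k) i)
          + cnorm (struct_of i) (crd (X ?k) i \<ominus>\<^bsub>struct_of i\<^esub> L i)"
      using cnorm_triangle L(1) by simp
    also have "\<dots> \<le> \<epsilon> + d"
    proof (rule add_mono)
      have "norm (X n - X ?k) < \<epsilon>" using N by simp
      then show "cnorm (struct_of i) (crd (X n) i \<ominus>\<^bsub>struct_of i\<^esub> crd (X ?k) i) \<le> \<epsilon>"
        using crd_minus[of i "X n" "X ?k"] by linarith
      show "cnorm (struct_of i) (crd (X ?k) i \<ominus>\<^bsub>struct_of i\<^esub> L i) \<le> d"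
        using M by (simp add: less_imp_le)
    qed
    finally show "cnorm (struct_of i) (crd (X n) i \<ominus>\<^bsub>struct_of i\<^esub> L i) \<le> \<epsilon> + d" .
  qed
  obtain N1 where N1: "\<forall>m\<ge>N1. \<forall>n\<ge>N1. norm (X m - X n) < 1" using XC[of 1] by auto
  have ok: "fam_ok L"
  proof (rule fam_okI[OF L(1), where B = "norm (X N1) + 1"])
    fix i :: "'a cstar_structure"
    interpret unital_cstar_algebra "struct_of i" by (rule struct_of_cstar)
    have "L i = crd (X N1) i \<oplus>\<^bsub>struct_of i\<^esub> (L i \<ominus>\<^bsub>struct_of i\<^esub> crd (X N1) i)"
      using L(1)[of i] crd_closed[of "X N1" i] by (metis M.minus_eq M.a_comm M.a_inv_closed M.a_assoc M.l_neg M.r_zero)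
    then have "cnorm (struct_of i) (L i) \<le> cnorm (struct_of i) (crd (X N1) i)
        + cnorm (struct_of i) (L i \<ominus>\<^bsub>struct_of i\<^esub> crd (X N1) i)"
      using cnorm_triangle[of "crd (X N1) i" "L i \<ominus>\<^bsub>struct_of i\<^esub> crd (X N1) i"] L(1)[of i] by simp
    also have "cnorm (struct_of i) (L i \<ominus>\<^bsub>struct_of i\<^esub> crd (X N1) i) \<le> 1"
      using close[OF N1, of N1 i] cnorm_minus_commute[OF L(1) crd_closed, of "X N1"] by simp
    finally show "cnorm (struct_of i) (L i) \<le> norm (X N1) + 1"
      using cnorm_crd_le[of i "X N1"] by simp
  qed
  have "X \<longlonglongrightarrow> Fam L"
    unfolding lim_sequentially
  proof (intro allI impI)
    fix \<epsilon> :: real assume e: "\<epsilon> > 0"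
    obtain N where N: "\<forall>m\<ge>N. \<forall>n\<ge>N. norm (X m - X n) < \<epsilon> / 2" using XC[of "\<epsilon> / 2"] e by auto
    have "dist (X n) (Fam L) < \<epsilon>" if "n \<ge> N" for n
    proof -
      have "norm (X n - Fam L) \<le> \<epsilon> / 2"
        by (rule norm_fam_le, unfold crd_simps crd_Fam[OF ok], rule close[OF N that])
      then show ?thesis using e by (simp add: dist_norm)
    qed
    then show "\<exists>N. \<forall>n\<ge>N. dist (X n) (Fam L) < \<epsilon>" by blast
  qed
  then show "convergent X" by (auto simp: convergent_def)
qed

instantiation fam :: (type) cstar
begin

definition imu_fam :: "'a fam" where "imu_fam = Fam (\<lambda>i. \<i> \<odot>\<^bsub>struct_of i\<^esub> \<one>\<^bsub>struct_of i\<^esub>)"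
definition adj_fam :: "'a fam \<Rightarrow> 'a fam" where
  "adj_fam F = Fam (\<lambda>i. star (struct_of i) (crd F i))"

lemma crd_adj_imu [simp]:
  "crd (adj F) i = star (struct_of i) (crd F i)"
  "crd imu i = \<i> \<odot>\<^bsub>struct_of i\<^esub> \<one>\<^bsub>struct_of i\<^esub>"
proof -
  show "crd imu i = \<i> \<odot>\<^bsub>struct_of i\<^esub> \<one>\<^bsub>struct_of i\<^esub>" unfolding imu_fam_def
  proof (rule crd_Fam, rule fam_okI[where B = 1])
    fix i :: "'a cstar_structure"
    interpret unital_cstar_algebra "struct_of i" by (rule struct_of_cstar)
    show "\<i> \<odot>\<^bsub>struct_of i\<^esub> \<one>\<^bsub>struct_of i\<^esub> \<in> carrier (struct_of i)" by simp
    show "cnorm (struct_of i) (\<i> \<odot>\<^bsub>struct_of i\<^esub> \<one>\<^bsub>struct_of i\<^esub>) \<le> 1"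
      using cnorm_one_le by (simp add: cnorm_scale)
  qed
  show "crd (adj F) i = star (struct_of i) (crd F i)" unfolding adj_fam_def
  proof (rule crd_Fam, rule fam_okI[where B = "norm F"])
    fix i :: "'a cstar_structure"
    interpret unital_cstar_algebra "struct_of i" by (rule struct_of_cstar)
    show cl: "star (struct_of i) (crd F i) \<in> carrier (struct_of i)" by (simp add: star_closed)
    let ?n = "cnorm (struct_of i)"
    \<comment> \<open>The C*-identity for the adjoint bounds the square of its norm by the product
      of both norms, so the involution is contractive and the adjoint family stays bounded.\<close>
    have "(?n (star (struct_of i) (crd F i)))\<^sup>2 \<le> ?n (crd F i) * ?n (star (struct_of i) (crd F i))"
      using cnorm_star_mult[OF cl] cnorm_mult[of "crd F i" "star (struct_of i) (crd F i)"] cl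
      by (simp add: star_star)
    then have "?n (star (struct_of i) (crd F i)) \<le> ?n (crd F i)"
      using cnorm_nonneg[OF cl] cnorm_nonneg[of "crd F i"]
      by (simp add: power2_eq_square) (metis crd_closed cnorm_nonneg less_eq_real_def mult_le_cancel_right_pos)
    then show "?n (star (struct_of i) (crd F i)) \<le> norm F"
      using cnorm_crd_le[of i F] by simp
  qed
qed

instance
proof
  fix F H K :: "'a fam" and r s :: real
  note S = struct_of_cstar
  have u: "unital_star_algebra (struct_of i)" for i :: "'a cstar_structure"
    using struct_of_cstar[of i] by (simp add: unital_cstar_algebra_def)
  have nn: "0 \<le> norm F" by simp
  show "adj (adj F) = F" "adj (F + H) = adj F + adj H" "adj (F * H) = adj H * adj F"
    "adj (r *\<^sub>R F) = r *\<^sub>R adj F"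
    by (rule fam_eqI, simp add: unital_star_algebra.star_star[OF u] unital_star_algebra.star_add[OF u]
      unital_star_algebra.star_mult[OF u] unital_star_algebra.star_smult[OF u])+
  show "norm (adj F * F) = (norm F)\<^sup>2"
  proof (rule antisym)
    show "norm (adj F * F) \<le> (norm F)\<^sup>2"
    proof (rule norm_fam_le)
      fix i :: "'a cstar_structure"
      interpret unital_cstar_algebra "struct_of i" by (rule struct_of_cstar)
      show "cnorm (struct_of i) (crd (adj F * F) i) \<le> (norm F)\<^sup>2"
        using cnorm_star_mult[of "crd F i"] power_mono[OF cnorm_crd_le[of i F] cnorm_nonneg, of 2] by simp
    qed
    have "norm F \<le> sqrt (norm (adj F * F))"
    proof (rule norm_fam_le)
      fix i :: "'a cstar_structure"
      interpret unital_cstar_algebra "struct_of i" by (rule struct_of_cstar)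
      show "cnorm (struct_of i) (crd F i) \<le> sqrt (norm (adj F * F))"
        using cnorm_star_mult[of "crd F i"] cnorm_crd_le[of i "adj F * F"] by (intro real_le_rsqrt) simp
    qed
    then show "(norm F)\<^sup>2 \<le> norm (adj F * F)"
      using norm_ge_zero[of "adj F * F"] norm_ge_zero[of F] by (metis power_mono real_sqrt_pow2)
  qed
  show "imu * imu = (- 1 :: 'a fam)" "imu * F = F * imu" "adj imu = - (imu :: 'a fam)"
  proof -
    have "crd (imu * imu :: 'a fam) i = crd (- 1) i" "crd (imu * F) i = crd (F * imu) i"
      "crd (adj imu :: 'a fam) i = crd (- imu) i" for i
    proof -
      interpret unital_cstar_algebra "struct_of i" by (rule struct_of_cstar)
      show "crd (imu * imu :: 'a fam) i = crd (- 1) i"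
        by (simp add: smult_mult_left smult_mult_right scale_scale scale_minus_one)
      show "crd (imu * F) i = crd (F * imu) i"
        by (simp add: smult_mult_left smult_mult_right)
      show "crd (adj imu :: 'a fam) i = crd (- imu) i"
        by (simp add: star_smult star_one scale_minus_one[symmetric] scale_scale)
    qed
    then show "imu * imu = (- 1 :: 'a fam)" "imu * F = F * imu" "adj imu = - (imu :: 'a fam)"
      by (auto intro: fam_eqI)
  qed
qed

end

section \<open>Matrices acting on Hilbert modules\<close>

lemma pos_sum: "(\<And>s. s \<in> J \<Longrightarrow> pos (f s :: 'b::cstar)) \<Longrightarrow> pos (sum f J)"
  by (induction J rule: infinite_finite_induct) (simp_all add: pos_add)

text \<open>The roots of \<open>x\<close> and of \<open>t - x\<close> commute and their squares sum
  to \<open>t\<close>; after rescaling, \<open>norm_le_1_of_sum_squares\<close> bounds the root of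
  \<open>x\<close>.\<close>

lemma norm_le_of_pos_scalar_minus:
  fixes x :: "'b::cstar"
  assumes x: "pos x" and p: "pos (t *\<^sub>R 1 - x)" and t: "0 \<le> t"
  shows "norm x \<le> t"
proof -
  obtain g where g: "pos g" "g * g = x" "\<And>c. c * x = x * c \<Longrightarrow> c * g = g * c"
    using pos_sqrt[OF x] by blast
  obtain m where m: "pos m" "m * m = t *\<^sub>R 1 - x"
      "\<And>c. c * (t *\<^sub>R 1 - x) = (t *\<^sub>R 1 - x) * c \<Longrightarrow> c * m = m * c"
    using pos_sqrt[OF p] by blast
  have "g * x = x * g" by (simp add: g(2)[symmetric] mult.assoc)
  then have gm: "g * m = m * g" by (intro m(3)) (simp add: algebra_simps)
  show ?thesis
  proof (cases "t = 0")
    case True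
    then have "pos (- x)" using p by simp
    then show ?thesis using pos_neg_eq_0[OF x] True by simp
  next
    case False
    then have t: "t > 0" using t by simp
    have "norm ((1 / sqrt t) *\<^sub>R g) \<le> 1"
    proof (rule norm_le_1_of_sum_squares[where m="(1 / sqrt t) *\<^sub>R m"])
      show "(1 / sqrt t) *\<^sub>R g * (1 / sqrt t) *\<^sub>R g + (1 / sqrt t) *\<^sub>R m * (1 / sqrt t) *\<^sub>R m = 1"
        using t by (simp add: g(2) m(2) scaleR_add_right[symmetric])
    qed (use pos_sa[OF g(1)] pos_sa[OF m(1)] gm in auto)
    then have "norm g \<le> sqrt t" using t by simp
    then have "(norm g)\<^sup>2 \<le> t" using t by (metis norm_ge_zero power_mono real_sqrt_pow2 less_imp_le)
    then show ?thesis using norm_mult_self[OF pos_sa[OF g(1)]] g(2) by simp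
  qed
qed

lemma pos_scalar_minus:
  fixes x :: "'b::cstar"
  assumes "pos x" "norm x \<le> t"
  shows "pos (t *\<^sub>R 1 - x)"
  by (rule pos_of_near_scalar[OF pos_sa]) (rule assms)+

lemma norm_mono_pos:
  fixes x y :: "'b::cstar"
  assumes x: "pos x" and yx: "pos (y - x)"
  shows "norm x \<le> norm y"
proof (rule norm_le_of_pos_scalar_minus[OF x _ norm_ge_zero])
  have "pos y" using pos_add[OF x yx] by simp
  from pos_add[OF pos_scalar_minus[OF this order_refl] yx]
  show "pos (norm y *\<^sub>R 1 - x)" by simp
qed

lemma pos_conj:
  fixes x :: "'b::cstar"
  assumes "pos x"
  shows "pos (adj c * x * c)"
proof -
  obtain g where g: "pos g" "g * g = x" using pos_sqrt assms by blast
  have "adj (g * c) * (g * c) = adj c * x * c"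
    using pos_sa[OF g(1)] by (simp add: adj_mult sa_def g(2)[symmetric] mult.assoc)
  then show ?thesis using pos_adj_mult by metis
qed

lemma adj_sum: "adj (sum f J) = (\<Sum>s\<in>J. adj (f s :: 'b::cstar))"
  by (induction J rule: infinite_finite_induct) (simp_all add: adj_add)

section \<open>Inner products with values in the algebra, and operator norms\<close>

definition ip :: "'i set \<Rightarrow> ('i \<Rightarrow> 'b::cstar) \<Rightarrow> ('i \<Rightarrow> 'b) \<Rightarrow> 'b" where
  "ip J \<xi> \<eta> = (\<Sum>s\<in>J. adj (\<xi> s) * \<eta> s)"

definition hnorm :: "'i set \<Rightarrow> ('i \<Rightarrow> 'b::cstar) \<Rightarrow> real" where
  "hnorm J \<xi> = sqrt (norm (ip J \<xi> \<xi>))"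

lemma adj_ip: "adj (ip J \<xi> \<eta>) = ip J \<eta> \<xi>"
  by (simp add: ip_def adj_sum adj_mult)

lemma pos_ip: "pos (ip J \<xi> \<xi>)"
  unfolding ip_def by (rule pos_sum) (rule pos_adj_mult)

lemma hnorm_nonneg [simp]: "0 \<le> hnorm J \<xi>"
  by (simp add: hnorm_def)

lemma hnorm_square: "(hnorm J \<xi>)\<^sup>2 = norm (ip J \<xi> \<xi>)"
  by (simp add: hnorm_def)

lemma ip_add_right: "ip J \<xi> (\<lambda>s. \<eta> s + \<zeta> s) = ip J \<xi> \<eta> + ip J \<xi> \<zeta>"
  by (simp add: ip_def distrib_left sum.distrib)

lemma ip_add_left: "ip J (\<lambda>s. \<eta> s + \<zeta> s) \<xi> = ip J \<eta> \<xi> + ip J \<zeta> \<xi>"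
  by (simp add: ip_def distrib_right adj_add sum.distrib)

lemma ip_mult_right: "ip J \<xi> (\<lambda>s. \<eta> s * c) = ip J \<xi> \<eta> * c"
  by (simp add: ip_def sum_distrib_right mult.assoc)

lemma ip_mult_left: "ip J (\<lambda>s. \<eta> s * c) \<xi> = adj c * ip J \<eta> \<xi>"
  by (simp add: ip_def sum_distrib_left adj_mult mult.assoc)

lemma ip_scaleR_right: "ip J \<xi> (\<lambda>s. r *\<^sub>R \<eta> s) = r *\<^sub>R ip J \<xi> \<eta>"
  by (simp add: ip_def scaleR_sum_right)

lemma ip_scaleR_left: "ip J (\<lambda>s. r *\<^sub>R \<eta> s) \<xi> = r *\<^sub>R ip J \<eta> \<xi>"
  by (simp add: ip_def scaleR_sum_right)

lemma hnorm_scaleR: "hnorm J (\<lambda>s. r *\<^sub>R \<xi> s) = \<bar>r\<bar> * hnorm J \<xi>"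
  by (simp add: hnorm_def ip_scaleR_left ip_scaleR_right real_sqrt_mult abs_mult[symmetric])

text \<open>The quadratic argument with coefficients in the algebra: \<open>\<xi>\<close> is
  multiplied by \<open>b\<close> on the right, and a real \<open>t\<close> above the norm of
  \<open>ip J \<xi> \<xi>\<close> replaces that element. Positivity of
  \<open>ip J \<zeta> \<zeta>\<close> then gives
  \<open>adj b * b \<le> t *\<^sub>R ip J \<eta> \<eta>\<close> in the order of the algebra, and
  \<open>t\<close> approaches the norm.\<close>

lemma cauchy_schwarz: "norm (ip J \<xi> \<eta>) \<le> hnorm J \<xi> * hnorm J (\<eta> :: 'i \<Rightarrow> 'b::cstar)"
proof -
  define b where "b = ip J \<xi> \<eta>"
  define r N where "r = norm (ip J \<xi> \<xi>)" and "N = norm (ip J \<eta> \<eta>)"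
  have main: "(norm b)\<^sup>2 \<le> t * N" if t: "t > 0" "r \<le> t" for t
  proof -
    define \<zeta> where "\<zeta> = (\<lambda>s. \<xi> s * b + (- t) *\<^sub>R \<eta> s)"
    have b': "ip J \<eta> \<xi> = adj b" by (simp add: b_def adj_ip)
    have eq1: "ip J \<zeta> \<zeta> = adj b * ip J \<xi> \<xi> * b - t *\<^sub>R (adj b * b) - t *\<^sub>R (adj b * b) + (t * t) *\<^sub>R ip J \<eta> \<eta>"
      unfolding \<zeta>_def ip_add_left ip_add_right ip_mult_left ip_mult_right ip_scaleR_left ip_scaleR_right
        b_def[symmetric] b'
      by (simp add: algebra_simps)
    have eq2: "ip J \<zeta> \<zeta> + adj b * (t *\<^sub>R 1 - ip J \<xi> \<xi>) * b = (t * t) *\<^sub>R ip J \<eta> \<eta> - t *\<^sub>R (adj b * b)"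
      unfolding eq1 by (simp add: algebra_simps)
    have "pos (adj b * (t *\<^sub>R 1 - ip J \<xi> \<xi>) * b)"
      using t by (intro pos_conj pos_scalar_minus pos_ip) (simp add: r_def)
    from pos_add[OF pos_ip[of J \<zeta>] this]
    have "pos ((t * t) *\<^sub>R ip J \<eta> \<eta> - t *\<^sub>R (adj b * b))" unfolding eq2 .
    then have "pos ((1 / t) *\<^sub>R ((t * t) *\<^sub>R ip J \<eta> \<eta> - t *\<^sub>R (adj b * b)))"
      using t by (intro pos_scaleR) simp_all
    then have "pos (t *\<^sub>R ip J \<eta> \<eta> - adj b * b)"
      using t by (simp add: scaleR_right_diff_distrib)
    then have "norm (adj b * b) \<le> norm (t *\<^sub>R ip J \<eta> \<eta>)" by (rule norm_mono_pos[OF pos_adj_mult])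
    then show ?thesis using t by (simp add: norm_adj_mult N_def)
  qed
  have "(norm b)\<^sup>2 \<le> r * N"
  proof (rule field_le_epsilon)
    fix d :: real assume d: "d > 0"
    have N0: "N \<ge> 0" "r \<ge> 0" by (simp_all add: N_def r_def)
    have "(norm b)\<^sup>2 \<le> (r + d / (N + 1)) * N" using main[of "r + d / (N + 1)"] d N0 by (simp add: add_nonneg_pos)
    also have "\<dots> \<le> r * N + d"
    proof -
      have "d / (N + 1) * N \<le> d" using d N0 by (simp add: field_simps)
      then show ?thesis by (simp add: distrib_right)
    qed
    finally show "(norm b)\<^sup>2 \<le> r * N + d" .
  qed
  then have "(norm b)\<^sup>2 \<le> (hnorm J \<xi> * hnorm J \<eta>)\<^sup>2"
    by (simp add: power_mult_distrib hnorm_square r_def N_def)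
  then show ?thesis unfolding b_def by (rule power2_le_imp_le) simp
qed

lemma hnorm_add: "hnorm J (\<lambda>s. \<xi> s + \<eta> s) \<le> hnorm J \<xi> + hnorm J (\<eta> :: 'i \<Rightarrow> 'b::cstar)"
proof (rule power2_le_imp_le)
  have "(hnorm J (\<lambda>s. \<xi> s + \<eta> s))\<^sup>2 = norm (ip J \<xi> \<xi> + ip J \<xi> \<eta> + (ip J \<eta> \<xi> + ip J \<eta> \<eta>))"
    by (simp add: hnorm_square ip_add_left ip_add_right algebra_simps)
  also have "\<dots> \<le> norm (ip J \<xi> \<xi>) + norm (ip J \<xi> \<eta>) + (norm (ip J \<eta> \<xi>) + norm (ip J \<eta> \<eta>))"
    by (intro order_trans[OF norm_triangle_ineq] add_mono norm_triangle_ineq)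
  also have "\<dots> \<le> (hnorm J \<xi>)\<^sup>2 + hnorm J \<xi> * hnorm J \<eta> + (hnorm J \<eta> * hnorm J \<xi> + (hnorm J \<eta>)\<^sup>2)"
    by (intro add_mono cauchy_schwarz) (simp_all add: hnorm_square)
  also have "\<dots> = (hnorm J \<xi> + hnorm J \<eta>)\<^sup>2" by (simp add: power2_eq_square algebra_simps)
  finally show "(hnorm J (\<lambda>s. \<xi> s + \<eta> s))\<^sup>2 \<le> (hnorm J \<xi> + hnorm J \<eta>)\<^sup>2" .
qed simp

definition mv :: "'i set \<Rightarrow> ('i \<Rightarrow> 'i \<Rightarrow> 'b::cstar) \<Rightarrow> ('i \<Rightarrow> 'b) \<Rightarrow> 'i \<Rightarrow> 'b" where
  "mv J a \<xi> s = (\<Sum>t\<in>J. a s t * \<xi> t)"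

definition opnorm :: "'i set \<Rightarrow> ('i \<Rightarrow> 'i \<Rightarrow> 'b::cstar) \<Rightarrow> real" where
  "opnorm J a = (SUP \<xi>\<in>{\<xi>. hnorm J \<xi> \<le> 1}. hnorm J (mv J a \<xi>))"

text \<open>The supremum in \<open>opnorm\<close> means nothing for an unbounded set, so a bound is
  carried along explicitly; \<open>opnorm_bounded\<close> turns any bound into the optimal
  one.\<close>

definition op_bounded :: "'i set \<Rightarrow> ('i \<Rightarrow> 'i \<Rightarrow> 'b::cstar) \<Rightarrow> real \<Rightarrow> bool" where
  "op_bounded J a C \<longleftrightarrow> 0 \<le> C \<and> (\<forall>\<xi>. hnorm J (mv J a \<xi>) \<le> C * hnorm J \<xi>)"

lemma hnorm_zero: "hnorm J (\<lambda>_. 0) = 0"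
  by (simp add: hnorm_def ip_def)

lemma opnorm_le:
  assumes "op_bounded J a C"
  shows "opnorm J a \<le> C"
  unfolding opnorm_def
proof (rule cSUP_least)
  show "{\<xi>. hnorm J \<xi> \<le> 1} \<noteq> {}" using hnorm_zero[of J] by (metis (mono_tags) empty_iff mem_Collect_eq zero_le_one)
  fix \<xi> :: "'a \<Rightarrow> 'b" assume "\<xi> \<in> {\<xi>. hnorm J \<xi> \<le> 1}"
  then have "C * hnorm J \<xi> \<le> C * 1" using assms by (intro mult_left_mono) (auto simp: op_bounded_def)
  then show "hnorm J (mv J a \<xi>) \<le> C" using assms unfolding op_bounded_def by (metis mult_1_right order_trans)
qed

lemma opnorm_bounded:
  assumes b: "op_bounded J a C"
  shows "op_bounded J a (opnorm J a)"
proof -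
  have upper: "hnorm J (mv J a \<xi>) \<le> opnorm J a" if "hnorm J \<xi> \<le> 1" for \<xi>
    unfolding opnorm_def
  proof (rule cSUP_upper)
    show "bdd_above ((\<lambda>\<xi>. hnorm J (mv J a \<xi>)) ` {\<xi>. hnorm J \<xi> \<le> 1})"
    proof (rule bdd_aboveI2)
      fix \<xi> :: "'a \<Rightarrow> 'b" assume "\<xi> \<in> {\<xi>. hnorm J \<xi> \<le> 1}"
      then have "C * hnorm J \<xi> \<le> C * 1" using b by (intro mult_left_mono) (auto simp: op_bounded_def)
      then show "hnorm J (mv J a \<xi>) \<le> C" using b unfolding op_bounded_def by (metis mult_1_right order_trans)
    qed
  qed (use that in simp)
  show ?thesis
    unfolding op_bounded_def
  proof (intro conjI allI)
    have "hnorm J (mv J a (\<lambda>_. 0)) \<le> opnorm J a" by (rule upper) (simp add: hnorm_zero)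
    with hnorm_nonneg show "0 \<le> opnorm J a" by (rule order_trans)
    fix \<xi> :: "'a \<Rightarrow> 'b"
    show "hnorm J (mv J a \<xi>) \<le> opnorm J a * hnorm J \<xi>"
    proof (cases "hnorm J \<xi> = 0")
      \<comment> \<open>A vector of length 0 cannot be normalised; the assumed bound
        \<open>C\<close> settles it.\<close>
      case True
      then show ?thesis using b by (auto simp: op_bounded_def dest: spec[of _ \<xi>])
    next
      case False
      define r where "r = hnorm J \<xi>"
      have r: "r > 0" using False by (simp add: r_def less_le)
      have "hnorm J (\<lambda>s. (1 / r) *\<^sub>R \<xi> s) \<le> 1" using r unfolding hnorm_scaleR r_def[symmetric] by simp
      from upper[OF this]
      have 1: "hnorm J (mv J a (\<lambda>s. (1 / r) *\<^sub>R \<xi> s)) \<le> opnorm J a" .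
      have 2: "mv J a (\<lambda>s. (1 / r) *\<^sub>R \<xi> s) = (\<lambda>s. (1 / r) *\<^sub>R mv J a \<xi> s)"
        by (rule ext) (simp add: mv_def scaleR_sum_right)
      have "(1 / r) * hnorm J (mv J a \<xi>) \<le> opnorm J a"
        using 1 r unfolding 2 hnorm_scaleR by simp
      then show ?thesis using r by (simp add: field_simps r_def[symmetric])
    qed
  qed
qed

lemma op_bounded_add:
  assumes "op_bounded J a C" "op_bounded J b D"
  shows "op_bounded J (\<lambda>s t. a s t + b s t) (C + D)"
  unfolding op_bounded_def
proof (intro conjI allI)
  show "0 \<le> C + D" using assms by (simp add: op_bounded_def)
  fix \<xi>
  have "mv J (\<lambda>s t. a s t + b s t) \<xi> = (\<lambda>s. mv J a \<xi> s + mv J b \<xi> s)"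
    by (rule ext) (simp add: mv_def distrib_right sum.distrib)
  then have "hnorm J (mv J (\<lambda>s t. a s t + b s t) \<xi>) \<le> hnorm J (mv J a \<xi>) + hnorm J (mv J b \<xi>)"
    using hnorm_add by simp
  also have "\<dots> \<le> C * hnorm J \<xi> + D * hnorm J \<xi>"
    using assms by (intro add_mono) (simp_all add: op_bounded_def)
  finally show "hnorm J (mv J (\<lambda>s t. a s t + b s t) \<xi>) \<le> (C + D) * hnorm J \<xi>" by (simp add: distrib_right)
qed

lemma mv_mult: "mv J (\<lambda>s t. \<Sum>u\<in>J. a s u * b u t) \<xi> = mv J a (mv J b \<xi>)"
proof (rule ext)
  fix s
  have "(\<Sum>t\<in>J. (\<Sum>u\<in>J. a s u * b u t) * \<xi> t) = (\<Sum>t\<in>J. \<Sum>u\<in>J. a s u * b u t * \<xi> t)"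
    by (simp only: sum_distrib_right)
  also have "\<dots> = (\<Sum>u\<in>J. \<Sum>t\<in>J. a s u * b u t * \<xi> t)" by (rule sum.swap)
  finally show "mv J (\<lambda>s t. \<Sum>u\<in>J. a s u * b u t) \<xi> s = mv J a (mv J b \<xi>) s"
    by (simp add: mv_def sum_distrib_left mult.assoc)
qed

lemma op_bounded_mult:
  assumes "op_bounded J a C" "op_bounded J b D"
  shows "op_bounded J (\<lambda>s t. \<Sum>u\<in>J. a s u * b u t) (C * D)"
  unfolding op_bounded_def mv_mult
proof (intro conjI allI)
  show "0 \<le> C * D" using assms by (simp add: op_bounded_def)
  fix \<xi>
  have "hnorm J (mv J a (mv J b \<xi>)) \<le> C * hnorm J (mv J b \<xi>)" using assms by (simp add: op_bounded_def)
  also have "\<dots> \<le> C * (D * hnorm J \<xi>)" using assms by (intro mult_left_mono) (simp_all add: op_bounded_def)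
  finally show "hnorm J (mv J a (mv J b \<xi>)) \<le> C * D * hnorm J \<xi>" by (simp add: mult.assoc)
qed

lemma ip_mv: "ip J (mv J a \<xi>) \<eta> = ip J \<xi> (mv J (\<lambda>s t. adj (a t s)) \<eta>)"
proof -
  have "ip J (mv J a \<xi>) \<eta> = (\<Sum>s\<in>J. \<Sum>t\<in>J. adj (\<xi> t) * adj (a s t) * \<eta> s)"
    by (simp add: ip_def mv_def adj_sum adj_mult sum_distrib_right)
  also have "\<dots> = (\<Sum>t\<in>J. \<Sum>s\<in>J. adj (\<xi> t) * adj (a s t) * \<eta> s)" by (rule sum.swap)
  finally show ?thesis by (simp add: ip_def mv_def sum_distrib_left mult.assoc)
qed

text \<open>The Cauchy-Schwarz inequality gives the lower bound \<open>le\<close>. Applied to the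
  adjoint matrix and combined with submultiplicativity, it shows that the adjoint has no larger
  norm, which yields the upper bound.\<close>

lemma opnorm_adj_mult:
  assumes a: "op_bounded J a C" and a': "op_bounded J (\<lambda>s t. adj (a t s)) D"
  shows "opnorm J (\<lambda>s t. \<Sum>u\<in>J. adj (a u s) * a u t) = (opnorm J a)\<^sup>2"
proof -
  have le: "(opnorm J a)\<^sup>2 \<le> opnorm J (\<lambda>s t. \<Sum>u\<in>J. adj (a u s) * a u t)"
    if a: "op_bounded J a C" and a': "op_bounded J (\<lambda>s t. adj (a t s)) D"
    for a :: "'a \<Rightarrow> 'a \<Rightarrow> 'b" and C D
  proof -
    let ?m = "\<lambda>s t. \<Sum>u\<in>J. adj (a u s) * a u t"
    have bm: "op_bounded J ?m (opnorm J ?m)" by (rule opnorm_bounded[OF op_bounded_mult[OF a' a]])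
    then have m0: "0 \<le> opnorm J ?m" by (simp add: op_bounded_def)
    have "op_bounded J a (sqrt (opnorm J ?m))"
      unfolding op_bounded_def
    proof (intro conjI allI)
      show "0 \<le> sqrt (opnorm J ?m)" using m0 by simp
      fix \<xi>
      have "(hnorm J (mv J a \<xi>))\<^sup>2 = norm (ip J \<xi> (mv J ?m \<xi>))"
        by (simp add: hnorm_square ip_mv mv_mult)
      also have "\<dots> \<le> hnorm J \<xi> * hnorm J (mv J ?m \<xi>)" by (rule cauchy_schwarz)
      also have "\<dots> \<le> hnorm J \<xi> * (opnorm J ?m * hnorm J \<xi>)"
        using bm by (intro mult_left_mono) (simp_all add: op_bounded_def)
      also have "\<dots> = (sqrt (opnorm J ?m) * hnorm J \<xi>)\<^sup>2"
        using m0 by (simp add: power_mult_distrib power2_eq_square[of "hnorm J \<xi>"] mult_ac)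
      finally show "hnorm J (mv J a \<xi>) \<le> sqrt (opnorm J ?m) * hnorm J \<xi>"
        by (rule power2_le_imp_le) (simp add: m0)
    qed
    from opnorm_le[OF this] have "opnorm J a \<le> sqrt (opnorm J ?m)" .
    moreover have "0 \<le> opnorm J a" using opnorm_bounded[OF a] by (simp add: op_bounded_def)
    ultimately have "(opnorm J a)\<^sup>2 \<le> (sqrt (opnorm J ?m))\<^sup>2" by (rule power_mono)
    then show ?thesis using m0 by simp
  qed
  have mult: "opnorm J (\<lambda>s t. \<Sum>u\<in>J. adj (a u s) * a u t) \<le> opnorm J (\<lambda>s t. adj (a t s)) * opnorm J a"
    by (rule opnorm_le[OF op_bounded_mult[OF opnorm_bounded[OF a'] opnorm_bounded[OF a]]])
  have mult': "opnorm J (\<lambda>s t. \<Sum>u\<in>J. adj (adj (a s u)) * adj (a t u)) \<le> opnorm J a * opnorm J (\<lambda>s t. adj (a t s))"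
    using opnorm_le[OF op_bounded_mult[OF opnorm_bounded[OF a] opnorm_bounded[OF a']]] by simp
  have n: "0 \<le> opnorm J a" "0 \<le> opnorm J (\<lambda>s t. adj (a t s))"
    using opnorm_bounded[OF a] opnorm_bounded[OF a'] by (simp_all add: op_bounded_def)
  have "(opnorm J (\<lambda>s t. adj (a t s)))\<^sup>2 \<le> opnorm J a * opnorm J (\<lambda>s t. adj (a t s))"
    using le[OF a', of C] a mult' by simp
  then have "opnorm J (\<lambda>s t. adj (a t s)) \<le> opnorm J a"
    using n unfolding power2_eq_square by (cases "opnorm J (\<lambda>s t. adj (a t s)) = 0") (simp_all add: mult_le_cancel_right)
  then have "opnorm J (\<lambda>s t. adj (a t s)) * opnorm J a \<le> (opnorm J a)\<^sup>2"
    using n unfolding power2_eq_square by (intro mult_right_mono) simp_all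
  with mult le[OF a a'] show ?thesis by linarith
qed

section \<open>Embedding an algebra as a corner\<close>

context unital_cstar_algebra
begin

definition idx :: "'a cstar_structure" where "idx = Struct A"

lemma struct_idx [simp]: "struct_of idx = A"
  unfolding idx_def by (rule Struct_inverse) (simp add: unital_cstar_algebra_axioms)

definition inc :: "'a \<Rightarrow> 'a fam" where
  "inc x = Fam (\<lambda>i. if i = idx then x else \<zero>\<^bsub>struct_of i\<^esub>)"

definition out :: "'a fam \<Rightarrow> 'a" where "out F = crd F idx"

definition unit :: "'a fam" where "unit = inc \<one>\<^bsub>A\<^esub>"

lemma struct_zero:
  "\<zero>\<^bsub>struct_of i\<^esub> \<in> carrier (struct_of i)" "cnorm (struct_of i) \<zero>\<^bsub>struct_of i\<^esub> = 0"
proof -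
  interpret C: unital_cstar_algebra "struct_of i" by (rule struct_of_cstar)
  show "\<zero>\<^bsub>struct_of i\<^esub> \<in> carrier (struct_of i)" "cnorm (struct_of i) \<zero>\<^bsub>struct_of i\<^esub> = 0" by simp_all
qed

lemma crd_inc:
  assumes "x \<in> carrier A"
  shows "crd (inc x) i = (if i = idx then x else \<zero>\<^bsub>struct_of i\<^esub>)"
  unfolding inc_def
proof (rule crd_Fam, rule fam_okI[where B = "cnorm A x"])
  show "(if j = idx then x else \<zero>\<^bsub>struct_of j\<^esub>) \<in> carrier (struct_of j)" for j
    using assms by (simp add: struct_zero)
  show "cnorm (struct_of j) (if j = idx then x else \<zero>\<^bsub>struct_of j\<^esub>) \<le> cnorm A x" for j
    using assms by (simp add: struct_zero cnorm_nonneg)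
qed

lemma out_closed [simp]: "out F \<in> carrier A"
  using crd_closed[of F idx] by (simp add: out_def)

lemma out_inc [simp]: "x \<in> carrier A \<Longrightarrow> out (inc x) = x"
  by (simp add: out_def crd_inc)

lemma out_simps [simp]:
  "out 0 = \<zero>\<^bsub>A\<^esub>" "out 1 = \<one>\<^bsub>A\<^esub>" "out (F + H) = out F \<oplus>\<^bsub>A\<^esub> out H" "out (F - H) = out F \<ominus>\<^bsub>A\<^esub> out H"
  "out (F * H) = out F \<otimes>\<^bsub>A\<^esub> out H" "out (r *\<^sub>R F) = complex_of_real r \<odot>\<^bsub>A\<^esub> out F"
  "out (adj F) = star A (out F)" "out imu = \<i> \<odot>\<^bsub>A\<^esub> \<one>\<^bsub>A\<^esub>"
  by (simp_all add: out_def)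

lemma unit_mult: "unit * F = inc (out F)" "F * unit = inc (out F)"
proof -
  have "crd (unit * F) i = crd (inc (out F)) i \<and> crd (F * unit) i = crd (inc (out F)) i" for i
  proof -
    interpret C: unital_cstar_algebra "struct_of i" by (rule struct_of_cstar)
    have F: "crd F idx \<in> carrier A" "crd F i \<in> carrier (struct_of i)"
      using out_closed[of F] by (simp_all add: out_def)
    then show ?thesis by (auto simp: unit_def crd_inc out_def)
  qed
  then show "unit * F = inc (out F)" "F * unit = inc (out F)" by (auto intro: fam_eqI)
qed

lemma unit_central: "unit * F = F * unit"
  by (simp add: unit_mult)

lemma unit_inc [simp]: "x \<in> carrier A \<Longrightarrow> unit * inc x = inc x"
  by (simp add: unit_mult)

lemma unit_eq_iff: "unit * F = F \<longleftrightarrow> inc (out F) = F"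
  by (simp add: unit_mult)

lemma corner_eqI: "unit * F = F \<Longrightarrow> unit * H = H \<Longrightarrow> out F = out H \<Longrightarrow> F = H"
  by (metis unit_mult(1))

lemma unit_closed:
  assumes "unit * F = F"
  shows "unit * (F * H) = F * H" "unit * (H * F) = H * F" "unit * (r *\<^sub>R F) = r *\<^sub>R F"
    "unit * H = H \<Longrightarrow> unit * (F + H) = F + H" "unit * H = H \<Longrightarrow> unit * (F - H) = F - H"
proof -
  show "unit * (F * H) = F * H" by (simp only: mult.assoc[symmetric] assms)
  show "unit * (H * F) = H * F"
    unfolding unit_central[of "H * F"] mult.assoc unit_central[of F, symmetric] assms ..
qed (simp_all add: assms distrib_left right_diff_distrib)

lemma unit_unit [simp]: "unit * unit = unit"
  by (simp add: unit_def unit_inc[unfolded unit_def])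

lemma adj_unit [simp]: "adj unit = unit"
proof -
  have "crd (adj unit) i = crd unit i" for i
  proof -
    interpret C: unital_cstar_algebra "struct_of i" by (rule struct_of_cstar)
    have "star (struct_of i) \<zero>\<^bsub>struct_of i\<^esub> = \<zero>\<^bsub>struct_of i\<^esub>"
      using C.star_smult[of "\<zero>\<^bsub>struct_of i\<^esub>" 0] C.scale_zero_left[of "\<zero>\<^bsub>struct_of i\<^esub>"]
        C.scale_zero_left[of "star (struct_of i) \<zero>\<^bsub>struct_of i\<^esub>"] C.star_closed[of "\<zero>\<^bsub>struct_of i\<^esub>"] by simp
    then show ?thesis by (auto simp: unit_def crd_inc star_one)
  qed
  then show ?thesis by (rule fam_eqI)
qed

lemma proj_unit: "proj unit"
  by (simp add: proj_def)

lemma inc_simps: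
  assumes x: "x \<in> carrier A"
  shows "y \<in> carrier A \<Longrightarrow> inc (x \<oplus>\<^bsub>A\<^esub> y) = inc x + inc y"
    "y \<in> carrier A \<Longrightarrow> inc (x \<ominus>\<^bsub>A\<^esub> y) = inc x - inc y"
    "y \<in> carrier A \<Longrightarrow> inc (x \<otimes>\<^bsub>A\<^esub> y) = inc x * inc y"
    "inc (star A x) = adj (inc x)"
    "inc (c \<odot>\<^bsub>A\<^esub> x) = Re c *\<^sub>R inc x + Im c *\<^sub>R (imu * inc x)"
proof -
  have u: "unit * inc x = inc x" using x by simp
  show "inc (x \<oplus>\<^bsub>A\<^esub> y) = inc x + inc y" "inc (x \<ominus>\<^bsub>A\<^esub> y) = inc x - inc y" "inc (x \<otimes>\<^bsub>A\<^esub> y) = inc x * inc y"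
    if "y \<in> carrier A"
    by (rule corner_eqI; use x that u in \<open>simp add: unit_closed\<close>)+
  have "unit * adj (inc x) = adj (inc x)"
  proof -
    have "adj (unit * inc x) = adj (inc x)" by (simp only: u)
    then have "adj (inc x) * unit = adj (inc x)" unfolding adj_mult adj_unit .
    then show ?thesis by (rule trans[OF unit_central])
  qed
  then show "inc (star A x) = adj (inc x)"
    by (rule corner_eqI[rotated]) (use x in \<open>simp_all add: star_closed\<close>)
  have c: "complex_of_real (Re c) + complex_of_real (Im c) * \<i> = c"
    by (simp add: complex_eq_iff)
  show "inc (c \<odot>\<^bsub>A\<^esub> x) = Re c *\<^sub>R inc x + Im c *\<^sub>R (imu * inc x)"
    by (rule corner_eqI; use x u c in \<open>simp add: unit_closed smult_mult_left scale_scale scale_add_left[symmetric]\<close>)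
qed

lemma inc_zero [simp]: "inc \<zero>\<^bsub>A\<^esub> = 0"
  using unit_mult(1)[of 0] by simp

lemma inc_eq_iff: "x \<in> carrier A \<Longrightarrow> y \<in> carrier A \<Longrightarrow> inc x = inc y \<longleftrightarrow> x = y"
  by (metis out_inc)

lemma norm_inc: "x \<in> carrier A \<Longrightarrow> norm (inc x) = cnorm A x"
proof (rule antisym)
  assume x: "x \<in> carrier A"
  show "norm (inc x) \<le> cnorm A x"
    by (rule norm_fam_le) (simp add: crd_inc[OF x] struct_zero cnorm_nonneg[OF x])
  show "cnorm A x \<le> norm (inc x)"
    using cnorm_crd_le[of idx "inc x"] by (simp add: crd_inc[OF x])
qed

text \<open>For \<open>t > 0\<close> the number \<open>- t\<close> lies outside the spectrum, so
  \<open>t + a\<close> is invertible in \<open>A\<close>. An inverse on the whole product lets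
  \<open>pos_of_invertible_translates\<close> conclude.\<close>

lemma pos_inc:
  assumes "positive A a"
  shows "pos (inc a)"
proof (rule pos_of_invertible_translates)
  have a: "a \<in> carrier A" "star A a = a" "spectrum A a \<subseteq> complex_of_real ` {0..}"
    using assms by (auto simp: positive_def)
  show "sa (inc a)" using inc_simps(4)[OF a(1)] a(2) by (simp add: sa_def)
  fix t :: real assume t: "t > 0"
  have "complex_of_real (- t) \<notin> complex_of_real ` {0..}" using t by (auto simp del: of_real_minus)
  then have "complex_of_real (- t) \<notin> spectrum A a" using a(3) by blast
  then obtain y where y: "y \<in> carrier A" "y \<otimes>\<^bsub>A\<^esub> (complex_of_real (- t) \<odot>\<^bsub>A\<^esub> \<one>\<^bsub>A\<^esub> \<ominus>\<^bsub>A\<^esub> a) = \<one>\<^bsub>A\<^esub>"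
      "(complex_of_real (- t) \<odot>\<^bsub>A\<^esub> \<one>\<^bsub>A\<^esub> \<ominus>\<^bsub>A\<^esub> a) \<otimes>\<^bsub>A\<^esub> y = \<one>\<^bsub>A\<^esub>"
    unfolding spectrum_def Units_def by blast
  have i: "inc (complex_of_real (- t) \<odot>\<^bsub>A\<^esub> \<one>\<^bsub>A\<^esub> \<ominus>\<^bsub>A\<^esub> a) = - (t *\<^sub>R unit) - inc a"
    using a(1) by (simp add: inc_simps unit_def del: of_real_minus)
  have yi: "inc y * (- (t *\<^sub>R unit) - inc a) = unit" "(- (t *\<^sub>R unit) - inc a) * inc y = unit"
    using y a(1) unfolding i[symmetric] by (simp_all add: inc_simps(3)[symmetric] unit_def)
  have yu: "inc y * unit = inc y" "unit * inc y = inc y" "unit * inc a = inc a" "inc a * unit = inc a"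
    using y(1) a(1) unit_central[of "inc y"] unit_central[of "inc a"] by simp_all
  \<comment> \<open>Outside the coordinate of \<open>A\<close> the family \<open>inc a\<close> is 0,
    so there \<open>t\<close> has to be inverted; in that coordinate \<open>y\<close> inverts
    \<open>- t - a\<close>, hence the minus sign.\<close>
  define Y where "Y = (1 / t) *\<^sub>R (1 - unit) - inc y"
  have "Y * (t *\<^sub>R 1 + inc a) = (1 - unit) + inc y * (- (t *\<^sub>R unit) - inc a)"
    unfolding Y_def using t by (simp add: algebra_simps yu)
  moreover have "(t *\<^sub>R 1 + inc a) * Y = (1 - unit) + (- (t *\<^sub>R unit) - inc a) * inc y"
    unfolding Y_def using t by (simp add: algebra_simps yu)
  ultimately show "\<exists>y. y * (t *\<^sub>R 1 + inc a) = 1 \<and> (t *\<^sub>R 1 + inc a) * y = 1"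
    unfolding yi by (intro exI[of _ Y]) simp
qed

section \<open>Transfer of topology, simplicity, SP-property and stable rank\<close>

lemma openin_norm_topology:
  "openin (norm_topology A) U \<longleftrightarrow> U \<subseteq> carrier A \<and>
    (\<forall>x\<in>U. \<exists>r>0. \<forall>y\<in>carrier A. norm (inc x - inc y) < r \<longrightarrow> y \<in> U)"
proof -
  interpret Met: Metric_space "carrier A" "cdist A" by (rule Metric_space_cdist)
  have ball: "Met.mball x r \<subseteq> U \<longleftrightarrow> (\<forall>y\<in>carrier A. norm (inc x - inc y) < r \<longrightarrow> y \<in> U)"
    if "x \<in> carrier A" for x r
    using that by (auto simp: Met.mball_def cdist_def inc_simps(2)[symmetric] norm_inc)
  show ?thesis unfolding norm_topology_def Met.openin_mtopology
  proof (rule conj_cong[OF refl])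
    assume U: "U \<subseteq> carrier A"
    show "(\<forall>x. x \<in> U \<longrightarrow> (\<exists>r>0. Met.mball x r \<subseteq> U)) \<longleftrightarrow>
        (\<forall>x\<in>U. \<exists>r>0. \<forall>y\<in>carrier A. norm (inc x - inc y) < r \<longrightarrow> y \<in> U)"
      unfolding Ball_def[of U]
      by (intro all_cong ex_cong1 conj_cong refl ball) (use U in blast)
  qed
qed

lemma topspace_norm_topology: "topspace (norm_topology A) = carrier A"
proof -
  interpret Met: Metric_space "carrier A" "cdist A" by (rule Metric_space_cdist)
  show ?thesis by (simp add: norm_topology_def)
qed

lemma closedin_norm_topology:
  assumes "closed C"
  shows "closedin (norm_topology A) {x \<in> carrier A. inc x \<in> C}"
  unfolding closedin_def topspace_norm_topology openin_norm_topology
proof (intro conjI ballI)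
  fix x assume "x \<in> carrier A - {x \<in> carrier A. inc x \<in> C}"
  then have x: "x \<in> carrier A" "inc x \<in> - C" by auto
  have "open (- C)" using assms by (simp add: open_Compl)
  then obtain r where r: "r > 0" "\<forall>z. dist z (inc x) < r \<longrightarrow> z \<in> - C"
    using x(2) unfolding open_dist by blast
  then show "\<exists>r>0. \<forall>y\<in>carrier A. norm (inc x - inc y) < r \<longrightarrow> y \<in> carrier A - {x \<in> carrier A. inc x \<in> C}"
    by (intro exI[of _ r]) (auto simp: dist_norm norm_minus_commute)
qed auto

lemma unit_nonzero: "simple_cstar A \<Longrightarrow> unit \<noteq> 0"
proof
  assume s: "simple_cstar A" and "unit = 0"
  then have "inc x = 0" if "x \<in> carrier A" for x using unit_inc[OF that] by simp
  then have "x = \<zero>\<^bsub>A\<^esub>" if "x \<in> carrier A" for x using that inc_eq_iff[of x "\<zero>\<^bsub>A\<^esub>"] by simp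
  then have "carrier A = {\<zero>\<^bsub>A\<^esub>}" by auto
  then show False using s by (simp add: simple_cstar_def)
qed

text \<open>The closure of the algebraic ideal generated by \<open>x\<close> corresponds to a closed
  nonzero ideal of \<open>A\<close> and so contains the unit. A finite sum at distance less than 1
  from the unit is invertible in the corner, and its inverse \<open>w\<close> is absorbed into the
  left factors.\<close>

lemma simple_corner:
  assumes simple: "simple_cstar A" and x: "unit * x = x" "x \<noteq> 0"
  shows "\<exists>(k::nat) X Y. unit = (\<Sum>i<k. X i * x * Y i)"
proof -
  define I where "I = {F. \<exists>(k::nat) X Y. F = (\<Sum>i<k. X i * x * Y i)}"
  have II: "(\<Sum>i<k. X i * x * Y i) \<in> I" for k :: nat and X Y unfolding I_def by blast
  have I0: "0 \<in> I" unfolding I_def by (auto intro!: exI[of _ "0::nat"])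
  have Iadd: "F + H \<in> I" if F': "F \<in> I" and H': "H \<in> I" for F H
  proof -
    obtain k :: nat and X Y where F: "F = (\<Sum>i<k. X i * x * Y i)" using F' unfolding I_def by blast
    obtain l :: nat and V W where H: "H = (\<Sum>i<l. V i * x * W i)" using H' unfolding I_def by blast
    define X' where "X' i = (if i < k then X i else V (i - k))" for i
    define Y' where "Y' i = (if i < k then Y i else W (i - k))" for i
    have "(\<Sum>i<k + l. X' i * x * Y' i) = (\<Sum>i<k. X' i * x * Y' i) + (\<Sum>i<l. X' (k + i) * x * Y' (k + i))"
      by (induction l) (simp_all add: add.assoc)
    then have "F + H = (\<Sum>i<k + l. X' i * x * Y' i)" by (simp add: F H X'_def Y'_def)
    then show ?thesis unfolding I_def by blast
  qed
  have Imult: "u * F * v \<in> I" if F': "F \<in> I" for u F v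
  proof -
    obtain k :: nat and X Y where F: "F = (\<Sum>i<k. X i * x * Y i)" using F' unfolding I_def by blast
    have "u * F * v = (\<Sum>i<k. (u * X i) * x * (Y i * v))"
      by (simp add: F sum_distrib_left sum_distrib_right mult.assoc)
    then show ?thesis using II[where X = "\<lambda>i. u * X i" and Y = "\<lambda>i. Y i * v"] by simp
  qed
  define J where "J = {a \<in> carrier A. inc a \<in> closure I}"
  have cadd: "F + H \<in> closure I" if F': "F \<in> closure I" and H': "H \<in> closure I" for F H
  proof -
    obtain f h where "\<forall>n. f n \<in> I" "f \<longlonglongrightarrow> F" "\<forall>n. h n \<in> I" "h \<longlonglongrightarrow> H"
      using F' H' unfolding closure_sequential by blast
    then show ?thesis unfolding closure_sequential
      by (intro exI[of _ "\<lambda>n. f n + h n"]) (auto intro: Iadd tendsto_add)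
  qed
  have cmult: "u * F * v \<in> closure I" if F': "F \<in> closure I" for u F v
  proof -
    obtain f where "\<forall>n. f n \<in> I" "f \<longlonglongrightarrow> F" using F' unfolding closure_sequential by blast
    then show ?thesis unfolding closure_sequential
      by (intro exI[of _ "\<lambda>n. u * f n * v"]) (auto intro!: Imult bounded_bilinear.tendsto[OF bounded_bilinear_mult])
  qed
  have "ideal J A"
  proof (rule idealI)
    show "ring A" by (rule A.ring_axioms)
    have neg: "inc (\<ominus>\<^bsub>A\<^esub> a) = (- 1) * inc a * 1" if "a \<in> carrier A" for a
      using that inc_simps(5)[of a "- 1"] by (simp add: scale_minus_one)
    show "subgroup J (add_monoid A)"
    proof (rule M.add.subgroupI)
      show "J \<subseteq> carrier A" by (auto simp: J_def)
      show "J \<noteq> {}" using I0 closure_subset[of I] by (auto simp: J_def intro!: exI[of _ "\<zero>\<^bsub>A\<^esub>"])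
      show "\<ominus>\<^bsub>A\<^esub> a \<in> J" if "a \<in> J" for a
        using that cmult[of "inc a" "- 1" 1] by (simp add: J_def neg)
      show "a \<oplus>\<^bsub>A\<^esub> b \<in> J" if "a \<in> J" "b \<in> J" for a b
        using that cadd by (simp add: J_def inc_simps)
    qed
    show "y \<otimes>\<^bsub>A\<^esub> a \<in> J" if "a \<in> J" "y \<in> carrier A" for a y
      using that cmult[of "inc a" "inc y" 1] by (simp add: J_def inc_simps)
    show "a \<otimes>\<^bsub>A\<^esub> y \<in> J" if "a \<in> J" "y \<in> carrier A" for a y
      using that cmult[of "inc a" 1 "inc y"] by (simp add: J_def inc_simps)
  qed
  moreover have "closedin (norm_topology A) J"
    unfolding J_def by (rule closedin_norm_topology) simp
  ultimately have "J = {\<zero>\<^bsub>A\<^esub>} \<or> J = carrier A" using simple by (simp add: simple_cstar_def)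
  moreover have "out x \<in> J" "out x \<noteq> \<zero>\<^bsub>A\<^esub>"
  proof -
    have ix: "inc (out x) = x" using x(1) by (simp add: unit_eq_iff)
    have "x \<in> I" using II[of "\<lambda>_. 1" "\<lambda>_. 1" 1] by simp
    then show "out x \<in> J" using closure_subset[of I] by (auto simp: J_def ix)
    show "out x \<noteq> \<zero>\<^bsub>A\<^esub>" using ix x(2) by auto
  qed
  ultimately have "\<one>\<^bsub>A\<^esub> \<in> J" by auto
  then have "unit \<in> closure I" by (simp add: J_def unit_def)
  then obtain F where F: "F \<in> I" "dist F unit < 1" unfolding closure_approachable by (metis zero_less_one)
  obtain k :: nat and X Y where k: "F = (\<Sum>i<k. X i * x * Y i)" using F(1) unfolding I_def by blast
  have "unit * (X i * x * Y i) = X i * x * Y i" for i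
    using unit_closed(1)[OF unit_closed(2)[OF x(1), of "X i"], of "Y i"] .
  then have uF: "unit * F = F" "F * unit = F" unfolding k unit_central[symmetric] by (simp_all add: sum_distrib_left)
  obtain w where w: "w * F = unit"
    using invertible_near_idempotent[of UNIV unit F] F(2) uF
    by (auto simp: complete_UNIV dist_norm norm_minus_commute)
  have "unit = (\<Sum>i<k. (w * X i) * x * Y i)"
    unfolding w[symmetric] k by (simp add: sum_distrib_left mult.assoc)
  then show ?thesis by (intro exI[of _ k] exI[of _ "\<lambda>i. w * X i"] exI[of _ Y])
qed

text \<open>\<open>B\<close> is pulled back along \<open>inc\<close>. The pullback is hereditary
  because \<open>pos_inc\<close> turns positivity by the spectrum into \<open>pos\<close>; it is
  closed under complex scalars through \<open>imu\<close>.\<close>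

lemma sp_corner:
  assumes sp: "SP_property A" and B: "hereditary_in unit B" "B \<noteq> {0}"
  shows "\<exists>q\<in>B. proj q \<and> q \<noteq> 0"
proof -
  have bu: "unit * x = x" and badj: "adj x \<in> B" and bim: "imu * x \<in> B" and bsc: "r *\<^sub>R x \<in> B" if "x \<in> B" for x r
    using B that unfolding hereditary_in_def by blast+
  have badd: "x + y \<in> B" and bmult: "x * y \<in> B" if "x \<in> B" "y \<in> B" for x y
    using B that unfolding hereditary_in_def by blast+
  have b0: "0 \<in> B" "closed B" using B unfolding hereditary_in_def by blast+
  have bher: "a \<in> B" if "b \<in> B" "unit * a = a" "pos a" "pos (b - a)" for a b
    using B that unfolding hereditary_in_def by blast
  define C where "C = {x \<in> carrier A. inc x \<in> B}"
  have "hereditary_subalgebra C A"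
    unfolding hereditary_subalgebra_def cstar_subalgebra_def
  proof (intro conjI ballI impI)
    have sc: "c \<odot>\<^bsub>A\<^esub> x \<in> C" if "x \<in> C" for c x
      using that by (auto simp: C_def inc_simps intro!: badd bsc bim)
    show "submodule C complex_ring A"
    proof (rule submoduleI)
      show "C \<subseteq> carrier A" "\<zero>\<^bsub>A\<^esub> \<in> C" using b0 by (auto simp: C_def)
      show "\<ominus>\<^bsub>A\<^esub> a \<in> C" if "a \<in> C" for a
        using sc[OF that, of "- 1"] that by (simp add: scale_minus_one C_def)
      show "a \<oplus>\<^bsub>A\<^esub> b \<in> C" if "a \<in> C" "b \<in> C" for a b
        using that by (auto simp: C_def inc_simps intro: badd)
      show "c \<odot>\<^bsub>A\<^esub> x \<in> C" if "x \<in> C" for c x by (rule sc[OF that])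
    qed
    show "x \<otimes>\<^bsub>A\<^esub> y \<in> C" if "x \<in> C" "y \<in> C" for x y
      using that by (auto simp: C_def inc_simps intro: bmult)
    show "star A x \<in> C" if "x \<in> C" for x
      using that by (auto simp: C_def inc_simps star_closed intro: badj)
    show "closedin (norm_topology A) C" unfolding C_def by (rule closedin_norm_topology[OF b0(2)])
    show "a \<in> C" if a: "a \<in> carrier A" and b: "b \<in> C" and p: "positive A a \<and> positive A (b \<ominus>\<^bsub>A\<^esub> a)" for a b
    proof -
      have bA: "b \<in> carrier A" "inc b \<in> B" using b by (auto simp: C_def)
      have "pos (inc a)" "pos (inc b - inc a)"
        using pos_inc p inc_simps(2)[OF bA(1) a] by metis+
      then have "inc a \<in> B" using bher[OF bA(2)] a by simp
      then show ?thesis using a by (simp add: C_def)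
    qed
  qed
  moreover have "C \<noteq> {\<zero>\<^bsub>A\<^esub>}"
  proof -
    obtain F where F: "F \<in> B" "F \<noteq> 0" using B(2) b0 by blast
    have "inc (out F) = F" using bu[OF F(1)] by (simp add: unit_eq_iff)
    then have "out F \<in> C" "out F \<noteq> \<zero>\<^bsub>A\<^esub>" using F by (auto simp: C_def)
    then show ?thesis by blast
  qed
  ultimately obtain p where p: "p \<in> C" "projection A p" "p \<noteq> \<zero>\<^bsub>A\<^esub>"
    using sp unfolding SP_property_def by blast
  have pA: "p \<in> carrier A" using p by (simp add: C_def)
  have "proj (inc p)" using p(2) inc_simps(3)[OF pA pA] inc_simps(4)[OF pA] by (simp add: proj_def projection_def)
  moreover have "inc p \<noteq> 0" using inc_eq_iff[OF pA, of "\<zero>\<^bsub>A\<^esub>"] p(3) by simp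
  ultimately show ?thesis using p(1) by (auto simp: C_def)
qed

lemma tsr_attained:
  assumes "tsr A = enat n"
  shows "product_topology (\<lambda>_. norm_topology A) {1..n} closure_of Lg n A = ({1..n} \<rightarrow>\<^sub>E carrier A)"
proof -
  let ?S = "{enat n | n. 1 \<le> n \<and>
     product_topology (\<lambda>_. norm_topology A) {1..n} closure_of Lg n A = ({1..n} \<rightarrow>\<^sub>E carrier A)}"
  have "?S \<noteq> {}"
  proof
    assume "?S = {}"
    then have "tsr A = \<infinity>" unfolding tsr_def Inf_enat_def by (simp only: if_True simp_thms)
    then show False using assms by simp
  qed
  then obtain s where s: "s \<in> ?S" by blast
  have "tsr A = (LEAST x. x \<in> ?S)" unfolding tsr_def Inf_enat_def using \<open>?S \<noteq> {}\<close> by (simp only: if_False)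
  then have "tsr A \<in> ?S" using LeastI[of "\<lambda>x. x \<in> ?S", OF s] by (simp only:)
  then show ?thesis using assms by auto
qed

lemma sr1_corner:
  assumes tsr: "tsr A = 1" and x: "unit * x = x" and \<epsilon>: "(\<epsilon>::real) > 0"
  shows "\<exists>x' l. unit * x' = x' \<and> unit * l = l \<and> l * x' = unit \<and> norm (x - x') < \<epsilon>"
proof -
  have cl: "product_topology (\<lambda>_. norm_topology A) {1..1} closure_of Lg 1 A = ({1..1} \<rightarrow>\<^sub>E carrier A)"
    by (rule tsr_attained) (simp add: tsr one_enat_def)
  have ix: "inc (out x) = x" using x by (simp add: unit_eq_iff)
  define f where "f = (\<lambda>i\<in>{1..1::nat}. out x)"
  define V where "V = {y \<in> carrier A. norm (x - inc y) < \<epsilon>}"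
  have "openin (norm_topology A) V"
    unfolding openin_norm_topology
  proof (intro conjI ballI)
    fix y assume "y \<in> V"
    then have y: "y \<in> carrier A" "norm (x - inc y) < \<epsilon>" by (auto simp: V_def)
    have "norm (x - inc z) < \<epsilon>" if "norm (inc y - inc z) < \<epsilon> - norm (x - inc y)" for z
      using that norm_triangle_ineq[of "x - inc y" "inc y - inc z"] by simp
    then show "\<exists>r>0. \<forall>z\<in>carrier A. norm (inc y - inc z) < r \<longrightarrow> z \<in> V"
      using y by (intro exI[of _ "\<epsilon> - norm (x - inc y)"]) (auto simp: V_def)
  qed (auto simp: V_def)
  \<comment> \<open>Tuples of length one are functions on \<open>{1..1}\<close>, so density in the
    product topology is tested on the preimage of a ball under the projection to coordinate
    1.\<close>
  then have op: "openin (product_topology (\<lambda>_. norm_topology A) {1..1})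
      {g \<in> topspace (product_topology (\<lambda>_. norm_topology A) {1..1}). g (1::nat) \<in> V}"
    by (intro openin_continuous_map_preimage[OF continuous_map_product_projection]) auto
  have fcl: "f \<in> (product_topology (\<lambda>_. norm_topology A) {1..1} closure_of Lg 1 A)"
    unfolding cl f_def by auto
  have fV: "f \<in> {g \<in> topspace (product_topology (\<lambda>_. norm_topology A) {1..1}). g (1::nat) \<in> V}"
    using \<epsilon> by (auto simp: f_def topspace_norm_topology V_def ix)
  obtain b where b': "b \<in> Lg 1 A"
      "b \<in> {g \<in> topspace (product_topology (\<lambda>_. norm_topology A) {1..1}). g (1::nat) \<in> V}"
    using fcl[unfolded in_closure_of, THEN conjunct2, rule_format, OF conjI[OF fV op]] by (elim exE conjE)
  then have b: "b \<in> Lg 1 A" "b 1 \<in> V" by simp_all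
  have bA: "b 1 \<in> carrier A" using b(2) by (simp add: V_def)
  have "\<one>\<^bsub>A\<^esub> \<in> {\<Oplus>\<^bsub>A\<^esub>i\<in>{1..1}. z i \<otimes>\<^bsub>A\<^esub> b i | z. z \<in> {1..1::nat} \<rightarrow> carrier A}"
    using b(1) unfolding Lg_def by auto
  then obtain z where z: "z \<in> {1..1::nat} \<rightarrow> carrier A" "\<one>\<^bsub>A\<^esub> = (\<Oplus>\<^bsub>A\<^esub>i\<in>{1..1::nat}. z i \<otimes>\<^bsub>A\<^esub> b i)" by blast
  have zA: "z 1 \<in> carrier A" using z(1) by auto
  have "(\<Oplus>\<^bsub>A\<^esub>i\<in>{1..1::nat}. z i \<otimes>\<^bsub>A\<^esub> b i) = z 1 \<otimes>\<^bsub>A\<^esub> b 1"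
    using M.finsum_insert[of "{}" "1::nat" "\<lambda>i. z i \<otimes>\<^bsub>A\<^esub> b i"] zA bA by simp
  then have "inc (z 1) * inc (b 1) = unit" using z(2) zA bA by (simp add: unit_def inc_simps(3)[symmetric])
  then show ?thesis using b(2) bA zA by (intro exI[of _ "inc (b 1)"] exI[of _ "inc (z 1)"]) (auto simp: V_def)
qed

end

section \<open>The crossed product\<close>

context unital_cstar_algebra
begin

lemma crd_idx [simp]: "crd F idx \<in> carrier A"
  using out_closed[of F] by (simp add: out_def)

lemma out_sum: "finite K \<Longrightarrow> out (sum F K) = finsum A (\<lambda>t. out (F t)) K"
  by (induction K rule: finite_induct) simp_all

lemma inc_finsum:
  assumes "finite K" "\<And>t. t \<in> K \<Longrightarrow> F t \<in> carrier A"
  shows "inc (finsum A F K) = (\<Sum>t\<in>K. inc (F t))"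
  using assms
  by (induction K rule: finite_induct) (simp_all add: inc_simps M.finsum_closed Pi_iff)

end

locale finite_action = unital_cstar_algebra A + G: group G
  for A :: "'a cstar_alg" and G :: "('g, 'm) monoid_scheme" (structure) +
  fixes \<alpha> :: "'g \<Rightarrow> 'a \<Rightarrow> 'a"
  assumes finite_G: "finite (carrier G)"
    and hom: "\<alpha> \<in> hom G (Aut A)"
begin

lemma \<alpha>_simps:
  assumes "s \<in> carrier G" "x \<in> carrier A"
  shows "\<alpha> s x \<in> carrier A" "y \<in> carrier A \<Longrightarrow> \<alpha> s (x \<oplus>\<^bsub>A\<^esub> y) = \<alpha> s x \<oplus>\<^bsub>A\<^esub> \<alpha> s y"
    "y \<in> carrier A \<Longrightarrow> \<alpha> s (x \<otimes>\<^bsub>A\<^esub> y) = \<alpha> s x \<otimes>\<^bsub>A\<^esub> \<alpha> s y"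
    "\<alpha> s (c \<odot>\<^bsub>A\<^esub> x) = c \<odot>\<^bsub>A\<^esub> \<alpha> s x" "\<alpha> s (star A x) = star A (\<alpha> s x)" "\<alpha> s \<one>\<^bsub>A\<^esub> = \<one>\<^bsub>A\<^esub>"
    "y \<in> carrier A \<Longrightarrow> \<alpha> s x = \<alpha> s y \<Longrightarrow> x = y"
proof -
  have "\<alpha> s \<in> star_automorphisms A"
    using hom assms(1) by (auto simp: hom_def Aut_def)
  then have h: "\<alpha> s \<in> ring_hom A A" "bij_betw (\<alpha> s) (carrier A) (carrier A)"
      "\<forall>c. \<forall>x\<in>carrier A. \<alpha> s (c \<odot>\<^bsub>A\<^esub> x) = c \<odot>\<^bsub>A\<^esub> \<alpha> s x" "\<forall>x\<in>carrier A. \<alpha> s (star A x) = star A (\<alpha> s x)"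
    by (auto simp: star_automorphisms_def Bij_def)
  show "\<alpha> s x \<in> carrier A" "\<alpha> s \<one>\<^bsub>A\<^esub> = \<one>\<^bsub>A\<^esub>"
    using ring_hom_closed[OF h(1)] ring_hom_one[OF h(1)] assms by auto
  show "\<alpha> s (x \<oplus>\<^bsub>A\<^esub> y) = \<alpha> s x \<oplus>\<^bsub>A\<^esub> \<alpha> s y" "\<alpha> s (x \<otimes>\<^bsub>A\<^esub> y) = \<alpha> s x \<otimes>\<^bsub>A\<^esub> \<alpha> s y" if "y \<in> carrier A"
    using ring_hom_add[OF h(1)] ring_hom_mult[OF h(1)] assms that by auto
  show "\<alpha> s (c \<odot>\<^bsub>A\<^esub> x) = c \<odot>\<^bsub>A\<^esub> \<alpha> s x" "\<alpha> s (star A x) = star A (\<alpha> s x)"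
    using h assms by auto
  show "x = y" if "y \<in> carrier A" "\<alpha> s x = \<alpha> s y"
    using bij_betw_imp_inj_on[OF h(2)] assms that by (auto dest: inj_onD)
qed

lemma \<alpha>_comp:
  assumes "s \<in> carrier G" "t \<in> carrier G" "x \<in> carrier A"
  shows "\<alpha> (s \<otimes> t) x = \<alpha> s (\<alpha> t x)"
proof -
  have "\<alpha> s \<in> Bij (carrier A)" "\<alpha> t \<in> Bij (carrier A)"
    using hom assms by (auto simp: hom_def Aut_def star_automorphisms_def)
  moreover have "\<alpha> (s \<otimes> t) = \<alpha> s \<otimes>\<^bsub>Aut A\<^esub> \<alpha> t" using hom assms by (auto simp: hom_def)
  ultimately show ?thesis using assms(3) by (simp add: Aut_def BijGroup_def compose_def)
qed

lemma \<alpha>_one: "x \<in> carrier A \<Longrightarrow> \<alpha> \<one> x = x"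
  using \<alpha>_comp[of \<one> \<one> x] \<alpha>_simps(7)[of \<one> "\<alpha> \<one> x" x] \<alpha>_simps(1)[of \<one> x] by simp

text \<open>Extended by the identity in all other coordinates, so that it is a unital star
  homomorphism of the whole product, to which \<open>star_hom_contractive\<close> applies.\<close>

definition act :: "'g \<Rightarrow> 'a fam \<Rightarrow> 'a fam" where
  "act s F = Fam (\<lambda>i. if i = idx then \<alpha> s (crd F i) else crd F i)"

lemma crd_act:
  assumes s: "s \<in> carrier G"
  shows "crd (act s F) i = (if i = idx then \<alpha> s (crd F i) else crd F i)"
  unfolding act_def
proof (rule crd_Fam, rule fam_okI[where B = "max (cnorm A (\<alpha> s (crd F idx))) (norm F)"])
  show "(if j = idx then \<alpha> s (crd F j) else crd F j) \<in> carrier (struct_of j)" for j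
    using \<alpha>_simps(1)[OF s crd_idx] by simp
  show "cnorm (struct_of j) (if j = idx then \<alpha> s (crd F j) else crd F j)
      \<le> max (cnorm A (\<alpha> s (crd F idx))) (norm F)" for j
    using cnorm_crd_le[of j F] by auto
qed

lemma act_simps:
  assumes s: "s \<in> carrier G"
  shows "act s (F + H) = act s F + act s H" "act s (F * H) = act s F * act s H"
    "act s (r *\<^sub>R F) = r *\<^sub>R act s F" "act s (adj F) = adj (act s F)" "act s 1 = 1" "act s imu = imu"
    "act s unit = unit"
  by (rule fam_eqI; simp add: crd_act[OF s] \<alpha>_simps[OF s] \<alpha>_simps(6)[OF s A.one_closed] unit_def crd_inc)+

lemma act_comp: "s \<in> carrier G \<Longrightarrow> t \<in> carrier G \<Longrightarrow> act (s \<otimes> t) F = act s (act t F)"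
  by (rule fam_eqI) (simp add: crd_act \<alpha>_comp)

lemma act_one: "act \<one> F = F"
  by (rule fam_eqI) (simp add: crd_act \<alpha>_one)

lemma act_inc: "s \<in> carrier G \<Longrightarrow> x \<in> carrier A \<Longrightarrow> act s (inc x) = inc (\<alpha> s x)"
  by (rule fam_eqI) (simp add: crd_act crd_inc \<alpha>_simps)

lemma out_act: "s \<in> carrier G \<Longrightarrow> out (act s F) = \<alpha> s (out F)"
  by (simp add: out_def crd_act)

lemma norm_act: "s \<in> carrier G \<Longrightarrow> norm (act s F) \<le> norm F"
  by (rule star_hom_contractive) (simp_all add: act_simps)

lemma corner_action: "corner_action G act unit"
  by (intro corner_action.intro corner_action_axioms.intro G.group_axioms finite_G unit_unit unit_central
    act_simps norm_act act_one act_comp)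

lemma left_inv_dense_equivariant_mats:
  assumes s: "simple_cstar A" and sp: "SP_property A" and tsr: "tsr A = 1"
  shows "\<exists>m\<ge>2. left_inv_dense (corner_action.equivariant_mats G act unit m) (corner_action.E G act 0 0 unit)
    (corner_action.E G act 0 0 unit + corner_action.E G act 1 1 unit)"
proof -
  interpret C: corner_action G act unit by (rule corner_action)
  interpret C: stable_corner_action G act unit
    by unfold_locales (rule sr1_corner[OF tsr])
  interpret S: simple_sp_corner unit
    by unfold_locales (fact proj_unit, fact unit_central, fact simple_corner[OF s], fact sp_corner[OF sp])
  show ?thesis
  proof (cases "\<exists>F. finite F \<and> {x :: 'a fam. unit * x = x} \<subseteq> span F")
    case True
    then obtain F where "finite F" "{x :: 'a fam. unit * x = x} \<subseteq> span F" by blast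
    then show ?thesis using C.left_inv_dense_two_rows_finite_dimensional by blast
  next
    case False
    \<comment> \<open>One less than the order of the group, which is exactly the surplus in
      \<open>left_inv_dense_blocks\<close>.\<close>
    define N where "N = card (carrier G) - 1"
    have "card (carrier G) > 0" using finite_G G.one_closed card_gt_0_iff by blast
    then have N: "card (carrier G) = N + 1" by (simp add: N_def)
    obtain q X Y where q: "proj q" "unit * q = q" "q \<noteq> 0"
      and XY: "\<forall>i<N. \<forall>j<N. Y i * X j = (if i = (j::nat) then q else 0)"
        "\<forall>i<N. unit * X i = X i \<and> X i * q = X i \<and> unit * Y i = Y i \<and> q * Y i = Y i"
      using S.small_projections[OF False unit_nonzero[OF s], of N] by blast
    obtain k :: nat and V W where k: "unit = (\<Sum>i<k. V i * q * W i)"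
      using simple_corner[OF s q(2,3)] by blast
    \<comment> \<open>Moves the left factors into the corner, as
      \<open>left_inv_dense_two_rows\<close> requires.\<close>
    have "unit = unit * unit" by simp
    also have "\<dots> = (\<Sum>i<k. (unit * V i) * q * W i)"
      by (subst (2) k) (simp add: sum_distrib_left mult.assoc)
    finally have k': "unit = (\<Sum>i<k. (unit * V i) * q * W i)" .
    have V: "unit * (unit * V i) = unit * V i" for i by (simp only: mult.assoc[symmetric] unit_unit)
    have qq: "q * q = q" using q(1) by (simp add: proj_def)
    show ?thesis
      by (rule C.left_inv_dense_two_rows[OF qq q(2) k' V _ _ _ _ _ N, where V = Y and W = X]) (use XY in auto)
  qed
qed

theorem unimodular_pairs_dense_in_functions:
  fixes f :: "nat \<Rightarrow> 'g \<Rightarrow> 'a" and \<epsilon> :: real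
  assumes s: "simple_cstar A" and sp: "SP_property A" and tsr: "tsr A = 1"
    and f: "\<And>i s. i < 2 \<Longrightarrow> s \<in> carrier G \<Longrightarrow> f i s \<in> carrier A" and \<epsilon>: "\<epsilon> > 0"
  shows "\<exists>g. (\<forall>i s. g i s \<in> carrier A) \<and>
    (\<forall>i<2. (\<Sum>s\<in>carrier G. cnorm A (f i s \<ominus>\<^bsub>A\<^esub> g i s)) < \<epsilon>) \<and>
    (\<forall>h\<in>carrier G \<rightarrow> carrier A. \<exists>c. (\<forall>i s. c i s \<in> carrier A) \<and> (\<forall>s\<in>carrier G. h s =
      (\<Oplus>\<^bsub>A\<^esub>t\<in>carrier G. c (0::nat) t \<otimes>\<^bsub>A\<^esub> \<alpha> t (g 0 (inv t \<otimes> s))) \<oplus>\<^bsub>A\<^esub>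
      (\<Oplus>\<^bsub>A\<^esub>t\<in>carrier G. c 1 t \<otimes>\<^bsub>A\<^esub> \<alpha> t (g 1 (inv t \<otimes> s)))))"
proof -
  interpret C: corner_action G act unit by (rule corner_action)
  obtain m where m: "m \<ge> 2" "left_inv_dense (C.equivariant_mats m) (C.E 0 0 unit) (C.E 0 0 unit + C.E 1 1 unit)"
    using left_inv_dense_equivariant_mats[OF s sp tsr] by blast
  obtain b where b: "\<forall>i<2. \<forall>s\<in>carrier G. unit * b i s = b i s"
      "\<forall>i<2. (\<Sum>s\<in>carrier G. norm (inc (f i s) - b i s)) < \<epsilon>"
      "\<forall>h. (\<forall>s\<in>carrier G. unit * h s = h s) \<longrightarrow> (\<exists>c. (\<forall>i<2. \<forall>s\<in>carrier G. unit * c i s = c i s) \<and>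
      (\<forall>s\<in>carrier G. (\<Sum>i<2. \<Sum>t\<in>carrier G. c i t * act t (b i (inv t \<otimes> s))) = h s))"
    using C.unimodular_pairs_dense[OF m(2,1), where b = "\<lambda>i s. inc (f i s)", OF _ \<epsilon>] f by auto
  have ib: "inc (out (b i s)) = b i s" if "i < 2" "s \<in> carrier G" for i s
    using b(1) that by (simp add: unit_eq_iff)
  show ?thesis
  proof (rule exI[of _ "\<lambda>i s. out (b i s)"], intro conjI allI ballI impI)
    fix i :: nat assume i: "i < 2"
    have "(\<Sum>s\<in>carrier G. cnorm A (f i s \<ominus>\<^bsub>A\<^esub> out (b i s))) = (\<Sum>s\<in>carrier G. norm (inc (f i s) - b i s))"
      by (rule sum.cong[OF refl]) (simp add: norm_inc[symmetric] inc_simps f i ib)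
    then show "(\<Sum>s\<in>carrier G. cnorm A (f i s \<ominus>\<^bsub>A\<^esub> out (b i s))) < \<epsilon>" using b(2) i by simp
  next
    fix h assume h: "h \<in> carrier G \<rightarrow> carrier A"
    have "\<forall>s\<in>carrier G. unit * inc (h s) = inc (h s)" using h by (simp add: Pi_iff)
    then obtain c where c: "\<forall>s\<in>carrier G. (\<Sum>i<2. \<Sum>t\<in>carrier G. c i t * act t (b i (inv t \<otimes> s))) = inc (h s)"
      using b(3)[THEN spec, of "\<lambda>s. inc (h s)"] by blast
    show "\<exists>c. (\<forall>i s. c i s \<in> carrier A) \<and> (\<forall>s\<in>carrier G. h s =
      (\<Oplus>\<^bsub>A\<^esub>t\<in>carrier G. c (0::nat) t \<otimes>\<^bsub>A\<^esub> \<alpha> t (out (b 0 (inv t \<otimes> s)))) \<oplus>\<^bsub>A\<^esub>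
      (\<Oplus>\<^bsub>A\<^esub>t\<in>carrier G. c 1 t \<otimes>\<^bsub>A\<^esub> \<alpha> t (out (b 1 (inv t \<otimes> s)))))"
    proof (rule exI[of _ "\<lambda>i t. out (c i t)"], intro conjI allI ballI)
      fix s assume s: "s \<in> carrier G"
      have *: "out (\<Sum>t\<in>carrier G. c i t * act t (b i (inv t \<otimes> s))) =
          (\<Oplus>\<^bsub>A\<^esub>t\<in>carrier G. out (c i t) \<otimes>\<^bsub>A\<^esub> \<alpha> t (out (b i (inv t \<otimes> s))))" for i
        unfolding out_sum[OF finite_G]
        by (rule M.finsum_cong') (auto simp: out_act \<alpha>_simps)
      have "h s = out (\<Sum>i<2. \<Sum>t\<in>carrier G. c i t * act t (b i (inv t \<otimes> s)))"
        using c s h by (simp add: Pi_iff)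
      then show "h s =
        (\<Oplus>\<^bsub>A\<^esub>t\<in>carrier G. out (c 0 t) \<otimes>\<^bsub>A\<^esub> \<alpha> t (out (b 0 (inv t \<otimes> s)))) \<oplus>\<^bsub>A\<^esub>
        (\<Oplus>\<^bsub>A\<^esub>t\<in>carrier G. out (c 1 t) \<otimes>\<^bsub>A\<^esub> \<alpha> t (out (b 1 (inv t \<otimes> s))))"
        by (simp add: numeral_2_eq_2 *)
    qed simp
  qed simp
qed

end

section \<open>The regular representation and its norm\<close>

lemma hnorm_cong: "(\<And>s. s \<in> J \<Longrightarrow> \<xi> s = \<eta> s) \<Longrightarrow> hnorm J \<xi> = hnorm J \<eta>"
  by (simp add: hnorm_def ip_def cong: sum.cong_simp)

lemma mv_cong: "(\<And>t. t \<in> J \<Longrightarrow> a s t = b s t) \<Longrightarrow> mv J a \<xi> s = mv J b \<xi> s"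
  by (simp add: mv_def cong: sum.cong_simp)

lemma op_cong:
  assumes "\<And>s t. s \<in> J \<Longrightarrow> t \<in> J \<Longrightarrow> a s t = b s t"
  shows "opnorm J a = opnorm J b" "op_bounded J a C \<longleftrightarrow> op_bounded J b C"
proof -
  have *: "hnorm J (mv J a \<xi>) = hnorm J (mv J b \<xi>)" for \<xi>
    by (intro hnorm_cong mv_cong assms)
  then show "opnorm J a = opnorm J b" "op_bounded J a C \<longleftrightarrow> op_bounded J b C"
    by (simp_all add: opnorm_def op_bounded_def)
qed

lemma hnorm_sum: "finite R \<Longrightarrow> hnorm J (\<lambda>s. \<Sum>r\<in>R. \<eta> r s) \<le> (\<Sum>r\<in>R. hnorm J (\<eta> r :: 'i \<Rightarrow> 'b::cstar))"
proof (induction R rule: finite_induct)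
  case (insert r R)
  then show ?case using hnorm_add[of J "\<eta> r" "\<lambda>s. \<Sum>r\<in>R. \<eta> r s"] by simp
qed (simp add: hnorm_zero)

lemma norm_le_hnorm:
  fixes \<xi> :: "'i \<Rightarrow> 'b::cstar"
  assumes "finite J" "s \<in> J"
  shows "norm (\<xi> s) \<le> hnorm J \<xi>"
proof -
  have "ip J \<xi> \<xi> - adj (\<xi> s) * \<xi> s = (\<Sum>t\<in>J - {s}. adj (\<xi> t) * \<xi> t)"
    using assms by (simp add: ip_def sum_diff1)
  then have "pos (ip J \<xi> \<xi> - adj (\<xi> s) * \<xi> s)" by (simp add: pos_sum pos_adj_mult)
  then have "norm (adj (\<xi> s) * \<xi> s) \<le> norm (ip J \<xi> \<xi>)" by (rule norm_mono_pos[OF pos_adj_mult])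
  then show ?thesis by (simp add: hnorm_def norm_adj_mult real_le_rsqrt)
qed

text \<open>In the regular representation each single value of a function acts as such a weighted
  permutation. The difference of the two inner products is a sum of terms obtained by conjugating
  the positive elements \<open>c\<^sup>2 *\<^sub>R 1 - adj (a s) * a s\<close>.\<close>

lemma hnorm_twisted_diagonal:
  fixes \<xi> :: "'i \<Rightarrow> 'b::cstar"
  assumes \<pi>: "bij_betw \<pi> J J" and c: "\<And>s. s \<in> J \<Longrightarrow> norm (a s) \<le> c" "0 \<le> c"
  shows "hnorm J (\<lambda>s. a s * \<xi> (\<pi> s)) \<le> c * hnorm J \<xi>"
proof -
  have eq: "c\<^sup>2 *\<^sub>R ip J \<xi> \<xi> - ip J (\<lambda>s. a s * \<xi> (\<pi> s)) (\<lambda>s. a s * \<xi> (\<pi> s)) =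
      (\<Sum>s\<in>J. adj (\<xi> (\<pi> s)) * (c\<^sup>2 *\<^sub>R 1 - adj (a s) * a s) * \<xi> (\<pi> s))"
  proof -
    have "ip J \<xi> \<xi> = (\<Sum>s\<in>J. adj (\<xi> (\<pi> s)) * \<xi> (\<pi> s))"
      unfolding ip_def by (rule sum.reindex_bij_betw[OF \<pi>, symmetric])
    then show ?thesis
      by (simp add: ip_def scaleR_sum_right sum_subtractf[symmetric] adj_mult right_diff_distrib left_diff_distrib mult.assoc)
  qed
  have "pos (c\<^sup>2 *\<^sub>R 1 - adj (a s) * a s)" if "s \<in> J" for s
    by (rule pos_scalar_minus[OF pos_adj_mult]) (use c that in \<open>simp add: norm_adj_mult power_mono\<close>)
  then have "pos (c\<^sup>2 *\<^sub>R ip J \<xi> \<xi> - ip J (\<lambda>s. a s * \<xi> (\<pi> s)) (\<lambda>s. a s * \<xi> (\<pi> s)))"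
    unfolding eq by (intro pos_sum pos_conj)
  then have "norm (ip J (\<lambda>s. a s * \<xi> (\<pi> s)) (\<lambda>s. a s * \<xi> (\<pi> s))) \<le> norm (c\<^sup>2 *\<^sub>R ip J \<xi> \<xi>)"
    by (rule norm_mono_pos[OF pos_ip])
  then have "(hnorm J (\<lambda>s. a s * \<xi> (\<pi> s)))\<^sup>2 \<le> (c * hnorm J \<xi>)\<^sup>2"
    by (simp add: hnorm_square power_mult_distrib)
  then show ?thesis by (rule power2_le_imp_le) (simp add: c)
qed

lemma hnorm_complex:
  fixes \<xi> :: "'i \<Rightarrow> 'b::cstar"
  shows "hnorm J (\<lambda>s. (Re z *\<^sub>R 1 + Im z *\<^sub>R imu) * \<xi> s) = cmod z * hnorm J \<xi>"
proof -
  let ?\<gamma> = "Re z *\<^sub>R 1 + Im z *\<^sub>R imu :: 'b"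
  have "adj ?\<gamma> * ?\<gamma> = ((Re z)\<^sup>2 + (Im z)\<^sup>2) *\<^sub>R 1"
    by (simp add: adj_add adj_scaleR adj_imu imu_imu algebra_simps power2_eq_square)
  then have "adj ?\<gamma> * ?\<gamma> = (cmod z)\<^sup>2 *\<^sub>R 1" by (simp only: cmod_power2)
  then have "adj (?\<gamma> * x) * (?\<gamma> * x) = (cmod z)\<^sup>2 *\<^sub>R (adj x * x)" for x
    unfolding adj_mult mult.assoc by (simp add: mult.assoc[of "adj ?\<gamma>", symmetric])
  then have "ip J (\<lambda>s. ?\<gamma> * \<xi> s) (\<lambda>s. ?\<gamma> * \<xi> s) = (cmod z)\<^sup>2 *\<^sub>R ip J \<xi> \<xi>"
    by (simp only: ip_def scaleR_sum_right)
  then show ?thesis by (simp add: hnorm_def real_sqrt_mult)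
qed

context finite_action
begin

text \<open>The regular representation on \<open>A\<^sup>G\<close> shows that the enveloping norm is definite; without this
  \<^const>\<open>cdist\<close> would not be a metric and \<^const>\<open>norm_topology\<close> would be unspecified.\<close>
definition regular :: "('g \<Rightarrow> 'a) \<Rightarrow> 'g \<Rightarrow> 'g \<Rightarrow> 'a fam" where
  "regular f s t = act (inv s) (inc (f (s \<otimes> inv t)))"

abbreviation K :: "('g \<Rightarrow> 'a) star_alg" where "K \<equiv> skew_group_algebra G A \<alpha>"

lemma carrier_K: "carrier K = carrier G \<rightarrow>\<^sub>E carrier A"
  by (simp add: skew_group_algebra_def)

lemma K_eval:
  assumes "s \<in> carrier G"
  shows "(f \<otimes>\<^bsub>K\<^esub> h) s = (\<Oplus>\<^bsub>A\<^esub>t\<in>carrier G. f t \<otimes>\<^bsub>A\<^esub> \<alpha> t (h (inv t \<otimes> s)))" "\<zero>\<^bsub>K\<^esub> s = \<zero>\<^bsub>A\<^esub>"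
    "(f \<oplus>\<^bsub>K\<^esub> h) s = f s \<oplus>\<^bsub>A\<^esub> h s" "(c \<odot>\<^bsub>K\<^esub> f) s = c \<odot>\<^bsub>A\<^esub> f s" "star K f s = \<alpha> s (star A (f (inv s)))"
  using assms by (simp_all add: skew_group_algebra_def)

lemma K_value: "f \<in> carrier K \<Longrightarrow> s \<in> carrier G \<Longrightarrow> f s \<in> carrier A"
  by (auto simp: carrier_K)

lemma K_eqI: "f \<in> carrier K \<Longrightarrow> h \<in> carrier K \<Longrightarrow> (\<And>s. s \<in> carrier G \<Longrightarrow> f s = h s) \<Longrightarrow> f = h"
  unfolding carrier_K by (rule PiE_ext)

lemma K_closed:
  assumes "f \<in> carrier K"
  shows "h \<in> carrier K \<Longrightarrow> f \<otimes>\<^bsub>K\<^esub> h \<in> carrier K" "h \<in> carrier K \<Longrightarrow> f \<oplus>\<^bsub>K\<^esub> h \<in> carrier K"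
    "c \<odot>\<^bsub>K\<^esub> f \<in> carrier K" "star K f \<in> carrier K"
  using assms by (auto simp: skew_group_algebra_def \<alpha>_simps star_closed PiE_iff intro!: M.finsum_closed)

lemma K_zero_closed: "\<zero>\<^bsub>K\<^esub> \<in> carrier K"
  by (simp add: skew_group_algebra_def)

lemma regular_add:
  "f \<in> carrier K \<Longrightarrow> h \<in> carrier K \<Longrightarrow> s \<in> carrier G \<Longrightarrow> t \<in> carrier G \<Longrightarrow>
    regular (f \<oplus>\<^bsub>K\<^esub> h) s t = regular f s t + regular h s t"
  by (simp add: regular_def K_eval K_value inc_simps act_simps)

lemma regular_scale:
  "f \<in> carrier K \<Longrightarrow> s \<in> carrier G \<Longrightarrow> t \<in> carrier G \<Longrightarrow>
    regular (c \<odot>\<^bsub>K\<^esub> f) s t = (Re c *\<^sub>R 1 + Im c *\<^sub>R imu) * regular f s t"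
  using inc_simps(5)[of "f (s \<otimes> inv t)" c]
  by (simp add: regular_def K_eval K_value act_simps distrib_right)

lemma regular_star:
  assumes "f \<in> carrier K" "s \<in> carrier G" "t \<in> carrier G"
  shows "regular (star K f) s t = adj (regular f t s)"
proof -
  have "regular (star K f) s t = act (inv s) (act (s \<otimes> inv t) (adj (inc (f (t \<otimes> inv s)))))"
    using assms by (simp add: regular_def K_eval K_value star_closed act_inc[symmetric] inc_simps(4) G.inv_mult_group)
  also have "\<dots> = act (inv t) (adj (inc (f (t \<otimes> inv s))))"
    using assms by (simp add: act_comp[symmetric] G.m_assoc[symmetric])
  finally show ?thesis using assms by (simp add: act_simps regular_def)
qed

lemma group_cancel: "s \<in> carrier G \<Longrightarrow> t \<in> carrier G \<Longrightarrow> s \<otimes> (inv s \<otimes> t) = t"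
  "s \<in> carrier G \<Longrightarrow> t \<in> carrier G \<Longrightarrow> inv s \<otimes> (s \<otimes> t) = t"
  by (simp_all add: G.m_assoc[symmetric])

lemma bij_div: "s \<in> carrier G \<Longrightarrow> bij_betw (\<lambda>u. s \<otimes> inv u) (carrier G) (carrier G)"
  by (rule bij_betw_byWitness[where f' = "\<lambda>r. inv r \<otimes> s"]) (auto simp: G.inv_mult_group G.m_assoc group_cancel)

lemma act_sum: "s \<in> carrier G \<Longrightarrow> act s (sum F R) = (\<Sum>r\<in>R. act s (F r))"
proof -
  assume s: "s \<in> carrier G"
  have "act s 0 = 0" using act_simps(3)[OF s, of 0 0] by simp
  then show ?thesis by (induction R rule: infinite_finite_induct) (simp_all add: act_simps[OF s])
qed

lemma regular_mult:
  assumes f: "f \<in> carrier K" and h: "h \<in> carrier K" and s: "s \<in> carrier G" and t: "t \<in> carrier G"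
  shows "regular (f \<otimes>\<^bsub>K\<^esub> h) s t = (\<Sum>u\<in>carrier G. regular f s u * regular h u t)"
proof -
  have "regular (f \<otimes>\<^bsub>K\<^esub> h) s t = (\<Sum>r\<in>carrier G. act (inv s) (inc (f r) * act r (inc (h (inv r \<otimes> (s \<otimes> inv t))))))"
    using f h s t finite_G
    by (simp add: regular_def K_eval inc_finsum act_sum K_value \<alpha>_simps inc_simps act_inc)
  \<comment> \<open>The substitution \<open>r = s \<otimes> inv u\<close> turns the convolution into
    a matrix product.\<close>
  also have "\<dots> = (\<Sum>u\<in>carrier G. act (inv s) (inc (f (s \<otimes> inv u)) *
      act (s \<otimes> inv u) (inc (h (inv (s \<otimes> inv u) \<otimes> (s \<otimes> inv t))))))"
    by (rule sum.reindex_bij_betw[OF bij_div[OF s], symmetric])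
  also have "\<dots> = (\<Sum>u\<in>carrier G. regular f s u * regular h u t)"
  proof (rule sum.cong[OF refl])
    fix u assume u: "u \<in> carrier G"
    have 1: "inv s \<otimes> (s \<otimes> inv u) = inv u" "inv (s \<otimes> inv u) \<otimes> (s \<otimes> inv t) = u \<otimes> inv t"
      using s t u by (simp_all add: G.m_assoc G.inv_mult_group group_cancel)
    have "act (inv s) (act (s \<otimes> inv u) (inc (h (u \<otimes> inv t)))) = act (inv u) (inc (h (u \<otimes> inv t)))"
      using act_comp[of "inv s" "s \<otimes> inv u" "inc (h (u \<otimes> inv t))"] s u by (simp add: 1)
    then show "act (inv s) (inc (f (s \<otimes> inv u)) * act (s \<otimes> inv u) (inc (h (inv (s \<otimes> inv u) \<otimes> (s \<otimes> inv t))))) =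
        regular f s u * regular h u t"
      using s unfolding 1 by (simp add: act_simps regular_def)
  qed
  finally show ?thesis .
qed

text \<open>\<open>f\<close> is split into its values: each acts by a weighted permutation of the
  coordinates with weights of norm at most \<open>cnorm A (f r)\<close>.\<close>

lemma op_bounded_regular:
  assumes f: "f \<in> carrier K"
  shows "op_bounded (carrier G) (regular f) (\<Sum>s\<in>carrier G. cnorm A (f s))"
  unfolding op_bounded_def
proof (intro conjI allI)
  show "0 \<le> (\<Sum>s\<in>carrier G. cnorm A (f s))" using f by (intro sum_nonneg cnorm_nonneg K_value)
  fix \<xi> :: "'g \<Rightarrow> 'a fam"
  have "mv (carrier G) (regular f) \<xi> s = (\<Sum>r\<in>carrier G. act (inv s) (inc (f r)) * \<xi> (inv r \<otimes> s))"
    if s: "s \<in> carrier G" for s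
  proof -
    have "(\<Sum>r\<in>carrier G. act (inv s) (inc (f r)) * \<xi> (inv r \<otimes> s)) =
        (\<Sum>u\<in>carrier G. act (inv s) (inc (f (s \<otimes> inv u))) * \<xi> (inv (s \<otimes> inv u) \<otimes> s))"
      by (rule sum.reindex_bij_betw[OF bij_div[OF s], symmetric])
    also have "\<dots> = mv (carrier G) (regular f) \<xi> s"
      unfolding mv_def regular_def using s by (intro sum.cong refl) (simp add: G.inv_mult_group G.m_assoc)
    finally show ?thesis by simp
  qed
  then have "hnorm (carrier G) (mv (carrier G) (regular f) \<xi>) =
      hnorm (carrier G) (\<lambda>s. \<Sum>r\<in>carrier G. act (inv s) (inc (f r)) * \<xi> (inv r \<otimes> s))"
    by (rule hnorm_cong)
  also have "\<dots> \<le> (\<Sum>r\<in>carrier G. hnorm (carrier G) (\<lambda>s. act (inv s) (inc (f r)) * \<xi> (inv r \<otimes> s)))"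
    by (rule hnorm_sum[OF finite_G])
  also have "\<dots> \<le> (\<Sum>r\<in>carrier G. cnorm A (f r) * hnorm (carrier G) \<xi>)"
  proof (rule sum_mono)
    fix r assume r: "r \<in> carrier G"
    show "hnorm (carrier G) (\<lambda>s. act (inv s) (inc (f r)) * \<xi> (inv r \<otimes> s)) \<le> cnorm A (f r) * hnorm (carrier G) \<xi>"
    proof (rule hnorm_twisted_diagonal)
      show "bij_betw (\<lambda>s. inv r \<otimes> s) (carrier G) (carrier G)"
        by (rule bij_betw_byWitness[where f' = "\<lambda>s. r \<otimes> s"]) (auto simp: r G.m_assoc[symmetric])
      show "norm (act (inv s) (inc (f r))) \<le> cnorm A (f r)" if "s \<in> carrier G" for s
        using norm_act[of "inv s" "inc (f r)"] norm_inc[OF K_value[OF f r]] that by simp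
    qed (rule cnorm_nonneg[OF K_value[OF f r]])
  qed
  finally show "hnorm (carrier G) (mv (carrier G) (regular f) \<xi>) \<le>
      (\<Sum>s\<in>carrier G. cnorm A (f s)) * hnorm (carrier G) \<xi>"
    by (simp add: sum_distrib_right)
qed

definition reg_norm :: "('g \<Rightarrow> 'a) \<Rightarrow> real" where
  "reg_norm f = opnorm (carrier G) (regular f)"

lemma op_bounded_reg_norm: "f \<in> carrier K \<Longrightarrow> op_bounded (carrier G) (regular f) (reg_norm f)"
  unfolding reg_norm_def by (rule opnorm_bounded[OF op_bounded_regular])

lemma reg_norm_le: "f \<in> carrier K \<Longrightarrow> reg_norm f \<le> (\<Sum>s\<in>carrier G. cnorm A (f s))"
  unfolding reg_norm_def by (rule opnorm_le[OF op_bounded_regular])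

lemma reg_norm_scale_le:
  assumes f: "f \<in> carrier K"
  shows "reg_norm (c \<odot>\<^bsub>K\<^esub> f) \<le> cmod c * reg_norm f"
  unfolding reg_norm_def[of "c \<odot>\<^bsub>K\<^esub> f"]
proof (rule opnorm_le)
  let ?\<gamma> = "Re c *\<^sub>R 1 + Im c *\<^sub>R imu :: 'a fam"
  note b = op_bounded_reg_norm[OF f, unfolded op_bounded_def]
  have "op_bounded (carrier G) (\<lambda>s t. ?\<gamma> * regular f s t) (cmod c * reg_norm f)"
    unfolding op_bounded_def
  proof (intro conjI allI)
    show "0 \<le> cmod c * reg_norm f" using b by simp
    fix \<xi>
    have "mv (carrier G) (\<lambda>s t. ?\<gamma> * regular f s t) \<xi> = (\<lambda>s. ?\<gamma> * mv (carrier G) (regular f) \<xi> s)"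
      by (rule ext) (simp add: mv_def sum_distrib_left mult.assoc)
    then show "hnorm (carrier G) (mv (carrier G) (\<lambda>s t. ?\<gamma> * regular f s t) \<xi>) \<le>
        cmod c * reg_norm f * hnorm (carrier G) \<xi>"
      using b by (simp add: hnorm_complex mult.assoc mult_left_mono)
  qed
  then show "op_bounded (carrier G) (regular (c \<odot>\<^bsub>K\<^esub> f)) (cmod c * reg_norm f)"
    by (subst op_cong(2)[OF regular_scale[OF f]])
qed

lemma cstar_seminorm_reg_norm: "cstar_seminorm K reg_norm"
  unfolding cstar_seminorm_def
proof (intro conjI ballI allI)
  fix f assume f: "f \<in> carrier K"
  show nn: "0 \<le> reg_norm f" using op_bounded_reg_norm[OF f] by (simp add: op_bounded_def)
  show "reg_norm (c \<odot>\<^bsub>K\<^esub> f) = cmod c * reg_norm f" for c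
  proof (rule antisym[OF reg_norm_scale_le[OF f]])
    have cf: "c \<odot>\<^bsub>K\<^esub> f \<in> carrier K" by (rule K_closed(3)[OF f])
    show "cmod c * reg_norm f \<le> reg_norm (c \<odot>\<^bsub>K\<^esub> f)"
    proof (cases "c = 0")
      case True
      then show ?thesis using op_bounded_reg_norm[OF cf] by (simp add: op_bounded_def)
    next
      case False
      have "inverse c \<odot>\<^bsub>K\<^esub> (c \<odot>\<^bsub>K\<^esub> f) = f"
        by (rule K_eqI[OF K_closed(3)[OF cf] f]) (use False in \<open>simp add: K_eval K_value[OF f] scale_scale scale_one\<close>)
      then have "reg_norm f \<le> cmod (inverse c) * reg_norm (c \<odot>\<^bsub>K\<^esub> f)"
        using reg_norm_scale_le[OF cf, of "inverse c"] by simp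
      then show ?thesis using False by (simp add: norm_divide field_simps)
    qed
  qed
  show "reg_norm (star K f \<otimes>\<^bsub>K\<^esub> f) = (reg_norm f)\<^sup>2"
  proof -
    have sf: "star K f \<in> carrier K" by (rule K_closed(4)[OF f])
    have "reg_norm (star K f \<otimes>\<^bsub>K\<^esub> f) =
        opnorm (carrier G) (\<lambda>s t. \<Sum>u\<in>carrier G. adj (regular f u s) * regular f u t)"
      unfolding reg_norm_def
      by (rule op_cong(1)) (simp add: regular_mult[OF sf f] regular_star[OF f] cong: sum.cong_simp)
    also have "\<dots> = (opnorm (carrier G) (regular f))\<^sup>2"
    proof (rule opnorm_adj_mult[OF op_bounded_regular[OF f]])
      show "op_bounded (carrier G) (\<lambda>s t. adj (regular f t s)) (\<Sum>s\<in>carrier G. cnorm A (star K f s))"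
        using op_bounded_regular[OF sf] by (subst (asm) op_cong(2)[OF regular_star[OF f]])
    qed
    finally show ?thesis by (simp only: reg_norm_def)
  qed
  fix h assume h: "h \<in> carrier K"
  show "reg_norm (f \<oplus>\<^bsub>K\<^esub> h) \<le> reg_norm f + reg_norm h"
  proof -
    have "op_bounded (carrier G) (regular (f \<oplus>\<^bsub>K\<^esub> h)) (reg_norm f + reg_norm h)"
      by (subst op_cong(2)[OF regular_add[OF f h]];
        (assumption | rule op_bounded_add[OF op_bounded_reg_norm[OF f] op_bounded_reg_norm[OF h]]))
    then show ?thesis unfolding reg_norm_def[of "f \<oplus>\<^bsub>K\<^esub> h"] by (rule opnorm_le)
  qed
  show "reg_norm (f \<otimes>\<^bsub>K\<^esub> h) \<le> reg_norm f * reg_norm h"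
  proof -
    have "op_bounded (carrier G) (regular (f \<otimes>\<^bsub>K\<^esub> h)) (reg_norm f * reg_norm h)"
      by (subst op_cong(2)[OF regular_mult[OF f h]];
        (assumption | rule op_bounded_mult[OF op_bounded_reg_norm[OF f] op_bounded_reg_norm[OF h]]))
    then show ?thesis unfolding reg_norm_def[of "f \<otimes>\<^bsub>K\<^esub> h"] by (rule opnorm_le)
  qed
qed

lemma reg_norm_eq_zero:
  assumes f: "f \<in> carrier K" and 0: "reg_norm f = 0"
  shows "f = \<zero>\<^bsub>K\<^esub>"
proof (rule K_eqI[OF f K_zero_closed])
  fix s assume s: "s \<in> carrier G"
  \<comment> \<open>The unit vector at \<open>\<one>\<close> picks out the column whose entries are
    translates of the values of \<open>f\<close>.\<close>
  define \<xi> where "\<xi> t = (if t = \<one> then 1 else 0 :: 'a fam)" for t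
  have "mv (carrier G) (regular f) \<xi> s = (\<Sum>t\<in>carrier G. if t = \<one> then regular f s t else 0)"
    unfolding mv_def by (rule sum.cong) (simp_all add: \<xi>_def)
  also have "\<dots> = act (inv s) (inc (f s))" using finite_G s by (simp add: regular_def)
  finally have m: "mv (carrier G) (regular f) \<xi> s = act (inv s) (inc (f s))" .
  have "hnorm (carrier G) (mv (carrier G) (regular f) \<xi>) \<le> 0"
    using op_bounded_reg_norm[OF f] 0 by (auto simp: op_bounded_def)
  then have "norm (act (inv s) (inc (f s))) \<le> 0"
    unfolding m[symmetric] by (rule order_trans[OF norm_le_hnorm[OF finite_G s]])
  then have "act s (act (inv s) (inc (f s))) = act s 0" by simp
  then have "inc (f s) = 0"
    using s act_simps(3)[OF s, of 0 0] by (simp add: act_comp[symmetric] act_one)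
  then show "f s = \<zero>\<^bsub>K\<^esub> s" using inc_eq_iff[OF K_value[OF f s], of "\<zero>\<^bsub>A\<^esub>"] s by (simp add: K_eval)
qed

end

section \<open>The metric of the crossed product and density of its left invertible pairs\<close>

context finite_action
begin

abbreviation B :: "('g \<Rightarrow> 'a) cstar_alg" where "B \<equiv> crossed_product G A \<alpha>"

lemma B_simps: "carrier B = carrier K" "mult B = mult K" "add B = add K" "zero B = zero K" "one B = one K"
    "smult B = smult K" "cnorm B = crossed_product_norm G A \<alpha>"
  by (simp_all add: crossed_product_def star_alg.defs cstar_alg.defs)

text \<open>Gives the differences in \<open>cdist\<close> and the finite sums in \<open>Lg\<close>
  their usual meaning for the crossed product.\<close>

lemma abelian_group_B: "abelian_group B"
proof (rule abelian_groupI)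
  show "\<zero>\<^bsub>B\<^esub> \<in> carrier B" unfolding B_simps by (rule K_zero_closed)
  show "\<exists>y\<in>carrier B. y \<oplus>\<^bsub>B\<^esub> x = \<zero>\<^bsub>B\<^esub>" if x: "x \<in> carrier B" for x
  proof (rule bexI[of _ "(- 1) \<odot>\<^bsub>K\<^esub> x"])
    note x = x[unfolded B_simps]
    show m: "(- 1) \<odot>\<^bsub>K\<^esub> x \<in> carrier B" unfolding B_simps by (rule K_closed(3)[OF x])
    show "(- 1) \<odot>\<^bsub>K\<^esub> x \<oplus>\<^bsub>B\<^esub> x = \<zero>\<^bsub>B\<^esub>"
      unfolding B_simps
      by (rule K_eqI[OF K_closed(2)[OF m[unfolded B_simps] x] K_zero_closed])
        (simp add: K_eval K_value[OF x] scale_minus_one M.l_neg)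
  qed
  fix x y assume x: "x \<in> carrier B" and y: "y \<in> carrier B"
  note x = x[unfolded B_simps] and y = y[unfolded B_simps]
  show "x \<oplus>\<^bsub>B\<^esub> y \<in> carrier B" unfolding B_simps by (rule K_closed(2)[OF x y])
  show "x \<oplus>\<^bsub>B\<^esub> y = y \<oplus>\<^bsub>B\<^esub> x"
    unfolding B_simps
    by (rule K_eqI[OF K_closed(2)[OF x y] K_closed(2)[OF y x]]) (simp add: K_eval K_value[OF x] K_value[OF y] M.a_comm)
  show "\<zero>\<^bsub>B\<^esub> \<oplus>\<^bsub>B\<^esub> x = x"
    unfolding B_simps
    by (rule K_eqI[OF K_closed(2)[OF K_zero_closed x] x]) (simp add: K_eval K_value[OF x])
  fix z assume z: "z \<in> carrier B"
  note z = z[unfolded B_simps]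
  show "x \<oplus>\<^bsub>B\<^esub> y \<oplus>\<^bsub>B\<^esub> z = x \<oplus>\<^bsub>B\<^esub> (y \<oplus>\<^bsub>B\<^esub> z)"
    unfolding B_simps
    by (rule K_eqI[OF K_closed(2)[OF K_closed(2)[OF x y] z] K_closed(2)[OF x K_closed(2)[OF y z]]])
      (simp add: K_eval K_value[OF x] K_value[OF y] K_value[OF z] M.a_assoc)
qed

lemma minus_B:
  assumes f: "f \<in> carrier K" and h: "h \<in> carrier K"
  shows "f \<ominus>\<^bsub>B\<^esub> h \<in> carrier K" "s \<in> carrier G \<Longrightarrow> (f \<ominus>\<^bsub>B\<^esub> h) s = f s \<ominus>\<^bsub>A\<^esub> h s"
proof -
  interpret B: abelian_group B by (rule abelian_group_B)
  have fh: "f \<in> carrier B" "h \<in> carrier B" unfolding B_simps by (rule f, rule h)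
  then have d: "f \<ominus>\<^bsub>B\<^esub> h \<in> carrier B" by (rule B.minus_closed)
  then show d': "f \<ominus>\<^bsub>B\<^esub> h \<in> carrier K" by (simp add: B_simps)
  assume s: "s \<in> carrier G"
  have "f = (f \<ominus>\<^bsub>B\<^esub> h) \<oplus>\<^bsub>B\<^esub> h"
    using fh by (simp add: B.minus_eq B.a_assoc B.l_neg)
  then have "f s = (f \<ominus>\<^bsub>B\<^esub> h) s \<oplus>\<^bsub>A\<^esub> h s" using K_eval(3)[OF s] by (metis B_simps(3))
  then show "(f \<ominus>\<^bsub>B\<^esub> h) s = f s \<ominus>\<^bsub>A\<^esub> h s"
    using K_value[OF d' s] K_value[OF h s] by (simp add: M.minus_eq M.a_assoc M.r_neg)
qed

text \<open>A real \<open>Sup\<close> is meaningful only for a nonempty bounded set: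
  \<open>reg_norm\<close> is a member, and the norm of \<open>L\<^sup>1(G,A)\<close> is a
  bound.\<close>

lemma crossed_product_norm_bounds:
  assumes f: "f \<in> carrier K"
  shows "crossed_product_norm G A \<alpha> f \<le> (\<Sum>s\<in>carrier G. cnorm A (f s))"
    and "cstar_seminorm K p \<Longrightarrow> \<forall>h \<in> carrier G \<rightarrow>\<^sub>E carrier A. p h \<le> (\<Sum>s\<in>carrier G. cnorm A (h s)) \<Longrightarrow>
      p f \<le> crossed_product_norm G A \<alpha> f"
proof -
  let ?P = "\<lambda>p. cstar_seminorm K p \<and> (\<forall>h \<in> carrier G \<rightarrow>\<^sub>E carrier A. p h \<le> (\<Sum>s\<in>carrier G. cnorm A (h s)))"
  have P: "?P reg_norm" using cstar_seminorm_reg_norm reg_norm_le by (simp add: carrier_K)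
  have le: "p f \<le> (\<Sum>s\<in>carrier G. cnorm A (f s))" if "?P p" for p
    using that f by (simp add: carrier_K)
  show "crossed_product_norm G A \<alpha> f \<le> (\<Sum>s\<in>carrier G. cnorm A (f s))"
    unfolding crossed_product_norm_def by (rule cSup_least) (use P le in blast)+
  show "p f \<le> crossed_product_norm G A \<alpha> f" if "cstar_seminorm K p"
    "\<forall>h \<in> carrier G \<rightarrow>\<^sub>E carrier A. p h \<le> (\<Sum>s\<in>carrier G. cnorm A (h s))"
    unfolding crossed_product_norm_def
    by (rule cSup_upper) (use that le in \<open>auto simp: bdd_above_def\<close>)
qed

lemma crossed_product_norm_le:
  assumes "\<And>p. cstar_seminorm K p \<Longrightarrow> \<forall>h \<in> carrier G \<rightarrow>\<^sub>E carrier A. p h \<le> (\<Sum>s\<in>carrier G. cnorm A (h s)) \<Longrightarrow> p f \<le> C"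
  shows "crossed_product_norm G A \<alpha> f \<le> C"
proof -
  have "\<forall>h \<in> carrier G \<rightarrow>\<^sub>E carrier A. reg_norm h \<le> (\<Sum>s\<in>carrier G. cnorm A (h s))"
    using reg_norm_le by (simp add: carrier_K)
  then show ?thesis
    unfolding crossed_product_norm_def
    by (intro cSup_least) (use cstar_seminorm_reg_norm assms in blast)+
qed

lemma reg_norm_le_crossed_product_norm: "f \<in> carrier K \<Longrightarrow> reg_norm f \<le> crossed_product_norm G A \<alpha> f"
  by (rule crossed_product_norm_bounds(2)[OF _ cstar_seminorm_reg_norm]) (simp_all add: reg_norm_le[unfolded carrier_K])

lemma cdist_B: "f \<in> carrier K \<Longrightarrow> h \<in> carrier K \<Longrightarrow> cdist B f h = crossed_product_norm G A \<alpha> (f \<ominus>\<^bsub>B\<^esub> h)"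
  by (simp add: cdist_def B_simps)

lemma reg_norm_nonneg: "f \<in> carrier K \<Longrightarrow> 0 \<le> reg_norm f"
  using cstar_seminorm_reg_norm by (simp add: cstar_seminorm_def)

text \<open>Symmetry and the triangle inequality hold for every seminorm in the supremum and pass to
  it. Distinct points are separated already by \<open>reg_norm\<close>, which lies below it.\<close>

lemma Metric_space_B: "Metric_space (carrier B) (cdist B)"
proof
  have comm: "crossed_product_norm G A \<alpha> (f \<ominus>\<^bsub>B\<^esub> h) \<le> crossed_product_norm G A \<alpha> (h \<ominus>\<^bsub>B\<^esub> f)"
    if f: "f \<in> carrier K" and h: "h \<in> carrier K" for f h
  proof (rule crossed_product_norm_le)
    fix p assume p: "cstar_seminorm K p" "\<forall>h \<in> carrier G \<rightarrow>\<^sub>E carrier A. p h \<le> (\<Sum>s\<in>carrier G. cnorm A (h s))"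
    note m = minus_B[OF f h] minus_B[OF h f]
    have "f \<ominus>\<^bsub>B\<^esub> h = (- 1) \<odot>\<^bsub>K\<^esub> (h \<ominus>\<^bsub>B\<^esub> f)"
      by (rule K_eqI[OF m(1) K_closed(3)[OF m(3)]])
        (simp add: K_eval m(2,4) scale_minus_one K_value[OF f] K_value[OF h] minus_swap)
    moreover have "p ((- 1) \<odot>\<^bsub>K\<^esub> (h \<ominus>\<^bsub>B\<^esub> f)) = cmod (- 1) * p (h \<ominus>\<^bsub>B\<^esub> f)"
      using p(1) m(3) unfolding cstar_seminorm_def by blast
    ultimately have "p (f \<ominus>\<^bsub>B\<^esub> h) = p (h \<ominus>\<^bsub>B\<^esub> f)" by simp
    then show "p (f \<ominus>\<^bsub>B\<^esub> h) \<le> crossed_product_norm G A \<alpha> (h \<ominus>\<^bsub>B\<^esub> f)"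
      using crossed_product_norm_bounds(2)[OF m(3) p] by simp
  qed
  have nn: "0 \<le> crossed_product_norm G A \<alpha> f" if "f \<in> carrier K" for f
    using reg_norm_nonneg[OF that] reg_norm_le_crossed_product_norm[OF that] by simp
  show "0 \<le> cdist B f h" for f h by (simp add: cdist_def B_simps nn minus_B(1))
  show "cdist B f h = cdist B h f" for f h
    using comm[of f h] comm[of h f] by (auto simp: cdist_def B_simps)
  fix f h assume "f \<in> carrier B" "h \<in> carrier B"
  then have f: "f \<in> carrier K" and h: "h \<in> carrier K" by (simp_all add: B_simps)
  show "cdist B f h = 0 \<longleftrightarrow> f = h"
  proof
    assume "cdist B f h = 0"
    then have "reg_norm (f \<ominus>\<^bsub>B\<^esub> h) = 0"
      using reg_norm_le_crossed_product_norm[OF minus_B(1)[OF f h]] reg_norm_nonneg[OF minus_B(1)[OF f h]]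
      by (simp add: cdist_B f h)
    then have "f \<ominus>\<^bsub>B\<^esub> h = \<zero>\<^bsub>K\<^esub>" by (rule reg_norm_eq_zero[OF minus_B(1)[OF f h]])
    then have eq: "f s \<ominus>\<^bsub>A\<^esub> h s = \<zero>\<^bsub>A\<^esub>" if "s \<in> carrier G" for s
      using minus_B(2)[OF f h that] by (simp add: K_eval that)
    show "f = h"
      by (rule K_eqI[OF f h minus_eq_zeroD[OF K_value[OF f] K_value[OF h] eq]])
  next
    assume "f = h"
    then have "(f \<ominus>\<^bsub>B\<^esub> h) s = \<zero>\<^bsub>A\<^esub>" if "s \<in> carrier G" for s
      using that K_value[OF h that] by (simp add: minus_B(2)[OF h h] M.minus_eq M.r_neg)
    then have "(\<Sum>s\<in>carrier G. cnorm A ((f \<ominus>\<^bsub>B\<^esub> h) s)) = 0" by simp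
    then show "cdist B f h = 0"
      using crossed_product_norm_bounds(1)[OF minus_B(1)[OF f h]] nn[OF minus_B(1)[OF f h]]
      by (simp add: cdist_B f h)
  qed
  fix k assume "k \<in> carrier B"
  then have k: "k \<in> carrier K" by (simp add: B_simps)
  have "crossed_product_norm G A \<alpha> (f \<ominus>\<^bsub>B\<^esub> k) \<le>
      crossed_product_norm G A \<alpha> (f \<ominus>\<^bsub>B\<^esub> h) + crossed_product_norm G A \<alpha> (h \<ominus>\<^bsub>B\<^esub> k)"
  proof (rule crossed_product_norm_le)
    fix p assume p: "cstar_seminorm K p" "\<forall>h \<in> carrier G \<rightarrow>\<^sub>E carrier A. p h \<le> (\<Sum>s\<in>carrier G. cnorm A (h s))"
    note m = minus_B[OF f h] minus_B[OF h k] minus_B[OF f k]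
    have "f \<ominus>\<^bsub>B\<^esub> k = (f \<ominus>\<^bsub>B\<^esub> h) \<oplus>\<^bsub>K\<^esub> (h \<ominus>\<^bsub>B\<^esub> k)"
      by (rule K_eqI[OF m(5) K_closed(2)[OF m(1,3)]])
        (simp add: K_eval m(2,4,6) minus_split[OF K_value[OF f] K_value[OF h] K_value[OF k], symmetric])
    moreover have "p ((f \<ominus>\<^bsub>B\<^esub> h) \<oplus>\<^bsub>K\<^esub> (h \<ominus>\<^bsub>B\<^esub> k)) \<le> p (f \<ominus>\<^bsub>B\<^esub> h) + p (h \<ominus>\<^bsub>B\<^esub> k)"
      using p(1) m(1,3) unfolding cstar_seminorm_def by blast
    ultimately show "p (f \<ominus>\<^bsub>B\<^esub> k) \<le>
        crossed_product_norm G A \<alpha> (f \<ominus>\<^bsub>B\<^esub> h) + crossed_product_norm G A \<alpha> (h \<ominus>\<^bsub>B\<^esub> k)"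
      using crossed_product_norm_bounds(2)[OF m(1) p] crossed_product_norm_bounds(2)[OF m(3) p] by simp
  qed
  then show "cdist B f k \<le> cdist B f h + cdist B h k" by (simp add: cdist_B f h k)
qed

lemma finsum_B_pair:
  assumes "F 1 \<in> carrier K" "F 2 \<in> carrier K"
  shows "(\<Oplus>\<^bsub>B\<^esub>i\<in>{1..2::nat}. F i) = F 1 \<oplus>\<^bsub>K\<^esub> F 2"
proof -
  interpret B: abelian_group B by (rule abelian_group_B)
  have "{1..2::nat} = insert 1 {2}" by auto
  then show ?thesis using assms B.finsum_insert[of "{2}" "1::nat" F] B.finsum_insert[of "{}" "2::nat" F]
    by (simp add: B_simps[symmetric])
qed

lemma Lg_pairI:
  assumes y: "y \<in> {1..2} \<rightarrow>\<^sub>E carrier B"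
    and gen: "\<And>h. h \<in> carrier K \<Longrightarrow> \<exists>c. (\<forall>i s. c i s \<in> carrier A) \<and> (\<forall>s\<in>carrier G. h s =
      (\<Oplus>\<^bsub>A\<^esub>t\<in>carrier G. c (0::nat) t \<otimes>\<^bsub>A\<^esub> \<alpha> t (y 1 (inv t \<otimes> s))) \<oplus>\<^bsub>A\<^esub>
      (\<Oplus>\<^bsub>A\<^esub>t\<in>carrier G. c 1 t \<otimes>\<^bsub>A\<^esub> \<alpha> t (y 2 (inv t \<otimes> s))))"
  shows "y \<in> Lg 2 B"
proof -
  have yK: "y 1 \<in> carrier K" "y 2 \<in> carrier K" using y by (auto simp: B_simps)
  have pair: "(\<Oplus>\<^bsub>B\<^esub>i\<in>{1..2::nat}. x i \<otimes>\<^bsub>B\<^esub> y i) = (x 1 \<otimes>\<^bsub>K\<^esub> y 1) \<oplus>\<^bsub>K\<^esub> (x 2 \<otimes>\<^bsub>K\<^esub> y 2)"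
    "x 1 \<otimes>\<^bsub>K\<^esub> y 1 \<in> carrier K" "x 2 \<otimes>\<^bsub>K\<^esub> y 2 \<in> carrier K"
    if "x \<in> {1..2::nat} \<rightarrow> carrier B" for x
  proof -
    have x: "x 1 \<in> carrier K" "x 2 \<in> carrier K" using that by (auto simp: B_simps)
    show c: "x 1 \<otimes>\<^bsub>K\<^esub> y 1 \<in> carrier K" "x 2 \<otimes>\<^bsub>K\<^esub> y 2 \<in> carrier K"
      by (rule K_closed(1)[OF x(1) yK(1)], rule K_closed(1)[OF x(2) yK(2)])
    show "(\<Oplus>\<^bsub>B\<^esub>i\<in>{1..2::nat}. x i \<otimes>\<^bsub>B\<^esub> y i) = (x 1 \<otimes>\<^bsub>K\<^esub> y 1) \<oplus>\<^bsub>K\<^esub> (x 2 \<otimes>\<^bsub>K\<^esub> y 2)"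
      using finsum_B_pair[of "\<lambda>i. x i \<otimes>\<^bsub>B\<^esub> y i"] c by (simp add: B_simps(2))
  qed
  have "{\<Oplus>\<^bsub>B\<^esub>i\<in>{1..2}. x i \<otimes>\<^bsub>B\<^esub> y i | x. x \<in> {1..2::nat} \<rightarrow> carrier B} = carrier B"
  proof (intro subset_antisym subsetI)
    fix z assume "z \<in> {\<Oplus>\<^bsub>B\<^esub>i\<in>{1..2}. x i \<otimes>\<^bsub>B\<^esub> y i | x. x \<in> {1..2::nat} \<rightarrow> carrier B}"
    then obtain x where "x \<in> {1..2::nat} \<rightarrow> carrier B" "z = (\<Oplus>\<^bsub>B\<^esub>i\<in>{1..2}. x i \<otimes>\<^bsub>B\<^esub> y i)" by blast
    then show "z \<in> carrier B" using pair[of x] K_closed(2) by (simp add: B_simps(1))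
  next
    fix h assume "h \<in> carrier B"
    then have h: "h \<in> carrier K" by (simp add: B_simps)
    obtain c where c: "\<forall>i s. c i s \<in> carrier A" "\<forall>s\<in>carrier G. h s =
      (\<Oplus>\<^bsub>A\<^esub>t\<in>carrier G. c (0::nat) t \<otimes>\<^bsub>A\<^esub> \<alpha> t (y 1 (inv t \<otimes> s))) \<oplus>\<^bsub>A\<^esub>
      (\<Oplus>\<^bsub>A\<^esub>t\<in>carrier G. c 1 t \<otimes>\<^bsub>A\<^esub> \<alpha> t (y 2 (inv t \<otimes> s)))"
      using gen[OF h] by blast
    \<comment> \<open>Tuples in \<open>Lg\<close> are indexed from 1, the coefficients
      \<open>c\<close> from 0.\<close>
    define x where "x i = (\<lambda>s\<in>carrier G. c (i - 1) s)" for i :: nat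
    have x: "x \<in> {1..2::nat} \<rightarrow> carrier B" using c(1) by (auto simp: x_def B_simps carrier_K)
    note p = pair[OF x]
    have "h = (x 1 \<otimes>\<^bsub>K\<^esub> y 1) \<oplus>\<^bsub>K\<^esub> (x 2 \<otimes>\<^bsub>K\<^esub> y 2)"
    proof (rule K_eqI[OF h K_closed(2)[OF p(2,3)]])
      fix s assume s: "s \<in> carrier G"
      have *: "(x (Suc i) \<otimes>\<^bsub>K\<^esub> y j) s = (\<Oplus>\<^bsub>A\<^esub>t\<in>carrier G. c i t \<otimes>\<^bsub>A\<^esub> \<alpha> t (y j (inv t \<otimes> s)))"
        if j: "y j \<in> carrier K" for i j
        unfolding K_eval(1)[OF s]
        by (rule M.finsum_cong') (use c(1) s in \<open>auto simp: x_def \<alpha>_simps K_value[OF j]\<close>)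
      show "h s = ((x 1 \<otimes>\<^bsub>K\<^esub> y 1) \<oplus>\<^bsub>K\<^esub> (x 2 \<otimes>\<^bsub>K\<^esub> y 2)) s"
        using c(2) s *[OF yK(1), of 0] *[OF yK(2), of 1] by (simp add: K_eval(3) numeral_2_eq_2)
    qed
    then have "h = (\<Oplus>\<^bsub>B\<^esub>i\<in>{1..2}. x i \<otimes>\<^bsub>B\<^esub> y i)" using p(1) by simp
    then show "h \<in> {\<Oplus>\<^bsub>B\<^esub>i\<in>{1..2}. x i \<otimes>\<^bsub>B\<^esub> y i | x. x \<in> {1..2::nat} \<rightarrow> carrier B}"
      using x by blast
  qed
  then show ?thesis using y by (simp add: Lg_def)
qed

lemma tsr_crossed_product_le:
  assumes s: "simple_cstar A" and sp: "SP_property A" and tsr: "tsr A = 1"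
  shows "tsr B \<le> 2"
proof -
  interpret Met: Metric_space "carrier B" "cdist B" by (rule Metric_space_B)
  have T: "norm_topology B = Met.mtopology" by (simp add: norm_topology_def)
  let ?T = "product_topology (\<lambda>_. norm_topology B) {1..2::nat}"
  have top: "topspace ?T = ({1..2} \<rightarrow>\<^sub>E carrier B)" by (simp add: T)
  have "({1..2} \<rightarrow>\<^sub>E carrier B) \<subseteq> (?T closure_of Lg 2 B)"
  proof
    fix f assume f: "f \<in> ({1..2::nat} \<rightarrow>\<^sub>E carrier B)"
    have "\<exists>y. y \<in> Lg 2 B \<and> y \<in> S" if S: "f \<in> S" "openin ?T S" for S
    proof -
      from S(2)[unfolded openin_product_topology_alt, rule_format, OF S(1)]
      obtain U where U: "\<forall>i\<in>{1..2::nat}. openin (norm_topology B) (U i)" "f \<in> Pi\<^sub>E {1..2} U" "Pi\<^sub>E {1..2} U \<subseteq> S"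
        by (elim exE conjE)
      have ball: "\<exists>r>0. Met.mball (f i) r \<subseteq> U i" if i: "i \<in> {1..2}" for i
      proof -
        have "openin Met.mtopology (U i)" using U(1) i by (simp add: T)
        moreover have "f i \<in> U i" using U(2) i by (rule PiE_mem)
        ultimately show ?thesis by (simp add: Met.openin_mtopology)
      qed
      obtain r1 where r1: "r1 > 0" "Met.mball (f 1) r1 \<subseteq> U 1" using ball[of 1] by auto
      obtain r2 where r2: "r2 > 0" "Met.mball (f 2) r2 \<subseteq> U 2" using ball[of 2] by auto
      note r = r1 r2
      have fK: "f (Suc i) \<in> carrier K" if "i < 2" for i using f that by (auto simp: B_simps)
      \<comment> \<open>One tolerance serves both coordinates of the box neighbourhood, since each
        function of the pair is approximated with the same bound.\<close>
      have "min r1 r2 > 0" using r by simp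
      from unimodular_pairs_dense_in_functions[OF s sp tsr, of "\<lambda>i. f (Suc i)", OF K_value[OF fK] this]
      obtain g where g: "\<forall>i s. g i s \<in> carrier A"
        "\<forall>i<2. (\<Sum>s\<in>carrier G. cnorm A (f (Suc i) s \<ominus>\<^bsub>A\<^esub> g i s)) < min r1 r2"
        "\<forall>h\<in>carrier G \<rightarrow> carrier A. \<exists>c. (\<forall>i s. c i s \<in> carrier A) \<and> (\<forall>s\<in>carrier G. h s =
          (\<Oplus>\<^bsub>A\<^esub>t\<in>carrier G. c (0::nat) t \<otimes>\<^bsub>A\<^esub> \<alpha> t (g 0 (inv t \<otimes> s))) \<oplus>\<^bsub>A\<^esub>
          (\<Oplus>\<^bsub>A\<^esub>t\<in>carrier G. c 1 t \<otimes>\<^bsub>A\<^esub> \<alpha> t (g 1 (inv t \<otimes> s))))"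
        by blast
      define y where "y = (\<lambda>i\<in>{1..2::nat}. \<lambda>s\<in>carrier G. g (i - 1) s)"
      have y: "y \<in> {1..2} \<rightarrow>\<^sub>E carrier B" using g(1) by (auto simp: y_def B_simps carrier_K)
      have yg: "y (Suc i) s = g i s" if "i < 2" "s \<in> carrier G" for i s using that by (simp add: y_def)
      have near: "cdist B (f (Suc i)) (y (Suc i)) < min r1 r2" if i: "i < 2" for i
      proof -
        have yK: "y (Suc i) \<in> carrier K" using y i by (auto simp: B_simps)
        have "cdist B (f (Suc i)) (y (Suc i)) \<le> (\<Sum>s\<in>carrier G. cnorm A (f (Suc i) s \<ominus>\<^bsub>A\<^esub> g i s))"
          unfolding cdist_B[OF fK[OF i] yK]
          using crossed_product_norm_bounds(1)[OF minus_B(1)[OF fK[OF i] yK]] minus_B(2)[OF fK[OF i] yK] yg[OF i]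
          by (simp cong: sum.cong_simp)
        then show ?thesis using g(2) i by fastforce
      qed
      have "y 1 \<in> U 1" "y 2 \<in> U 2"
        using near[of 0] near[of 1] r f y by (auto simp: Met.mball_def PiE_iff numeral_2_eq_2 subset_iff)
      then have "y \<in> Pi\<^sub>E {1..2} U"
        using y by (auto simp: PiE_iff) (metis One_nat_def Suc_1 le_SucE le_antisym)
      moreover have "y \<in> Lg 2 B"
      proof (rule Lg_pairI[OF y])
        fix h assume "h \<in> carrier K"
        then have h: "h \<in> carrier G \<rightarrow> carrier A" by (auto simp: carrier_K)
        from g(3)[rule_format, OF h] obtain c where c: "\<forall>i s. c i s \<in> carrier A" "\<forall>s\<in>carrier G. h s =
          (\<Oplus>\<^bsub>A\<^esub>t\<in>carrier G. c (0::nat) t \<otimes>\<^bsub>A\<^esub> \<alpha> t (g 0 (inv t \<otimes> s))) \<oplus>\<^bsub>A\<^esub>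
          (\<Oplus>\<^bsub>A\<^esub>t\<in>carrier G. c 1 t \<otimes>\<^bsub>A\<^esub> \<alpha> t (g 1 (inv t \<otimes> s)))" by blast
        have *: "(\<Oplus>\<^bsub>A\<^esub>t\<in>carrier G. c i t \<otimes>\<^bsub>A\<^esub> \<alpha> t (g i (inv t \<otimes> s))) =
            (\<Oplus>\<^bsub>A\<^esub>t\<in>carrier G. c i t \<otimes>\<^bsub>A\<^esub> \<alpha> t (y (Suc i) (inv t \<otimes> s)))"
          if "i < 2" "s \<in> carrier G" for i s
          by (rule M.finsum_cong') (use c(1) g(1) that in \<open>auto simp: yg \<alpha>_simps\<close>)
        show "\<exists>c. (\<forall>i s. c i s \<in> carrier A) \<and> (\<forall>s\<in>carrier G. h s =
          (\<Oplus>\<^bsub>A\<^esub>t\<in>carrier G. c (0::nat) t \<otimes>\<^bsub>A\<^esub> \<alpha> t (y 1 (inv t \<otimes> s))) \<oplus>\<^bsub>A\<^esub>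
          (\<Oplus>\<^bsub>A\<^esub>t\<in>carrier G. c 1 t \<otimes>\<^bsub>A\<^esub> \<alpha> t (y 2 (inv t \<otimes> s))))"
          using c *[of 0] *[of 1] by (intro exI[of _ c]) (simp add: numeral_2_eq_2)
      qed
      ultimately show ?thesis using U(3) by blast
    qed
    then show "f \<in> (?T closure_of Lg 2 B)" unfolding in_closure_of top using f by (intro conjI allI impI) auto
  qed
  moreover have "(?T closure_of Lg 2 B) \<subseteq> ({1..2} \<rightarrow>\<^sub>E carrier B)"
    using closure_of_subset_topspace[of ?T "Lg 2 B"] by (simp only: top)
  ultimately have "(?T closure_of Lg 2 B) = ({1..2} \<rightarrow>\<^sub>E carrier B)" by (rule subset_antisym[rotated])
  then have "tsr B \<le> enat 2" unfolding tsr_def by (intro Inf_lower CollectI exI[of _ 2]) simp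
  then show ?thesis by (simp add: numeral_eq_enat)
qed

end

theorem corollary3p3:
  fixes A :: "'a cstar_alg" and G :: "('g, 'm) monoid_scheme" and \<alpha> :: "'g \<Rightarrow> 'a \<Rightarrow> 'a"
  assumes "unital_cstar_algebra A"
    and "simple_cstar A"
    and "tsr A = 1"
    and "SP_property A"
    and "group G"
    and "finite (carrier G)"
    and "\<alpha> \<in> hom G (Aut A)"
  shows "tsr (crossed_product G A \<alpha>) \<le> 2"
proof -
  interpret finite_action A G \<alpha>
    by (intro finite_action.intro finite_action_axioms.intro assms)
  show ?thesis by (rule tsr_crossed_product_le[OF assms(2,4,3)])
qed

end
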